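(* Let $f:\mathcal{G}\to\mathbb{C}$. Then $f$ is the partition function of a vertex model over $\mathbb{C}$ (i.e. $f=p_y$ for some $k\in\mathbb{N}$ and some $y:\mathbb{N}^k\to\mathbb{C}$) if and only if $f(\emptyset)=1$, $f(O)\in\mathbb{R}$, and $$\operatorname{rank}(C_{f,k})\leq f(O)^k\quad\text{for each }k\in\mathbb{N}.$$
   Context: $\mathcal{G}$ denotes the collection of all finite undirected graphs up to isomorphism; loops and multiple edges are allowed, and a graph may also contain copies of the "vertexless loop" $O$ (a closed edge with no vertex; a graph is best viewed as a topological 1-complex). $\emptyset$ is the empty graph. $\mathbb{N}=\{0,1,2,\dots\}$, $[n]=\{1,\dots,n\}$. A $k$-color vertex model over $\mathbb{C}$ is any function $y:\mathbb{N}^k\to\mathbb{C}$; its partition function is $p_y(G)=\sum_{\kappa:E\to[k]}\prod_{v\in V}y_{\kappa(\delta(v))}$ for $G=(V,E)$, where $\delta(v)$ is the set of edges incident with $v$ and the multiset $\kappa(\delta(v))$ of colors is identified with its incidence vector in $\mathbb{N}^k$ (each vertexless loop contributes a factor $k$, so $p_y(O)=k$). For $k\in\mathbb{N}$, a $k$-fragment is a graph $G=(V,E)$ together with an injective map $\lambda:[k]\to V$ such that each $\lambda(i)$ has degree 1; $\mathcal{G}_k$ is the collection of $k$-fragments. For $G,H\in\mathcal{G}_k$, $G\cdot H\in\mathcal{G}$ is obtained from the disjoint union of $G$ and $H$ by identifying equally labeled vertices and then deleting each of the $k$ identified points as a vertex, merging its two incident edges into one edge (this may create vertexless loops). The $k$th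 connection matrix of $f$ is the $\mathcal{G}_k\times\mathcal{G}_k$ matrix $C_{f,k}$ with $(C_{f,k})_{G,H}=f(G\cdot H)$. *)

theory Defs
  imports Complex_Main "HOL-Library.Multiset" "HOL-Library.FuncSet" "HOL-Library.Extended_Real"
begin

text \<open>
  An edge has either two ends (a loop being an edge whose two ends coincide) or no end at all;
  the edges without ends are the vertexless loops.
\<close>

datatype ('v, 'e) multigraph =
  Multigraph (verts: "'v set") (edges: "'e set") (ends: "'e \<Rightarrow> 'v multiset")

definition wf_multigraph :: "('v, 'e) multigraph \<Rightarrow> bool" where
  "wf_multigraph G \<longleftrightarrow> finite (verts G) \<and> finite (edges G) \<and>
     (\<forall>e\<in>edges G. set_mset (ends G e) \<subseteq> verts G \<and> size (ends G e) \<in> {0, 2})"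

definition isomorphic :: "('v, 'e) multigraph \<Rightarrow> ('w, 'd) multigraph \<Rightarrow> bool" where
  "isomorphic G H \<longleftrightarrow> (\<exists>\<alpha> \<beta>. bij_betw \<alpha> (verts G) (verts H) \<and> bij_betw \<beta> (edges G) (edges H) \<and>
     (\<forall>e\<in>edges G. ends H (\<beta> e) = image_mset \<alpha> (ends G e)))"

lemma isomorphic_refl: "isomorphic G G"
  unfolding isomorphic_def by (rule exI[of _ id], rule exI[of _ id]) auto

lemma isomorphic_sym:
  assumes "wf_multigraph G" "isomorphic G H"
  shows "isomorphic H G"
proof -
  from assms(2) obtain \<alpha> \<beta> where a: "bij_betw \<alpha> (verts G) (verts H)"
    and b: "bij_betw \<beta> (edges G) (edges H)"
    and c: "\<And>e. e \<in> edges G \<Longrightarrow> ends H (\<beta> e) = image_mset \<alpha> (ends G e)"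
    unfolding isomorphic_def by blast
  let ?a = "inv_into (verts G) \<alpha>" and ?b = "inv_into (edges G) \<beta>"
  have "ends G (?b d) = image_mset ?a (ends H d)" if d: "d \<in> edges H" for d
  proof -
    have e: "?b d \<in> edges G" using b d by (metis bij_betw_imp_surj_on inv_into_into)
    have bd: "\<beta> (?b d) = d" using b d by (simp add: bij_betw_inv_into_right)
    have sub: "set_mset (ends G (?b d)) \<subseteq> verts G"
      using assms(1) e unfolding wf_multigraph_def by blast
    have "image_mset ?a (ends H d) = image_mset ?a (image_mset \<alpha> (ends G (?b d)))"
      using c[OF e] bd by simp
    also have "\<dots> = image_mset (\<lambda>v. ?a (\<alpha> v)) (ends G (?b d))"
      by (simp add: image_mset.compositionality comp_def)
    also have "\<dots> = image_mset (\<lambda>v. v) (ends G (?b d))"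
      by (rule image_mset_cong) (use sub a in \<open>auto simp: bij_betw_inv_into_left\<close>)
    finally show ?thesis by simp
  qed
  then show ?thesis
    unfolding isomorphic_def using bij_betw_inv_into[OF a] bij_betw_inv_into[OF b] by blast
qed

lemma isomorphic_trans:
  assumes "isomorphic G H" "isomorphic H K"
  shows "isomorphic G K"
proof -
  from assms(1) obtain \<alpha> \<beta> where a: "bij_betw \<alpha> (verts G) (verts H)"
    "bij_betw \<beta> (edges G) (edges H)"
    "\<And>e. e \<in> edges G \<Longrightarrow> ends H (\<beta> e) = image_mset \<alpha> (ends G e)"
    unfolding isomorphic_def by blast
  from assms(2) obtain \<alpha>' \<beta>' where b: "bij_betw \<alpha>' (verts H) (verts K)"
    "bij_betw \<beta>' (edges H) (edges K)"
    "\<And>e. e \<in> edges H \<Longrightarrow> ends K (\<beta>' e) = image_mset \<alpha>' (ends H e)"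
    unfolding isomorphic_def by blast
  have "ends K ((\<beta>' \<circ> \<beta>) e) = image_mset (\<alpha>' \<circ> \<alpha>) (ends G e)" if "e \<in> edges G" for e
  proof -
    have "\<beta> e \<in> edges H" using a(2) that by (meson bij_betwE)
    then show ?thesis by (simp add: a(3)[OF that] b(3) image_mset.compositionality)
  qed
  then show ?thesis
    unfolding isomorphic_def using bij_betw_trans[OF a(1) b(1)] bij_betw_trans[OF a(2) b(2)] by blast
qed

text \<open>Every finite graph is isomorphic to one whose vertices and edges are natural numbers.\<close>

quotient_type graph = "(nat, nat) multigraph" /
  partial: "\<lambda>G H. wf_multigraph G \<and> wf_multigraph H \<and> isomorphic G H"
proof (rule part_equivpI)
  show "\<exists>G::(nat, nat) multigraph. wf_multigraph G \<and> wf_multigraph G \<and> isomorphic G G"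
    by (rule exI[of _ "Multigraph {} {} (\<lambda>_. {#})"])
      (auto simp: wf_multigraph_def isomorphic_refl)
qed (auto intro!: sympI transpI intro: isomorphic_sym isomorphic_trans)

definition graph_of :: "('v, 'e) multigraph \<Rightarrow> graph" where
  "graph_of G = abs_graph (SOME H. wf_multigraph H \<and> isomorphic G H)"

lemma ex_nat_multigraph:
  assumes "wf_multigraph G"
  shows "\<exists>H :: (nat, nat) multigraph. wf_multigraph H \<and> isomorphic G H"
proof -
  from assms have fin: "finite (verts G)" "finite (edges G)"
    unfolding wf_multigraph_def by auto
  obtain \<alpha> :: "_ \<Rightarrow> nat" where a: "inj_on \<alpha> (verts G)"
    using finite_imp_inj_to_nat_seg[OF fin(1)] by blast
  obtain \<beta> :: "_ \<Rightarrow> nat" where b: "inj_on \<beta> (edges G)"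
    using finite_imp_inj_to_nat_seg[OF fin(2)] by blast
  let ?H = "Multigraph (\<alpha> ` verts G) (\<beta> ` edges G)
    (\<lambda>d. image_mset \<alpha> (ends G (inv_into (edges G) \<beta> d)))"
  have "wf_multigraph ?H"
    using assms b unfolding wf_multigraph_def by auto
  moreover have "isomorphic G ?H"
    unfolding isomorphic_def
    by (rule exI[of _ \<alpha>], rule exI[of _ \<beta>]) (use a b in \<open>auto simp: bij_betw_def\<close>)
  ultimately show ?thesis by blast
qed

lemma graph_of_eq_iff:
  assumes G: "wf_multigraph G" and H: "wf_multigraph H"
  shows "graph_of G = graph_of H \<longleftrightarrow> isomorphic G H"
proof -
  let ?g = "SOME K :: (nat, nat) multigraph. wf_multigraph K \<and> isomorphic G K"
  let ?h = "SOME K :: (nat, nat) multigraph. wf_multigraph K \<and> isomorphic H K"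
  have g: "wf_multigraph ?g \<and> isomorphic G ?g" using someI_ex[OF ex_nat_multigraph[OF G]] .
  have h: "wf_multigraph ?h \<and> isomorphic H ?h" using someI_ex[OF ex_nat_multigraph[OF H]] .
  have "graph_of G = graph_of H \<longleftrightarrow> isomorphic ?g ?h"
    unfolding graph_of_def
    using Quotient3_rel[OF Quotient3_graph, of ?g ?h] g h isomorphic_refl by blast
  also have "\<dots> \<longleftrightarrow> isomorphic G H"
    using g h G H isomorphic_sym isomorphic_trans by metis
  finally show ?thesis .
qed

lift_definition empty_graph :: graph is "Multigraph {} {} (\<lambda>_. {#})"
  by (auto simp: wf_multigraph_def isomorphic_refl)

lift_definition vertexless_loop :: graph is "Multigraph {} {0} (\<lambda>_. {#})"
  by (auto simp: wf_multigraph_def isomorphic_refl)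

text \<open>The multiset of colours seen at a vertex; a loop at the vertex contributes its colour twice.\<close>

definition colours_at :: "('v, 'e) multigraph \<Rightarrow> ('e \<Rightarrow> nat) \<Rightarrow> 'v \<Rightarrow> nat multiset" where
  "colours_at G \<kappa> v = (\<Sum>e\<in>edges G. replicate_mset (count (ends G e) v) (\<kappa> e))"

text \<open>
  A vector in \<open>\<nat>\<^sup>k\<close> is a function of type \<^typ>\<open>nat \<Rightarrow> nat\<close> that vanishes outside \<open>{1..k}\<close>. Only the
  values of \<open>y\<close> at such vectors enter the sum. Vertexless loops are edges, so each of them
  contributes a factor \<open>k\<close>.
\<close>

definition multigraph_partition_function ::
    "nat \<Rightarrow> ((nat \<Rightarrow> nat) \<Rightarrow> complex) \<Rightarrow> ('v, 'e) multigraph \<Rightarrow> complex" where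
  "multigraph_partition_function k y G =
     (\<Sum>\<kappa> \<in> edges G \<rightarrow>\<^sub>E {1..k}. \<Prod>v\<in>verts G. y (count (colours_at G \<kappa> v)))"

lemma multigraph_partition_function_isomorphic:
  assumes wf: "wf_multigraph G" and iso: "isomorphic G H"
  shows "multigraph_partition_function k y G = multigraph_partition_function k y H"
proof -
  from iso obtain \<alpha> \<beta> where a: "bij_betw \<alpha> (verts G) (verts H)"
    and b: "bij_betw \<beta> (edges G) (edges H)"
    and c: "\<And>e. e \<in> edges G \<Longrightarrow> ends H (\<beta> e) = image_mset \<alpha> (ends G e)"
    unfolding isomorphic_def by blast
  let ?b = "inv_into (edges G) \<beta>"
  have bl: "?b (\<beta> e) = e" if "e \<in> edges G" for e
    using b that by (rule bij_betw_inv_into_left)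
  have br: "\<beta> (?b d) = d" "?b d \<in> edges G" if "d \<in> edges H" for d
    using b that bij_betw_inv_into_right bij_betw_imp_surj_on inv_into_into by (metis, metis)
  have be: "\<beta> e \<in> edges H" if "e \<in> edges G" for e
    using b that bij_betwE by blast
  have cnt: "count (ends H (\<beta> e)) (\<alpha> v) = count (ends G e) v"
    if "e \<in> edges G" "v \<in> verts G" for e v
  proof -
    have sub: "set_mset (ends G e) \<subseteq> verts G"
      using wf that unfolding wf_multigraph_def by blast
    have inj: "inj_on \<alpha> (verts G)" using a by (simp add: bij_betw_def)
    have "inj_on \<alpha> (set_mset (ends G e) \<union> {v})"
      by (rule inj_on_subset[OF inj]) (use sub that in auto)
    then have "\<alpha> -` {\<alpha> v} \<inter> set_mset (ends G e) = {v} \<inter> set_mset (ends G e)"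
      by (auto simp: inj_on_def)
    then show ?thesis
      using c[OF that(1)] by (cases "v \<in># ends G e") (auto simp: count_image_mset not_in_iff)
  qed
  have col: "colours_at G (restrict (\<lambda>e. \<kappa> (\<beta> e)) (edges G)) v = colours_at H \<kappa> (\<alpha> v)"
    if "v \<in> verts G" for \<kappa> v
  proof -
    have "colours_at H \<kappa> (\<alpha> v) =
        (\<Sum>e\<in>edges G. replicate_mset (count (ends H (\<beta> e)) (\<alpha> v)) (\<kappa> (\<beta> e)))"
      unfolding colours_at_def by (rule sum.reindex_bij_betw[OF b, symmetric])
    then show ?thesis
      unfolding colours_at_def using cnt that by (simp cong: sum.cong)
  qed
  have restr: "restrict (\<lambda>e. restrict (\<lambda>d. \<kappa> (?b d)) (edges H) (\<beta> e)) (edges G) = \<kappa>"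
    if "\<kappa> \<in> edges G \<rightarrow>\<^sub>E {1..k}" for \<kappa> :: "_ \<Rightarrow> nat"
  proof
    fix e
    show "restrict (\<lambda>e. restrict (\<lambda>d. \<kappa> (?b d)) (edges H) (\<beta> e)) (edges G) e = \<kappa> e"
      using bl[of e] be[of e] PiE_arb[OF that, of e] by (cases "e \<in> edges G") simp_all
  qed
  have restr': "restrict (\<lambda>d. restrict (\<lambda>e. \<kappa> (\<beta> e)) (edges G) (?b d)) (edges H) = \<kappa>"
    if "\<kappa> \<in> edges H \<rightarrow>\<^sub>E {1..k}" for \<kappa> :: "_ \<Rightarrow> nat"
  proof
    fix d
    show "restrict (\<lambda>d. restrict (\<lambda>e. \<kappa> (\<beta> e)) (edges G) (?b d)) (edges H) d = \<kappa> d"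
      using br[of d] PiE_arb[OF that, of d] by (cases "d \<in> edges H") simp_all
  qed
  show ?thesis
    unfolding multigraph_partition_function_def
  proof (rule sum.reindex_bij_witness[where
        i = "\<lambda>\<kappa>. restrict (\<lambda>e. \<kappa> (\<beta> e)) (edges G)" and
        j = "\<lambda>\<kappa>. restrict (\<lambda>d. \<kappa> (?b d)) (edges H)"], goal_cases)
    case (1 \<kappa>)
    then show ?case by (rule restr)
  next
    case (2 \<kappa>)
    then show ?case by (intro restrict_PiE_iff[THEN iffD2] ballI) (rule PiE_mem, assumption, rule br)
  next
    case (3 \<kappa>)
    then show ?case by (rule restr')
  next
    case (4 \<kappa>)
    then show ?case by (intro restrict_PiE_iff[THEN iffD2] ballI) (rule PiE_mem, assumption, rule be)
  next
    case (5 \<kappa>)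
    let ?k = "restrict (\<lambda>d. \<kappa> (?b d)) (edges H)"
    have "(\<Prod>w\<in>verts H. y (count (colours_at H ?k w))) =
        (\<Prod>v\<in>verts G. y (count (colours_at H ?k (\<alpha> v))))"
      by (rule prod.reindex_bij_betw[OF a, symmetric])
    also have "\<dots> = (\<Prod>v\<in>verts G. y (count (colours_at G \<kappa> v)))"
      by (rule prod.cong[OF refl]) (simp only: col[of _ ?k, symmetric] restr[OF 5])
    finally show ?case .
  qed
qed

lift_definition partition_function ::
    "nat \<Rightarrow> ((nat \<Rightarrow> nat) \<Rightarrow> complex) \<Rightarrow> graph \<Rightarrow> complex"
  is multigraph_partition_function
  by (blast intro: multigraph_partition_function_isomorphic)

definition degree :: "('v, 'e) multigraph \<Rightarrow> 'v \<Rightarrow> nat" where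
  "degree G v = (\<Sum>e\<in>edges G. count (ends G e) v)"

text \<open>
  Fragments are taken as concrete labelled graphs rather than isomorphism classes. Isomorphic
  fragments have equal rows (and columns) in a connection matrix, so its rank is not affected.
\<close>

type_synonym fragment = "(nat, nat) multigraph \<times> (nat \<Rightarrow> nat)"

definition fragments :: "nat \<Rightarrow> fragment set" where
  "fragments k = {(G, l). wf_multigraph G \<and> l \<in> {1..k} \<rightarrow>\<^sub>E verts G \<and> inj_on l {1..k} \<and>
     (\<forall>i\<in>{1..k}. degree G (l i) = 1)}"

definition disjoint_union ::
    "('v, 'e) multigraph \<Rightarrow> ('w, 'd) multigraph \<Rightarrow> ('v + 'w, 'e + 'd) multigraph" where
  "disjoint_union G H = Multigraph (verts G <+> verts H) (edges G <+> edges H)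
     (case_sum (\<lambda>e. image_mset Inl (ends G e)) (\<lambda>d. image_mset Inr (ends H d)))"

definition map_verts :: "('v \<Rightarrow> 'w) \<Rightarrow> ('v, 'e) multigraph \<Rightarrow> ('w, 'e) multigraph" where
  "map_verts \<phi> G = Multigraph (\<phi> ` verts G) (edges G) (\<lambda>e. image_mset \<phi> (ends G e))"

text \<open>
  Delete the vertices in \<open>S\<close>, each of degree 2, and merge the two edges at each of them. Since
  merging can chain, the new edges are the classes of the equivalence relation generated by
  sharing a vertex of \<open>S\<close>. The ends of a class are the ends of its members that lie outside \<open>S\<close>:
  two of them if the class forms a path, none (a vertexless loop) if it forms a cycle.
\<close>

definition dissolve :: "'v set \<Rightarrow> ('v, 'e) multigraph \<Rightarrow> ('v, 'e set) multigraph" where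
  "dissolve S G = Multigraph (verts G - S)
     (edges G // {(e, e'). e \<in> edges G \<and> e' \<in> edges G \<and> (\<exists>v\<in>S. v \<in># ends G e \<and> v \<in># ends G e')}\<^sup>*)
     (\<lambda>C. \<Sum>e\<in>C. filter_mset (\<lambda>v. v \<notin> S) (ends G e))"

text \<open>The labelled vertex \<open>m i\<close> of \<open>H\<close> is identified with the labelled vertex \<open>l i\<close> of \<open>G\<close>.\<close>

fun glue :: "nat \<Rightarrow> fragment \<Rightarrow> fragment \<Rightarrow> (nat + nat, (nat + nat) set) multigraph" where
  "glue k (G, l) (H, m) = dissolve (Inl ` l ` {1..k})
     (map_verts
       (case_sum Inl (\<lambda>w. if w \<in> m ` {1..k} then Inl (l (inv_into {1..k} m w)) else Inr w))
       (disjoint_union G H))"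

definition connection_matrix :: "(graph \<Rightarrow> complex) \<Rightarrow> nat \<Rightarrow> fragment \<Rightarrow> fragment \<Rightarrow> complex" where
  "connection_matrix f k F F' = f (graph_of (glue k F F'))"

text \<open>
  The rank of a possibly infinite matrix with rows \<open>A\<close> and columns \<open>B\<close>: the maximal number of
  linearly independent rows, or \<open>\<infinity>\<close> if there is no maximum.
\<close>

definition matrix_rank :: "'a set \<Rightarrow> 'b set \<Rightarrow> ('a \<Rightarrow> 'b \<Rightarrow> 'c::field) \<Rightarrow> enat" where
  "matrix_rank A B M = Sup {enat (card I) |I. I \<subseteq> A \<and> finite I \<and>
     (\<forall>c. (\<forall>j\<in>B. (\<Sum>i\<in>I. c i * M i j) = 0) \<longrightarrow> (\<forall>i\<in>I. c i = 0))}"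

end

theory Submission
  imports Defs "HOL-Computational_Algebra.Fundamental_Theorem_Algebra" "HOL-Analysis.Analysis" "HOL-Library.Poly_Mapping" "HOL-Combinatorics.Permutations"
begin

text \<open>
  Necessity: summing over the colours of the glued edges factors the connection matrix through a
  space of dimension \<open>n\<^sup>k\<close>.

  Sufficiency, with \<open>n = f(O)\<close>. Take \<open>m\<close> copies of a system of \<open>k\<close> legs, each leg being a bare strand
  or a half-edge of a given graph; closing them up with permutations of the \<open>k m\<close> legs gives entries
  of a connection matrix of rank at most \<open>n\<^bsup>2 k m\<^esup>\<close>. For an idempotent \<open>e\<close> of the group algebra of \<open>S\<^sub>k\<close>
  put \<open>1 - e\<close> on some copies and \<open>e\<close> on the others. The inequality
  \<open>\<bar>tr\<bar>\<^sup>2 \<le> rank \<cdot> \<parallel>\<cdot>\<parallel>\<^sup>2\<close> for the resulting matrix, with \<open>m \<rightarrow> \<infinity>\<close>, shows that the trace of \<open>e\<close> cannot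
  be a negative number and that \<open>f\<close> annihilates \<open>e\<close> if the trace is \<open>0\<close>. Applied to antisymmetrizers
  this makes \<open>n\<close> a natural number. Applied to the projection onto the kernel of the Gram matrix
  \<open>n\<^bsup>cyc(p s\<inverse>)\<^esup>\<close> it shows that the values of \<open>f\<close> at the regluings of a graph are
  combinations of the functions \<open>p \<mapsto> n\<^bsup>cyc(p s\<inverse>)\<^esup>\<close>.

  These combinations define a functional on the polynomial ring in variables \<open>Y\<^sub>\<alpha>\<close>, one for each
  multiset \<open>\<alpha>\<close> of colours below \<open>n\<close>, and \<open>g\<^sub>i\<^sub>j\<close>. It maps \<open>1\<close> to \<open>1\<close> and kills the ideal generated by all
  \<open>p(G) - f(G)\<close>, where \<open>p(G)\<close> is the generic partition function with vertex weights \<open>Y\<close> and edge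
  weights \<open>g\<close>. By the Nullstellensatz \<open>f\<close> is the partition function for some numerical \<open>Y\<close> and \<open>g\<close>; writing
  the symmetric matrix \<open>g\<close> as \<open>A A\<^sup>T\<close> and absorbing \<open>A\<close> in \<open>Y\<close> gives a vertex model.
\<close>

section \<open>Linear algebra\<close>

text \<open>For complex values no positivity of the connection matrices is available; the growth of
  their ranks takes its place. A single copy of the legs gives a lossy inequality, and the copies
  make the loss negligible. With \<open>1 - e\<close> on \<open>r\<close> of \<open>m\<close> copies
  the test matrix has \<open>(m choose r)\<^sup>2 * r!\<close> rows, each with square sum
  \<open>r!\<close> up to a polynomial and a common power of the value of \<open>f\<close> at
  \<open>e\<close>. The factorials cancel, and the best choice of \<open>r\<close> sets
  \<open>(\<bar>\<beta>\<bar> + 1) ^ (2 * m)\<close> against \<open>n ^ (2 * k * m)\<close>, where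
  \<beta> is the trace of \<open>1 - e\<close>. If \<open>e\<close> has trace 0, then \<beta> is
  already \<open>n ^ k\<close>, which leaves no room for the summand 1 that a nonzero value of
  \<open>f\<close> at \<open>e\<close> would contribute.

  A half-edge has one end at a vertex and one at an edge, and the two kinds of ends are never
  interchanged. Hence graphs are reglued by permutations only, and everything stays inside group
  algebras of symmetric groups, where pairing ends of a single kind would lead to perfect matchings.
  The price is the edge weight \<open>g\<close>, an unknown symmetric matrix in place of the
  identity.\<close>

lemma nontrivial_solution:
  fixes a :: "'i \<Rightarrow> 'j \<Rightarrow> 'c::field"
  assumes "finite J" "finite I" "card J < card I"
  shows "\<exists>c. (\<forall>j\<in>J. (\<Sum>i\<in>I. c i * a i j) = 0) \<and> (\<exists>i\<in>I. c i \<noteq> 0)"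
  using assms
proof (induction J arbitrary: I a rule: finite_induct)
  case empty
  then have "I \<noteq> {}" by auto
  then show ?case by (intro exI[of _ "\<lambda>_. 1"]) auto
next
  case (insert j J)
  show ?case
  proof (cases "\<forall>i\<in>I. a i j = 0")
    case True
    obtain c where "\<forall>j\<in>J. (\<Sum>i\<in>I. c i * a i j) = 0" "\<exists>i\<in>I. c i \<noteq> 0"
      using insert.IH[of I a] insert.prems insert.hyps by auto
    then show ?thesis using True by (intro exI[of _ c]) auto
  next
    case False
    then obtain p where p: "p \<in> I" "a p j \<noteq> 0" by blast
    let ?I = "I - {p}"
    let ?a = "\<lambda>i l. a i l - a i j / a p j * a p l"
    obtain c where c: "\<forall>l\<in>J. (\<Sum>i\<in>?I. c i * ?a i l) = 0" "\<exists>i\<in>?I. c i \<noteq> 0"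
    proof -
      have "card J < card ?I" using insert.prems insert.hyps p by auto
      then show ?thesis using insert.IH[of ?I ?a] insert.prems(1) that by blast
    qed
    define s where "s = (\<Sum>i\<in>?I. c i * a i j)"
    \<comment> \<open>The value at the pivot \<open>p\<close> is chosen to cancel column
      \<open>j\<close>; in every other column it turns the reduced entries \<open>?a\<close> back
      into \<open>a\<close>.\<close>
    define d where "d = c(p := - s / a p j)"
    have sum_d: "(\<Sum>i\<in>I. d i * a i l) = - s / a p j * a p l + (\<Sum>i\<in>?I. c i * a i l)" for l
      unfolding d_def using p insert.prems by (subst sum.remove[of I p]) (auto intro!: sum.cong)
    have "(\<Sum>i\<in>I. d i * a i j) = 0"
      unfolding sum_d using p by (simp add: s_def)
    moreover have "(\<Sum>i\<in>I. d i * a i l) = 0" if l: "l \<in> J" for l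
    proof -
      have "(\<Sum>i\<in>?I. c i * ?a i l) = (\<Sum>i\<in>?I. c i * a i l) - s / a p j * a p l"
        unfolding s_def by (simp add: sum_subtractf algebra_simps sum_distrib_left sum_divide_distrib)
      then show ?thesis using c(1) l unfolding sum_d by simp
    qed
    moreover have "\<exists>i\<in>I. d i \<noteq> 0" using c(2) by (auto simp: d_def)
    ultimately show ?thesis by (intro exI[of _ d]) auto
  qed
qed

section \<open>Ranks of matrices with possibly infinitely many rows\<close>

lemma matrix_rank_le_inner_dimension:
  fixes M :: "'a \<Rightarrow> 'b \<Rightarrow> 'c::field"
  assumes P: "finite P" and M: "\<And>i j. i \<in> A \<Longrightarrow> j \<in> B \<Longrightarrow> M i j = (\<Sum>p\<in>P. a i p * b p j)"
  shows "matrix_rank A B M \<le> enat (card P)"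
  unfolding matrix_rank_def
proof (rule Sup_least, clarify)
  fix I assume I: "I \<subseteq> A" "finite I"
    and ind: "\<forall>c. (\<forall>j\<in>B. (\<Sum>i\<in>I. c i * M i j) = 0) \<longrightarrow> (\<forall>i\<in>I. c i = 0)"
  show "enat (card I) \<le> enat (card P)"
  proof (rule ccontr)
    assume "\<not> enat (card I) \<le> enat (card P)"
    then obtain c where c: "\<forall>p\<in>P. (\<Sum>i\<in>I. c i * a i p) = 0" "\<exists>i\<in>I. c i \<noteq> 0"
      using nontrivial_solution[OF P I(2), of a] by auto
    have "(\<Sum>i\<in>I. c i * M i j) = 0" if "j \<in> B" for j
    proof -
      have "(\<Sum>i\<in>I. c i * M i j) = (\<Sum>i\<in>I. \<Sum>p\<in>P. (c i * a i p) * b p j)"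
        using I(1) that by (intro sum.cong) (auto simp: M sum_distrib_left mult.assoc)
      also have "\<dots> = (\<Sum>p\<in>P. (\<Sum>i\<in>I. c i * a i p) * b p j)"
        by (subst sum.swap) (simp add: sum_distrib_right)
      finally show ?thesis using c(1) by simp
    qed
    then show False using ind c(2) by blast
  qed
qed

text \<open>The rank is a supremum in \<open>enat\<close>, so the finite bound is what makes it
  attained: a largest independent set of rows exists, and by maximality it spans all other rows. The
  bound is real because \<open>n\<close> is not yet known to be an integer when this is
  applied.\<close>

lemma matrix_rank_row_basis:
  fixes M :: "'a \<Rightarrow> 'b \<Rightarrow> 'c::field"
  assumes r: "ereal_of_enat (matrix_rank A B M) \<le> ereal r"
  obtains J where "J \<subseteq> A" "finite J" "real (card J) \<le> r"
    "\<And>i. i \<in> A \<Longrightarrow> \<exists>w. \<forall>b\<in>B. M i b = (\<Sum>j\<in>J. w j * M j b)"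
proof -
  define ind where "ind I \<longleftrightarrow> I \<subseteq> A \<and> finite I \<and>
    (\<forall>c. (\<forall>j\<in>B. (\<Sum>i\<in>I. c i * M i j) = 0) \<longrightarrow> (\<forall>i\<in>I. c i = 0))" for I
  have bound: "real (card I) \<le> r" if "ind I" for I
  proof -
    have "enat (card I) \<le> matrix_rank A B M"
      unfolding matrix_rank_def by (rule Sup_upper) (use that in \<open>auto simp: ind_def\<close>)
    then have "ereal_of_enat (enat (card I)) \<le> ereal r"
      using r ereal_of_enat_le_iff order.trans by blast
    then show ?thesis by simp
  qed
  have "ind {}" by (simp add: ind_def)
  moreover have "\<forall>I. ind I \<longrightarrow> card I < Suc (nat \<lceil>r\<rceil>)"
  proof (intro allI impI)
    fix I assume "ind I"
    then have "real (card I) \<le> r" by (rule bound)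
    then show "card I < Suc (nat \<lceil>r\<rceil>)" by linarith
  qed
  ultimately obtain J where J: "ind J" and max: "\<And>I. ind I \<Longrightarrow> card I \<le> card J"
    using ex_has_greatest_nat[of ind "{}" card] by blast
  have rows: "\<exists>w. \<forall>b\<in>B. M i b = (\<Sum>j\<in>J. w j * M j b)" if i: "i \<in> A" for i
  proof (cases "i \<in> J")
    case True
    have "(\<Sum>j\<in>J. (if j = i then 1 else 0) * M j b) = M i b" for b
      using True J by (simp add: ind_def if_distrib[of "\<lambda>x. x * _"] sum.delta cong: if_cong)
    then show ?thesis by metis
  next
    case False
    have fJ: "finite J" and JA: "J \<subseteq> A" using J by (auto simp: ind_def)
    have "\<not> ind (insert i J)" using max[of "insert i J"] False fJ by auto
    then obtain c where c: "\<forall>j\<in>B. (\<Sum>l\<in>insert i J. c l * M l j) = 0" "\<exists>l\<in>insert i J. c l \<noteq> 0"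
      using i fJ JA by (auto simp: ind_def)
    have s: "c i * M i j + (\<Sum>l\<in>J. c l * M l j) = 0" if "j \<in> B" for j
      using c(1) that False fJ by auto
    have ci: "c i \<noteq> 0"
    proof
      assume "c i = 0"
      with s have "\<forall>j\<in>B. (\<Sum>l\<in>J. c l * M l j) = 0" by simp
      then have "\<forall>l\<in>J. c l = 0" using J by (auto simp: ind_def)
      with \<open>c i = 0\<close> c(2) show False by auto
    qed
    have "M i b = (\<Sum>j\<in>J. (- c j / c i) * M j b)" if "b \<in> B" for b
    proof -
      have "(\<Sum>j\<in>J. (- c j / c i) * M j b) = - (\<Sum>j\<in>J. c j * M j b) / c i"
        by (simp add: sum_negf sum_divide_distrib)
      also have "\<dots> = M i b" using s[OF that] ci by (simp add: add_eq_0_iff2 field_simps)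
      finally show ?thesis ..
    qed
    then show ?thesis by (intro exI[of _ "\<lambda>j. - c j / c i"] ballI)
  qed
  show ?thesis
    by (rule that[OF _ _ bound[OF J] rows]) (use J in \<open>auto simp: ind_def\<close>)
qed

text \<open>Vectors are functions on the finite set \<open>X\<close>. The given family may be
  dependent, hence only \<open>m \<le> card J\<close>. Both inclusions of spans are recorded, since
  the projection below has to come back from the orthonormal vectors to the given ones.\<close>

lemma gram_schmidt:
  fixes v :: "'j \<Rightarrow> 'x \<Rightarrow> complex"
  assumes X: "finite X" and J: "finite J"
  shows "\<exists>m q. m \<le> card J \<and>
    (\<forall>a<m. \<forall>b<m. (\<Sum>x\<in>X. q a x * cnj (q b x)) = (if a = b then 1 else 0)) \<and>
    (\<forall>j\<in>J. \<exists>w. \<forall>x\<in>X. v j x = (\<Sum>a<m. w a * q a x)) \<and>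
    (\<forall>a<m. \<exists>w. \<forall>x\<in>X. q a x = (\<Sum>j\<in>J. w j * v j x))"
  using J
proof (induction J rule: finite_induct)
  case empty
  show ?case by (intro exI[of _ "0::nat"]) auto
next
  case (insert i J)
  then obtain m :: nat and q where m: "m \<le> card J"
    and on: "\<And>a b. a < m \<Longrightarrow> b < m \<Longrightarrow> (\<Sum>x\<in>X. q a x * cnj (q b x)) = (if a = b then 1 else 0)"
    and sp: "\<forall>j\<in>J. \<exists>w. \<forall>x\<in>X. v j x = (\<Sum>a<m. w a * q a x)"
    and sq: "\<forall>a<m. \<exists>w. \<forall>x\<in>X. q a x = (\<Sum>j\<in>J. w j * v j x)"
    by blast
  define p where "p a = (\<Sum>x\<in>X. v i x * cnj (q a x))" for a
  define u where "u x = v i x - (\<Sum>a<m. p a * q a x)" for x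
  have orth: "(\<Sum>x\<in>X. u x * cnj (q b x)) = 0" if b: "b < m" for b
  proof -
    have "(\<Sum>x\<in>X. u x * cnj (q b x)) = p b - (\<Sum>x\<in>X. \<Sum>a<m. p a * (q a x * cnj (q b x)))"
      unfolding u_def p_def by (simp add: algebra_simps sum_subtractf sum_distrib_left)
    also have "(\<Sum>x\<in>X. \<Sum>a<m. p a * (q a x * cnj (q b x))) = (\<Sum>a<m. p a * (\<Sum>x\<in>X. q a x * cnj (q b x)))"
      by (subst sum.swap) (simp add: sum_distrib_left)
    also have "\<dots> = (\<Sum>a<m. if a = b then p a else 0)"
      by (rule sum.cong) (use b on in auto)
    also have "\<dots> = p b" using b by simp
    finally show ?thesis by simp
  qed
  obtain W where W: "\<And>a x. a < m \<Longrightarrow> x \<in> X \<Longrightarrow> q a x = (\<Sum>j\<in>J. W a j * v j x)"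
    using sq by metis
  have u_span: "\<exists>w. \<forall>x\<in>X. u x = (\<Sum>j\<in>insert i J. w j * v j x)"
  proof (intro exI ballI)
    fix x assume x: "x \<in> X"
    let ?w = "\<lambda>j. if j = i then 1 else - (\<Sum>a<m. p a * W a j)"
    have "(\<Sum>j\<in>insert i J. ?w j * v j x) = v i x + (\<Sum>j\<in>J. - (\<Sum>a<m. p a * W a j) * v j x)"
      using insert.hyps by (auto intro!: sum.cong)
    also have "(\<Sum>j\<in>J. - (\<Sum>a<m. p a * W a j) * v j x) = - (\<Sum>j\<in>J. \<Sum>a<m. p a * W a j * v j x)"
      by (simp add: sum_negf sum_distrib_right)
    also have "(\<Sum>j\<in>J. \<Sum>a<m. p a * W a j * v j x) = (\<Sum>a<m. p a * q a x)"
      by (subst sum.swap) (simp add: W[OF _ x] sum_distrib_left mult.assoc)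
    finally show "u x = (\<Sum>j\<in>insert i J. ?w j * v j x)" by (simp add: u_def)
  qed
  have ext: "\<exists>w. \<forall>x\<in>X. q a x = (\<Sum>j\<in>insert i J. w j * v j x)" if "a < m" for a
    using insert.hyps W[OF that]
    by (intro exI[of _ "\<lambda>j. if j = i then 0 else W a j"]) (auto intro!: sum.cong)
  define N where "N = (\<Sum>x\<in>X. u x * cnj (u x))"
  have N: "N = of_real (\<Sum>x\<in>X. (cmod (u x))\<^sup>2)"
    unfolding N_def by (simp add: complex_norm_square[symmetric])
  show ?case
  proof (cases "(\<Sum>x\<in>X. (cmod (u x))\<^sup>2) = 0")
    case True
    then have "u x = 0" if "x \<in> X" for x
      using X that by (subst (asm) sum_nonneg_eq_0_iff) auto
    then have "\<forall>x\<in>X. v i x = (\<Sum>a<m. p a * q a x)" by (simp add: u_def)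
    then show ?thesis using m on sp ext insert.hyps
      by (intro exI[of _ m] exI[of _ q]) auto
  next
    case False
    define s where "s = sqrt (\<Sum>x\<in>X. (cmod (u x))\<^sup>2)"
    have s: "s > 0" using False unfolding s_def
      by (simp add: order_less_le sum_nonneg)
    have s2: "of_real s * of_real s = N"
      unfolding N s_def of_real_mult[symmetric] by (simp add: sum_nonneg)
    let ?q = "q(m := \<lambda>x. u x / of_real s)"
    have 1: "(\<Sum>x\<in>X. ?q a x * cnj (?q b x)) = (if a = b then 1 else 0)" if "a < Suc m" "b < Suc m" for a b
    proof -
      have mm: "(\<Sum>x\<in>X. u x / of_real s * cnj (u x / of_real s)) = 1"
      proof -
        have "(\<Sum>x\<in>X. u x / of_real s * cnj (u x / of_real s)) = N / (of_real s * of_real s)"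
          unfolding N_def by (simp add: sum_divide_distrib)
        then show ?thesis using s2 s by (metis divide_self_if mult_eq_0_iff of_real_eq_0_iff order_less_irrefl)
      qed
      have um: "(\<Sum>x\<in>X. u x / of_real s * cnj (q b x)) = 0" if "b < m" for b
        using orth[OF that] by (simp add: sum_divide_distrib[symmetric])
      have mu: "(\<Sum>x\<in>X. q a x * cnj (u x / of_real s)) = 0" if "a < m" for a
      proof -
        have "(\<Sum>x\<in>X. q a x * cnj (u x / of_real s)) = (\<Sum>x\<in>X. cnj (u x * cnj (q a x)) / of_real s)"
          by (intro sum.cong refl) simp
        also have "\<dots> = cnj (\<Sum>x\<in>X. u x * cnj (q a x)) / of_real s"
          by (simp only: sum_divide_distrib cnj_sum)
        finally show ?thesis by (simp add: orth that)
      qed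
      show ?thesis using that on mm um mu by (auto simp: less_Suc_eq)
    qed
    have 2: "\<exists>w. \<forall>x\<in>X. v j x = (\<Sum>a<Suc m. w a * ?q a x)" if j: "j \<in> insert i J" for j
    proof (cases "j = i")
      case True
      have "(\<Sum>a<Suc m. (p(m := of_real s)) a * ?q a x) = v i x" for x
        using s by (simp add: u_def)
      then show ?thesis using True by metis
    next
      case False
      then obtain w where "\<forall>x\<in>X. v j x = (\<Sum>a<m. w a * q a x)" using sp j by blast
      then show ?thesis by (intro exI[of _ "w(m := 0)"]) auto
    qed
    have 3: "\<exists>w. \<forall>x\<in>X. ?q a x = (\<Sum>j\<in>insert i J. w j * v j x)" if "a < Suc m" for a
    proof (cases "a = m")
      case True
      obtain w where "\<forall>x\<in>X. u x = (\<Sum>j\<in>insert i J. w j * v j x)" using u_span by blast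
      then have "\<forall>x\<in>X. ?q a x = (\<Sum>j\<in>insert i J. (w j / of_real s) * v j x)"
        using True by (simp add: sum_divide_distrib add_divide_distrib)
      then show ?thesis by (intro exI[of _ "\<lambda>j. w j / of_real s"])
    qed (use that ext in auto)
    show ?thesis using m insert.hyps 1 2 3
      by (intro exI[of _ "Suc m"] exI[of _ ?q]) auto
  qed
qed

text \<open>The coefficients refer to a family that may be linearly dependent, so its Gram matrix
  cannot simply be inverted; the projection is computed in an orthonormal basis and rewritten
  through \<open>W\<close>.\<close>

lemma orthogonal_projection:
  fixes v :: "'j \<Rightarrow> 'x \<Rightarrow> complex"
  assumes X: "finite X" and J: "finite J"
  shows "\<exists>c. \<forall>j\<in>J. (\<Sum>x\<in>X. (u x - (\<Sum>i\<in>J. c i * v i x)) * cnj (v j x)) = 0"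
proof -
  obtain m :: nat and q where
    on: "\<And>a b. a < m \<Longrightarrow> b < m \<Longrightarrow> (\<Sum>x\<in>X. q a x * cnj (q b x)) = (if a = b then 1 else 0)"
    and sp: "\<forall>j\<in>J. \<exists>w. \<forall>x\<in>X. v j x = (\<Sum>a<m. w a * q a x)"
    and sq: "\<forall>a<m. \<exists>w. \<forall>x\<in>X. q a x = (\<Sum>j\<in>J. w j * v j x)"
    using gram_schmidt[OF X J, of v] by blast
  obtain W where W: "\<And>a x. a < m \<Longrightarrow> x \<in> X \<Longrightarrow> q a x = (\<Sum>j\<in>J. W a j * v j x)"
    using sq by metis
  define p where "p a = (\<Sum>x\<in>X. u x * cnj (q a x))" for a
  define c where "c j = (\<Sum>a<m. p a * W a j)" for j
  have c: "(\<Sum>i\<in>J. c i * v i x) = (\<Sum>a<m. p a * q a x)" if x: "x \<in> X" for x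
    unfolding c_def sum_distrib_right by (subst sum.swap) (simp add: W[OF _ x] sum_distrib_left mult.assoc)
  have orth: "(\<Sum>x\<in>X. (u x - (\<Sum>a<m. p a * q a x)) * cnj (q b x)) = 0" if b: "b < m" for b
  proof -
    have "(\<Sum>x\<in>X. (u x - (\<Sum>a<m. p a * q a x)) * cnj (q b x)) = p b - (\<Sum>x\<in>X. \<Sum>a<m. p a * (q a x * cnj (q b x)))"
      unfolding p_def by (simp add: algebra_simps sum_subtractf sum_distrib_left)
    also have "(\<Sum>x\<in>X. \<Sum>a<m. p a * (q a x * cnj (q b x))) = (\<Sum>a<m. p a * (\<Sum>x\<in>X. q a x * cnj (q b x)))"
      by (subst sum.swap) (simp add: sum_distrib_left)
    also have "\<dots> = (\<Sum>a<m. if a = b then p a else 0)"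
      by (rule sum.cong) (use b on in auto)
    also have "\<dots> = p b" using b by simp
    finally show ?thesis by simp
  qed
  have "(\<Sum>x\<in>X. (u x - (\<Sum>i\<in>J. c i * v i x)) * cnj (v j x)) = 0" if j: "j \<in> J" for j
  proof -
    obtain w where w: "\<forall>x\<in>X. v j x = (\<Sum>b<m. w b * q b x)"
      using bspec[OF sp j] by (elim exE)
    define e where "e x = u x - (\<Sum>a<m. p a * q a x)" for x
    have e: "(\<Sum>x\<in>X. e x * cnj (q b x)) = 0" if "b < m" for b
      using orth[OF that] by (simp add: e_def)
    have "(\<Sum>x\<in>X. (u x - (\<Sum>i\<in>J. c i * v i x)) * cnj (v j x)) = (\<Sum>x\<in>X. e x * cnj (v j x))"
      by (intro sum.cong refl) (simp add: c e_def)
    also have "\<dots> = (\<Sum>x\<in>X. \<Sum>b<m. cnj (w b) * (e x * cnj (q b x)))"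
      by (intro sum.cong refl) (simp add: w sum_distrib_left mult_ac)
    also have "\<dots> = (\<Sum>b<m. cnj (w b) * (\<Sum>x\<in>X. e x * cnj (q b x)))"
      by (subst sum.swap) (simp add: sum_distrib_left)
    finally show ?thesis by (simp add: e)
  qed
  then show ?thesis by blast
qed

text \<open>Let \<open>q\<close> be an orthonormal basis of the span of the \<open>v j\<close> and
  write \<open>M = q d\<close>. The trace is then a sum of \<open>m\<close> products of
  \<open>q a\<close> with \<open>d a\<close>. Cauchy-Schwarz is applied twice, in \<open>X\<close>
  to each product and over the \<open>m \<le> card J\<close> summands, and the square sum of
  \<open>M\<close> equals that of \<open>d\<close> because \<open>q\<close> is orthonormal.\<close>

lemma trace_square_le_rank_times_norm:
  fixes M :: "'x \<Rightarrow> 'x \<Rightarrow> complex"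
  assumes X: "finite X" and J: "finite J"
    and M: "\<And>x y. x \<in> X \<Longrightarrow> y \<in> X \<Longrightarrow> M x y = (\<Sum>j\<in>J. v j x * b j y)"
  shows "(cmod (\<Sum>x\<in>X. M x x))\<^sup>2 \<le> real (card J) * (\<Sum>x\<in>X. \<Sum>y\<in>X. (cmod (M x y))\<^sup>2)"
proof -
  obtain m :: nat and q where m: "m \<le> card J" and
    on: "\<And>a b. a < m \<Longrightarrow> b < m \<Longrightarrow> (\<Sum>x\<in>X. q a x * cnj (q b x)) = (if a = b then 1 else 0)"
    and sp: "\<forall>j\<in>J. \<exists>w. \<forall>x\<in>X. v j x = (\<Sum>a<m. w a * q a x)"
    using gram_schmidt[OF X J, of v] by blast
  obtain W where W: "\<And>j x. j \<in> J \<Longrightarrow> x \<in> X \<Longrightarrow> v j x = (\<Sum>a<m. W j a * q a x)"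
    using sp by metis
  define d where "d a y = (\<Sum>j\<in>J. W j a * b j y)" for a y
  have Md: "M x y = (\<Sum>a<m. q a x * d a y)" if "x \<in> X" "y \<in> X" for x y
  proof -
    have "M x y = (\<Sum>j\<in>J. \<Sum>a<m. q a x * (W j a * b j y))"
      unfolding M[OF that] by (intro sum.cong refl) (simp add: W that sum_distrib_right sum_distrib_left mult_ac)
    then show ?thesis unfolding d_def by (subst (asm) sum.swap) (simp add: sum_distrib_left)
  qed
  have col: "(\<Sum>x\<in>X. (cmod (M x y))\<^sup>2) = (\<Sum>a<m. (cmod (d a y))\<^sup>2)" if y: "y \<in> X" for y
  proof -
    have "of_real (\<Sum>x\<in>X. (cmod (M x y))\<^sup>2) = (\<Sum>x\<in>X. M x y * cnj (M x y))"
      by (simp add: complex_norm_square[symmetric])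
    also have "\<dots> = (\<Sum>x\<in>X. \<Sum>a<m. \<Sum>b<m. d a y * cnj (d b y) * (q a x * cnj (q b x)))"
      by (intro sum.cong refl) (simp add: Md y sum_product mult_ac)
    also have "\<dots> = (\<Sum>a<m. \<Sum>x\<in>X. \<Sum>b<m. d a y * cnj (d b y) * (q a x * cnj (q b x)))"
      by (rule sum.swap)
    also have "\<dots> = (\<Sum>a<m. \<Sum>b<m. d a y * cnj (d b y) * (\<Sum>x\<in>X. q a x * cnj (q b x)))"
      by (intro sum.cong refl, subst sum.swap) (simp add: sum_distrib_left)
    also have "\<dots> = (\<Sum>a<m. \<Sum>b<m. if a = b then d a y * cnj (d b y) else 0)"
      by (intro sum.cong refl) (auto simp: on)
    also have "\<dots> = (\<Sum>a<m. d a y * cnj (d a y))" by (simp add: sum.delta)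
    also have "\<dots> = of_real (\<Sum>a<m. (cmod (d a y))\<^sup>2)"
      by (simp add: complex_norm_square[symmetric])
    finally show ?thesis by (simp only: of_real_eq_iff)
  qed
  have norm_q: "(\<Sum>x\<in>X. (cmod (q a x))\<^sup>2) = 1" if "a < m" for a
  proof -
    have "of_real (\<Sum>x\<in>X. (cmod (q a x))\<^sup>2) = (1::complex)"
      using on[OF that that] by (simp add: complex_norm_square[symmetric])
    then show ?thesis by (metis of_real_eq_1_iff)
  qed
  define S where "S a = (\<Sum>y\<in>X. (cmod (d a y))\<^sup>2)" for a
  have "cmod (\<Sum>x\<in>X. M x x) = cmod (\<Sum>a<m. \<Sum>x\<in>X. q a x * d a x)"
    by (subst sum.swap) (simp add: Md)
  also have "\<dots> \<le> (\<Sum>a<m. sqrt (S a))"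
  proof (rule order.trans[OF norm_sum], rule sum_mono)
    fix a assume "a \<in> {..<m}"
    then have a: "a < m" by simp
    have "cmod (\<Sum>x\<in>X. q a x * d a x) \<le> (\<Sum>x\<in>X. cmod (q a x) * cmod (d a x))"
      by (rule order.trans[OF norm_sum]) (simp add: norm_mult)
    also have "\<dots> \<le> (\<Sum>x\<in>X. \<bar>cmod (q a x)\<bar> * \<bar>cmod (d a x)\<bar>)" by simp
    also have "\<dots> \<le> L2_set (\<lambda>x. cmod (q a x)) X * L2_set (\<lambda>x. cmod (d a x)) X"
      by (rule L2_set_mult_ineq)
    also have "\<dots> = sqrt (S a)"
      by (simp add: L2_set_def norm_q[OF a] S_def)
    finally show "cmod (\<Sum>x\<in>X. q a x * d a x) \<le> sqrt (S a)" .
  qed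
  also have "\<dots> \<le> L2_set (\<lambda>_. 1) {..<m} * L2_set (\<lambda>a. sqrt (S a)) {..<m}"
    using L2_set_mult_ineq[of "\<lambda>_. 1" "\<lambda>a. sqrt (S a)" "{..<m}"] by (simp add: S_def sum_nonneg)
  also have "\<dots> = sqrt (real m) * sqrt (\<Sum>a<m. S a)"
    by (simp add: L2_set_def S_def sum_nonneg)
  finally have "(cmod (\<Sum>x\<in>X. M x x))\<^sup>2 \<le> (sqrt (real m) * sqrt (\<Sum>a<m. S a))\<^sup>2"
    by (intro power_mono) auto
  also have "\<dots> = real m * (\<Sum>a<m. S a)"
    by (simp add: power_mult_distrib S_def sum_nonneg)
  also have "(\<Sum>a<m. S a) = (\<Sum>x\<in>X. \<Sum>y\<in>X. (cmod (M x y))\<^sup>2)"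
    unfolding S_def by (subst sum.swap, subst (2) sum.swap) (simp add: col)
  also have "real m * (\<Sum>x\<in>X. \<Sum>y\<in>X. (cmod (M x y))\<^sup>2) \<le> real (card J) * (\<Sum>x\<in>X. \<Sum>y\<in>X. (cmod (M x y))\<^sup>2)"
    using m by (intro mult_right_mono) (auto intro!: sum_nonneg)
  finally show ?thesis .
qed

text \<open>\<open>T\<close> arises from a finite submatrix of \<open>M\<close> by linear
  combinations of rows and of columns, so a row basis of \<open>M\<close> factors \<open>T\<close>
  as well. In this form the rank hypothesis enters the growth argument.\<close>

lemma rank_trace_inequality:
  fixes M :: "'a \<Rightarrow> 'b \<Rightarrow> complex"
  assumes r: "ereal_of_enat (matrix_rank A B M) \<le> ereal r"
    and fin: "finite X" "finite P" "finite Q"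
    and R: "\<And>p. p \<in> P \<Longrightarrow> R p \<in> A" and C: "\<And>q. q \<in> Q \<Longrightarrow> C q \<in> B"
    and T: "\<And>x y. x \<in> X \<Longrightarrow> y \<in> X \<Longrightarrow> T x y = (\<Sum>p\<in>P. \<Sum>q\<in>Q. a x p * b y q * M (R p) (C q))"
  shows "(cmod (\<Sum>x\<in>X. T x x))\<^sup>2 \<le> r * (\<Sum>x\<in>X. \<Sum>y\<in>X. (cmod (T x y))\<^sup>2)"
proof -
  obtain J where J: "J \<subseteq> A" "finite J" "real (card J) \<le> r"
    and sp: "\<And>i. i \<in> A \<Longrightarrow> \<exists>w. \<forall>b\<in>B. M i b = (\<Sum>j\<in>J. w j * M j b)"
    using matrix_rank_row_basis[OF r] by metis
  obtain W where W: "\<And>i b. i \<in> A \<Longrightarrow> b \<in> B \<Longrightarrow> M i b = (\<Sum>j\<in>J. W i j * M j b)"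
    using sp by metis
  have "T x y = (\<Sum>j\<in>J. (\<Sum>p\<in>P. a x p * W (R p) j) * (\<Sum>q\<in>Q. b y q * M j (C q)))"
    if "x \<in> X" "y \<in> X" for x y
  proof -
    have "T x y = (\<Sum>p\<in>P. \<Sum>q\<in>Q. \<Sum>j\<in>J. (a x p * W (R p) j) * (b y q * M j (C q)))"
      unfolding T[OF that]
      by (intro sum.cong refl) (simp add: W[OF R C] sum_distrib_left mult_ac)
    also have "\<dots> = (\<Sum>p\<in>P. \<Sum>j\<in>J. \<Sum>q\<in>Q. (a x p * W (R p) j) * (b y q * M j (C q)))"
      by (intro sum.cong refl, rule sum.swap)
    also have "\<dots> = (\<Sum>j\<in>J. \<Sum>p\<in>P. \<Sum>q\<in>Q. (a x p * W (R p) j) * (b y q * M j (C q)))"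
      by (rule sum.swap)
    finally show ?thesis by (simp add: sum_product)
  qed
  then have "(cmod (\<Sum>x\<in>X. T x x))\<^sup>2 \<le> real (card J) * (\<Sum>x\<in>X. \<Sum>y\<in>X. (cmod (T x y))\<^sup>2)"
    by (rule trace_square_le_rank_times_norm[OF fin(1) J(2)])
  also have "\<dots> \<le> r * (\<Sum>x\<in>X. \<Sum>y\<in>X. (cmod (T x y))\<^sup>2)"
    using J(3) by (intro mult_right_mono) (auto intro!: sum_nonneg)
  finally show ?thesis .
qed

section \<open>Dissolving vertices and gluing\<close>

definition adj :: "'v set \<Rightarrow> ('v, 'e) multigraph \<Rightarrow> ('e \<times> 'e) set" where
  "adj S G = {(e, e'). e \<in> edges G \<and> e' \<in> edges G \<and> (\<exists>v\<in>S. v \<in># ends G e \<and> v \<in># ends G e')}"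

abbreviation cls :: "'v set \<Rightarrow> ('v, 'e) multigraph \<Rightarrow> 'e \<Rightarrow> 'e set" where
  "cls S G e \<equiv> (adj S G)\<^sup>* `` {e}"

lemma dissolve_sel [simp]:
  "verts (dissolve S G) = verts G - S"
  "edges (dissolve S G) = edges G // (adj S G)\<^sup>*"
  "ends (dissolve S G) = (\<lambda>C. \<Sum>e\<in>C. filter_mset (\<lambda>v. v \<notin> S) (ends G e))"
  by (auto simp: dissolve_def adj_def)

lemma adj_edges: "(e, e') \<in> adj S G \<Longrightarrow> e \<in> edges G \<and> e' \<in> edges G"
  by (simp add: adj_def)

lemma sym_adj: "sym (adj S G)"
  by (auto simp: adj_def sym_def)

lemma adj_rtrancl_sym: "(e, e') \<in> (adj S G)\<^sup>* \<Longrightarrow> (e', e) \<in> (adj S G)\<^sup>*"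
  by (meson sym_adj sym_rtrancl symE)

lemma adj_rtrancl_edges: "(e, e') \<in> (adj S G)\<^sup>* \<Longrightarrow> e \<in> edges G \<Longrightarrow> e' \<in> edges G"
  by (induction rule: rtrancl_induct) (auto simp: adj_def)

lemma cls_subset: "e \<in> edges G \<Longrightarrow> cls S G e \<subseteq> edges G"
  using adj_rtrancl_edges by fast

lemma cls_eq_iff: "cls S G e = cls S G e' \<longleftrightarrow> (e, e') \<in> (adj S G)\<^sup>*"
proof
  assume "cls S G e = cls S G e'"
  then have "e' \<in> cls S G e" by simp
  then show "(e, e') \<in> (adj S G)\<^sup>*" by simp
next
  assume r: "(e, e') \<in> (adj S G)\<^sup>*"
  show "cls S G e = cls S G e'"
  proof (rule set_eqI)
    fix x show "x \<in> cls S G e \<longleftrightarrow> x \<in> cls S G e'"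
      using rtrancl_trans[OF r, of x] rtrancl_trans[OF adj_rtrancl_sym[OF r], of x] by auto
  qed
qed

lemma quotient_cls: "edges G // (adj S G)\<^sup>* = cls S G ` edges G"
  by (auto simp: quotient_def)

lemma cls_disjoint:
  assumes "C \<in> edges G // (adj S G)\<^sup>*" "D \<in> edges G // (adj S G)\<^sup>*" "x \<in> C" "x \<in> D"
  shows "C = D"
proof -
  obtain e where e: "C = cls S G e" using assms(1) by (auto simp: quotient_cls)
  obtain d where d: "D = cls S G d" using assms(2) by (auto simp: quotient_cls)
  have "cls S G e = cls S G x" using assms(3) unfolding e cls_eq_iff by simp
  moreover have "cls S G d = cls S G x" using assms(4) unfolding d cls_eq_iff by simp
  ultimately show ?thesis unfolding e d by simp
qed

lemma sum_quotient:
  assumes "finite (edges G)"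
  shows "(\<Sum>C\<in>edges G // (adj S G)\<^sup>*. \<Sum>e\<in>C. g e) = (\<Sum>e\<in>edges G. g e)"
proof -
  have U: "\<Union> (edges G // (adj S G)\<^sup>*) = edges G"
    using cls_subset by (fastforce simp: quotient_def)
  have "(\<Sum>e\<in>\<Union> (edges G // (adj S G)\<^sup>*). g e) = (\<Sum>C\<in>edges G // (adj S G)\<^sup>*. \<Sum>e\<in>C. g e)"
  proof (rule sum.Union_disjoint[unfolded comp_def])
    show "\<forall>C\<in>edges G // (adj S G)\<^sup>*. finite C"
      using assms U by (metis Union_upper finite_subset)
    show "\<forall>C\<in>edges G // (adj S G)\<^sup>*. \<forall>D\<in>edges G // (adj S G)\<^sup>*. C \<noteq> D \<longrightarrow> C \<inter> D = {}"
      using cls_disjoint by (metis disjoint_iff)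
  qed
  then show ?thesis using U by simp
qed

text \<open>To recognise a dissolved graph it suffices to name the merged edges: \<open>q\<close>
  sends each old edge to the edge that it becomes part of. Rule 1 makes \<open>q\<close> constant on
  classes, rule 2 keeps different classes apart. The identifications of closures and gluings rest on
  this.\<close>

lemma dissolve_isomorphicI:
  assumes q: "q ` edges G = edges K"
    and 1: "\<And>e e' v. e \<in> edges G \<Longrightarrow> e' \<in> edges G \<Longrightarrow> v \<in> S \<Longrightarrow> v \<in># ends G e \<Longrightarrow> v \<in># ends G e' \<Longrightarrow> q e = q e'"
    and 2: "\<And>e e'. e \<in> edges G \<Longrightarrow> e' \<in> edges G \<Longrightarrow> q e = q e' \<Longrightarrow> (e, e') \<in> (adj S G)\<^sup>*"
    and a: "bij_betw \<alpha> (verts G - S) (verts K)"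
    and ends: "\<And>e0. e0 \<in> edges G \<Longrightarrow> ends K (q e0) =
       image_mset \<alpha> (\<Sum>e\<in>{e\<in>edges G. q e = q e0}. filter_mset (\<lambda>v. v \<notin> S) (ends G e))"
  shows "isomorphic (dissolve S G) K"
proof -
  have qc: "q e' = q e" if "(e, e') \<in> (adj S G)\<^sup>*" for e e'
    using that by (induction rule: rtrancl_induct) (auto simp: adj_def dest: 1)
  have cl: "cls S G e = {e'\<in>edges G. q e' = q e}" if "e \<in> edges G" for e
  proof (rule set_eqI)
    fix x show "x \<in> cls S G e \<longleftrightarrow> x \<in> {e'\<in>edges G. q e' = q e}"
      using qc[of e x] 2[of e x] that adj_rtrancl_edges[of e x S G] by auto
  qed
  let ?b = "\<lambda>C. q (SOME e. e \<in> C)"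
  have b: "?b (cls S G e) = q e" if "e \<in> edges G" for e
  proof -
    have "(SOME e'. e' \<in> cls S G e) \<in> cls S G e" by (rule someI[of _ e]) auto
    then show ?thesis using cl[OF that] by blast
  qed
  have "bij_betw ?b (edges G // (adj S G)\<^sup>*) (edges K)"
  proof (rule bij_betw_imageI)
    show "inj_on ?b (edges G // (adj S G)\<^sup>*)"
    proof (rule inj_onI)
      fix C D assume "C \<in> edges G // (adj S G)\<^sup>*" "D \<in> edges G // (adj S G)\<^sup>*" and eq: "?b C = ?b D"
      then obtain e d where "e \<in> edges G" "C = cls S G e" "d \<in> edges G" "D = cls S G d"
        unfolding quotient_cls by (elim imageE)
      moreover from this have "q e = q d" using eq by (simp only: b)
      ultimately show "C = D" using 2 cls_eq_iff by metis
    qed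
    have "?b ` (edges G // (adj S G)\<^sup>*) = (\<lambda>e. ?b (cls S G e)) ` edges G"
      unfolding quotient_cls image_image ..
    also have "\<dots> = q ` edges G" by (rule image_cong) (auto simp only: b)
    finally show "?b ` (edges G // (adj S G)\<^sup>*) = edges K" using q by simp
  qed
  moreover have "ends K (?b C) = image_mset \<alpha> (ends (dissolve S G) C)" if "C \<in> edges (dissolve S G)" for C
  proof -
    have "C \<in> cls S G ` edges G" using that by (simp add: quotient_cls)
    then obtain e where e: "e \<in> edges G" "C = cls S G e" by (elim imageE)
    have "?b C = q e" by (simp only: e(2) b[OF e(1)])
    moreover have "ends (dissolve S G) C = (\<Sum>x\<in>{x\<in>edges G. q x = q e}. filter_mset (\<lambda>v. v \<notin> S) (ends G x))"
      by (simp only: e(2) cl[OF e(1)] dissolve_sel)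
    ultimately show ?thesis using ends[OF e(1)] by (simp only:)
  qed
  ultimately show ?thesis
    unfolding isomorphic_def using a by (intro exI[of _ \<alpha>] exI[of _ ?b]) auto
qed

lemma image_mset_sum: "image_mset h (\<Sum>e\<in>C. g e) = (\<Sum>e\<in>C. image_mset h (g e))"
  by (induction C rule: infinite_finite_induct) auto

lemma filter_mset_sum: "filter_mset P (\<Sum>e\<in>C. g e) = (\<Sum>e\<in>C. filter_mset P (g e))"
  by (induction C rule: infinite_finite_induct) auto

text \<open>Naturality of dissolving. The less obvious direction pulls a path of adjacent edges of
  \<open>H\<close> back edge by edge, which works because \<open>\<beta>\<close> is onto and ends at
  vertices of \<open>S\<close> correspond exactly.\<close>

lemma dissolve_isomorphic:
  assumes wf: "wf_multigraph G" and S: "S \<subseteq> verts G"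
    and a: "bij_betw \<alpha> (verts G) (verts H)" and b: "bij_betw \<beta> (edges G) (edges H)"
    and ends: "\<And>e. e \<in> edges G \<Longrightarrow> ends H (\<beta> e) = image_mset \<alpha> (ends G e)"
  shows "isomorphic (dissolve S G) (dissolve (\<alpha> ` S) H)"
proof -
  have bE: "\<beta> ` edges G = edges H" and injb: "inj_on \<beta> (edges G)" and inja: "inj_on \<alpha> (verts G)"
    using a b by (auto simp: bij_betw_def)
  have sub: "set_mset (ends G e) \<subseteq> verts G" if "e \<in> edges G" for e
    using wf that by (auto simp: wf_multigraph_def)
  have mem: "\<alpha> v \<in># ends H (\<beta> e) \<longleftrightarrow> v \<in># ends G e" if "e \<in> edges G" "v \<in> S" for e v
    using sub[OF that(1)] that S inja by (auto simp: ends inj_on_def)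
  have adj: "(\<beta> e, \<beta> e') \<in> adj (\<alpha> ` S) H \<longleftrightarrow> (e, e') \<in> adj S G"
    if "e \<in> edges G" "e' \<in> edges G" for e e'
    using that bE mem by (auto simp: adj_def)
  have fwd: "(\<beta> e, \<beta> e') \<in> (adj (\<alpha> ` S) H)\<^sup>*" if "(e, e') \<in> (adj S G)\<^sup>*" for e e'
    using that
  proof (induction rule: rtrancl_induct)
    case (step x y)
    then have "(\<beta> x, \<beta> y) \<in> adj (\<alpha> ` S) H" using adj[of x y] by (auto simp: adj_def)
    then show ?case using step.IH by simp
  qed simp
  have bwd: "(e, e') \<in> (adj S G)\<^sup>*" if "(\<beta> e, d) \<in> (adj (\<alpha> ` S) H)\<^sup>*" "e \<in> edges G" "d = \<beta> e'" "e' \<in> edges G" for e e' d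
    using that
  proof (induction arbitrary: e' rule: rtrancl_induct)
    case base
    then have "e = e'" using injb by (auto simp: inj_on_def)
    then show ?case by simp
  next
    case (step x y)
    then obtain u where u: "u \<in> edges G" "x = \<beta> u" using bE by (auto simp: adj_def)
    then have "(u, e') \<in> adj S G" using step adj[of u e'] by auto
    then show ?case using step.IH[of u] step.prems u by simp
  qed
  have clH: "cls (\<alpha> ` S) H (\<beta> e0) = \<beta> ` {e\<in>edges G. cls (\<alpha> ` S) H (\<beta> e) = cls (\<alpha> ` S) H (\<beta> e0)}"
    if e0: "e0 \<in> edges G" for e0
  proof -
    have "(\<exists>e\<in>edges G. d = \<beta> e \<and> (\<beta> e, \<beta> e0) \<in> (adj (\<alpha> ` S) H)\<^sup>*) \<longleftrightarrow> (\<beta> e0, d) \<in> (adj (\<alpha> ` S) H)\<^sup>*" for d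
    proof
      assume d: "(\<beta> e0, d) \<in> (adj (\<alpha> ` S) H)\<^sup>*"
      then have "d \<in> edges H" using adj_rtrancl_edges e0 bE by fast
      then obtain e where "e \<in> edges G" "d = \<beta> e" by (auto simp: bE[symmetric])
      then show "\<exists>e\<in>edges G. d = \<beta> e \<and> (\<beta> e, \<beta> e0) \<in> (adj (\<alpha> ` S) H)\<^sup>*"
        using adj_rtrancl_sym[OF d] by (intro bexI[of _ e]) simp_all
    qed (auto dest: adj_rtrancl_sym)
    then show ?thesis unfolding cls_eq_iff by (intro set_eqI) auto
  qed
  show ?thesis
  proof (rule dissolve_isomorphicI[where q = "\<lambda>e. cls (\<alpha> ` S) H (\<beta> e)" and \<alpha> = \<alpha>], goal_cases)
    case 1
    show ?case unfolding dissolve_sel quotient_cls unfolding bE[symmetric] image_image ..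
  next
    case (2 e e' v)
    then show ?case unfolding cls_eq_iff by (intro fwd r_into_rtrancl) (auto simp: adj_def)
  next
    case (3 e e')
    then show ?case unfolding cls_eq_iff using bwd[of e "\<beta> e'" e'] by simp
  next
    case 4
    have "\<alpha> ` (verts G - S) = verts H - \<alpha> ` S"
      using a S inj_on_image_set_diff[OF inja, of "verts G" S] by (auto simp: bij_betw_def)
    then show ?case using inj_on_subset[OF inja, of "verts G - S"] by (simp add: bij_betw_def)
  next
    case (5 e0)
    let ?E = "{e\<in>edges G. cls (\<alpha> ` S) H (\<beta> e) = cls (\<alpha> ` S) H (\<beta> e0)}"
    have "ends (dissolve (\<alpha> ` S) H) (cls (\<alpha> ` S) H (\<beta> e0)) =
       (\<Sum>e\<in>\<beta> ` ?E. filter_mset (\<lambda>v. v \<notin> \<alpha> ` S) (ends H e))"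
      by (simp only: dissolve_sel clH[OF 5, symmetric])
    also have "\<dots> = (\<Sum>e\<in>?E. filter_mset (\<lambda>v. v \<notin> \<alpha> ` S) (ends H (\<beta> e)))"
      by (subst sum.reindex) (auto intro: inj_on_subset[OF injb])
    also have "\<dots> = (\<Sum>e\<in>?E. image_mset \<alpha> (filter_mset (\<lambda>v. v \<notin> S) (ends G e)))"
    proof (rule sum.cong[OF refl])
      fix e assume "e \<in> ?E"
      then have e: "e \<in> edges G" by simp
      have "filter_mset (\<lambda>v. v \<notin> \<alpha> ` S) (image_mset \<alpha> (ends G e)) = image_mset \<alpha> (filter_mset (\<lambda>v. \<alpha> v \<notin> \<alpha> ` S) (ends G e))"
        by (simp add: filter_mset_image_mset)
      also have "filter_mset (\<lambda>v. \<alpha> v \<notin> \<alpha> ` S) (ends G e) = filter_mset (\<lambda>v. v \<notin> S) (ends G e)"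
        by (rule filter_mset_cong) (use sub[OF e] S inja in \<open>auto simp: inj_on_def\<close>)
      finally show "filter_mset (\<lambda>v. v \<notin> \<alpha> ` S) (ends H (\<beta> e)) = image_mset \<alpha> (filter_mset (\<lambda>v. v \<notin> S) (ends G e))"
        by (simp add: ends e)
    qed
    also have "\<dots> = image_mset \<alpha> (\<Sum>e\<in>?E. filter_mset (\<lambda>v. v \<notin> S) (ends G e))"
      by (rule image_mset_sum[symmetric])
    finally show ?case .
  qed
qed

lemma count_sum_mset_fun: "count (\<Sum>e\<in>C. g e) v = (\<Sum>e\<in>C. count (g e) v)"
  by (induction C rule: infinite_finite_induct) auto

lemma size_sum_mset_fun: "size (\<Sum>e\<in>C. g e :: 'c multiset) = (\<Sum>e\<in>C. size (g e))"
  by (induction C rule: infinite_finite_induct) auto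

lemma degree_dissolve:
  assumes "finite (edges G)" "w \<notin> S"
  shows "Defs.degree (dissolve S G) w = Defs.degree G w"
proof -
  have "Defs.degree (dissolve S G) w = (\<Sum>C\<in>edges G // (adj S G)\<^sup>*. \<Sum>e\<in>C. count (ends G e) w)"
    using assms(2) by (simp add: Defs.degree_def count_sum_mset_fun)
  then show ?thesis using sum_quotient[OF assms(1)] by (simp add: Defs.degree_def)
qed

lemma isomorphic_wf:
  assumes "wf_multigraph G" "isomorphic G H"
  shows "wf_multigraph H"
proof -
  obtain \<alpha> \<beta> where ab: "bij_betw \<alpha> (verts G) (verts H)" "bij_betw \<beta> (edges G) (edges H)"
    "\<And>e. e \<in> edges G \<Longrightarrow> ends H (\<beta> e) = image_mset \<alpha> (ends G e)"
    using assms(2) unfolding isomorphic_def by blast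
  have "set_mset (ends H d) \<subseteq> verts H \<and> size (ends H d) \<in> {0,2}" if "d \<in> edges H" for d
  proof -
    obtain e where e: "e \<in> edges G" "d = \<beta> e" using ab(2) \<open>d \<in> edges H\<close> by (auto simp: bij_betw_def)
    then have "set_mset (ends G e) \<subseteq> verts G" "size (ends G e) \<in> {0,2}"
      using assms(1) by (auto simp: wf_multigraph_def)
    then show ?thesis using e ab by (auto simp: bij_betw_def)
  qed
  moreover have "finite (verts H)" "finite (edges H)"
    using assms(1) bij_betw_finite[OF ab(1)] bij_betw_finite[OF ab(2)] by (auto simp: wf_multigraph_def)
  ultimately show ?thesis unfolding wf_multigraph_def by simp
qed

lemma graph_of_cong:
  "wf_multigraph G \<Longrightarrow> isomorphic G H \<Longrightarrow> graph_of G = graph_of H"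
  using graph_of_eq_iff isomorphic_wf by blast

text \<open>At a vertex of degree 2 there is either one loop, whose class keeps no end and becomes a
  vertexless loop, or there are two edges, whose four ends lose two.\<close>

lemma wf_dissolve_single:
  assumes wf: "wf_multigraph G" and d: "Defs.degree G v = 2"
  shows "wf_multigraph (dissolve {v} G)"
proof -
  have fin: "finite (edges G)" using wf by (simp add: wf_multigraph_def)
  have sub: "set_mset (ends G e) \<subseteq> verts G" and sz: "size (ends G e) \<in> {0,2}" if "e \<in> edges G" for e
    using wf that by (auto simp: wf_multigraph_def)
  let ?T = "{e\<in>edges G. v \<in># ends G e}"
  have cl: "cls {v} G e = (if v \<in># ends G e then ?T else {e})" if e: "e \<in> edges G" for e
  proof (cases "v \<in># ends G e")
    case True
    have f1: "x \<in> ?T" if "(e, x) \<in> (adj {v} G)\<^sup>*" for x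
      using that by (induction rule: rtrancl_induct) (use True e in \<open>auto simp: adj_def\<close>)
    have f2: "(e, x) \<in> (adj {v} G)\<^sup>*" if "x \<in> ?T" for x
      using that True e by (intro r_into_rtrancl) (auto simp: adj_def)
    have "cls {v} G e = ?T"
    proof (rule set_eqI)
      fix x show "x \<in> cls {v} G e \<longleftrightarrow> x \<in> ?T"
        using f1[of x] f2[of x] by (simp only: Image_singleton_iff) blast
    qed
    then show ?thesis using True by simp
  next
    case False
    have f1: "x = e" if "(e, x) \<in> (adj {v} G)\<^sup>*" for x
      using that by (induction rule: rtrancl_induct) (use False in \<open>auto simp: adj_def\<close>)
    have "cls {v} G e = {e}"
    proof (rule set_eqI)
      fix x show "x \<in> cls {v} G e \<longleftrightarrow> x \<in> {e}"
        using f1[of x] by (simp only: Image_singleton_iff) blast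
    qed
    then show ?thesis using False by simp
  qed
  have "set_mset (ends (dissolve {v} G) C) \<subseteq> verts G - {v} \<and> size (ends (dissolve {v} G) C) \<in> {0,2}"
    if "C \<in> edges G // (adj {v} G)\<^sup>*" for C
  proof -
    obtain e where e: "e \<in> edges G" "C = cls {v} G e" using \<open>C \<in> _\<close> unfolding quotient_cls by (elim imageE)
    have CE: "C \<subseteq> edges G" using e cls_subset by fast
    then have fC: "finite C" using fin finite_subset by blast
    have 1: "set_mset (ends (dissolve {v} G) C) \<subseteq> verts G - {v}"
      using CE sub fC by (auto simp: set_mset_sum)
    have 2: "size (ends (dissolve {v} G) C) + (\<Sum>e\<in>C. count (ends G e) v) = (\<Sum>e\<in>C. size (ends G e))"
    proof -
      have "size (filter_mset (\<lambda>w. w \<notin> {v}) M) + count M v = size M" for M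
        by (induction M) auto
      then show ?thesis by (simp add: size_sum_mset_fun sum.distrib[symmetric])
    qed
    show ?thesis
    proof (cases "v \<in># ends G e")
      case True
      then have C: "C = ?T" using e cl by simp
      have "(\<Sum>e\<in>edges G. count (ends G e) v) = (\<Sum>e\<in>?T. count (ends G e) v)"
        by (rule sum.mono_neutral_right) (use fin in \<open>auto simp: not_in_iff\<close>)
      then have s2: "(\<Sum>e\<in>C. count (ends G e) v) = 2" using d C by (simp add: Defs.degree_def)
      have "size (ends G x) = 2" if "x \<in> C" for x
        using sz[of x] that C by (cases "ends G x = {#}") auto
      then have sC: "(\<Sum>e\<in>C. size (ends G e)) = 2 * card C" by simp
      \<comment> \<open>Every member of the class contributes at least 1 to the degree 2, so the
        class has one or two members.\<close>
      have "card C \<le> (\<Sum>e\<in>C. count (ends G e) v)"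
        using C sum_mono[of C "\<lambda>_. 1" "\<lambda>e. count (ends G e) v"] by simp
      moreover have "card C > 0" using True e C fC card_gt_0_iff by blast
      ultimately have "card C = 1 \<or> card C = 2" using s2 by linarith
      then show ?thesis using 1 2 s2 sC by auto
    next
      case False
      then have "C = {e}" using e cl by simp
      then show ?thesis using 1 2 False sz[OF e(1)] by (auto simp: not_in_iff)
    qed
  qed
  moreover have "finite (verts (dissolve {v} G))" "finite (edges (dissolve {v} G))"
    using wf by (auto simp: wf_multigraph_def quotient_cls)
  ultimately show ?thesis unfolding wf_multigraph_def by simp
qed

text \<open>Dissolving vertex by vertex replaces reasoning about chains of merged edges by
  induction. A class of classes on the right has as its union a class on the left, which also
  matches the surviving ends.\<close>

lemma dissolve_insert:
  assumes fin: "finite (edges G)" and v: "v \<notin> S"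
  shows "isomorphic (dissolve (insert v S) G) (dissolve {v} (dissolve S G))"
proof -
  let ?D = "dissolve S G"
  have adj_sub: "(e, e') \<in> (adj S G)\<^sup>* \<Longrightarrow> (e, e') \<in> (adj (insert v S) G)\<^sup>*" for e e'
    by (erule rev_subsetD[OF _ rtrancl_mono]) (auto simp: adj_def)
  have fc: "finite (cls S G e)" if "e \<in> edges G" for e
    using cls_subset[OF that] fin finite_subset by blast
  have memD: "v \<in># ends ?D (cls S G e) \<longleftrightarrow> (\<exists>x\<in>cls S G e. v \<in># ends G x)" if "e \<in> edges G" for e
    using fc[OF that] v by (simp add: set_mset_sum)
  have bck: "(e, e') \<in> (adj (insert v S) G)\<^sup>*"
    if "(cls S G e, C) \<in> (adj {v} ?D)\<^sup>*" "e \<in> edges G" "C = cls S G e'" "e' \<in> edges G" for e e' C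
    using that
  proof (induction arbitrary: e' rule: rtrancl_induct)
    case base
    then have "cls S G e = cls S G e'" by simp
    then show ?case unfolding cls_eq_iff by (rule adj_sub)
  next
    case (step B C)
    have "B \<in> cls S G ` edges G" using adj_edges[OF step(2)] by (simp add: quotient_cls)
    then obtain u where u: "u \<in> edges G" "B = cls S G u" by (elim imageE)
    then have 1: "(e, u) \<in> (adj (insert v S) G)\<^sup>*" using step.IH[OF step.prems(1)] by simp
    have "v \<in># ends ?D (cls S G u)" "v \<in># ends ?D (cls S G e')"
      using step(2) step.prems(2) u(2) by (simp_all only: adj_def mem_Collect_eq case_prod_conv singleton_iff bex_simps) blast+
    then obtain x x' where x: "(u, x) \<in> (adj S G)\<^sup>*" "(e', x') \<in> (adj S G)\<^sup>*" "v \<in># ends G x" "v \<in># ends G x'"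
      unfolding memD[OF u(1)] memD[OF step.prems(3)] by auto
    have "x \<in> edges G" "x' \<in> edges G" using x u step.prems adj_rtrancl_edges by fast+
    then have "(x, x') \<in> (adj (insert v S) G)\<^sup>*" using x by (intro r_into_rtrancl) (auto simp: adj_def)
    moreover have "(u, x) \<in> (adj (insert v S) G)\<^sup>*" "(x', e') \<in> (adj (insert v S) G)\<^sup>*"
      using adj_sub[OF x(1)] adj_rtrancl_sym[OF adj_sub[OF x(2)]] by simp_all
    ultimately show ?case using 1 by (meson rtrancl_trans)
  qed
  show ?thesis
  proof (rule dissolve_isomorphicI[where q = "\<lambda>e. cls {v} ?D (cls S G e)" and \<alpha> = id], goal_cases)
    case 1
    show ?case
      by (subst dissolve_sel(2), subst quotient_cls, subst dissolve_sel(2), subst quotient_cls)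
        (simp only: image_image)
  next
    case (2 e e' w)
    have ED: "cls S G e \<in> edges ?D" "cls S G e' \<in> edges ?D" using 2 by (auto simp: quotient_cls)
    show ?case
    proof (cases "w = v")
      case True
      have "v \<in># ends ?D (cls S G e)" "v \<in># ends ?D (cls S G e')"
        unfolding memD[OF 2(1)] memD[OF 2(2)] using 2 True by auto
      then have "(cls S G e, cls S G e') \<in> adj {v} ?D" using ED by (auto simp: adj_def)
      then show ?thesis unfolding cls_eq_iff by blast
    next
      case False
      then have "(e, e') \<in> (adj S G)\<^sup>*" using 2 by (intro r_into_rtrancl) (auto simp: adj_def)
      then have "cls S G e = cls S G e'" by (simp only: cls_eq_iff)
      then show ?thesis by simp
    qed
  next
    case (3 e e')
    then have "(cls S G e, cls S G e') \<in> (adj {v} ?D)\<^sup>*" by (simp only: cls_eq_iff)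
    then show ?case by (rule bck) (use 3 in auto)
  next
    case 4
    have "verts G - insert v S = verts G - S - {v}" by blast
    then show ?case by simp
  next
    case (5 e0)
    let ?q = "\<lambda>e. cls {v} ?D (cls S G e)"
    let ?E = "{e\<in>edges G. ?q e = ?q e0}"
    let ?B = "cls {v} ?D (cls S G e0)"
    have e0D: "cls S G e0 \<in> edges ?D" using 5 by (auto simp: quotient_cls)
    have BD: "?B \<subseteq> edges ?D" by (rule cls_subset[OF e0D])
    have UB: "\<Union> ?B = ?E"
    proof (rule set_eqI)
      fix x
      have "x \<in> \<Union> ?B \<longleftrightarrow> (\<exists>C. (cls S G e0, C) \<in> (adj {v} ?D)\<^sup>* \<and> x \<in> C)" by auto
      also have "\<dots> \<longleftrightarrow> x \<in> edges G \<and> (cls S G e0, cls S G x) \<in> (adj {v} ?D)\<^sup>*"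
      proof
        assume "\<exists>C. (cls S G e0, C) \<in> (adj {v} ?D)\<^sup>* \<and> x \<in> C"
        then obtain C where C: "(cls S G e0, C) \<in> (adj {v} ?D)\<^sup>*" "x \<in> C" by blast
        then have "C \<in> edges ?D" using BD by auto
        then obtain u where u: "u \<in> edges G" "C = cls S G u" by (auto simp: quotient_cls)
        then have ux: "(u, x) \<in> (adj S G)\<^sup>*" using C by simp
        then have "cls S G u = cls S G x" "x \<in> edges G"
          using u adj_rtrancl_edges[OF ux] by (simp_all only: cls_eq_iff)
        then show "x \<in> edges G \<and> (cls S G e0, cls S G x) \<in> (adj {v} ?D)\<^sup>*" using C u by simp
      next
        assume "x \<in> edges G \<and> (cls S G e0, cls S G x) \<in> (adj {v} ?D)\<^sup>*"
        then show "\<exists>C. (cls S G e0, C) \<in> (adj {v} ?D)\<^sup>* \<and> x \<in> C" by blast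
      qed
      also have "\<dots> \<longleftrightarrow> x \<in> ?E" unfolding cls_eq_iff[of "{v}"]
        using adj_rtrancl_sym[of "cls S G e0" "cls S G x"] adj_rtrancl_sym[of "cls S G x" "cls S G e0"] by auto
      finally show "x \<in> \<Union> ?B \<longleftrightarrow> x \<in> ?E" .
    qed
    have "ends (dissolve {v} ?D) ?B = (\<Sum>C\<in>?B. \<Sum>e\<in>C. filter_mset (\<lambda>w. w \<notin> insert v S) (ends G e))"
      by (simp add: filter_mset_sum filter_filter_mset conj_commute)
    also have "\<dots> = (\<Sum>e\<in>\<Union> ?B. filter_mset (\<lambda>w. w \<notin> insert v S) (ends G e))"
    proof (rule sum.Union_disjoint[unfolded comp_def, symmetric])
      show "\<forall>A\<in>?B. finite A" using BD fc unfolding dissolve_sel quotient_cls by fast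
      show "\<forall>A\<in>?B. \<forall>B\<in>?B. A \<noteq> B \<longrightarrow> A \<inter> B = {}"
      proof (intro ballI impI)
        fix A B assume AB: "A \<in> ?B" "B \<in> ?B" "A \<noteq> B"
        have "A \<in> edges G // (adj S G)\<^sup>*" "B \<in> edges G // (adj S G)\<^sup>*"
          using subsetD[OF BD AB(1)] subsetD[OF BD AB(2)] by (simp_all only: dissolve_sel)
        then show "A \<inter> B = {}" using cls_disjoint AB(3) by fast
      qed
    qed
    finally show ?case unfolding UB by simp
  qed
qed

text \<open>Induction along \<open>dissolve_insert\<close>; it goes through because dissolving
  leaves the degrees of the remaining vertices unchanged. The number of ends of a class is carried
  over by the isomorphism, whereas that these ends are vertices is checked directly, since an
  isomorphism does not exclude ends outside the vertex set.\<close>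

lemma wf_dissolve:
  assumes wf: "wf_multigraph G" and S: "finite S" "\<And>v. v \<in> S \<Longrightarrow> Defs.degree G v = 2"
  shows "wf_multigraph (dissolve S G)"
  using S
proof (induction S rule: finite_induct)
  case empty
  have "adj {} G = {}" by (auto simp: adj_def)
  then show ?case using wf by (auto simp: wf_multigraph_def quotient_def)
next
  case (insert v S)
  have fin: "finite (edges G)" using wf by (simp add: wf_multigraph_def)
  have "wf_multigraph (dissolve {v} (dissolve S G))"
    by (rule wf_dissolve_single) (use insert fin in \<open>auto simp: degree_dissolve\<close>)
  moreover have sub: "set_mset (ends (dissolve (insert v S) G) C) \<subseteq> verts (dissolve (insert v S) G)"
    if C: "C \<in> edges (dissolve (insert v S) G)" for C
  proof -
    obtain e where e: "e \<in> edges G" "C = cls (insert v S) G e" using C by (auto simp: quotient_cls)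
    have "C \<subseteq> edges G" using e cls_subset by fast
    moreover from this have "finite C" using fin finite_subset by blast
    ultimately show ?thesis using wf by (auto simp: set_mset_sum wf_multigraph_def)
  qed
  moreover have "isomorphic (dissolve (insert v S) G) (dissolve {v} (dissolve S G))"
    by (rule dissolve_insert) (use fin insert in auto)
  then obtain \<alpha> \<beta> where ab: "bij_betw \<alpha> (verts (dissolve (insert v S) G)) (verts (dissolve {v} (dissolve S G)))"
      "bij_betw \<beta> (edges (dissolve (insert v S) G)) (edges (dissolve {v} (dissolve S G)))"
      "\<And>e. e \<in> edges (dissolve (insert v S) G) \<Longrightarrow>
         ends (dissolve {v} (dissolve S G)) (\<beta> e) = image_mset \<alpha> (ends (dissolve (insert v S) G) e)"
    unfolding isomorphic_def by blast
  moreover have "size (ends (dissolve (insert v S) G) C) \<in> {0,2}" if C: "C \<in> edges (dissolve (insert v S) G)" for C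
  proof -
    have "\<beta> C \<in> edges (dissolve {v} (dissolve S G))" using bij_betwE[OF ab(2)] C by simp
    then have "size (ends (dissolve {v} (dissolve S G)) (\<beta> C)) \<in> {0,2}"
      using \<open>wf_multigraph (dissolve {v} (dissolve S G))\<close> unfolding wf_multigraph_def by simp
    then show ?thesis using ab(3)[OF C] by (simp only: size_image_mset)
  qed
  moreover have "finite (verts (dissolve (insert v S) G))" "finite (edges (dissolve (insert v S) G))"
    using wf by (auto simp: wf_multigraph_def quotient_cls)
  ultimately show ?case unfolding wf_multigraph_def by blast
qed

section \<open>Disjoint unions and gluings\<close>

lemma disjoint_union_sel [simp]:
  "verts (disjoint_union G H) = verts G <+> verts H"
  "edges (disjoint_union G H) = edges G <+> edges H"
  "ends (disjoint_union G H) (Inl e) = image_mset Inl (ends G e)"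
  "ends (disjoint_union G H) (Inr d) = image_mset Inr (ends H d)"
  by (auto simp: disjoint_union_def)

lemma map_verts_sel [simp]:
  "verts (map_verts h G) = h ` verts G"
  "edges (map_verts h G) = edges G"
  "ends (map_verts h G) e = image_mset h (ends G e)"
  by (auto simp: map_verts_def)

lemma wf_multigraph_ends: "wf_multigraph G \<Longrightarrow> e \<in> edges G \<Longrightarrow> x \<in># ends G e \<Longrightarrow> x \<in> verts G"
  unfolding wf_multigraph_def by blast

lemma wf_multigraph_iff: "wf_multigraph G \<longleftrightarrow> finite (verts G) \<and> finite (edges G) \<and>
    (\<forall>e\<in>edges G. \<forall>x. x \<in># ends G e \<longrightarrow> x \<in> verts G) \<and> (\<forall>e\<in>edges G. size (ends G e) \<in> {0, 2})"
  unfolding wf_multigraph_def by blast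

lemma wf_disjoint_union: "wf_multigraph G \<Longrightarrow> wf_multigraph H \<Longrightarrow> wf_multigraph (disjoint_union G H)"
  unfolding wf_multigraph_iff by auto

lemma wf_map_verts: "wf_multigraph G \<Longrightarrow> wf_multigraph (map_verts h G)"
  unfolding wf_multigraph_iff by auto

text \<open>A gluing is described by the graph \<open>\<Gamma>\<close> in which equally labelled
  vertices are identified but not yet dissolved. It is covered by a copy of \<open>G\<close> and a
  copy of \<open>H\<close> that share no edges and meet in the labelled vertices only.\<close>

lemma glue_isomorphicI:
  assumes G: "(G, l) \<in> fragments k" and H: "(H, m) \<in> fragments k"
    and a: "inj_on \<alpha> (verts G)" "inj_on \<alpha>' (verts H)" "\<alpha> ` verts G \<union> \<alpha>' ` verts H = verts \<Gamma>"
    and lab: "\<And>i. i \<in> {1..k} \<Longrightarrow> \<alpha> (l i) = \<alpha>' (m i)"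
    and sep: "\<And>v w. v \<in> verts G \<Longrightarrow> w \<in> verts H \<Longrightarrow> \<alpha> v = \<alpha>' w \<Longrightarrow> \<exists>i\<in>{1..k}. v = l i \<and> w = m i"
    and b: "inj_on \<beta> (edges G)" "inj_on \<beta>' (edges H)" "\<beta> ` edges G \<union> \<beta>' ` edges H = edges \<Gamma>"
      "\<beta> ` edges G \<inter> \<beta>' ` edges H = {}"
    and ends: "\<And>e. e \<in> edges G \<Longrightarrow> ends \<Gamma> (\<beta> e) = image_mset \<alpha> (ends G e)"
      "\<And>e. e \<in> edges H \<Longrightarrow> ends \<Gamma> (\<beta>' e) = image_mset \<alpha>' (ends H e)"
  shows "isomorphic (glue k (G, l) (H, m)) (dissolve (\<alpha> ` l ` {1..k}) \<Gamma>)"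
proof -
  have wfG: "wf_multigraph G" and wfH: "wf_multigraph H"
    and l: "\<And>i. i \<in> {1..k} \<Longrightarrow> l i \<in> verts G" and m: "\<And>i. i \<in> {1..k} \<Longrightarrow> m i \<in> verts H"
    and injm: "inj_on m {1..k}"
    using G H by (auto simp: fragments_def)
  define \<phi> where "\<phi> = case_sum Inl (\<lambda>w. if w \<in> m ` {1..k} then Inl (l (inv_into {1..k} m w)) else Inr w)"
  define X where "X = map_verts \<phi> (disjoint_union G H)"
  define A where "A = case_sum \<alpha> \<alpha>'"
  have wfX: "wf_multigraph X" unfolding X_def by (intro wf_map_verts wf_disjoint_union wfG wfH)
  have A\<phi>: "A (\<phi> (Inl v)) = \<alpha> v" for v by (simp add: A_def \<phi>_def)
  have A\<phi>': "A (\<phi> (Inr w)) = \<alpha>' w" for w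
  proof (cases "w \<in> m ` {1..k}")
    case True
    then obtain i where i: "i \<in> {1..k}" "w = m i" by blast
    then show ?thesis using lab[OF i(1)] injm by (simp add: A_def \<phi>_def)
  qed (simp add: A_def \<phi>_def)
  have vX: "verts X = Inl ` verts G \<union> Inr ` (verts H - m ` {1..k})"
  proof -
    let ?M = "m ` {1..k}"
    have 1: "\<phi> ` Inl ` verts G = Inl ` verts G" by (simp add: image_image \<phi>_def)
    have 2: "\<phi> ` Inr ` (verts H - ?M) = Inr ` (verts H - ?M)"
      unfolding image_image by (rule image_cong) (simp_all add: \<phi>_def)
    have 3: "\<phi> ` Inr ` (verts H \<inter> ?M) \<subseteq> Inl ` verts G"
      using l injm by (auto simp: \<phi>_def)
    have "verts X = \<phi> ` Inl ` verts G \<union> (\<phi> ` Inr ` (verts H \<inter> ?M) \<union> \<phi> ` Inr ` (verts H - ?M))"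
      unfolding X_def map_verts_sel disjoint_union_sel Plus_def image_Un[symmetric] by (simp add: Int_Diff_Un)
    then show ?thesis unfolding 1 2 using 3 by blast
  qed
  have "bij_betw A (verts X) (verts \<Gamma>)"
  proof (rule bij_betw_imageI)
    show "inj_on A (verts X)"
    proof (rule inj_onI)
      fix x y assume xy: "x \<in> verts X" "y \<in> verts X" "A x = A y"
      have key: False if "v \<in> verts G" "w \<in> verts H" "w \<notin> m ` {1..k}" "\<alpha> v = \<alpha>' w" for v w
        using sep[OF that(1,2,4)] that(3) by blast
      consider v where "x = Inl v" "v \<in> verts G" | w where "x = Inr w" "w \<in> verts H" "w \<notin> m ` {1..k}"
        using xy(1) unfolding vX by blast
      then show "x = y"
      proof cases
        case 1
        then have "y \<noteq> Inr w" for w using key xy(2,3) unfolding vX by (auto simp: A_def)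
        then obtain v' where "y = Inl v'" "v' \<in> verts G" using xy(2) unfolding vX by blast
        then show ?thesis using 1 xy(3) a(1) by (auto simp: A_def inj_on_def)
      next
        case 2
        then have "y \<noteq> Inl v" for v using key xy(2) xy(3)[symmetric] unfolding vX by (auto simp: A_def)
        then obtain w' where "y = Inr w'" "w' \<in> verts H" using xy(2) unfolding vX by blast
        then show ?thesis using 2 xy(3) a(2) by (auto simp: A_def inj_on_def)
      qed
    qed
    have "A ` verts X = (\<lambda>z. A (\<phi> z)) ` (verts G <+> verts H)"
      by (simp add: X_def image_image)
    also have "\<dots> = verts \<Gamma>" using a(3) A\<phi> A\<phi>' by (auto simp: Plus_def image_Un image_image)
    finally show "A ` verts X = verts \<Gamma>" .
  qed
  moreover have "bij_betw (case_sum \<beta> \<beta>') (edges X) (edges \<Gamma>)"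
  proof (rule bij_betw_imageI)
    show "inj_on (case_sum \<beta> \<beta>') (edges X)"
    proof (rule inj_onI)
      have no: "\<beta> e \<noteq> \<beta>' d" if "e \<in> edges G" "d \<in> edges H" for e d using b(4) that by blast
      fix x y assume "x \<in> edges X" "y \<in> edges X" "case_sum \<beta> \<beta>' x = case_sum \<beta> \<beta>' y"
      then show "x = y"
        using inj_onD[OF b(1)] inj_onD[OF b(2)] no no[symmetric]
        by (cases x; cases y) (auto simp: X_def)
    qed
    show "case_sum \<beta> \<beta>' ` edges X = edges \<Gamma>"
      using b(3) by (auto simp: X_def Plus_def image_Un image_image)
  qed
  moreover have "ends \<Gamma> (case_sum \<beta> \<beta>' e) = image_mset A (ends X e)" if "e \<in> edges X" for e
    using that ends by (auto simp: X_def multiset.map_comp comp_def A\<phi> A\<phi>')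
  moreover have "Inl ` l ` {1..k} \<subseteq> verts X" using l by (auto simp: vX)
  ultimately have "isomorphic (dissolve (Inl ` l ` {1..k}) X) (dissolve (A ` Inl ` l ` {1..k}) \<Gamma>)"
    by (intro dissolve_isomorphic[OF wfX])
  moreover have "A ` Inl ` l ` {1..k} = \<alpha> ` l ` {1..k}" by (simp add: A_def image_image)
  moreover have "glue k (G, l) (H, m) = dissolve (Inl ` l ` {1..k}) X"
    by (simp add: X_def \<phi>_def)
  ultimately show ?thesis by simp
qed

lemma dissolve_empty: "isomorphic (dissolve {} G) G"
  by (rule dissolve_isomorphicI[where q = id and \<alpha> = id])
    (auto simp: conj_commute cong: conj_cong)

section \<open>Closing up systems of legs\<close>

text \<open>\<open>RV\<close> marks the vertices that remain; \<open>Inp\<close> and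
  \<open>Out\<close> are the two ports of a leg and will be dissolved. Legs are pairs so that the
  first component can number the copies of a system.\<close>

datatype vx = RV "nat \<times> nat" | Inp "nat \<times> nat" | Out "nat \<times> nat"
datatype ed = Conn "nat \<times> nat" | Strand "nat \<times> nat" | Star "nat \<times> nat" | Hedge "nat \<times> nat"

instance vx :: countable by countable_datatype
instance ed :: countable by countable_datatype

text \<open>
  A leg outside \<open>hl X\<close> is a bare strand. A leg in \<open>hl X\<close> has its output at the vertex
  \<open>vm X l\<close> and its input at the edge \<open>em X l\<close>; closing up with a permutation of the legs joins
  every input to an output.
\<close>

datatype lsys = LSys (lg: "(nat \<times> nat) set") (hl: "(nat \<times> nat) set")
  (vs: "(nat \<times> nat) set") (vm: "nat \<times> nat \<Rightarrow> nat \<times> nat")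
  (es: "(nat \<times> nat) set") (em: "nat \<times> nat \<Rightarrow> nat \<times> nat")

definition wf_sys :: "lsys \<Rightarrow> bool" where
  "wf_sys X \<longleftrightarrow> finite (lg X) \<and> finite (vs X) \<and> finite (es X) \<and> hl X \<subseteq> lg X \<and>
    vm X ` hl X \<subseteq> vs X \<and> em X ` hl X \<subseteq> es X \<and> (\<forall>h\<in>es X. card {l\<in>hl X. em X l = h} = 2)"

text \<open>The merged edge that starts at \<open>Hedge h\<close> leaves through an input
  \<open>l\<close> and \<open>Conn l\<close>. If the leg \<open>\<sigma> l\<close> is a half-edge it
  ends, through \<open>Star (\<sigma> l)\<close>, at a vertex; bare strands met on the way only
  prolong it.\<close>

primrec pre_ends :: "lsys \<Rightarrow> (nat \<times> nat \<Rightarrow> nat \<times> nat) \<Rightarrow> ed \<Rightarrow> vx multiset" where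
  "pre_ends X \<sigma> (Conn l) = {#Inp l, Out (\<sigma> l)#}"
| "pre_ends X \<sigma> (Strand l) = {#Inp l, Out l#}"
| "pre_ends X \<sigma> (Star l) = {#Out l, RV (vm X l)#}"
| "pre_ends X \<sigma> (Hedge h) = mset_set (Inp ` {l\<in>hl X. em X l = h})"

definition pre :: "lsys \<Rightarrow> (nat \<times> nat \<Rightarrow> nat \<times> nat) \<Rightarrow> (vx, ed) multigraph" where
  "pre X \<sigma> = Multigraph (RV ` vs X \<union> (Inp ` lg X \<union> Out ` lg X))
     (Conn ` lg X \<union> (Strand ` (lg X - hl X) \<union> (Star ` hl X \<union> Hedge ` es X))) (pre_ends X \<sigma>)"

definition clo :: "lsys \<Rightarrow> (nat \<times> nat \<Rightarrow> nat \<times> nat) \<Rightarrow> (vx, ed set) multigraph" where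
  "clo X \<sigma> = dissolve (Inp ` lg X \<union> Out ` lg X) (pre X \<sigma>)"

lemma pre_sel [simp]:
  "verts (pre X \<sigma>) = RV ` vs X \<union> (Inp ` lg X \<union> Out ` lg X)"
  "edges (pre X \<sigma>) = Conn ` lg X \<union> (Strand ` (lg X - hl X) \<union> (Star ` hl X \<union> Hedge ` es X))"
  "ends (pre X \<sigma>) = pre_ends X \<sigma>"
  by (simp_all add: pre_def)

lemma wf_sys_finite:
  assumes "wf_sys X" shows "finite (lg X)" "finite (vs X)" "finite (es X)" "finite (hl X)"
  using assms by (auto simp: wf_sys_def intro: finite_subset)

lemma pre_edge_sum:
  assumes "wf_sys X"
  shows "(\<Sum>e\<in>edges (pre X \<sigma>). g e) = (\<Sum>l\<in>lg X. g (Conn l)) + ((\<Sum>l\<in>lg X - hl X. g (Strand l)) +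
    ((\<Sum>l\<in>hl X. g (Star l)) + (\<Sum>h\<in>es X. g (Hedge h))))"
  unfolding pre_sel using wf_sys_finite[OF assms]
  by (subst sum.union_disjoint, simp, simp, blast)+
    (simp add: sum.reindex inj_on_def comp_def)

lemma wf_pre:
  assumes X: "wf_sys X" and \<sigma>: "\<sigma> ` lg X = lg X"
  shows "wf_multigraph (pre X \<sigma>)"
proof -
  have "size (pre_ends X \<sigma> (Hedge h)) = 2" if "h \<in> es X" for h
    using X that by (simp add: wf_sys_def card_image inj_on_def)
  moreover have "\<sigma> l \<in> lg X" if "l \<in> lg X" for l using \<sigma> that by blast
  moreover have "l \<in> lg X" "vm X l \<in> vs X" if "l \<in> hl X" for l
    using X that by (auto simp: wf_sys_def)
  ultimately show ?thesis
    using wf_sys_finite[OF X] unfolding wf_multigraph_iff by auto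
qed

text \<open>Each port lies on exactly one \<open>Conn\<close> and on exactly one piece of the leg
  system: a strand, or else the edge point for an input and the star for an output. For outputs the
  first count is where the bijectivity of \<open>\<sigma>\<close> enters. Degree 2 is what makes the
  closure well-formed.\<close>

lemma degree_pre:
  assumes X: "wf_sys X" and \<sigma>: "bij_betw \<sigma> (lg X) (lg X)" and p: "p \<in> Inp ` lg X \<union> Out ` lg X"
  shows "Defs.degree (pre X \<sigma>) p = 2"
proof -
  note fin = wf_sys_finite[OF X]
  have hs: "hl X \<subseteq> lg X" "em X ` hl X \<subseteq> es X" using X by (auto simp: wf_sys_def)
  have d: "Defs.degree (pre X \<sigma>) p = (\<Sum>l\<in>lg X. count (pre_ends X \<sigma> (Conn l)) p) +
    ((\<Sum>l\<in>lg X - hl X. count (pre_ends X \<sigma> (Strand l)) p) +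
    ((\<Sum>l\<in>hl X. count (pre_ends X \<sigma> (Star l)) p) + (\<Sum>h\<in>es X. count (pre_ends X \<sigma> (Hedge h)) p)))"
    unfolding Defs.degree_def pre_edge_sum[OF X] by simp
  from p consider l0 where "l0 \<in> lg X" "p = Inp l0" | l0 where "l0 \<in> lg X" "p = Out l0" by blast
  then show ?thesis
  proof cases
    case 1
    have "(\<Sum>h\<in>es X. count (pre_ends X \<sigma> (Hedge h)) p) = (\<Sum>h\<in>es X. if h = em X l0 then (if l0 \<in> hl X then 1 else 0) else 0)"
      by (rule sum.cong[OF refl]) (use 1 fin in \<open>auto simp: count_mset_set'\<close>)
    also have "\<dots> = (if l0 \<in> hl X then 1 else 0)" using hs fin by (auto simp: sum.delta)
    finally have h: "(\<Sum>h\<in>es X. count (pre_ends X \<sigma> (Hedge h)) p) = (if l0 \<in> hl X then 1 else 0)" .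
    have c: "count (pre_ends X \<sigma> (Conn l)) p = (if l = l0 then 1 else 0)"
      "count (pre_ends X \<sigma> (Strand l)) p = (if l = l0 then 1 else 0)"
      "count (pre_ends X \<sigma> (Star l)) p = 0" for l
      using 1 by simp_all
    show ?thesis unfolding d h c using 1 fin by (auto simp: sum.delta)
  next
    case 2
    have "(\<Sum>l\<in>lg X. count (pre_ends X \<sigma> (Conn l)) p) = (\<Sum>l\<in>lg X. if \<sigma> l = l0 then 1 else 0)"
      by (rule sum.cong) (use 2 in auto)
    also have "\<dots> = (\<Sum>l\<in>lg X. if l = l0 then 1 else 0)"
      using sum.reindex_bij_betw[OF \<sigma>, of "\<lambda>l. if l = l0 then 1 else 0::nat"] by simp
    also have "\<dots> = 1" using 2 fin by simp
    finally have 1: "(\<Sum>l\<in>lg X. count (pre_ends X \<sigma> (Conn l)) p) = 1" .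
    have "(\<Sum>h\<in>es X. count (pre_ends X \<sigma> (Hedge h)) p) = 0"
      using 2 fin by (auto simp: count_mset_set')
    then have h: "(\<Sum>h\<in>es X. count (pre_ends X \<sigma> (Hedge h)) p) = 0" .
    have c: "count (pre_ends X \<sigma> (Strand l)) p = (if l = l0 then 1 else 0)"
      "count (pre_ends X \<sigma> (Star l)) p = (if l = l0 then 1 else 0)" for l
      using 2 by simp_all
    show ?thesis unfolding d 1 h c using 2 fin hs by (auto simp: sum.delta)
  qed
qed

lemma wf_clo:
  assumes "wf_sys X" "bij_betw \<sigma> (lg X) (lg X)"
  shows "wf_multigraph (clo X \<sigma>)"
  unfolding clo_def
  by (rule wf_dissolve) (use assms wf_sys_finite in \<open>auto intro!: wf_pre degree_pre simp: bij_betw_def\<close>)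

lemma clo_cong:
  assumes "\<And>l. l \<in> lg X \<Longrightarrow> \<sigma> l = \<sigma>' l" "wf_sys X" "bij_betw \<sigma> (lg X) (lg X)"
  shows "graph_of (clo X \<sigma>) = graph_of (clo X \<sigma>')"
proof (rule graph_of_cong[OF wf_clo[OF assms(2,3)]])
  have s: "\<sigma> ` lg X = lg X" using assms(3) by (simp add: bij_betw_def)
  have "isomorphic (clo X \<sigma>) (dissolve (id ` (Inp ` lg X \<union> Out ` lg X)) (pre X \<sigma>'))"
    unfolding clo_def
    by (rule dissolve_isomorphic[where \<beta> = id]) (use assms(1) wf_pre[OF assms(2) s] in auto)
  then show "isomorphic (clo X \<sigma>) (clo X \<sigma>')" by (simp add: clo_def)
qed

text \<open>Since \<open>\<sigma>\<close> preserves both sets of legs, no merged edge passes from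
  one system to the other. Common functions \<open>v\<close> and \<open>e\<close> let the union be
  written as a system of the same kind; \<open>q\<close> marks a class by the side on which it
  lies.\<close>

lemma clo_union:
  assumes X: "wf_sys X" and Y: "wf_sys Y" and Z: "Z = LSys (lg X \<union> lg Y) (hl X \<union> hl Y) (vs X \<union> vs Y) v (es X \<union> es Y) e"
    and fn: "vm X = v" "vm Y = v" "em X = e" "em Y = e"
    and disj: "lg X \<inter> lg Y = {}" "vs X \<inter> vs Y = {}" "es X \<inter> es Y = {}"
    and \<sigma>: "bij_betw \<sigma> (lg X) (lg X)" "bij_betw \<sigma> (lg Y) (lg Y)"
  shows "isomorphic (clo Z \<sigma>) (disjoint_union (clo X \<sigma>) (clo Y \<sigma>))"
proof -
  have hX: "hl X \<subseteq> lg X" "em X ` hl X \<subseteq> es X" and hY: "hl Y \<subseteq> lg Y" "em Y ` hl Y \<subseteq> es Y"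
    and vX: "vm X ` hl X \<subseteq> vs X" and vY: "vm Y ` hl Y \<subseteq> vs Y"
    using X Y by (auto simp: wf_sys_def)
  note sX = bij_betw_imp_surj_on[OF \<sigma>(1)] and sY = bij_betw_imp_surj_on[OF \<sigma>(2)]
  let ?SX = "Inp ` lg X \<union> Out ` lg X" and ?SY = "Inp ` lg Y \<union> Out ` lg Y" and ?S = "Inp ` lg Z \<union> Out ` lg Z"
  have eZ: "edges (pre Z \<sigma>) = edges (pre X \<sigma>) \<union> edges (pre Y \<sigma>)"
    using hX(1) hY(1) disj(1) by (auto simp: Z)
  have dE: "edges (pre X \<sigma>) \<inter> edges (pre Y \<sigma>) = {}" using hX(1) hY(1) disj by auto
  have vZ: "verts (pre Z \<sigma>) = verts (pre X \<sigma>) \<union> verts (pre Y \<sigma>)" by (auto simp: Z)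
  have dV: "verts (pre X \<sigma>) \<inter> verts (pre Y \<sigma>) = {}" using disj by auto
  have S: "?S = ?SX \<union> ?SY" by (auto simp: Z)
  have enX: "pre_ends Z \<sigma> a = pre_ends X \<sigma> a" if "a \<in> edges (pre X \<sigma>)" for a
  proof (cases a)
    case (Hedge h)
    then have "h \<in> es X" using that by auto
    then have "{l \<in> hl Z. em Z l = h} = {l \<in> hl X. em X l = h}" using hY disj fn by (auto simp: Z)
    then show ?thesis using Hedge by simp
  qed (use fn in \<open>auto simp: Z\<close>)
  have enY: "pre_ends Z \<sigma> a = pre_ends Y \<sigma> a" if "a \<in> edges (pre Y \<sigma>)" for a
  proof (cases a)
    case (Hedge h)
    then have "h \<in> es Y" using that by auto
    then have "{l \<in> hl Z. em Z l = h} = {l \<in> hl Y. em Y l = h}" using hX disj fn by (auto simp: Z)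
    then show ?thesis using Hedge by simp
  qed (use fn in \<open>auto simp: Z\<close>)
  have wX: "wf_multigraph (pre X \<sigma>)" and wY: "wf_multigraph (pre Y \<sigma>)"
    using wf_pre X Y sX sY by blast+
  have subX: "w \<in> verts (pre X \<sigma>)" if "a \<in> edges (pre X \<sigma>)" "w \<in># pre_ends X \<sigma> a" for a w
    using wf_multigraph_ends[OF wX that(1)] that(2) by simp
  have subY: "w \<in> verts (pre Y \<sigma>)" if "a \<in> edges (pre Y \<sigma>)" "w \<in># pre_ends Y \<sigma> a" for a w
    using wf_multigraph_ends[OF wY that(1)] that(2) by simp
  define q where "q a = (if a \<in> edges (pre X \<sigma>) then Inl (cls ?SX (pre X \<sigma>) a) else Inr (cls ?SY (pre Y \<sigma>) a))" for a
  have qX: "q a = Inl (cls ?SX (pre X \<sigma>) a)" if "a \<in> edges (pre X \<sigma>)" for a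
    unfolding q_def using that by (rule if_P)
  have qY: "q a = Inr (cls ?SY (pre Y \<sigma>) a)" if "a \<in> edges (pre Y \<sigma>)" for a
    unfolding q_def by (rule if_not_P) (use that dE in blast)
  have adX: "(a, b) \<in> (adj ?S (pre Z \<sigma>))\<^sup>*" if "(a, b) \<in> (adj ?SX (pre X \<sigma>))\<^sup>*" for a b
    using that
  proof (rule rev_subsetD[OF _ rtrancl_mono], intro subrelI)
    fix a b assume ab: "(a, b) \<in> adj ?SX (pre X \<sigma>)"
    then have E: "a \<in> edges (pre X \<sigma>)" "b \<in> edges (pre X \<sigma>)" using adj_edges by fast+
    obtain u where "u \<in> ?SX" "u \<in># pre_ends X \<sigma> a" "u \<in># pre_ends X \<sigma> b"
      using ab unfolding adj_def by auto
    then have "u \<in> ?S" "u \<in># pre_ends Z \<sigma> a" "u \<in># pre_ends Z \<sigma> b"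
      unfolding S by (blast, simp_all only: enX[OF E(1)] enX[OF E(2)])
    then show "(a, b) \<in> adj ?S (pre Z \<sigma>)"
      using E unfolding adj_def eZ pre_sel(3) by blast
  qed
  have adY: "(a, b) \<in> (adj ?S (pre Z \<sigma>))\<^sup>*" if "(a, b) \<in> (adj ?SY (pre Y \<sigma>))\<^sup>*" for a b
    using that
  proof (rule rev_subsetD[OF _ rtrancl_mono], intro subrelI)
    fix a b assume ab: "(a, b) \<in> adj ?SY (pre Y \<sigma>)"
    then have E: "a \<in> edges (pre Y \<sigma>)" "b \<in> edges (pre Y \<sigma>)" using adj_edges by fast+
    obtain u where "u \<in> ?SY" "u \<in># pre_ends Y \<sigma> a" "u \<in># pre_ends Y \<sigma> b"
      using ab unfolding adj_def by auto
    then have "u \<in> ?S" "u \<in># pre_ends Z \<sigma> a" "u \<in># pre_ends Z \<sigma> b"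
      unfolding S by (blast, simp_all only: enY[OF E(1)] enY[OF E(2)])
    then show "(a, b) \<in> adj ?S (pre Z \<sigma>)"
      using E unfolding adj_def eZ pre_sel(3) by blast
  qed
  let ?\<alpha> = "\<lambda>w. if w \<in> RV ` vs X then Inl w else Inr w"
  have dXY: "verts (disjoint_union (clo X \<sigma>) (clo Y \<sigma>)) = RV ` vs X <+> RV ` vs Y"
  proof -
    have "verts (clo U \<sigma>) = RV ` vs U" for U by (auto simp: clo_def)
    then show ?thesis by simp
  qed
  show ?thesis
    unfolding clo_def[of Z]
  proof (rule dissolve_isomorphicI[where q = q and \<alpha> = ?\<alpha>], goal_cases)
    case 1
    have "q ` edges (pre Z \<sigma>) = q ` edges (pre X \<sigma>) \<union> q ` edges (pre Y \<sigma>)" by (simp only: eZ image_Un)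
    also have "q ` edges (pre X \<sigma>) = Inl ` cls ?SX (pre X \<sigma>) ` edges (pre X \<sigma>)"
      unfolding image_image by (rule image_cong[OF refl qX])
    also have "q ` edges (pre Y \<sigma>) = Inr ` cls ?SY (pre Y \<sigma>) ` edges (pre Y \<sigma>)"
      unfolding image_image by (rule image_cong[OF refl qY])
    finally show ?case
      unfolding disjoint_union_sel(2) clo_def dissolve_sel(2) quotient_cls Plus_def .
  next
    case (2 a b w)
    then have w: "w \<in> ?SX \<or> w \<in> ?SY" unfolding S by blast
    consider "a \<in> edges (pre X \<sigma>)" "b \<in> edges (pre X \<sigma>)" | "a \<in> edges (pre Y \<sigma>)" "b \<in> edges (pre Y \<sigma>)"
      | "a \<in> edges (pre X \<sigma>)" "b \<in> edges (pre Y \<sigma>)" | "a \<in> edges (pre Y \<sigma>)" "b \<in> edges (pre X \<sigma>)"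
      using 2(1,2) unfolding eZ by blast
    then show ?case
    proof cases
      case 1
      have m: "w \<in># pre_ends X \<sigma> a" "w \<in># pre_ends X \<sigma> b" using 2 enX 1 by simp_all
      have "w \<in> ?SX" using w subX[OF 1(1) m(1)] disj(1) by auto
      then have "(a, b) \<in> (adj ?SX (pre X \<sigma>))\<^sup>*"
        using 1 m unfolding adj_def pre_sel(3) by (intro r_into_rtrancl) blast
      then show ?thesis unfolding qX[OF 1(1)] qX[OF 1(2)] sum.inject(1) cls_eq_iff .
    next
      case 2
      have m: "w \<in># pre_ends Y \<sigma> a" "w \<in># pre_ends Y \<sigma> b" using \<open>w \<in># ends (pre Z \<sigma>) a\<close> \<open>w \<in># ends (pre Z \<sigma>) b\<close> enY 2 by simp_all
      have "w \<in> ?SY" using w subY[OF 2(1) m(1)] disj(1) by auto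
      then have "(a, b) \<in> (adj ?SY (pre Y \<sigma>))\<^sup>*"
        using 2 m unfolding adj_def pre_sel(3) by (intro r_into_rtrancl) blast
      then show ?thesis unfolding qY[OF 2(1)] qY[OF 2(2)] sum.inject(2) cls_eq_iff .
    next
      case 3
      have "w \<in># pre_ends X \<sigma> a" "w \<in># pre_ends Y \<sigma> b" using 2 enX[OF 3(1)] enY[OF 3(2)] by simp_all
      then have "w \<in> verts (pre X \<sigma>)" "w \<in> verts (pre Y \<sigma>)" using subX 3 subY by blast+
      then show ?thesis using dV by blast
    next
      case 4
      have "w \<in># pre_ends Y \<sigma> a" "w \<in># pre_ends X \<sigma> b" using 2 enX[OF 4(2)] enY[OF 4(1)] by simp_all
      then have "w \<in> verts (pre X \<sigma>)" "w \<in> verts (pre Y \<sigma>)" using subX 4 subY by blast+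
      then show ?thesis using dV by blast
    qed
  next
    case (3 a b)
    consider "a \<in> edges (pre X \<sigma>)" "b \<in> edges (pre X \<sigma>)" | "a \<in> edges (pre Y \<sigma>)" "b \<in> edges (pre Y \<sigma>)"
      | "a \<in> edges (pre X \<sigma>)" "b \<in> edges (pre Y \<sigma>)" | "a \<in> edges (pre Y \<sigma>)" "b \<in> edges (pre X \<sigma>)"
      using 3(1,2) unfolding eZ by blast
    then show ?case
    proof cases
      case 1
      then show ?thesis using 3(3) unfolding qX[OF 1(1)] qX[OF 1(2)] sum.inject(1) cls_eq_iff by (intro adX)
    next
      case 2
      then show ?thesis using 3(3) unfolding qY[OF 2(1)] qY[OF 2(2)] sum.inject(2) cls_eq_iff by (intro adY)
    next
      case c: 3
      then show ?thesis using 3(3) unfolding qX[OF c(1)] qY[OF c(2)] by blast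
    next
      case c: 4
      then show ?thesis using 3(3) unfolding qY[OF c(1)] qX[OF c(2)] by blast
    qed
  next
    case 4
    have "verts (pre Z \<sigma>) - ?S = RV ` vs X \<union> RV ` vs Y" by (auto simp: Z)
    then show ?case unfolding dXY using disj(2) by (auto simp: bij_betw_def inj_on_def Plus_def image_iff)
  next
    case (5 a)
    have fm: "filter_mset (\<lambda>v. v \<notin> ?S) (pre_ends Z \<sigma> b) = filter_mset (\<lambda>v. v \<notin> ?SX) (pre_ends X \<sigma> b)"
      if b: "b \<in> edges (pre X \<sigma>)" for b
      unfolding enX[OF b] by (rule filter_mset_cong) (use subX[OF b] disj(1) in \<open>auto simp: Z\<close>)
    have fm': "filter_mset (\<lambda>v. v \<notin> ?S) (pre_ends Z \<sigma> b) = filter_mset (\<lambda>v. v \<notin> ?SY) (pre_ends Y \<sigma> b)"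
      if b: "b \<in> edges (pre Y \<sigma>)" for b
      unfolding enY[OF b] by (rule filter_mset_cong) (use subY[OF b] disj(1) in \<open>auto simp: Z\<close>)
    from 5 consider "a \<in> edges (pre X \<sigma>)" | "a \<in> edges (pre Y \<sigma>)" unfolding eZ by blast
    then show ?case
    proof cases
      case 1
      have C: "{b\<in>edges (pre Z \<sigma>). q b = q a} = cls ?SX (pre X \<sigma>) a"
      proof (rule set_eqI)
        fix b
        show "b \<in> {b\<in>edges (pre Z \<sigma>). q b = q a} \<longleftrightarrow> b \<in> cls ?SX (pre X \<sigma>) a"
        proof
          assume "b \<in> {b\<in>edges (pre Z \<sigma>). q b = q a}"
          then have b: "b \<in> edges (pre Z \<sigma>)" "q b = q a" by blast+
          have "b \<in> edges (pre X \<sigma>)"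
          proof (rule ccontr)
            assume "b \<notin> edges (pre X \<sigma>)"
            then have "b \<in> edges (pre Y \<sigma>)" using b(1) unfolding eZ by blast
            then show False using b(2) unfolding qX[OF 1] by (simp only: qY sum.distinct)
          qed
          then have "cls ?SX (pre X \<sigma>) a = cls ?SX (pre X \<sigma>) b" using b(2) unfolding qX[OF 1] by (simp only: qX sum.inject)
          then show "b \<in> cls ?SX (pre X \<sigma>) a" unfolding cls_eq_iff by blast
        next
          assume b: "b \<in> cls ?SX (pre X \<sigma>) a"
          then have bX: "b \<in> edges (pre X \<sigma>)" using cls_subset[OF 1] by blast
          have "cls ?SX (pre X \<sigma>) a = cls ?SX (pre X \<sigma>) b" using b unfolding cls_eq_iff by blast
          then have "q b = q a" by (simp only: qX[OF 1] qX[OF bX])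
          then show "b \<in> {b\<in>edges (pre Z \<sigma>). q b = q a}" using bX unfolding eZ by blast
        qed
      qed
      have "ends (disjoint_union (clo X \<sigma>) (clo Y \<sigma>)) (q a) =
          image_mset Inl (\<Sum>e\<in>cls ?SX (pre X \<sigma>) a. filter_mset (\<lambda>v. v \<notin> ?SX) (pre_ends X \<sigma> e))"
        unfolding qX[OF 1] disjoint_union_sel clo_def dissolve_sel pre_sel(3) ..
      also have "\<dots> = image_mset Inl (\<Sum>e\<in>cls ?SX (pre X \<sigma>) a. filter_mset (\<lambda>v. v \<notin> ?S) (pre_ends Z \<sigma> e))"
        by (intro arg_cong[of _ _ "image_mset Inl"] sum.cong refl fm[symmetric]) (use cls_subset[OF 1] in blast)
      also have "\<dots> = image_mset ?\<alpha> (\<Sum>e\<in>cls ?SX (pre X \<sigma>) a. filter_mset (\<lambda>v. v \<notin> ?S) (pre_ends Z \<sigma> e))"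
        unfolding image_mset_sum
      proof (intro sum.cong refl image_mset_cong)
        fix e w assume "e \<in> cls ?SX (pre X \<sigma>) a" and w: "w \<in># filter_mset (\<lambda>v. v \<notin> ?S) (pre_ends Z \<sigma> e)"
        then have e: "e \<in> edges (pre X \<sigma>)" using cls_subset[OF 1] by blast
        have "w \<in> verts (pre X \<sigma>)" "w \<notin> ?S" using w enX[OF e] subX[OF e] by auto
        then show "Inl w = ?\<alpha> w" unfolding S pre_sel(1) by auto
      qed
      finally show ?thesis unfolding C pre_sel(3) .
    next
      case 2
      have C: "{b\<in>edges (pre Z \<sigma>). q b = q a} = cls ?SY (pre Y \<sigma>) a"
      proof (rule set_eqI)
        fix b
        show "b \<in> {b\<in>edges (pre Z \<sigma>). q b = q a} \<longleftrightarrow> b \<in> cls ?SY (pre Y \<sigma>) a"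
        proof
          assume "b \<in> {b\<in>edges (pre Z \<sigma>). q b = q a}"
          then have b: "b \<in> edges (pre Z \<sigma>)" "q b = q a" by blast+
          have "b \<in> edges (pre Y \<sigma>)"
          proof (rule ccontr)
            assume "b \<notin> edges (pre Y \<sigma>)"
            then have "b \<in> edges (pre X \<sigma>)" using b(1) unfolding eZ by blast
            then show False using b(2) unfolding qY[OF 2] by (simp only: qX sum.distinct)
          qed
          then have "cls ?SY (pre Y \<sigma>) a = cls ?SY (pre Y \<sigma>) b" using b(2) unfolding qY[OF 2] by (simp only: qY sum.inject)
          then show "b \<in> cls ?SY (pre Y \<sigma>) a" unfolding cls_eq_iff by blast
        next
          assume b: "b \<in> cls ?SY (pre Y \<sigma>) a"
          then have bY: "b \<in> edges (pre Y \<sigma>)" using cls_subset[OF 2] by blast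
          have "cls ?SY (pre Y \<sigma>) a = cls ?SY (pre Y \<sigma>) b" using b unfolding cls_eq_iff by blast
          then have "q b = q a" by (simp only: qY[OF 2] qY[OF bY])
          then show "b \<in> {b\<in>edges (pre Z \<sigma>). q b = q a}" using bY unfolding eZ by blast
        qed
      qed
      have "ends (disjoint_union (clo X \<sigma>) (clo Y \<sigma>)) (q a) =
          image_mset Inr (\<Sum>e\<in>cls ?SY (pre Y \<sigma>) a. filter_mset (\<lambda>v. v \<notin> ?SY) (pre_ends Y \<sigma> e))"
        unfolding qY[OF 2] disjoint_union_sel clo_def dissolve_sel pre_sel(3) ..
      also have "\<dots> = image_mset Inr (\<Sum>e\<in>cls ?SY (pre Y \<sigma>) a. filter_mset (\<lambda>v. v \<notin> ?S) (pre_ends Z \<sigma> e))"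
        by (intro arg_cong[of _ _ "image_mset Inr"] sum.cong refl fm'[symmetric]) (use cls_subset[OF 2] in blast)
      also have "\<dots> = image_mset ?\<alpha> (\<Sum>e\<in>cls ?SY (pre Y \<sigma>) a. filter_mset (\<lambda>v. v \<notin> ?S) (pre_ends Z \<sigma> e))"
        unfolding image_mset_sum
      proof (intro sum.cong refl image_mset_cong)
        fix e w assume "e \<in> cls ?SY (pre Y \<sigma>) a" and w: "w \<in># filter_mset (\<lambda>v. v \<notin> ?S) (pre_ends Z \<sigma> e)"
        then have e: "e \<in> edges (pre Y \<sigma>)" using cls_subset[OF 2] by blast
        have "w \<in> verts (pre Y \<sigma>)" using w enY[OF e] subY[OF e] by auto
        then show "Inr w = ?\<alpha> w" using dV unfolding pre_sel(1) by auto
      qed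
      finally show ?thesis unfolding C pre_sel(3) .
    qed
  qed
qed

text \<open>An isomorphism transfers finiteness and the number of ends but, as a bijection of the
  vertex sets only, cannot rule out ends of \<open>G\<close> that are no vertices. This is the
  content of the last assumption.\<close>

lemma wf_isomorphic_back:
  assumes "isomorphic G H" "wf_multigraph H"
    and sub: "\<And>e. e \<in> edges G \<Longrightarrow> set_mset (ends G e) \<subseteq> verts G"
  shows "wf_multigraph G"
proof -
  obtain \<alpha> \<beta> where ab: "bij_betw \<alpha> (verts G) (verts H)" "bij_betw \<beta> (edges G) (edges H)"
    "\<And>e. e \<in> edges G \<Longrightarrow> ends H (\<beta> e) = image_mset \<alpha> (ends G e)"
    using assms(1) unfolding isomorphic_def by blast
  have "size (ends G e) \<in> {0,2}" if "e \<in> edges G" for e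
  proof -
    have "size (ends H (\<beta> e)) \<in> {0,2}"
      using assms(2) bij_betwE[OF ab(2)] that unfolding wf_multigraph_def by blast
    then show ?thesis using ab(3)[OF that] by (simp only: size_image_mset)
  qed
  moreover have "finite (verts G)" "finite (edges G)"
    using assms(2) bij_betw_finite[OF ab(1)] bij_betw_finite[OF ab(2)] by (auto simp: wf_multigraph_def)
  ultimately show ?thesis using sub unfolding wf_multigraph_def by simp
qed

lemma dissolve_ends_subset:
  assumes "wf_multigraph G" "C \<in> edges (dissolve S G)"
  shows "set_mset (ends (dissolve S G) C) \<subseteq> verts (dissolve S G)"
proof -
  have "C \<in> cls S G ` edges G" using assms(2) by (simp add: quotient_cls)
  then have C: "C \<subseteq> edges G" using cls_subset by fast
  moreover have "finite C" using C assms(1) finite_subset by (auto simp: wf_multigraph_def)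
  ultimately show ?thesis using assms(1) by (auto simp: set_mset_sum dest: wf_multigraph_ends)
qed

text \<open>For gluings of fragments the ends are vertices anyway, so well-formedness of the graph
  \<open>K\<close> found by an isomorphism is enough.\<close>

lemma graph_of_glue:
  assumes F: "(G, l) \<in> fragments k" "(H, m) \<in> fragments k"
    and iso: "isomorphic (glue k (G, l) (H, m)) K" and K: "wf_multigraph K"
  shows "graph_of (glue k (G, l) (H, m)) = graph_of K"
proof (rule graph_of_cong[OF wf_isomorphic_back[OF iso K] iso])
  fix e assume e: "e \<in> edges (glue k (G, l) (H, m))"
  have "wf_multigraph G" "wf_multigraph H" using F by (auto simp: fragments_def)
  then show "set_mset (ends (glue k (G, l) (H, m)) e) \<subseteq> verts (glue k (G, l) (H, m))"
    using e unfolding glue.simps by (intro dissolve_ends_subset wf_map_verts wf_disjoint_union)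
qed

section \<open>Isomorphism classes and their representatives\<close>

lemma graph_of_nat: "wf_multigraph G \<Longrightarrow> graph_of G = abs_graph G"
proof -
  assume G: "wf_multigraph G"
  let ?g = "SOME K :: (nat, nat) multigraph. wf_multigraph K \<and> isomorphic G K"
  have g: "wf_multigraph ?g \<and> isomorphic G ?g" using someI_ex[OF ex_nat_multigraph[OF G]] .
  then have "abs_graph G = abs_graph ?g"
    using Quotient3_rel[OF Quotient3_graph, of G ?g] G isomorphic_refl by blast
  then show ?thesis by (simp add: graph_of_def)
qed

lemma ex_graph_of: "\<exists>G :: (nat, nat) multigraph. wf_multigraph G \<and> graph_of G = g"
proof -
  have "wf_multigraph (rep_graph g)" using Quotient3_rep_reflp[OF Quotient3_graph] by blast
  moreover have "abs_graph (rep_graph g) = g" by (rule Quotient3_abs_rep[OF Quotient3_graph])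
  ultimately show ?thesis using graph_of_nat by metis
qed

lemma graph_of_empty: "graph_of (Multigraph {} {} (\<lambda>_. {#}) :: (nat, nat) multigraph) = empty_graph"
  by (subst graph_of_nat) (auto simp: wf_multigraph_def empty_graph.abs_eq)

lemma graph_of_vertexless_loop: "graph_of (Multigraph {} {0} (\<lambda>_. {#}) :: (nat, nat) multigraph) = vertexless_loop"
  by (subst graph_of_nat) (auto simp: wf_multigraph_def vertexless_loop.abs_eq)

lemma disjoint_union_isomorphic:
  assumes "isomorphic G G'" "isomorphic H H'"
  shows "isomorphic (disjoint_union G H) (disjoint_union G' H')"
proof -
  obtain a b where ab: "bij_betw a (verts G) (verts G')" "bij_betw b (edges G) (edges G')"
    "\<And>e. e \<in> edges G \<Longrightarrow> ends G' (b e) = image_mset a (ends G e)"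
    using assms(1) unfolding isomorphic_def by blast
  obtain c d where cd: "bij_betw c (verts H) (verts H')" "bij_betw d (edges H) (edges H')"
    "\<And>e. e \<in> edges H \<Longrightarrow> ends H' (d e) = image_mset c (ends H e)"
    using assms(2) unfolding isomorphic_def by blast
  have m: "bij_betw (map_sum p q) (A <+> B) (C <+> D)" if "bij_betw p A C" "bij_betw q B D"
    for p q and A :: "'x set" and B :: "'y set" and C :: "'z set" and D :: "'w set"
  proof (rule bij_betw_imageI)
    show "inj_on (map_sum p q) (A <+> B)"
    proof (rule inj_onI)
      fix x y assume "x \<in> A <+> B" "y \<in> A <+> B" "map_sum p q x = map_sum p q y"
      then show "x = y"
        using bij_betw_imp_inj_on[OF that(1)] bij_betw_imp_inj_on[OF that(2)]
        by (cases x; cases y) (auto dest: inj_onD)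
    qed
    show "map_sum p q ` (A <+> B) = C <+> D"
      unfolding Plus_def image_Un image_image
      by (simp add: bij_betw_imp_surj_on[OF that(1), symmetric] bij_betw_imp_surj_on[OF that(2), symmetric] image_image)
  qed
  show ?thesis unfolding isomorphic_def
    by (intro exI[of _ "map_sum a c"] exI[of _ "map_sum b d"])
      (use m[OF ab(1) cd(1)] m[OF ab(2) cd(2)] ab(3) cd(3) in \<open>auto simp: multiset.map_comp comp_def\<close>)
qed

section \<open>Multiplicativity\<close>

text \<open>Here \<open>n\<close> is an arbitrary real number; that it is a natural number is one of
  the consequences of the rank bounds.\<close>

locale rank_bounded =
  fixes f :: "graph \<Rightarrow> complex" and n :: real
  assumes f_empty: "f empty_graph = 1"
    and f_loop: "f vertexless_loop = of_real n"
    and rank: "\<And>k. ereal_of_enat (matrix_rank (fragments k) (fragments k) (connection_matrix f k)) \<le> ereal (n ^ k)"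
begin

text \<open>0-fragments are graphs and gluing them is disjoint union, so the matrix for
  \<open>k = 0\<close> has rank at most \<open>n ^ 0 = 1\<close> and its 2-by-2 minors vanish. The
  minor with rows for the empty graph and \<open>G\<close> and columns for the empty graph and
  \<open>H\<close> is the claim, as the entry at the empty graph is 1.\<close>

lemma f_disjoint_union:
  assumes G: "wf_multigraph G" and H: "wf_multigraph H"
  shows "f (graph_of (disjoint_union G H)) = f (graph_of G) * f (graph_of H)"
proof -
  obtain G' :: "(nat, nat) multigraph" where G': "wf_multigraph G'" "isomorphic G G'"
    using ex_nat_multigraph[OF G] by blast
  obtain H' :: "(nat, nat) multigraph" where H': "wf_multigraph H'" "isomorphic H H'"
    using ex_nat_multigraph[OF H] by blast
  define u :: "nat \<Rightarrow> nat" where "u = (\<lambda>_. undefined)"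
  define E :: "(nat, nat) multigraph" where "E = Multigraph {} {} (\<lambda>_. {#})"
  have E: "wf_multigraph E" by (auto simp: E_def wf_multigraph_def)
  have frag: "(K, u) \<in> fragments 0" if "wf_multigraph K" for K
    using that by (auto simp: fragments_def u_def)
  let ?M = "connection_matrix f 0"
  have M: "?M (K, u) (K', u) = f (graph_of (disjoint_union K K'))"
    if "wf_multigraph K" "wf_multigraph K'" for K K'
  proof -
    have "isomorphic (glue 0 (K, u) (K', u)) (dissolve (Inl ` u ` {1..0}) (disjoint_union K K'))"
      by (rule glue_isomorphicI[where \<alpha> = Inl and \<alpha>' = Inr and \<beta> = Inl and \<beta>' = Inr])
        (use frag that in \<open>auto simp: Plus_def\<close>)
    then have "isomorphic (glue 0 (K, u) (K', u)) (disjoint_union K K')"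
      using dissolve_empty isomorphic_trans by fastforce
    then have "graph_of (glue 0 (K, u) (K', u)) = graph_of (disjoint_union K K')"
      by (intro graph_of_glue frag that wf_disjoint_union)
    then show ?thesis by (simp add: connection_matrix_def)
  qed
  have El: "graph_of (disjoint_union E K) = graph_of K" if K: "wf_multigraph K" for K :: "(nat, nat) multigraph"
  proof (rule graph_of_cong[symmetric, OF K])
    show "isomorphic K (disjoint_union E K)" unfolding isomorphic_def
      by (intro exI[of _ Inr]) (auto simp: E_def bij_betw_def)
  qed
  have Er: "graph_of (disjoint_union K E) = graph_of K" if K: "wf_multigraph K" for K :: "(nat, nat) multigraph"
  proof (rule graph_of_cong[symmetric, OF K])
    show "isomorphic K (disjoint_union K E)" unfolding isomorphic_def
      by (intro exI[of _ Inl]) (auto simp: E_def bij_betw_def)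
  qed
  have "\<exists>J. (J \<subseteq> fragments 0 \<and> finite J \<and> real (card J) \<le> n ^ 0) \<and>
    (\<forall>i\<in>fragments 0. \<exists>w. \<forall>b\<in>fragments 0. ?M i b = (\<Sum>j\<in>J. w j * ?M j b))"
  proof (rule matrix_rank_row_basis[OF rank[of 0]])
    fix J assume "J \<subseteq> fragments 0" "finite J" "real (card J) \<le> n ^ 0"
      "\<And>i. i \<in> fragments 0 \<Longrightarrow> \<exists>w. \<forall>b\<in>fragments 0. ?M i b = (\<Sum>j\<in>J. w j * ?M j b)"
    then show ?thesis by (intro exI[of _ J]) simp
  qed
  then obtain J where J: "J \<subseteq> fragments 0" "finite J" "real (card J) \<le> n ^ 0"
    and sp: "\<forall>i\<in>fragments 0. \<exists>w. \<forall>b\<in>fragments 0. ?M i b = (\<Sum>j\<in>J. w j * ?M j b)"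
    by (elim exE conjE)
  obtain wE where wE: "\<forall>b\<in>fragments 0. ?M (E, u) b = (\<Sum>j\<in>J. wE j * ?M j b)"
    using bspec[OF sp frag[OF E]] by (elim exE)
  obtain wG where wG: "\<forall>b\<in>fragments 0. ?M (G', u) b = (\<Sum>j\<in>J. wG j * ?M j b)"
    using bspec[OF sp frag[OF G'(1)]] by (elim exE)
  have ME: "?M (E, u) (E, u) = 1" using M[OF E E] El[OF E] f_empty by (simp add: E_def graph_of_empty)
  \<comment> \<open>The bound on the number of basis rows is 1; having none at all contradicts the
    entry 1 of the empty graph.\<close>
  have "card J = 0 \<or> card J = 1" using J(3) by auto
  then have "f (graph_of (disjoint_union G' H')) = f (graph_of G') * f (graph_of H')"
  proof
    assume "card J = 0"
    then have "?M (E, u) (E, u) = 0" using wE frag[OF E] J(2) by auto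
    then show ?thesis using ME by simp
  next
    assume "card J = 1"
    then obtain j where j: "J = {j}" by (auto simp: card_1_singleton_iff)
    have 1: "wE j * ?M j (E, u) = 1" using wE frag[OF E] j ME by auto
    have 2: "?M (E, u) (H', u) = wE j * ?M j (H', u)" using wE frag[OF H'(1)] j by auto
    have 3: "?M (G', u) (E, u) = wG j * ?M j (E, u)" using wG frag[OF E] j by auto
    have 4: "?M (G', u) (H', u) = wG j * ?M j (H', u)" using wG frag[OF H'(1)] j by auto
    have "f (graph_of G') * f (graph_of H') = ?M (G', u) (E, u) * ?M (E, u) (H', u)"
      using M[OF G'(1) E] M[OF E H'(1)] El[OF H'(1)] Er[OF G'(1)] by simp
    also have "\<dots> = (wE j * ?M j (E, u)) * (wG j * ?M j (H', u))" unfolding 2 3 by (simp add: mult_ac)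
    also have "\<dots> = ?M (G', u) (H', u)" unfolding 1 4 by simp
    finally show ?thesis using M[OF G'(1) H'(1)] by simp
  qed
  moreover have "graph_of (disjoint_union G' H') = graph_of (disjoint_union G H)"
    by (rule graph_of_cong[symmetric]) (use G H G' H' in \<open>auto intro: wf_disjoint_union disjoint_union_isomorphic\<close>)
  moreover have "graph_of G' = graph_of G" "graph_of H' = graph_of H"
    using graph_of_cong G H G' H' by metis+
  ultimately show ?thesis by simp
qed

lemma f_vertexless:
  assumes G: "wf_multigraph G" "verts G = {}"
  shows "f (graph_of G) = of_real n ^ card (edges G)"
proof -
  define Lp :: "nat \<Rightarrow> (nat, nat) multigraph" where "Lp m = Multigraph {} {..<m} (\<lambda>_. {#})" for m
  let ?O = "Multigraph {} {0} (\<lambda>_. {#}) :: (nat, nat) multigraph"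
  have wfO: "wf_multigraph ?O" by (auto simp: wf_multigraph_def)
  have wf: "wf_multigraph (Lp m)" for m by (auto simp: wf_multigraph_def Lp_def)
  have Lp: "f (graph_of (Lp m)) = of_real n ^ m" for m
  proof (induction m)
    case 0
    show ?case by (simp add: Lp_def graph_of_empty f_empty)
  next
    case (Suc m)
    have "isomorphic (Lp (Suc m)) (disjoint_union (Lp m) ?O)" unfolding isomorphic_def
      by (rule exI[of _ "\<lambda>_. undefined"], rule exI[of _ "\<lambda>i. if i < m then Inl i else Inr 0"])
        (auto simp: Lp_def bij_betw_def inj_on_def Plus_def image_iff)
    then have "graph_of (Lp (Suc m)) = graph_of (disjoint_union (Lp m) ?O)" by (rule graph_of_cong[OF wf])
    then show ?case
      using f_disjoint_union[OF wf wfO, of m] Suc.IH by (simp add: graph_of_vertexless_loop f_loop)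
  qed
  have emp: "ends G e = {#}" if "e \<in> edges G" for e
    using G that by (auto simp: wf_multigraph_def)
  have "finite (edges G)" using G by (simp add: wf_multigraph_def)
  then obtain b where b: "bij_betw b (edges G) {..<card (edges G)}"
    by (metis ex_bij_betw_finite_nat lessThan_atLeast0)
  have "isomorphic G (Lp (card (edges G)))" unfolding isomorphic_def
    by (rule exI[of _ "\<lambda>_. undefined"], rule exI[of _ b]) (use b in \<open>auto simp: Lp_def G(2) emp bij_betw_def\<close>)
  then show ?thesis using graph_of_cong[OF G(1)] Lp by metis
qed

end

section \<open>Cycles and stars as closures\<close>

definition strands :: "(nat \<times> nat) set \<Rightarrow> lsys" where
  "strands L = LSys L {} {} id {} id"

text \<open>The number of cycles of \<open>\<sigma>\<close> on \<open>L\<close>. Counting vertexless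
  loops of the closure makes the value of \<open>f\<close> on strands immediate, and cycles are then
  handled through colourings.\<close>

definition loops :: "(nat \<times> nat) set \<Rightarrow> (nat \<times> nat \<Rightarrow> nat \<times> nat) \<Rightarrow> nat" where
  "loops L \<sigma> = card (edges (clo (strands L) \<sigma>))"

lemma strands_sel [simp]: "lg (strands L) = L" "hl (strands L) = {}" "vs (strands L) = {}" "es (strands L) = {}"
  by (simp_all add: strands_def)

lemma wf_strands: "finite L \<Longrightarrow> wf_sys (strands L)"
  by (simp add: wf_sys_def)

text \<open>The classes of the closure are the cycles of \<open>\<sigma>\<close>, so both sides
  count the colourings that are constant on cycles. With \<open>q = 2\<close> every identity between
  numbers of cycles reduces to a bijection between sets of colourings.\<close>

lemma card_invariant_colourings:
  assumes L: "finite L" and \<sigma>: "bij_betw \<sigma> L L"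
  shows "card {\<phi>\<in>L \<rightarrow>\<^sub>E {..<q}. \<forall>l\<in>L. \<phi> (\<sigma> l) = \<phi> l} = q ^ loops L \<sigma>"
proof -
  let ?S = "Inp ` L \<union> Out ` L" and ?G = "pre (strands L) \<sigma>"
  let ?c = "cls ?S ?G"
  let ?E = "edges (clo (strands L) \<sigma>)"
  have E: "?E = ?c ` edges ?G" unfolding clo_def strands_sel dissolve_sel(2) quotient_cls ..
  have eG: "edges ?G = Conn ` L \<union> Strand ` L" by simp
  have \<sigma>L: "\<sigma> l \<in> L" if "l \<in> L" for l using bij_betwE[OF \<sigma>] that by blast
  have SC: "?c (Strand l) = ?c (Conn l)" if "l \<in> L" for l
    unfolding cls_eq_iff using that by (intro r_into_rtrancl) (auto simp: adj_def)
  have CC: "?c (Conn (\<sigma> l)) = ?c (Conn l)" if "l \<in> L" for l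
  proof -
    have "?c (Strand (\<sigma> l)) = ?c (Conn l)"
      unfolding cls_eq_iff using that \<sigma>L[OF that]
      by (intro r_into_rtrancl) (auto simp: adj_def intro!: bexI[of _ "Out (\<sigma> l)"])
    then show ?thesis using SC[OF \<sigma>L[OF that]] by simp
  qed
  have E2: "?E = ?c ` Conn ` L"
  proof -
    have "?c ` Strand ` L = ?c ` Conn ` L" unfolding image_image by (rule image_cong[OF refl SC])
    then show ?thesis unfolding E eG image_Un by simp
  qed
  define F where "F h = restrict (\<lambda>l. h (?c (Conn l))) L" for h :: "ed set \<Rightarrow> nat"
  have "bij_betw F (?E \<rightarrow>\<^sub>E {..<q}) {\<phi>\<in>L \<rightarrow>\<^sub>E {..<q}. \<forall>l\<in>L. \<phi> (\<sigma> l) = \<phi> l}"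
  proof (rule bij_betw_imageI)
    show "inj_on F (?E \<rightarrow>\<^sub>E {..<q})"
    proof (rule inj_onI)
      fix g h assume g: "g \<in> ?E \<rightarrow>\<^sub>E {..<q}" and h: "h \<in> ?E \<rightarrow>\<^sub>E {..<q}" and eq: "F g = F h"
      have "g (?c (Conn l)) = h (?c (Conn l))" if "l \<in> L" for l
        using fun_cong[OF eq, of l] that by (simp add: F_def)
      then show "g = h" using g h by (intro PiE_ext[of g ?E _ h]) (auto simp: E2)
    qed
    show "F ` (?E \<rightarrow>\<^sub>E {..<q}) = {\<phi>\<in>L \<rightarrow>\<^sub>E {..<q}. \<forall>l\<in>L. \<phi> (\<sigma> l) = \<phi> l}"
    proof (intro equalityI subsetI)
      fix \<phi> assume "\<phi> \<in> F ` (?E \<rightarrow>\<^sub>E {..<q})"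
      then obtain h where h: "h \<in> ?E \<rightarrow>\<^sub>E {..<q}" "\<phi> = F h" by blast
      have "h (?c (Conn l)) \<in> {..<q}" if "l \<in> L" for l
        by (rule PiE_mem[OF h(1)]) (use that in \<open>auto simp: E2\<close>)
      moreover have "F h (\<sigma> l) = F h l" if "l \<in> L" for l
        using CC[OF that] \<sigma>L[OF that] that by (simp only: F_def restrict_apply' if_True)
      ultimately show "\<phi> \<in> {\<phi>\<in>L \<rightarrow>\<^sub>E {..<q}. \<forall>l\<in>L. \<phi> (\<sigma> l) = \<phi> l}"
        using h(2) by (auto simp: F_def)
    next
      fix \<phi> assume "\<phi> \<in> {\<phi>\<in>L \<rightarrow>\<^sub>E {..<q}. \<forall>l\<in>L. \<phi> (\<sigma> l) = \<phi> l}"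
      then have \<phi>: "\<phi> \<in> L \<rightarrow>\<^sub>E {..<q}" and inv: "\<And>l. l \<in> L \<Longrightarrow> \<phi> (\<sigma> l) = \<phi> l" by auto
      \<comment> \<open>An invariant colouring of the legs is spread to the edges before merging.
        The values on \<open>Star\<close> and \<open>Hedge\<close> are dummies, since a system of
        strands has no such edges.\<close>
      define \<kappa> where "\<kappa> e = (case e of Conn l \<Rightarrow> \<phi> l | Strand l \<Rightarrow> \<phi> l | Star l \<Rightarrow> 0 | Hedge l \<Rightarrow> 0)" for e
      have ad: "\<kappa> e = \<kappa> e'" if ee: "(e, e') \<in> adj ?S ?G" for e e'
      proof -
        have inj: "l = l'" if "\<sigma> l = \<sigma> l'" "l \<in> L" "l' \<in> L" for l l'
          using \<sigma> that by (auto simp: bij_betw_def inj_on_def)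
        have mem: "e \<in> Conn ` L \<union> Strand ` L" "e' \<in> Conn ` L \<union> Strand ` L"
          using adj_edges[OF ee] unfolding eG by blast+
        obtain w where w: "w \<in># pre_ends (strands L) \<sigma> e" "w \<in># pre_ends (strands L) \<sigma> e'"
          using ee by (auto simp: adj_def)
        have inv': "\<phi> l' = \<phi> l" if "\<sigma> l = l'" "l \<in> L" for l l' using inv that by blast
        from mem w show ?thesis by (auto simp: \<kappa>_def inv dest: inj) (metis inv')+
      qed
      have con: "\<kappa> e' = \<kappa> e" if "(e, e') \<in> (adj ?S ?G)\<^sup>*" for e e'
        using that by (induction rule: rtrancl_induct) (auto dest: ad)
      define h where "h = restrict (\<lambda>C. \<kappa> (SOME e. e \<in> C)) ?E"
      have hc: "h (?c (Conn l)) = \<phi> l" if "l \<in> L" for l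
      proof -
        have "(SOME e. e \<in> ?c (Conn l)) \<in> ?c (Conn l)" by (rule someI[of _ "Conn l"]) simp
        then have "(Conn l, SOME e. e \<in> ?c (Conn l)) \<in> (adj ?S ?G)\<^sup>*" by (simp only: Image_singleton_iff)
        then have "\<kappa> (SOME e. e \<in> ?c (Conn l)) = \<kappa> (Conn l)" by (rule con)
        moreover have "?c (Conn l) \<in> ?E" using that by (auto simp: E2)
        ultimately show ?thesis by (simp only: h_def restrict_apply' if_True \<kappa>_def ed.case)
      qed
      have "h \<in> ?E \<rightarrow>\<^sub>E {..<q}"
      proof (rule PiE_I)
        fix C assume "C \<in> ?E"
        then obtain l where "l \<in> L" "C = ?c (Conn l)" unfolding E2 by blast
        then show "h C \<in> {..<q}" using hc PiE_mem[OF \<phi>] by simp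
      qed (simp add: h_def)
      moreover have "\<phi> = F h"
      proof
        fix l show "\<phi> l = F h l"
          using hc[of l] PiE_arb[OF \<phi>, of l] by (cases "l \<in> L") (simp_all only: F_def restrict_apply if_True if_False not_False_eq_True True_implies_equals)
      qed
      ultimately show "\<phi> \<in> F ` (?E \<rightarrow>\<^sub>E {..<q})" by blast
    qed
  qed
  then have "card {\<phi>\<in>L \<rightarrow>\<^sub>E {..<q}. \<forall>l\<in>L. \<phi> (\<sigma> l) = \<phi> l} = card (?E \<rightarrow>\<^sub>E {..<q})"
    by (rule bij_betw_same_card[symmetric])
  also have "\<dots> = q ^ card ?E"
    using L by (subst card_PiE) (auto simp: E2)
  finally show ?thesis by (simp add: loops_def)
qed

lemma (in rank_bounded) f_strands:
  assumes "finite L" "bij_betw \<sigma> L L"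
  shows "f (graph_of (clo (strands L) \<sigma>)) = of_real n ^ loops L \<sigma>"
  unfolding loops_def
  by (rule f_vertexless) (use assms wf_clo[OF wf_strands, of L \<sigma>] in \<open>auto simp: clo_def\<close>)

lemma image_mset_set_sum: "image_mset g (mset_set A) = (\<Sum>a\<in>A. {#g a#})"
  by (induction A rule: infinite_finite_induct) auto

definition star_graph :: "lsys \<Rightarrow> (nat \<times> nat \<Rightarrow> nat \<times> nat) \<Rightarrow> (nat \<times> nat, nat \<times> nat) multigraph" where
  "star_graph X \<sigma> = Multigraph (vs X) (es X) (\<lambda>h. image_mset (\<lambda>l. vm X (\<sigma> l)) (mset_set {l\<in>lg X. em X l = h}))"

text \<open>\<open>q\<close> names the edge into which a piece is merged. \<open>Conn l\<close>
  leads from the edge of \<open>l\<close> to the output \<open>\<sigma> l\<close>, so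
  \<open>Star l\<close> belongs to the edge of the preimage of \<open>l\<close> under
  \<open>\<sigma>\<close>.\<close>

lemma clo_star_graph:
  assumes X: "wf_sys X" and hl: "hl X = lg X" and \<sigma>: "bij_betw \<sigma> (lg X) (lg X)"
  shows "isomorphic (clo X \<sigma>) (star_graph X \<sigma>)"
proof -
  let ?L = "lg X"
  let ?S = "Inp ` ?L \<union> Out ` ?L"
  let ?i = "inv_into ?L \<sigma>"
  let ?G = "pre X \<sigma>"
  note fin = wf_sys_finite[OF X]
  have em: "em X l \<in> es X" if "l \<in> ?L" for l using X that hl by (auto simp: wf_sys_def)
  have ne: "\<exists>l\<in>?L. em X l = h" if "h \<in> es X" for h
  proof (rule ccontr)
    assume "\<not> ?thesis"
    then have "{l\<in>hl X. em X l = h} = {}" using hl by auto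
    moreover have "card {l\<in>hl X. em X l = h} = 2" using X that by (simp add: wf_sys_def)
    ultimately show False by (metis card.empty zero_neq_numeral)
  qed
  have \<sigma>L: "\<sigma> l \<in> ?L" if "l \<in> ?L" for l using bij_betwE[OF \<sigma>] that by blast
  have iL: "?i l \<in> ?L" "\<sigma> (?i l) = l" if "l \<in> ?L" for l
    using \<sigma> that by (auto simp: bij_betw_def inv_into_into f_inv_into_f)
  have i\<sigma>: "?i (\<sigma> l) = l" if "l \<in> ?L" for l using \<sigma> that by (auto simp: bij_betw_def)
  have eG: "edges ?G = Conn ` ?L \<union> (Star ` ?L \<union> Hedge ` es X)" by (simp add: hl)
  define q where "q e = (case e of Conn l \<Rightarrow> em X l | Strand l \<Rightarrow> l | Star l \<Rightarrow> em X (?i l) | Hedge h \<Rightarrow> h)" for e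
  have qs: "q (Conn l) = em X l" "q (Star l) = em X (?i l)" "q (Hedge h) = h" for l h by (simp_all add: q_def)
  have CH: "(Conn l, Hedge (em X l)) \<in> (adj ?S ?G)\<^sup>*" if "l \<in> ?L" for l
    using that em fin by (intro r_into_rtrancl) (auto simp: adj_def hl)
  have SH: "(Star l, Hedge (em X (?i l))) \<in> (adj ?S ?G)\<^sup>*" if "l \<in> ?L" for l
  proof -
    have "(Star l, Conn (?i l)) \<in> adj ?S ?G" using that iL[OF that] by (auto simp: adj_def hl)
    then show ?thesis using CH[OF iL(1)[OF that]] by (rule converse_rtrancl_into_rtrancl)
  qed
  have EH: "(e, Hedge (q e)) \<in> (adj ?S ?G)\<^sup>*" if "e \<in> edges ?G" for e
    using that unfolding eG by (auto simp: qs CH SH)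
  show ?thesis unfolding clo_def
  proof (rule dissolve_isomorphicI[where q = q and \<alpha> = "\<lambda>w. case w of RV u \<Rightarrow> u | _ \<Rightarrow> undefined"], goal_cases)
    case 1
    have "q ` edges ?G = em X ` ?L \<union> (em X ` ?i ` ?L \<union> es X)"
      unfolding eG image_Un image_image qs by simp
    moreover have "em X ` ?L \<subseteq> es X" "em X ` ?i ` ?L \<subseteq> es X" using em em[OF iL(1)] by blast+
    ultimately show ?case by (simp add: star_graph_def) blast
  next
    case (2 e e' w)
    then have "w \<in># pre_ends X \<sigma> e" "w \<in># pre_ends X \<sigma> e'" by simp_all
    moreover have s1: "?i l' = l" if "\<sigma> l = l'" "l \<in> ?L" for l l' using i\<sigma> that by blast
    have s2: "l = l'" if "\<sigma> l = \<sigma> l'" "l \<in> ?L" "l' \<in> ?L" for l l' using i\<sigma> that by metis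
    ultimately show ?case using 2(1,2,3) unfolding eG by (auto simp: qs i\<sigma> fin hl) (metis s1 s2)+
  next
    case (3 e e')
    have "(e, Hedge (q e)) \<in> (adj ?S ?G)\<^sup>*" "(Hedge (q e), e') \<in> (adj ?S ?G)\<^sup>*"
      using EH[OF 3(1)] adj_rtrancl_sym[OF EH[OF 3(2)]] 3(3) by simp_all
    then show ?case by (rule rtrancl_trans)
  next
    case 4
    have "verts ?G - ?S = RV ` vs X" by auto
    then show ?case by (auto simp: bij_betw_def inj_on_def star_graph_def image_image)
  next
    case (5 e0)
    let ?h = "q e0"
    let ?\<alpha> = "\<lambda>w. case w of RV u \<Rightarrow> u | _ \<Rightarrow> undefined"
    let ?A = "{l\<in>?L. em X (?i l) = ?h}"
    have finE: "finite {e\<in>edges ?G. q e = ?h}" using fin by (simp add: hl)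
    \<comment> \<open>Among the pieces of a merged edge only stars have ends that survive
      dissolving.\<close>
    have "(\<Sum>e\<in>{e\<in>edges ?G. q e = ?h}. filter_mset (\<lambda>v. v \<notin> ?S) (ends ?G e)) =
        (\<Sum>e\<in>Star ` ?A. filter_mset (\<lambda>v. v \<notin> ?S) (ends ?G e))"
    proof (rule sum.mono_neutral_right[OF finE])
      show "Star ` ?A \<subseteq> {e\<in>edges ?G. q e = ?h}" unfolding eG by (auto simp: qs)
      show "\<forall>e\<in>{e\<in>edges ?G. q e = ?h} - Star ` ?A. filter_mset (\<lambda>v. v \<notin> ?S) (ends ?G e) = {#}"
      proof
        have em0: "filter_mset P M = {#}" if "\<forall>x\<in>#M. \<not> P x" for P and M :: "vx multiset"
          using that by (induction M) auto
        fix e assume "e \<in> {e\<in>edges ?G. q e = ?h} - Star ` ?A"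
        then show "filter_mset (\<lambda>v. v \<notin> ?S) (ends ?G e) = {#}"
          unfolding eG using fin \<sigma>L by (intro em0) (auto simp: qs hl)
      qed
    qed
    also have "\<dots> = (\<Sum>l\<in>?A. {#RV (vm X l)#})"
      by (subst sum.reindex) (auto simp: inj_on_def intro!: sum.cong)
    finally have s: "(\<Sum>e\<in>{e\<in>edges ?G. q e = ?h}. filter_mset (\<lambda>v. v \<notin> ?S) (ends ?G e)) = (\<Sum>l\<in>?A. {#RV (vm X l)#})" .
    have bA: "bij_betw \<sigma> {l\<in>?L. em X l = ?h} ?A"
    proof (rule bij_betw_imageI)
      show "inj_on \<sigma> {l\<in>?L. em X l = ?h}" using \<sigma> by (auto simp: bij_betw_def inj_on_def)
      show "\<sigma> ` {l\<in>?L. em X l = ?h} = ?A"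
      proof (intro equalityI subsetI)
        fix l assume "l \<in> ?A"
        then have "?i l \<in> {l\<in>?L. em X l = ?h}" "l = \<sigma> (?i l)" using iL by auto
        then show "l \<in> \<sigma> ` {l\<in>?L. em X l = ?h}" by blast
      qed (use \<sigma>L i\<sigma> in auto)
    qed
    have "image_mset ?\<alpha> (\<Sum>l\<in>?A. {#RV (vm X l)#}) = (\<Sum>l\<in>?A. {#vm X l#})"
      by (simp add: image_mset_sum)
    also have "\<dots> = (\<Sum>l\<in>{l\<in>?L. em X l = ?h}. {#vm X (\<sigma> l)#})"
      by (rule sum.reindex_bij_betw[OF bA, symmetric])
    also have "\<dots> = ends (star_graph X \<sigma>) ?h" by (simp add: star_graph_def image_mset_set_sum)
    finally show ?case unfolding s ..
  qed
qed

section \<open>Rows and columns of the connection matrices\<close>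

text \<open>The first \<open>K\<close> labels sit at the inputs and the last \<open>K\<close> at the outputs of the legs.\<close>

definition lab :: "nat \<Rightarrow> (nat \<Rightarrow> nat \<times> nat) \<Rightarrow> (nat \<times> nat \<Rightarrow> nat \<times> nat) \<Rightarrow> (nat \<times> nat \<Rightarrow> nat \<times> nat) \<Rightarrow> nat \<Rightarrow> nat" where
  "lab K en \<tau> \<rho> = restrict (\<lambda>i. if i \<le> K then to_nat (Inp (\<tau> (en i))) else to_nat (Out (\<rho> (en (i - K))))) {1..2*K}"

text \<open>A row carries nothing but the connections \<open>\<sigma>\<close>, a column carries the
  leg system. The two permutations of \<open>col_fragment\<close> act on its labels, so that
  multiplying \<open>\<sigma>\<close> from both sides is a matter of choosing the column.
  \<open>to_nat\<close> is applied because fragments live on natural numbers.\<close>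

definition row_fragment :: "nat \<Rightarrow> (nat \<Rightarrow> nat \<times> nat) \<Rightarrow> lsys \<Rightarrow> (nat \<times> nat \<Rightarrow> nat \<times> nat) \<Rightarrow> fragment" where
  "row_fragment K en X \<sigma> = (Multigraph (to_nat ` (Inp ` lg X \<union> Out ` lg X)) (to_nat ` Conn ` lg X)
     (\<lambda>e. image_mset to_nat (pre_ends X \<sigma> (from_nat e))), lab K en id id)"

definition col_fragment :: "nat \<Rightarrow> (nat \<Rightarrow> nat \<times> nat) \<Rightarrow> lsys \<Rightarrow> (nat \<times> nat \<Rightarrow> nat \<times> nat) \<Rightarrow> (nat \<times> nat \<Rightarrow> nat \<times> nat) \<Rightarrow> fragment" where
  "col_fragment K en X \<tau> \<rho> = (Multigraph (to_nat ` verts (pre X id))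
     (to_nat ` (Strand ` (lg X - hl X) \<union> (Star ` hl X \<union> Hedge ` es X)))
     (\<lambda>e. image_mset to_nat (pre_ends X id (from_nat e))), lab K en \<tau> \<rho>)"

lemma count_image_mset_inj: "inj h \<Longrightarrow> count (image_mset h M) (h x) = count M x"
  by (induction M) (auto simp: inj_eq)

text \<open>The last three facts say what gluing identifies: the port \<open>Inp l\<close> of a row
  with \<open>Inp (\<tau> l)\<close> of a column, and \<open>Out l\<close> with
  \<open>Out (\<rho> l)\<close>.\<close>

lemma lab_ports:
  assumes en: "bij_betw en {1..K} L" and \<tau>: "bij_betw \<tau> L L" and \<rho>: "bij_betw \<rho> L L"
  shows "lab K en \<tau> \<rho> ` {1..2*K} = to_nat ` (Inp ` L \<union> Out ` L)" "inj_on (lab K en \<tau> \<rho>) {1..2*K}"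
    and "\<And>i. i \<in> {1..2*K} \<Longrightarrow> (\<exists>l\<in>L. lab K en id id i = to_nat (Inp l) \<and> lab K en \<tau> \<rho> i = to_nat (Inp (\<tau> l))) \<or>
      (\<exists>l\<in>L. lab K en id id i = to_nat (Out l) \<and> lab K en \<tau> \<rho> i = to_nat (Out (\<rho> l)))"
    and "\<And>l. l \<in> L \<Longrightarrow> \<exists>i\<in>{1..2*K}. lab K en id id i = to_nat (Inp l) \<and> lab K en \<tau> \<rho> i = to_nat (Inp (\<tau> l))"
    and "\<And>l. l \<in> L \<Longrightarrow> \<exists>i\<in>{1..2*K}. lab K en id id i = to_nat (Out l) \<and> lab K en \<tau> \<rho> i = to_nat (Out (\<rho> l))"
proof -
  have enL: "en i \<in> L" if "i \<in> {1..K}" for i using bij_betwE[OF en] that by blast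
  show 3: "(\<exists>l\<in>L. lab K en id id i = to_nat (Inp l) \<and> lab K en \<tau> \<rho> i = to_nat (Inp (\<tau> l))) \<or>
      (\<exists>l\<in>L. lab K en id id i = to_nat (Out l) \<and> lab K en \<tau> \<rho> i = to_nat (Out (\<rho> l)))" if i: "i \<in> {1..2*K}" for i
  proof (cases "i \<le> K")
    case True
    then show ?thesis using i enL[of i] by (auto simp: lab_def)
  next
    case False
    then have "i - K \<in> {1..K}" using i by auto
    then show ?thesis using i False enL[of "i - K"] by (auto simp: lab_def)
  qed
  show 4: "\<exists>i\<in>{1..2*K}. lab K en id id i = to_nat (Inp l) \<and> lab K en \<tau> \<rho> i = to_nat (Inp (\<tau> l))" if "l \<in> L" for l
  proof -
    obtain i where "i \<in> {1..K}" "l = en i" using en \<open>l \<in> L\<close> by (auto simp: bij_betw_def)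
    then show ?thesis by (intro bexI[of _ i]) (auto simp: lab_def)
  qed
  show 5: "\<exists>i\<in>{1..2*K}. lab K en id id i = to_nat (Out l) \<and> lab K en \<tau> \<rho> i = to_nat (Out (\<rho> l))" if "l \<in> L" for l
  proof -
    obtain i where "i \<in> {1..K}" "l = en i" using en \<open>l \<in> L\<close> by (auto simp: bij_betw_def)
    then show ?thesis by (intro bexI[of _ "i + K"]) (auto simp: lab_def)
  qed
  have t: "\<tau> l \<in> L" "\<rho> l \<in> L" if "l \<in> L" for l using bij_betwE[OF \<tau>] bij_betwE[OF \<rho>] that by blast+
  have s: "\<exists>l'\<in>L. l = \<tau> l'" "\<exists>l'\<in>L. l = \<rho> l'" if "l \<in> L" for l
    using \<tau> \<rho> that by (auto simp: bij_betw_def image_iff dest!: equalityD2)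
  show "lab K en \<tau> \<rho> ` {1..2*K} = to_nat ` (Inp ` L \<union> Out ` L)"
  proof (intro equalityI subsetI)
    fix x assume "x \<in> lab K en \<tau> \<rho> ` {1..2*K}"
    then show "x \<in> to_nat ` (Inp ` L \<union> Out ` L)" using 3 t by fastforce
  next
    fix x assume "x \<in> to_nat ` (Inp ` L \<union> Out ` L)"
    then consider l where "l \<in> L" "x = to_nat (Inp l)" | l where "l \<in> L" "x = to_nat (Out l)" by blast
    then show "x \<in> lab K en \<tau> \<rho> ` {1..2*K}"
    proof cases
      case 1
      then obtain l' where "l' \<in> L" "l = \<tau> l'" using s by blast
      then show ?thesis using 4[of l'] 1 by force
    next
      case 2
      then obtain l' where "l' \<in> L" "l = \<rho> l'" using s by blast
      then show ?thesis using 5[of l'] 2 by force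
    qed
  qed
  show "inj_on (lab K en \<tau> \<rho>) {1..2*K}"
  proof (rule inj_onI)
    have i1: "i = j" if "\<tau> (en i) = \<tau> (en j)" "i \<in> {1..K}" "j \<in> {1..K}" for i j
      using that en \<tau> enL by (metis bij_betw_def inj_onD)
    have i2: "i = j" if "\<rho> (en i) = \<rho> (en j)" "i \<in> {1..K}" "j \<in> {1..K}" for i j
      using that en \<rho> enL by (metis bij_betw_def inj_onD)
    fix i j assume ij: "i \<in> {1..2*K}" "j \<in> {1..2*K}" "lab K en \<tau> \<rho> i = lab K en \<tau> \<rho> j"
    show "i = j"
    proof (cases "i \<le> K"; cases "j \<le> K")
      assume "i \<le> K" "j \<le> K"
      then show ?thesis using ij i1[of i j] by (auto simp: lab_def)
    next
      assume "\<not> i \<le> K" "\<not> j \<le> K"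
      then have "i - K \<in> {1..K}" "j - K \<in> {1..K}" using ij(1,2) by auto
      then have "i - K = j - K" using ij i2[of "i - K" "j - K"] \<open>\<not> i \<le> K\<close> \<open>\<not> j \<le> K\<close> by (auto simp: lab_def)
      then show ?thesis using \<open>\<not> i \<le> K\<close> \<open>\<not> j \<le> K\<close> by simp
    qed (use ij in \<open>auto simp: lab_def\<close>)
  qed
qed

lemma fragmentsI:
  assumes "wf_multigraph (fst F)" "snd F ` {1..k} \<subseteq> verts (fst F)" "inj_on (snd F) {1..k}"
    "snd F \<in> extensional {1..k}" "\<And>i. i \<in> {1..k} \<Longrightarrow> Defs.degree (fst F) (snd F i) = 1"
  shows "F \<in> fragments k"
  using assms unfolding fragments_def PiE_def Pi_def by (cases F) auto

lemma row_fragment_in: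
  assumes X: "wf_sys X" and en: "bij_betw en {1..K} (lg X)" and \<sigma>: "bij_betw \<sigma> (lg X) (lg X)"
  shows "row_fragment K en X \<sigma> \<in> fragments (2*K)"
proof -
  note fin = wf_sys_finite[OF X]
  have sL: "\<sigma> l \<in> lg X" if "l \<in> lg X" for l using bij_betwE[OF \<sigma>] that by blast
  have id: "bij_betw id (lg X) (lg X)" by simp
  let ?G = "fst (row_fragment K en X \<sigma>)"
  have deg: "Defs.degree ?G (to_nat p) = 1" if "p \<in> Inp ` lg X \<union> Out ` lg X" for p
  proof -
    have "Defs.degree ?G (to_nat p) = (\<Sum>l\<in>lg X. count (pre_ends X \<sigma> (Conn l)) p)"
      unfolding Defs.degree_def row_fragment_def fst_conv multigraph.sel
      by (simp add: sum.reindex inj_on_def comp_def image_image count_image_mset_inj del: pre_ends.simps)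
    also have "\<dots> = 1"
    proof -
      from that consider l0 where "l0 \<in> lg X" "p = Inp l0" | l0 where "l0 \<in> lg X" "p = Out l0" by blast
      then show ?thesis
      proof cases
        case 1
        then have "count (pre_ends X \<sigma> (Conn l)) p = (if l = l0 then 1 else 0)" for l by simp
        then show ?thesis using 1 fin by simp
      next
        case 2
        have "(\<Sum>l\<in>lg X. count (pre_ends X \<sigma> (Conn l)) p) = (\<Sum>l\<in>lg X. if \<sigma> l = l0 then 1 else 0)"
          by (rule sum.cong) (use 2 in auto)
        also have "\<dots> = (\<Sum>l\<in>lg X. if l = l0 then 1 else 0)"
          using sum.reindex_bij_betw[OF \<sigma>, of "\<lambda>l. if l = l0 then 1 else 0::nat"] by simp
        also have "\<dots> = 1" using 2 fin by simp
        finally show ?thesis .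
      qed
    qed
    finally show ?thesis .
  qed
  have "wf_multigraph ?G"
    unfolding wf_multigraph_iff row_fragment_def using fin sL by auto
  moreover have "lab K en id id ` {1..2*K} = to_nat ` (Inp ` lg X \<union> Out ` lg X)" "inj_on (lab K en id id) {1..2*K}"
    by (rule lab_ports[OF en id id])+
  moreover have "lab K en id id \<in> extensional {1..2*K}" by (simp add: lab_def)
  moreover have "Defs.degree ?G (lab K en id id i) = 1" if "i \<in> {1..2*K}" for i
  proof -
    have "lab K en id id i \<in> to_nat ` (Inp ` lg X \<union> Out ` lg X)"
      using lab_ports(1)[OF en id id] that by blast
    then obtain p where "lab K en id id i = to_nat p" "p \<in> Inp ` lg X \<union> Out ` lg X" by (elim imageE)
    then show ?thesis using deg by simp
  qed
  moreover have "snd (row_fragment K en X \<sigma>) = lab K en id id"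
    "to_nat ` (Inp ` lg X \<union> Out ` lg X) \<subseteq> verts ?G"
    by (auto simp: row_fragment_def)
  ultimately show ?thesis by (intro fragmentsI) simp_all
qed

lemma col_fragment_in:
  assumes X: "wf_sys X" and en: "bij_betw en {1..K} (lg X)"
    and \<tau>: "bij_betw \<tau> (lg X) (lg X)" and \<rho>: "bij_betw \<rho> (lg X) (lg X)"
  shows "col_fragment K en X \<tau> \<rho> \<in> fragments (2*K)"
proof -
  note fin = wf_sys_finite[OF X]
  have id: "bij_betw id (lg X) (lg X)" by simp
  let ?G = "fst (col_fragment K en X \<tau> \<rho>)"
  let ?E = "Strand ` (lg X - hl X) \<union> (Star ` hl X \<union> Hedge ` es X)"
  have deg: "Defs.degree ?G (to_nat p) = 1" if p: "p \<in> Inp ` lg X \<union> Out ` lg X" for p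
  proof -
    have "Defs.degree ?G (to_nat p) = (\<Sum>e\<in>?E. count (pre_ends X id e) p)"
      unfolding Defs.degree_def col_fragment_def fst_conv multigraph.sel
      by (subst sum.reindex) (auto simp: inj_on_def comp_def count_image_mset_inj intro!: sum.cong)
    moreover have "Defs.degree (pre X id) p = (\<Sum>e\<in>Conn ` lg X. count (pre_ends X id e) p) + (\<Sum>e\<in>?E. count (pre_ends X id e) p)"
      unfolding Defs.degree_def pre_sel using fin by (subst sum.union_disjoint) auto
    moreover have "(\<Sum>e\<in>Conn ` lg X. count (pre_ends X id e) p) = 1"
    proof -
      have "(\<Sum>e\<in>Conn ` lg X. count (pre_ends X id e) p) = (\<Sum>l\<in>lg X. count (pre_ends X id (Conn l)) p)"
        by (simp add: sum.reindex inj_on_def del: pre_ends.simps)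
      moreover from p obtain l0 where l0: "l0 \<in> lg X" "p = Inp l0 \<or> p = Out l0" by blast
      then have "count (pre_ends X id (Conn l)) p = (if l = l0 then 1 else 0)" for l by auto
      ultimately show ?thesis using l0 fin by simp
    qed
    ultimately show ?thesis using degree_pre[OF X id p] by simp
  qed
  have "wf_multigraph ?G"
  proof -
    have w: "wf_multigraph (pre X id)" using wf_pre[OF X, of id] by simp
    have 1: "set_mset (pre_ends X id d) \<subseteq> verts (pre X id)" and 2: "size (pre_ends X id d) \<in> {0,2}"
      if "d \<in> ?E" for d
      using w that unfolding wf_multigraph_def pre_sel(2,3) by blast+
    show ?thesis
      unfolding wf_multigraph_def col_fragment_def fst_conv multigraph.sel
    proof (intro conjI ballI)
      show "finite (to_nat ` verts (pre X id))" "finite (to_nat ` ?E)" using fin by simp_all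
      fix e assume "e \<in> to_nat ` ?E"
      then obtain d where d: "e = to_nat d" "d \<in> ?E" by (elim imageE)
      show "set_mset (image_mset to_nat (pre_ends X id (from_nat e))) \<subseteq> to_nat ` verts (pre X id)"
        unfolding d(1) from_nat_to_nat set_image_mset by (rule image_mono[OF 1[OF d(2)]])
      show "size (image_mset to_nat (pre_ends X id (from_nat e))) \<in> {0,2}"
        unfolding d(1) from_nat_to_nat size_image_mset by (rule 2[OF d(2)])
    qed
  qed
  moreover have "lab K en \<tau> \<rho> ` {1..2*K} = to_nat ` (Inp ` lg X \<union> Out ` lg X)" "inj_on (lab K en \<tau> \<rho>) {1..2*K}"
    by (rule lab_ports[OF en \<tau> \<rho>])+
  moreover have "lab K en \<tau> \<rho> \<in> extensional {1..2*K}" by (simp add: lab_def)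
  moreover have "Defs.degree ?G (lab K en \<tau> \<rho> i) = 1" if "i \<in> {1..2*K}" for i
  proof -
    have "lab K en \<tau> \<rho> i \<in> to_nat ` (Inp ` lg X \<union> Out ` lg X)"
      using lab_ports(1)[OF en \<tau> \<rho>] that by blast
    then obtain p where "lab K en \<tau> \<rho> i = to_nat p" "p \<in> Inp ` lg X \<union> Out ` lg X" by (elim imageE)
    then show ?thesis using deg by simp
  qed
  moreover have "snd (col_fragment K en X \<tau> \<rho>) = lab K en \<tau> \<rho>"
    "to_nat ` (Inp ` lg X \<union> Out ` lg X) \<subseteq> verts ?G"
    by (auto simp: col_fragment_def)
  ultimately show ?thesis by (intro fragmentsI) simp_all
qed

text \<open>After identification the connection from \<open>Inp l\<close> to
  \<open>Out (\<sigma> l)\<close> runs from \<open>Inp (\<tau> l)\<close> to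
  \<open>Out (\<rho> (\<sigma> l))\<close>. The closing permutation is therefore \<rho> after
  \<sigma> after the inverse of \<tau>, which \<open>comp\<close> expresses without
  inverses.\<close>

lemma glue_row_col:
  assumes X: "wf_sys X" and en: "bij_betw en {1..K} (lg X)" and \<sigma>: "bij_betw \<sigma> (lg X) (lg X)"
    and \<tau>: "bij_betw \<tau> (lg X) (lg X)" and \<rho>: "bij_betw \<rho> (lg X) (lg X)" and \<pi>: "bij_betw \<pi> (lg X) (lg X)"
    and comp: "\<And>l. l \<in> lg X \<Longrightarrow> \<pi> (\<tau> l) = \<rho> (\<sigma> l)"
  shows "graph_of (glue (2*K) (row_fragment K en X \<sigma>) (col_fragment K en X \<tau> \<rho>)) = graph_of (clo X \<pi>)"
proof -
  let ?L = "lg X"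
  obtain G where G: "row_fragment K en X \<sigma> = (G, lab K en id id)" and Gs: "verts G = to_nat ` (Inp ` ?L \<union> Out ` ?L)"
    "edges G = to_nat ` Conn ` ?L" "ends G = (\<lambda>e. image_mset to_nat (pre_ends X \<sigma> (from_nat e)))"
    by (simp add: row_fragment_def)
  let ?E = "Strand ` (lg X - hl X) \<union> (Star ` hl X \<union> Hedge ` es X)"
  obtain H where H: "col_fragment K en X \<tau> \<rho> = (H, lab K en \<tau> \<rho>)" and Hs: "verts H = to_nat ` verts (pre X id)"
    "edges H = to_nat ` ?E" "ends H = (\<lambda>e. image_mset to_nat (pre_ends X id (from_nat e)))"
    by (simp add: col_fragment_def)
  have sL: "\<sigma> l \<in> ?L" "\<tau> l \<in> ?L" "\<rho> l \<in> ?L" if "l \<in> ?L" for l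
    using bij_betwE[OF \<sigma>] bij_betwE[OF \<tau>] bij_betwE[OF \<rho>] that by blast+
  define a where "a w = (case w of RV u \<Rightarrow> RV u | Inp l \<Rightarrow> Inp (\<tau> l) | Out l \<Rightarrow> Out (\<rho> l))" for w
  define b where "b e = (case e of Conn l \<Rightarrow> Conn (\<tau> l) | _ \<Rightarrow> e)" for e
  have injL: "inj_on \<tau> ?L" "inj_on \<rho> ?L" using \<tau> \<rho> by (auto simp: bij_betw_def)
  have "isomorphic (glue (2*K) (G, lab K en id id) (H, lab K en \<tau> \<rho>))
      (dissolve ((\<lambda>v. a (from_nat v)) ` lab K en id id ` {1..2*K}) (pre X \<pi>))"
  proof (rule glue_isomorphicI[where \<alpha>' = from_nat and \<beta> = "\<lambda>e. b (from_nat e)" and \<beta>' = from_nat], goal_cases)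
    case 1 show ?case using row_fragment_in[OF X en \<sigma>] G by simp
  next
    case 2 show ?case using col_fragment_in[OF X en \<tau> \<rho>] H by simp
  next
    case 3
    have "inj_on a (Inp ` ?L \<union> Out ` ?L)"
    proof (rule inj_onI)
      fix x y assume "x \<in> Inp ` ?L \<union> Out ` ?L" "y \<in> Inp ` ?L \<union> Out ` ?L" "a x = a y"
      then show "x = y"
        by (elim UnE imageE) (auto simp: a_def dest: inj_onD[OF injL(1)] inj_onD[OF injL(2)])
    qed
    then show ?case unfolding Gs by (intro inj_on_imageI) (simp add: comp_def)
  next
    case 4
    show ?case unfolding Hs by (intro inj_on_imageI) (simp add: comp_def)
  next
    case 5
    have "(\<lambda>v. a (from_nat v)) ` verts G \<subseteq> verts (pre X \<pi>)" unfolding Gs using sL by (auto simp: a_def)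
    moreover have "from_nat ` verts H = verts (pre X \<pi>)" unfolding Hs image_image by simp
    ultimately show ?case by blast
  next
    case (6 i)
    from lab_ports(3)[OF en \<tau> \<rho> 6] show ?case by (auto simp: a_def)
  next
    case (7 v w)
    from 7(2) have w: "w = to_nat (from_nat w :: vx)" unfolding Hs by auto
    from 7(1) consider l where "l \<in> ?L" "v = to_nat (Inp l)" | l where "l \<in> ?L" "v = to_nat (Out l)"
      unfolding Gs by blast
    then show ?case
    proof cases
      case 1
      then have "w = to_nat (Inp (\<tau> l))" using w 7(3) by (simp add: a_def)
      then show ?thesis using lab_ports(4)[OF en \<tau> \<rho> 1(1)] 1(2) by metis
    next
      case 2
      then have "w = to_nat (Out (\<rho> l))" using w 7(3) by (simp add: a_def)
      then show ?thesis using lab_ports(5)[OF en \<tau> \<rho> 2(1)] 2(2) by metis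
    qed
  next
    case 8
    have "inj_on b (Conn ` ?L)"
    proof (rule inj_onI)
      fix x y assume "x \<in> Conn ` ?L" "y \<in> Conn ` ?L" "b x = b y"
      then show "x = y" by (elim imageE) (auto simp: b_def dest: inj_onD[OF injL(1)])
    qed
    then show ?case unfolding Gs by - (rule inj_on_imageI, simp only: comp_def from_nat_to_nat)
  next
    case 9
    show ?case unfolding Hs by (intro inj_on_imageI) (simp add: comp_def)
  next
    case 10
    have "(\<lambda>e. b (from_nat e)) ` edges G = Conn ` \<tau> ` ?L" unfolding Gs image_image by (simp add: b_def)
    also have "\<tau> ` ?L = ?L" using \<tau> by (simp add: bij_betw_def)
    finally show ?case unfolding Hs image_image by simp
  next
    case 11
    show ?case unfolding Gs Hs by (auto simp: b_def)
  next
    case (12 e)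
    then obtain l where "l \<in> ?L" "e = to_nat (Conn l)" unfolding Gs by blast
    then show ?case unfolding Gs by (simp add: a_def b_def comp)
  next
    case (13 e)
    then obtain d where d: "d \<in> ?E" "e = to_nat d" unfolding Hs by blast
    then have "pre_ends X \<pi> d = pre_ends X id d" by auto
    then show ?case unfolding Hs using d(2) by (simp add: multiset.map_comp comp_def del: pre_ends.simps)
  qed
  moreover have "(\<lambda>v. a (from_nat v)) ` lab K en id id ` {1..2*K} = Inp ` ?L \<union> Out ` ?L"
  proof -
    have "lab K en id id ` {1..2*K} = to_nat ` (Inp ` ?L \<union> Out ` ?L)" by (rule lab_ports[OF en]) simp_all
    then have "(\<lambda>v. a (from_nat v)) ` lab K en id id ` {1..2*K} = Inp ` \<tau> ` ?L \<union> Out ` \<rho> ` ?L"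
      by (simp add: image_image image_Un a_def)
    then show ?thesis using \<tau> \<rho> by (simp add: bij_betw_def)
  qed
  ultimately have "isomorphic (glue (2*K) (G, lab K en id id) (H, lab K en \<tau> \<rho>)) (clo X \<pi>)"
    by (simp add: clo_def)
  then show ?thesis unfolding G H
    by (rule graph_of_glue[rotated 2])
      (use row_fragment_in[OF X en \<sigma>] col_fragment_in[OF X en \<tau> \<rho>] G H wf_clo[OF X \<pi>] in auto)
qed

section \<open>Counting cycles by invariant colourings\<close>

definition inv_cols :: "nat \<Rightarrow> (nat \<times> nat) set \<Rightarrow> (nat \<times> nat \<Rightarrow> nat \<times> nat) \<Rightarrow> (nat \<times> nat \<Rightarrow> nat) set" where
  "inv_cols q L \<sigma> = {\<phi>\<in>L \<rightarrow>\<^sub>E {..<q}. \<forall>l\<in>L. \<phi> (\<sigma> l) = \<phi> l}"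

lemma card_inv_cols: "finite L \<Longrightarrow> bij_betw \<sigma> L L \<Longrightarrow> card (inv_cols q L \<sigma>) = q ^ loops L \<sigma>"
  unfolding inv_cols_def by (rule card_invariant_colourings)

lemma finite_inv_cols: "finite L \<Longrightarrow> finite (inv_cols q L \<sigma>)"
  unfolding inv_cols_def by (rule finite_subset[of _ "L \<rightarrow>\<^sub>E {..<q}"]) (auto intro: finite_PiE)

text \<open>Pulling back 2-colourings along an equivariant surjection is injective and preserves
  invariance, and \<open>2 ^ x\<close> is strictly increasing.\<close>

lemma loops_relabel_le:
  assumes L: "finite L" "bij_betw \<sigma> L L" "finite L'" "bij_betw \<sigma>' L' L'"
    and b: "\<beta> ` L = L'" and c: "\<And>l. l \<in> L \<Longrightarrow> \<beta> (\<sigma> l) = \<sigma>' (\<beta> l)"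
  shows "loops L' \<sigma>' \<le> loops L \<sigma>"
proof -
  have sL: "\<sigma> l \<in> L" if "l \<in> L" for l using bij_betwE[OF L(2)] that by blast
  have "card (inv_cols 2 L' \<sigma>') \<le> card (inv_cols 2 L \<sigma>)"
  proof (rule card_inj_on_le[where f = "\<lambda>\<phi>. restrict (\<phi> \<circ> \<beta>) L"])
    show "inj_on (\<lambda>\<phi>. restrict (\<phi> \<circ> \<beta>) L) (inv_cols 2 L' \<sigma>')"
    proof (rule inj_onI)
      fix \<phi> \<psi> assume \<phi>: "\<phi> \<in> inv_cols 2 L' \<sigma>'" and \<psi>: "\<psi> \<in> inv_cols 2 L' \<sigma>'"
        and eq: "restrict (\<phi> \<circ> \<beta>) L = restrict (\<psi> \<circ> \<beta>) L"
      have "\<phi> l' = \<psi> l'" if "l' \<in> L'" for l'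
      proof -
        obtain l where "l \<in> L" "l' = \<beta> l" using b \<open>l' \<in> L'\<close> by blast
        then show ?thesis using fun_cong[OF eq, of l] by simp
      qed
      then show "\<phi> = \<psi>" using \<phi> \<psi> by (intro PiE_ext[of \<phi> L' _ \<psi>]) (auto simp: inv_cols_def)
    qed
    show "(\<lambda>\<phi>. restrict (\<phi> \<circ> \<beta>) L) ` inv_cols 2 L' \<sigma>' \<subseteq> inv_cols 2 L \<sigma>"
    proof (rule image_subsetI)
      fix \<phi> assume "\<phi> \<in> inv_cols 2 L' \<sigma>'"
      then have \<phi>: "\<phi> \<in> L' \<rightarrow>\<^sub>E {..<2}" "\<And>l. l \<in> L' \<Longrightarrow> \<phi> (\<sigma>' l) = \<phi> l" by (auto simp: inv_cols_def)
      have bL: "\<beta> l \<in> L'" if "l \<in> L" for l using b that by blast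
      show "restrict (\<phi> \<circ> \<beta>) L \<in> inv_cols 2 L \<sigma>"
        using \<phi>(2) PiE_mem[OF \<phi>(1)] bL sL c unfolding inv_cols_def by auto
    qed
  qed (use L finite_inv_cols in auto)
  then show ?thesis using L by (simp add: card_inv_cols)
qed

lemma loops_relabel:
  assumes L: "finite L" "bij_betw \<sigma> L L" "bij_betw \<sigma>' L' L'"
    and b: "bij_betw \<beta> L L'" and c: "\<And>l. l \<in> L \<Longrightarrow> \<beta> (\<sigma> l) = \<sigma>' (\<beta> l)"
  shows "loops L \<sigma> = loops L' \<sigma>'"
proof (rule antisym)
  have fin: "finite L'" using b L(1) bij_betw_finite by blast
  show "loops L' \<sigma>' \<le> loops L \<sigma>"
  proof (rule loops_relabel_le[OF L(1,2) fin L(3)])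
    show "\<beta> ` L = L'" using b by (simp add: bij_betw_def)
  qed (rule c)
  let ?b = "inv_into L \<beta>"
  have i: "?b (\<beta> l) = l" if "l \<in> L" for l using b that by (simp add: bij_betw_inv_into_left)
  have j: "?b l \<in> L" "\<beta> (?b l) = l" if "l \<in> L'" for l
    using b that by (auto simp: bij_betw_def inv_into_into f_inv_into_f)
  show "loops L \<sigma> \<le> loops L' \<sigma>'"
  proof (rule loops_relabel_le[OF fin L(3) L(1,2), of ?b])
    show "?b ` L' = L" using bij_betw_inv_into[OF b] by (simp add: bij_betw_def)
    fix l assume l: "l \<in> L'"
    have "\<sigma> (?b l) \<in> L" using bij_betwE[OF L(2)] j(1)[OF l] by blast
    then have "?b (\<beta> (\<sigma> (?b l))) = \<sigma> (?b l)" by (rule i)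
    then show "?b (\<sigma>' l) = \<sigma> (?b l)" using c[OF j(1)[OF l]] j(2)[OF l] by simp
  qed
qed

lemma loops_cong:
  "finite L \<Longrightarrow> bij_betw \<sigma> L L \<Longrightarrow> (\<And>l. l \<in> L \<Longrightarrow> \<sigma> l = \<sigma>' l) \<Longrightarrow> loops L \<sigma> = loops L \<sigma>'"
proof (rule loops_relabel[where \<beta> = id])
  assume *: "bij_betw \<sigma> L L" "\<And>l. l \<in> L \<Longrightarrow> \<sigma> l = \<sigma>' l"
  show "bij_betw \<sigma>' L L" using * bij_betw_cong[of L \<sigma> \<sigma>' L] by blast
qed (auto simp: bij_betw_def)

text \<open>The two products are conjugate by \<open>\<rho>\<close>.\<close>

lemma loops_comp_commute:
  assumes "finite L" "bij_betw \<sigma> L L" "bij_betw \<rho> L L"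
  shows "loops L (\<sigma> \<circ> \<rho>) = loops L (\<rho> \<circ> \<sigma>)"
  by (rule loops_relabel[where \<beta> = \<rho>]) (use assms in \<open>auto intro: bij_betw_trans\<close>)

lemma loops_id: "finite L \<Longrightarrow> loops L id = card L"
proof -
  assume L: "finite L"
  have "bij_betw id L L" by simp
  from card_inv_cols[OF L this, of 2] have "2 ^ loops L id = card (inv_cols 2 L id)" ..
  also have "inv_cols 2 L id = L \<rightarrow>\<^sub>E {..<2}" by (auto simp: inv_cols_def)
  also have "card \<dots> = 2 ^ card L" using L by (simp add: card_PiE)
  finally show ?thesis by (simp only: power_inject_exp one_less_numeral_iff semiring_norm)
qed

lemma loops_union:
  assumes "finite L" "finite L'" "L \<inter> L' = {}" "bij_betw \<sigma> L L" "bij_betw \<sigma> L' L'"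
  shows "loops (L \<union> L') \<sigma> = loops L \<sigma> + loops L' \<sigma>"
proof -
  have "isomorphic (clo (strands (L \<union> L')) \<sigma>) (disjoint_union (clo (strands L) \<sigma>) (clo (strands L') \<sigma>))"
    by (rule clo_union[where v = id and e = id]) (use assms in \<open>auto simp: strands_def wf_sys_def\<close>)
  then obtain \<beta> where "bij_betw \<beta> (edges (clo (strands (L \<union> L')) \<sigma>))
      (edges (clo (strands L) \<sigma>) <+> edges (clo (strands L') \<sigma>))"
    unfolding isomorphic_def by auto
  then have "loops (L \<union> L') \<sigma> = card (edges (clo (strands L) \<sigma>) <+> edges (clo (strands L') \<sigma>))"
    unfolding loops_def by (rule bij_betw_same_card)
  also have "\<dots> = loops L \<sigma> + loops L' \<sigma>"
    using wf_clo[OF wf_strands, of L \<sigma>] wf_clo[OF wf_strands, of L' \<sigma>] assms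
    unfolding loops_def by (intro card_Plus) (auto simp: wf_multigraph_def)
  finally show ?thesis .
qed

section \<open>Blocks of legs\<close>

definition legs :: "nat \<Rightarrow> nat \<Rightarrow> (nat \<times> nat) set" where
  "legs k r = {..<r} \<times> {..<k}"

lemma mem_legs [simp]: "(b, x) \<in> legs k r \<longleftrightarrow> b < r \<and> x < k"
  by (auto simp: legs_def)

lemma finite_legs [simp]: "finite (legs k r)"
  by (simp add: legs_def)

lemma legs_Suc: "legs k (Suc r) = legs k r \<union> {r} \<times> {..<k}"
  by (auto simp: legs_def)

text \<open>Multiplying by the transposition of a fresh block with an old one only subdivides cycles.\<close>

lemma loops_swap:
  assumes u: "bij_betw u (legs k r) (legs k r)" "\<And>x. u (r, x) = (r, x)" and j: "j < r"
  shows "loops (legs k (Suc r)) (u \<circ> (\<lambda>(b, x). (Transposition.transpose j r b, x))) = loops (legs k r) u"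
proof -
  let ?s = "\<lambda>(b, x). (Transposition.transpose j r b, x::nat)"
  let ?L = "legs k r" and ?L' = "legs k (Suc r)"
  have s: "bij_betw ?s ?L' ?L'"
    by (rule bij_betw_byWitness[where f' = ?s]) (use j in \<open>auto simp: Transposition.transpose_def split: if_splits\<close>)
  have uL: "u l \<in> ?L" if "l \<in> ?L" for l using bij_betwE[OF u(1)] that by blast
  have u': "bij_betw u ?L' ?L'"
    unfolding legs_Suc by (rule bij_betw_combine[OF u(1)]) (use u(2) in \<open>auto simp: bij_betw_def inj_on_def image_iff\<close>)
  have us: "bij_betw (u \<circ> ?s) ?L' ?L'" by (rule bij_betw_trans[OF s u'])
  have "bij_betw (\<lambda>\<phi>. restrict \<phi> ?L) (inv_cols 2 ?L' (u \<circ> ?s)) (inv_cols 2 ?L u)"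
  proof (rule bij_betw_byWitness[where f' = "\<lambda>\<psi>. restrict (\<lambda>(b, x). if b = r then \<psi> (j, x) else \<psi> (b, x)) ?L'"])
    \<comment> \<open>\<open>u \<circ> ?s\<close> sends \<open>(j, x)\<close> to the fixed point
      \<open>(r, x)\<close> of \<open>u\<close>. An invariant colouring thus agrees at the two and
      is determined by its restriction to the old blocks, where it is invariant under
      \<open>u\<close>.\<close>
    have key: "\<phi> (r, x) = \<phi> (j, x) \<and> \<phi> (u (j, x)) = \<phi> (j, x)"
      if "\<phi> \<in> inv_cols 2 ?L' (u \<circ> ?s)" "x < k" for \<phi> x
    proof -
      have inv: "\<forall>l\<in>?L'. \<phi> ((u \<circ> ?s) l) = \<phi> l" using that(1) unfolding inv_cols_def by blast
      show ?thesis using bspec[OF inv, of "(j, x)"] bspec[OF inv, of "(r, x)"] u(2) j that(2) by simp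
    qed
    have key2: "\<phi> (u (b, x)) = \<phi> (b, x)" if "\<phi> \<in> inv_cols 2 ?L' (u \<circ> ?s)" "x < k" "b < r" for \<phi> b x
    proof (cases "b = j")
      case True
      then show ?thesis using key[OF that(1,2)] by simp
    next
      case False
      have inv: "\<forall>l\<in>?L'. \<phi> ((u \<circ> ?s) l) = \<phi> l" using that(1) unfolding inv_cols_def by blast
      show ?thesis using bspec[OF inv, of "(b, x)"] False that by (simp add: Transposition.transpose_def)
    qed
    show "\<forall>\<phi>\<in>inv_cols 2 ?L' (u \<circ> ?s). restrict (\<lambda>(b, x). if b = r then (restrict \<phi> ?L) (j, x) else (restrict \<phi> ?L) (b, x)) ?L' = \<phi>"
    proof (intro ballI ext)
      fix \<phi> and l :: "nat \<times> nat" assume \<phi>: "\<phi> \<in> inv_cols 2 ?L' (u \<circ> ?s)"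
      obtain b x where l: "l = (b, x)" by fastforce
      have "\<phi> l = undefined" if "l \<notin> ?L'" using \<phi> PiE_arb[OF _ that] unfolding inv_cols_def by blast
      then show "restrict (\<lambda>(b, x). if b = r then (restrict \<phi> ?L) (j, x) else (restrict \<phi> ?L) (b, x)) ?L' l = \<phi> l"
        using key[OF \<phi>, of x] j unfolding l by (cases "b < Suc r \<and> x < k") auto
    qed
    show "\<forall>\<psi>\<in>inv_cols 2 ?L u. restrict (restrict (\<lambda>(b, x). if b = r then \<psi> (j, x) else \<psi> (b, x)) ?L') ?L = \<psi>"
    proof (intro ballI ext)
      fix \<psi> and l :: "nat \<times> nat" assume \<psi>: "\<psi> \<in> inv_cols 2 ?L u"
      obtain b x where l: "l = (b, x)" by fastforce
      have "\<psi> l = undefined" if "l \<notin> ?L" using \<psi> PiE_arb[OF _ that] unfolding inv_cols_def by blast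
      then show "restrict (restrict (\<lambda>(b, x). if b = r then \<psi> (j, x) else \<psi> (b, x)) ?L') ?L l = \<psi> l"
        unfolding l by (cases "b < r \<and> x < k") auto
    qed
    show "(\<lambda>\<phi>. restrict \<phi> ?L) ` inv_cols 2 ?L' (u \<circ> ?s) \<subseteq> inv_cols 2 ?L u"
    proof (rule image_subsetI)
      fix \<phi> assume \<phi>: "\<phi> \<in> inv_cols 2 ?L' (u \<circ> ?s)"
      then have "\<phi> l \<in> {..<2}" if "l \<in> ?L'" for l using that unfolding inv_cols_def by (auto dest: PiE_mem)
      moreover have "?L \<subseteq> ?L'" by (auto simp: legs_Suc)
      ultimately show "restrict \<phi> ?L \<in> inv_cols 2 ?L u"
        using key2[OF \<phi>] uL unfolding inv_cols_def by auto
    qed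
    show "(\<lambda>\<psi>. restrict (\<lambda>(b, x). if b = r then \<psi> (j, x) else \<psi> (b, x)) ?L') ` inv_cols 2 ?L u \<subseteq> inv_cols 2 ?L' (u \<circ> ?s)"
    proof (rule image_subsetI)
      fix \<psi> assume \<psi>: "\<psi> \<in> inv_cols 2 ?L u"
      have \<psi>r: "\<psi> l < 2" if "l \<in> ?L" for l using \<psi> that unfolding inv_cols_def by (auto dest: PiE_mem)
      have \<psi>u: "\<psi> (u l) = \<psi> l" if "l \<in> ?L" for l using \<psi> that unfolding inv_cols_def by auto
      let ?\<psi> = "\<lambda>(b, x). if b = r then \<psi> (j, x) else \<psi> (b, x)"
      have \<psi>L: "?\<psi> l = \<psi> l" if "l \<in> ?L" for l using that by (cases l) auto
      have step: "restrict ?\<psi> ?L' ((u \<circ> ?s) (b, x)) = restrict ?\<psi> ?L' (b, x)" if "b < Suc r" "x < k" for b x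
      proof -
        have m: "(u \<circ> ?s) (b, x) \<in> ?L'" by (rule bij_betw_apply[OF us]) (use that in simp)
        have "?\<psi> ((u \<circ> ?s) (b, x)) = ?\<psi> (b, x)"
        proof (cases "b = r")
          case True
          then have "(u \<circ> ?s) (b, x) = u (j, x)" by simp
          moreover have "?\<psi> (u (j, x)) = \<psi> (u (j, x))" by (rule \<psi>L) (use uL j that in auto)
          ultimately show ?thesis using True \<psi>u[of "(j, x)"] j that by simp
        next
          case False
          show ?thesis
          proof (cases "b = j")
            case True
            then have "(u \<circ> ?s) (b, x) = (r, x)" using u(2) by simp
            then show ?thesis using True False by simp
          next
            case bj: False
            then have "(u \<circ> ?s) (b, x) = u (b, x)" using False by (simp add: Transposition.transpose_def)
            moreover have "?\<psi> (u (b, x)) = \<psi> (u (b, x))" by (rule \<psi>L) (use uL False that in auto)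
            ultimately show ?thesis using False \<psi>u[of "(b, x)"] that by simp
          qed
        qed
        then show ?thesis using m that by simp
      qed
      have "restrict ?\<psi> ?L' ((u \<circ> ?s) l) = restrict ?\<psi> ?L' l" if "l \<in> ?L'" for l
      proof -
        obtain b x where l: "l = (b, x)" by (rule prod.exhaust)
        show ?thesis unfolding l by (rule step) (use that in \<open>simp_all add: l\<close>)
      qed
      moreover have "restrict ?\<psi> ?L' \<in> ?L' \<rightarrow>\<^sub>E {..<2}"
        using \<psi>r j by (auto simp: less_Suc_eq)
      ultimately show "restrict ?\<psi> ?L' \<in> inv_cols 2 ?L' (u \<circ> ?s)"
        unfolding inv_cols_def by blast
    qed
  qed
  then have "card (inv_cols 2 ?L' (u \<circ> ?s)) = card (inv_cols 2 ?L u)" by (rule bij_betw_same_card)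
  then have "(2::nat) ^ loops ?L' (u \<circ> ?s) = 2 ^ loops ?L u"
    using card_inv_cols[OF _ us, of 2] card_inv_cols[OF _ u(1), of 2] by simp
  then show ?thesis by simp
qed

section \<open>The group algebra of the legs\<close>

text \<open>The group of bijections of the legs, written additively so that \<open>gp \<Rightarrow>\<^sub>0 complex\<close> is its group algebra.\<close>

typedef gp = "{g :: nat \<times> nat \<Rightarrow> nat \<times> nat. bij g}" morphisms ap Gp
  by (rule exI[of _ id]) simp

lemma bij_ap: "bij (ap g)"
  using ap[of g] by simp

lemma ap_Gp: "bij g \<Longrightarrow> ap (Gp g) = g"
  by (simp add: Gp_inverse)

lemma gp_eqI: "(\<And>l. ap g l = ap h l) \<Longrightarrow> g = h"
  by (meson ap_inject ext)

instantiation gp :: monoid_add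
begin
definition zero_gp :: gp where "zero_gp = Gp id"
definition plus_gp :: "gp \<Rightarrow> gp \<Rightarrow> gp" where "plus_gp g h = Gp (ap g \<circ> ap h)"
lemma ap_zero: "ap 0 = id" by (simp add: zero_gp_def ap_Gp)
lemma ap_plus: "ap (g + h) = ap g \<circ> ap h" by (simp add: plus_gp_def ap_Gp bij_ap bij_comp)
instance by standard (auto intro!: gp_eqI simp: ap_plus ap_zero)
end

section \<open>Linear functionals on group algebras\<close>

type_synonym ga = "gp \<Rightarrow>\<^sub>0 complex"

abbreviation keys :: "('g \<Rightarrow>\<^sub>0 'c::zero) \<Rightarrow> 'g set" where "keys \<equiv> Poly_Mapping.keys"
abbreviation lookup :: "('g \<Rightarrow>\<^sub>0 'c::zero) \<Rightarrow> 'g \<Rightarrow> 'c" where "lookup \<equiv> Poly_Mapping.lookup"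
abbreviation single :: "'g \<Rightarrow> 'c \<Rightarrow> 'g \<Rightarrow>\<^sub>0 'c::zero" where "single \<equiv> Poly_Mapping.single"

definition lin :: "('g \<Rightarrow> complex) \<Rightarrow> ('g \<Rightarrow>\<^sub>0 complex) \<Rightarrow> complex" where
  "lin \<phi> a = (\<Sum>g\<in>keys a. lookup a g * \<phi> g)"

lemma lin_superset: "finite A \<Longrightarrow> keys a \<subseteq> A \<Longrightarrow> lin \<phi> a = (\<Sum>g\<in>A. lookup a g * \<phi> g)"
  unfolding lin_def by (rule sum.mono_neutral_left) (auto simp: in_keys_iff)

lemma lin_zero [simp]: "lin \<phi> 0 = 0"
  by (simp add: lin_def)

lemma lin_single [simp]: "lin \<phi> (single g c) = c * \<phi> g"
  by (simp add: lin_def)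

lemma lin_add: "lin \<phi> (a + b) = lin \<phi> a + lin \<phi> b"
  using keys_add[of a b]
  by (simp add: lin_superset[of "keys a \<union> keys b"] lookup_add algebra_simps sum.distrib)

lemma lin_uminus: "lin \<phi> (- a) = - lin \<phi> a"
  by (simp add: lin_superset[of "keys a"] sum_negf)

lemma lin_diff: "lin \<phi> (a - b) = lin \<phi> a - lin \<phi> b"
  using lin_add[of \<phi> a "- b"] by (simp add: lin_uminus)

lemma lin_sum: "lin \<phi> (\<Sum>i\<in>I. a i) = (\<Sum>i\<in>I. lin \<phi> (a i))"
  by (induction I rule: infinite_finite_induct) (auto simp: lin_add)

lemma poly_mapping_expand: "a = (\<Sum>g\<in>keys a. single g (lookup a g))"
proof (rule poly_mapping_eqI)
  fix h
  have "lookup (\<Sum>g\<in>keys a. single g (lookup a g)) h = (\<Sum>g\<in>keys a. if g = h then lookup a h else 0)"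
    by (auto simp: lookup_sum lookup_single when_def intro!: sum.cong)
  also have "\<dots> = lookup a h" by (simp add: in_keys_iff)
  finally show "lookup a h = lookup (\<Sum>g\<in>keys a. single g (lookup a g)) h" ..
qed

lemma mult_expand:
  fixes a b :: "'g::monoid_add \<Rightarrow>\<^sub>0 complex"
  shows "a * b = (\<Sum>g\<in>keys a. \<Sum>h\<in>keys b. single (g + h) (lookup a g * lookup b h))"
proof -
  have "a * b = (\<Sum>g\<in>keys a. single g (lookup a g)) * (\<Sum>h\<in>keys b. single h (lookup b h))"
    using poly_mapping_expand[of a] poly_mapping_expand[of b] by simp
  then show ?thesis by (simp add: sum_product mult_single)
qed

lemma lin_mult:
  fixes a b :: "'g::monoid_add \<Rightarrow>\<^sub>0 complex"
  shows "lin \<phi> (a * b) = (\<Sum>g\<in>keys a. \<Sum>h\<in>keys b. lookup a g * lookup b h * \<phi> (g + h))"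
  by (subst mult_expand) (simp add: lin_sum)

lemma lin_mult_mult:
  fixes a b c :: "'g::monoid_add \<Rightarrow>\<^sub>0 complex"
  shows "lin \<phi> (a * b * c) = (\<Sum>g\<in>keys a. \<Sum>h\<in>keys b. \<Sum>i\<in>keys c. lookup a g * lookup b h * lookup c i * \<phi> (g + h + i))"
proof -
  have "a * b * c = (\<Sum>g\<in>keys a. \<Sum>h\<in>keys b. single (g + h) (lookup a g * lookup b h)) * (\<Sum>i\<in>keys c. single i (lookup c i))"
    using mult_expand[of a b] poly_mapping_expand[of c] by simp
  then show ?thesis unfolding sum_distrib_right unfolding sum_distrib_left by (simp add: mult_single lin_sum)
qed

text \<open>Fixing all later blocks pointwise is what allows one further block to be split off at a
  time, for traces as well as for values of \<open>f\<close>.\<close>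

definition stab :: "nat \<Rightarrow> nat \<Rightarrow> gp set" where
  "stab k m = {g. ap g ` legs k m = legs k m \<and> (\<forall>b x. m \<le> b \<longrightarrow> ap g (b, x) = (b, x))}"

definition SA :: "nat \<Rightarrow> nat \<Rightarrow> ga set" where
  "SA k m = {a. keys a \<subseteq> stab k m}"

lemma stab_bij: "g \<in> stab k m \<Longrightarrow> bij_betw (ap g) (legs k m) (legs k m)"
  using bij_ap[of g] by (auto simp: stab_def bij_betw_def bij_def intro: inj_on_subset)

lemma stab_fix: "g \<in> stab k m \<Longrightarrow> m \<le> b \<Longrightarrow> ap g (b, x) = (b, x)"
  by (auto simp: stab_def)

lemma stab_zero: "0 \<in> stab k m"
  by (simp add: stab_def ap_zero)

lemma stab_plus: "g \<in> stab k m \<Longrightarrow> h \<in> stab k m \<Longrightarrow> g + h \<in> stab k m"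
  unfolding stab_def mem_Collect_eq ap_plus image_comp[symmetric] by simp

lemma stab_mono:
  assumes "m \<le> m'" shows "stab k m \<subseteq> stab k m'"
proof
  fix g assume g: "g \<in> stab k m"
  have "legs k m' = legs k m \<union> {m..<m'} \<times> {..<k}" using assms by (auto simp: legs_def)
  moreover have "ap g ` ({m..<m'} \<times> {..<k}) = {m..<m'} \<times> {..<k}"
    using stab_fix[OF g] by (force simp: image_iff)
  ultimately show "g \<in> stab k m'" using g assms by (auto simp: stab_def image_Un)
qed

lemma SA_mono: "m \<le> m' \<Longrightarrow> a \<in> SA k m \<Longrightarrow> a \<in> SA k m'"
  using stab_mono[of m m' k] by (auto simp: SA_def)

lemma SA_mult: "a \<in> SA k m \<Longrightarrow> b \<in> SA k m \<Longrightarrow> a * b \<in> SA k m"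
  using keys_mult[of a b] stab_plus by (fastforce simp: SA_def)

lemma SA_one: "1 \<in> SA k m"
  using stab_zero by (simp add: SA_def)

lemma SA_add: "a \<in> SA k m \<Longrightarrow> b \<in> SA k m \<Longrightarrow> a + b \<in> SA k m"
  using keys_add[of a b] by (auto simp: SA_def)

lemma SA_diff: "a \<in> SA k m \<Longrightarrow> b \<in> SA k m \<Longrightarrow> a - b \<in> SA k m"
  using SA_add[of a k m "- b"] by (simp add: SA_def keys_def)

lemma SA_single: "g \<in> stab k m \<Longrightarrow> single g c \<in> SA k m"
  by (simp add: SA_def)

lemma SA_zero: "0 \<in> SA k m"
  by (simp add: SA_def)

lemma SA_sum: "(\<And>i. i \<in> I \<Longrightarrow> a i \<in> SA k m) \<Longrightarrow> (\<Sum>i\<in>I. a i) \<in> SA k m"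
  by (induction I rule: infinite_finite_induct) (auto intro: SA_add SA_zero)

section \<open>Permutations inside one block and of the blocks\<close>

definition emb :: "nat \<Rightarrow> (nat \<Rightarrow> nat) \<Rightarrow> gp" where
  "emb i p = Gp (\<lambda>(b, x). if b = i then (b, p x) else (b, x))"

definition blk :: "(nat \<Rightarrow> nat) \<Rightarrow> gp" where
  "blk \<gamma> = Gp (\<lambda>(b, x). (\<gamma> b, x))"

lemma ap_emb: "bij p \<Longrightarrow> ap (emb i p) (b, x) = (if b = i then (b, p x) else (b, x))"
proof -
  assume p: "bij p"
  have "bij (\<lambda>(b, x). if b = i then (b, p x) else (b, x))"
  proof (rule o_bij[where g = "\<lambda>(b, x). if b = i then (b, inv p x) else (b, x)"])
  qed (use p in \<open>auto simp: bij_is_inj bij_is_surj surj_f_inv_f\<close>)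
  then show ?thesis by (simp add: emb_def ap_Gp)
qed

lemma ap_blk: "bij \<gamma> \<Longrightarrow> ap (blk \<gamma>) (b, x) = (\<gamma> b, x)"
proof -
  assume \<gamma>: "bij \<gamma>"
  have "bij (\<lambda>(b, x). (\<gamma> b, x::nat))"
  proof (rule o_bij[where g = "\<lambda>(b, x). (inv \<gamma> b, x)"])
  qed (use \<gamma> in \<open>auto simp: bij_is_inj bij_is_surj surj_f_inv_f\<close>)
  then show ?thesis by (simp add: blk_def ap_Gp)
qed

lemma emb_commute: "bij p \<Longrightarrow> bij q \<Longrightarrow> i \<noteq> j \<Longrightarrow> emb i p + emb j q = emb j q + emb i p"
  by (rule gp_eqI) (auto simp: ap_plus ap_emb)

lemma blk_emb: "bij \<gamma> \<Longrightarrow> bij p \<Longrightarrow> blk \<gamma> + emb i p = emb (\<gamma> i) p + blk \<gamma>"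
  by (rule gp_eqI) (auto simp: ap_plus ap_emb ap_blk bij_is_inj inj_eq)

lemma blk_plus: "bij \<gamma> \<Longrightarrow> bij \<delta> \<Longrightarrow> blk \<gamma> + blk \<delta> = blk (\<gamma> \<circ> \<delta>)"
  by (rule gp_eqI) (auto simp: ap_plus ap_blk bij_comp)

lemma blk_id: "blk id = 0"
  by (rule gp_eqI) (auto simp: ap_zero ap_blk)

lemma emb_stab: "p permutes {..<k} \<Longrightarrow> i < m \<Longrightarrow> emb i p \<in> stab k m"
proof -
  assume p: "p permutes {..<k}" and i: "i < m"
  note ap = ap_emb[OF permutes_bij[OF p]]
  have "(b, x) \<in> ap (emb i p) ` legs k m" if "b < m" "x < k" for b x
  proof (cases "b = i")
    case True
    obtain x' where "x' < k" "x = p x'" using permutes_image[OF p] \<open>x < k\<close> by blast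
    then show ?thesis using True that by (intro image_eqI[of _ _ "(b, x')"]) (auto simp: ap)
  next
    case False
    then show ?thesis using that by (intro image_eqI[of _ _ "(b, x)"]) (auto simp: ap)
  qed
  moreover have "ap (emb i p) l \<in> legs k m" if "l \<in> legs k m" for l
    using that permutes_in_image[OF p] by (cases l) (auto simp: ap)
  ultimately show ?thesis using i by (auto simp: stab_def ap)
qed

lemma blk_stab: "\<gamma> permutes {..<m} \<Longrightarrow> blk \<gamma> \<in> stab k m"
proof -
  assume g: "\<gamma> permutes {..<m}"
  note ap = ap_blk[OF permutes_bij[OF g]]
  have "(b, x) \<in> ap (blk \<gamma>) ` legs k m" if "b < m" "x < k" for b x
  proof -
    obtain b' where "b' < m" "b = \<gamma> b'" using permutes_image[OF g] \<open>b < m\<close> by blast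
    then show ?thesis using that by (intro image_eqI[of _ _ "(b', x)"]) (auto simp: ap)
  qed
  moreover have "ap (blk \<gamma>) l \<in> legs k m" if "l \<in> legs k m" for l
    using that permutes_in_image[OF g] by (cases l) (auto simp: ap)
  ultimately show ?thesis using permutes_not_in[OF g] by (auto simp: stab_def ap)
qed

text \<open>\<open>E k \<alpha> i\<close> is the element \<open>\<alpha>\<close> of the group algebra of the permutations of \<open>k\<close> points, acting on
  block \<open>i\<close>; \<open>B \<gamma>\<close> permutes the blocks.\<close>

definition E :: "nat \<Rightarrow> ((nat \<Rightarrow> nat) \<Rightarrow> complex) \<Rightarrow> nat \<Rightarrow> ga" where
  "E k \<alpha> i = (\<Sum>p | p permutes {..<k}. single (emb i p) (\<alpha> p))"

definition B :: "(nat \<Rightarrow> nat) \<Rightarrow> ga" where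
  "B \<gamma> = single (blk \<gamma>) 1"

lemma B_mult: "bij \<gamma> \<Longrightarrow> bij \<delta> \<Longrightarrow> B \<gamma> * B \<delta> = B (\<gamma> \<circ> \<delta>)"
  by (simp add: B_def mult_single blk_plus)

lemma B_id: "B id = 1"
  by (simp add: B_def blk_id)

lemma E_commute: "i \<noteq> j \<Longrightarrow> E k \<alpha> i * E k \<alpha> j = E k \<alpha> j * E k \<alpha> i"
  unfolding E_def sum_product mult_single
  by (subst sum.swap) (auto intro!: sum.cong simp: emb_commute permutes_bij mult.commute)

lemma B_E: "bij \<gamma> \<Longrightarrow> B \<gamma> * E k \<alpha> i = E k \<alpha> (\<gamma> i) * B \<gamma>"
  unfolding E_def B_def sum_distrib_left sum_distrib_right mult_single
  by (auto intro!: sum.cong simp: blk_emb permutes_bij)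

lemma E_SA: "i < m \<Longrightarrow> E k \<alpha> i \<in> SA k m"
  unfolding E_def by (intro SA_sum SA_single emb_stab) auto

lemma B_SA: "\<gamma> permutes {..<m} \<Longrightarrow> B \<gamma> \<in> SA k m"
  unfolding B_def by (intro SA_single blk_stab)

section \<open>An idempotent placed on several blocks, and its trace\<close>

locale idempotent =
  fixes k :: nat and \<alpha> :: "(nat \<Rightarrow> nat) \<Rightarrow> complex" and n :: real
  assumes idem0: "E k \<alpha> 0 * E k \<alpha> 0 = E k \<alpha> 0"
begin

abbreviation "e \<equiv> E k \<alpha>"

text \<open>Conjugation by the transposition of the blocks 0 and \<open>i\<close> carries the
  assumption from block 0 to block \<open>i\<close>.\<close>

lemma idem: "e i * e i = e i"
proof -
  let ?t = "Transposition.transpose 0 i"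
  have t: "bij ?t" by simp
  have tt: "?t \<circ> ?t = id" by (simp add: fun_eq_iff)
  have s: "B ?t * e 0 = e i * B ?t" using B_E[OF t, of k \<alpha> 0] by simp
  have "e i * e i * B ?t = e i * (B ?t * e 0)" by (simp only: s mult.assoc)
  also have "\<dots> = B ?t * e 0 * e 0" by (simp only: s[symmetric] mult.assoc[symmetric])
  also have "\<dots> = B ?t * e 0" by (simp only: mult.assoc idem0)
  also have "\<dots> = e i * B ?t" by (rule s)
  finally have "e i * e i * B ?t * B ?t = e i * B ?t * B ?t" by simp
  moreover have "B ?t * B ?t = 1" using B_mult[OF t t] by (simp add: tt B_id)
  ultimately show ?thesis by (simp only: mult.assoc mult_1_right)
qed

primrec zz :: "nat \<Rightarrow> ga" where
  "zz 0 = 1"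
| "zz (Suc r) = zz r * (1 - e r)"

primrec hh :: "nat \<Rightarrow> nat \<Rightarrow> ga" where
  "hh r 0 = 1"
| "hh r (Suc s) = hh r s * e (r + s)"

lemma zz_SA: "zz r \<in> SA k r"
proof (induction r)
  case (Suc r)
  show ?case unfolding zz.simps
    by (intro SA_mult SA_diff SA_one E_SA SA_mono[OF _ Suc.IH]) simp_all
qed (simp add: SA_one)

lemma hh_SA: "hh r s \<in> SA k (r + s)"
proof (induction s)
  case (Suc s)
  show ?case unfolding hh.simps
    by (intro SA_mult E_SA SA_mono[OF _ Suc.IH]) simp_all
qed (simp add: SA_one)

lemma e_commute: "e i * e j = e j * e i"
  by (cases "i = j") (auto simp: E_commute)

lemma zz_e_commute: "zz r * e i = e i * zz r"
proof (induction r)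
  case (Suc r)
  have "zz (Suc r) * e i = zz r * e i - zz r * (e r * e i)" by (simp add: algebra_simps)
  also have "\<dots> = zz r * e i - zz r * e i * e r" by (simp add: e_commute[of r i] mult.assoc)
  also have "\<dots> = e i * zz (Suc r)" unfolding Suc.IH by (simp add: algebra_simps)
  finally show ?case .
qed simp

lemma zz_hh_commute: "zz r * hh r' s = hh r' s * zz r"
proof (induction s)
  case (Suc s)
  have "zz r * hh r' (Suc s) = hh r' s * (zz r * e (r' + s))" using Suc.IH by (simp add: mult.assoc[symmetric])
  then show ?case by (simp add: zz_e_commute mult.assoc)
qed simp

lemma zz_e: "i < r \<Longrightarrow> zz r * e i = 0"
proof (induction r)
  case (Suc r)
  show ?case
  proof (cases "i = r")
    case True
    then show ?thesis by (simp add: mult.assoc left_diff_distrib idem)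
  next
    case False
    have "zz (Suc r) * e i = zz r * e i * (1 - e r)"
      by (simp add: algebra_simps e_commute[of r i])
    then show ?thesis using False Suc by simp
  qed
qed simp

lemma zz_zz: "zz r * zz r = zz r"
proof -
  have "zz r * zz j = zz r" if "j \<le> r" for j
    using that
  proof (induction j)
    case (Suc j)
    have "zz r * zz (Suc j) = zz r * zz j * (1 - e j)" by (simp add: mult.assoc)
    also have "\<dots> = zz r - zz r * e j" using Suc by (simp add: algebra_simps)
    finally show ?case using zz_e[of j r] Suc.prems by simp
  qed simp
  then show ?thesis by simp
qed

lemma hh_e: "r \<le> i \<Longrightarrow> i < r + s \<Longrightarrow> hh r s * e i = hh r s"
proof (induction s)
  case (Suc s)
  show ?case
  proof (cases "i = r + s")
    case True
    then show ?thesis by (simp add: mult.assoc idem)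
  next
    case False
    have "hh r (Suc s) * e i = hh r s * e i * e (r + s)" by (simp add: mult.assoc e_commute)
    then show ?thesis using False Suc by simp
  qed
qed simp

lemma hh_hh: "hh r s * hh r s = hh r s"
proof -
  have "hh r s * hh r j = hh r s" if "j \<le> s" for j
    using that
  proof (induction j)
    case (Suc j)
    have "hh r s * hh r (Suc j) = hh r s * hh r j * e (r + j)" by (simp add: mult.assoc)
    then show ?case using Suc hh_e[of r "r + j" s] by simp
  qed simp
  then show ?thesis by simp
qed

lemma hh_B_commute:
  assumes "\<gamma> permutes {..<r}" shows "hh r s * B \<gamma> = B \<gamma> * hh r s"
proof (induction s)
  case (Suc s)
  have g: "\<gamma> (r + s) = r + s" using permutes_not_in[OF assms] by simp
  have "hh r (Suc s) * B \<gamma> = hh r s * (e (\<gamma> (r + s)) * B \<gamma>)" by (simp add: g mult.assoc)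
  also have "\<dots> = hh r s * B \<gamma> * e (r + s)"
    unfolding B_E[OF permutes_bij[OF assms], symmetric] by (simp add: mult.assoc)
  finally show ?case using Suc.IH by (simp add: mult.assoc)
qed simp

text \<open>For natural \<open>n\<close> this is the trace of permutations of the factors of a
  tensor power of an \<open>n\<close>-dimensional space: each cycle contributes a factor
  \<open>n\<close>. For real \<open>n\<close> the formula is kept although no space stands behind
  it.\<close>

definition t :: "nat \<Rightarrow> ga \<Rightarrow> complex" where
  "t r = lin (\<lambda>g. of_real n ^ loops (legs k r) (ap g))"

definition \<epsilon> :: complex where
  "\<epsilon> = (\<Sum>p | p permutes {..<k}. \<alpha> p * of_real n ^ loops (legs k 1) (ap (emb 0 p)))"

text \<open>The trace of \<open>1 - e\<close> on a single block, the identity of \<open>k\<close>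
  legs having trace \<open>n ^ k\<close>.\<close>

definition \<beta> :: complex where "\<beta> = of_real n ^ k - \<epsilon>"

lemma t_commute:
  assumes "a \<in> SA k r" "b \<in> SA k r" shows "t r (a * b) = t r (b * a)"
proof -
  have "loops (legs k r) (ap (g + h)) = loops (legs k r) (ap (h + g))" if "g \<in> keys a" "h \<in> keys b" for g h
    unfolding ap_plus by (rule loops_comp_commute) (use that assms stab_bij in \<open>auto simp: SA_def\<close>)
  then show ?thesis unfolding t_def lin_mult by (subst sum.swap) (auto intro!: sum.cong simp: mult_ac)
qed

lemma loops_stab_emb:
  assumes g: "g \<in> stab k r" and p: "p permutes {..<k}"
  shows "loops (legs k (Suc r)) (ap (g + emb r p)) = loops (legs k r) (ap g) + loops (legs k 1) (ap (emb 0 p))"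
proof -
  note em = ap_emb[OF permutes_bij[OF p]]
  let ?R = "{r} \<times> {..<k}"
  have pk: "p x < k \<longleftrightarrow> x < k" for x using permutes_in_image[OF p, of x] by simp
  have ps: "\<exists>x'<k. x = p x'" if "x < k" for x using permutes_image[OF p] \<open>x < k\<close> by blast
  have bp: "bij_betw (ap (emb i p)) ({i} \<times> {..<k}) ({i} \<times> {..<k})" for i
  proof (rule bij_betw_imageI)
    show "inj_on (ap (emb i p)) ({i} \<times> {..<k})" using bij_ap by (metis bij_is_inj inj_on_subset subset_UNIV)
    show "ap (emb i p) ` ({i} \<times> {..<k}) = {i} \<times> {..<k}"
      using ps pk by (force simp: em image_iff)
  qed
  have e1: "ap (g + emb r p) l = ap g l" if "l \<in> legs k r" for l
    using that by (cases l) (auto simp: ap_plus em)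
  have e2: "ap (g + emb r p) l = ap (emb r p) l" if "l \<in> ?R" for l
    using that stab_fix[OF g] by (auto simp: ap_plus em)
  have b1: "bij_betw (ap (g + emb r p)) (legs k r) (legs k r)"
    using stab_bij[OF g] e1 by (simp cong: bij_betw_cong)
  have b2: "bij_betw (ap (g + emb r p)) ?R ?R"
    using bp[of r] bij_betw_cong[of ?R "ap (g + emb r p)" "ap (emb r p)" ?R] e2 by blast
  have "loops (legs k (Suc r)) (ap (g + emb r p)) = loops (legs k r) (ap (g + emb r p)) + loops ?R (ap (g + emb r p))"
    unfolding legs_Suc by (rule loops_union) (use b1 b2 in \<open>auto simp: legs_def\<close>)
  also have "loops (legs k r) (ap (g + emb r p)) = loops (legs k r) (ap g)"
    by (rule loops_cong) (use b1 e1 in auto)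
  also have "loops ?R (ap (g + emb r p)) = loops ?R (ap (emb r p))"
    by (rule loops_cong) (use b2 e2 in auto)
  also have "\<dots> = loops (legs k 1) (ap (emb 0 p))"
  proof (rule loops_relabel[where \<beta> = "\<lambda>(b, x). (0, x)"])
    have l1: "legs k 1 = {0} \<times> {..<k}" by (auto simp: legs_def)
    show "bij_betw (ap (emb 0 p)) (legs k 1) (legs k 1)" unfolding l1 by (rule bp)
    show "bij_betw (\<lambda>(b, x). (0, x)) ?R (legs k 1)"
      by (rule bij_betw_byWitness[where f' = "\<lambda>(b, x). (r, x)"]) auto
  qed (use bp in \<open>auto simp: em\<close>)
  finally show ?thesis .
qed

text \<open>A factor in a fresh block closes up by itself, so the numbers of cycles add and the
  traces multiply.\<close>

lemma t_Suc_e: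
  assumes a: "a \<in> SA k r" shows "t (Suc r) (a * e r) = t r a * \<epsilon>"
proof -
  have "a * e r = (\<Sum>g\<in>keys a. \<Sum>p | p permutes {..<k}. single (g + emb r p) (lookup a g * \<alpha> p))"
    unfolding E_def by (subst poly_mapping_expand[of a]) (simp add: sum_product mult_single)
  then have "t (Suc r) (a * e r) = (\<Sum>g\<in>keys a. \<Sum>p | p permutes {..<k}.
      lookup a g * \<alpha> p * of_real n ^ loops (legs k (Suc r)) (ap (g + emb r p)))"
    by (simp add: t_def lin_sum)
  also have "\<dots> = (\<Sum>g\<in>keys a. \<Sum>p | p permutes {..<k}. (lookup a g * of_real n ^ loops (legs k r) (ap g)) *
      (\<alpha> p * of_real n ^ loops (legs k 1) (ap (emb 0 p))))"
    using a by (intro sum.cong refl) (subst loops_stab_emb, auto simp: SA_def power_add)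
  finally show ?thesis by (simp add: t_def lin_def \<epsilon>_def sum_product)
qed

lemma t_Suc:
  assumes a: "a \<in> SA k r" shows "t (Suc r) a = t r a * of_real n ^ k"
proof -
  have idp: "id permutes {..<k}" by (rule permutes_id)
  have e0: "emb r id = 0" "emb 0 id = 0" by (rule gp_eqI, auto simp: ap_emb ap_zero)+
  have "card (legs k 1) = k" by (simp add: legs_def)
  then have "loops (legs k (Suc r)) (ap g) = loops (legs k r) (ap g) + k" if "g \<in> keys a" for g
    using loops_stab_emb[of g r id] that a idp loops_id[OF finite_legs, of k 1] by (auto simp: e0 ap_zero SA_def)
  then show ?thesis unfolding t_def lin_def sum_distrib_right
    by (intro sum.cong refl) (auto simp: power_add mult_ac)
qed

lemma t_Suc_one_minus_e:
  assumes a: "a \<in> SA k r" shows "t (Suc r) (a * (1 - e r)) = t r a * \<beta>"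
proof -
  have "t (Suc r) (a * (1 - e r)) = t (Suc r) a - t (Suc r) (a * e r)"
    by (simp add: t_def right_diff_distrib lin_diff)
  then show ?thesis using t_Suc[OF a] t_Suc_e[OF a] by (simp add: \<beta>_def algebra_simps)
qed

lemma t_zz: "t r (zz r) = \<beta> ^ r"
proof (induction r)
  case 0
  have "loops (legs k 0) (ap 0) = 0" using loops_id[OF finite_legs, of k 0] by (simp add: ap_zero legs_def)
  then show ?case by (simp add: t_def lin_def)
qed (simp add: t_Suc_one_minus_e[OF zz_SA])

text \<open>A partial trace: summing out the fresh block turns the transposition with it into the
  identity. The cyclic property first brings the transposition to the right end, where
  \<open>loops_swap\<close> applies.\<close>

lemma t_swap:
  assumes a: "a \<in> SA k r" and b: "b \<in> SA k r" and j: "j < r"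
  shows "t (Suc r) (a * B (Transposition.transpose j r) * b) = t r (a * b)"
proof -
  let ?s = "blk (Transposition.transpose j r)"
  have s: "?s \<in> stab k (Suc r)" by (rule blk_stab) (use j in \<open>auto intro: permutes_swap_id\<close>)
  have aps: "ap ?s = (\<lambda>(b, x). (Transposition.transpose j r b, x))" by (auto simp: ap_blk)
  have "loops (legs k (Suc r)) (ap (g + ?s + h)) = loops (legs k r) (ap (g + h))"
    if g: "g \<in> stab k r" and h: "h \<in> stab k r" for g h
  proof -
    have gs: "g \<in> stab k (Suc r)" "h \<in> stab k (Suc r)" using g h stab_mono[of r "Suc r" k] by auto
    have "loops (legs k (Suc r)) (ap (g + ?s) \<circ> ap h) = loops (legs k (Suc r)) (ap h \<circ> ap (g + ?s))"
      by (rule loops_comp_commute) (use gs s in \<open>auto intro!: stab_bij stab_plus\<close>)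
    also have "ap h \<circ> ap (g + ?s) = ap (h + g) \<circ> ap ?s" by (simp add: ap_plus comp_assoc)
    also have "loops (legs k (Suc r)) (ap (h + g) \<circ> ap ?s) = loops (legs k r) (ap (h + g))"
      unfolding aps
      by (rule loops_swap[OF _ _ j]) (use stab_plus[OF h g] in \<open>auto intro: stab_bij stab_fix\<close>)
    also have "\<dots> = loops (legs k r) (ap (g + h))"
      unfolding ap_plus by (rule loops_comp_commute) (use g h stab_bij in auto)
    finally show ?thesis by (simp only: ap_plus)
  qed
  then have "loops (legs k (Suc r)) (ap (g + ?s + h)) = loops (legs k r) (ap (g + h))"
    if "g \<in> keys a" "h \<in> keys b" for g h using that a b by (auto simp: SA_def)
  then show ?thesis unfolding t_def lin_mult_mult lin_mult[of _ a b] B_def by simp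
qed

text \<open>Induction on \<open>r\<close>: a permutation of \<open>r + 1\<close> blocks either fixes the last block, which gives a factor
  \<open>\<beta>\<close>, or is the product of a transposition with the last block and a permutation of the others.\<close>

lemma zz_B_norm:
  "(\<Sum>\<gamma> | \<gamma> permutes {..<r}. (cmod (t r (zz r * B \<gamma>)))\<^sup>2) = (\<Prod>i<r. (cmod \<beta>)\<^sup>2 + real i)"
proof (induction r)
  case 0
  have "{\<gamma>. \<gamma> permutes {..<0::nat}} = {id}" by auto
  then show ?case using t_zz[of 0] by (simp add: B_id[unfolded id_def])
next
  case (Suc r)
  let ?S = "{\<gamma>. \<gamma> permutes {..<r}}"
  have ins: "{..<Suc r} = insert r {..<r}" by auto
  have bij: "bij_betw (\<lambda>(b, p). Transposition.transpose r b \<circ> p) (insert r {..<r} \<times> ?S) {\<gamma>. \<gamma> permutes {..<Suc r}}"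
  proof (rule bij_betw_imageI)
    show "(\<lambda>(b, p). Transposition.transpose r b \<circ> p) ` (insert r {..<r} \<times> ?S) = {\<gamma>. \<gamma> permutes {..<Suc r}}"
      unfolding ins permutes_insert by auto
    show "inj_on (\<lambda>(b, p). Transposition.transpose r b \<circ> p) (insert r {..<r} \<times> ?S)"
    proof (rule inj_onI, clarify)
      fix b p c q assume p: "p permutes {..<r}" and q: "q permutes {..<r}"
        and eq: "Transposition.transpose r b \<circ> p = Transposition.transpose r c \<circ> q"
      have "p r = r" "q r = r" using permutes_not_in[OF p] permutes_not_in[OF q] by auto
      then have bc: "b = c" using fun_cong[OF eq, of r] by simp
      have "Transposition.transpose r b \<circ> (Transposition.transpose r b \<circ> p) = Transposition.transpose r b \<circ> (Transposition.transpose r b \<circ> q)"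
        using eq bc by simp
      then show "b = c \<and> p = q" using bc by (simp add: fun_eq_iff)
    qed
  qed
  have v1: "t (Suc r) (zz (Suc r) * B p) = \<beta> * t r (zz r * B p)" if p: "p permutes {..<r}" for p
  proof -
    have pr: "p r = r" using permutes_not_in[OF p] by simp
    have "zz (Suc r) * B p = zz r * B p * (1 - e r)"
      using B_E[OF permutes_bij[OF p], of k \<alpha> r] by (simp add: algebra_simps pr)
    then show ?thesis
      using t_Suc_one_minus_e[OF SA_mult[OF zz_SA B_SA[OF p]]] by simp
  qed
  \<comment> \<open>The factor \<open>1 - e r\<close> passes the transposition as
    \<open>1 - e j\<close>. Once the trace has removed the transposition, \<open>zz r\<close>
    absorbs it, since \<open>zz r\<close> annihilates \<open>e j\<close>.\<close>
  have v2: "t (Suc r) (zz (Suc r) * B (Transposition.transpose r j \<circ> p)) = t r (zz r * B p)"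
    if p: "p permutes {..<r}" and j: "j < r" for p j
  proof -
    let ?s = "Transposition.transpose j r"
    have s: "bij ?s" by simp
    have "B (Transposition.transpose r j \<circ> p) = B ?s * B p"
      using B_mult[OF s permutes_bij[OF p]] by (simp add: transpose_commute)
    moreover have "(1 - e r) * B ?s = B ?s * (1 - e j)"
      using B_E[OF s, of k \<alpha> j] by (simp add: algebra_simps)
    ultimately have "zz (Suc r) * B (Transposition.transpose r j \<circ> p) = zz r * B ?s * ((1 - e j) * B p)"
      by (simp add: mult.assoc[symmetric]) (simp add: mult.assoc)
    then have "t (Suc r) (zz (Suc r) * B (Transposition.transpose r j \<circ> p)) = t r (zz r * ((1 - e j) * B p))"
      using t_swap[OF zz_SA SA_mult[OF SA_diff[OF SA_one E_SA[OF j]] B_SA[OF p]] j] by simp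
    also have "zz r * ((1 - e j) * B p) = zz r * B p" using zz_e[OF j]
      by (simp add: mult.assoc[symmetric] right_diff_distrib)
    finally show ?thesis .
  qed
  have "(\<Sum>\<gamma> | \<gamma> permutes {..<Suc r}. (cmod (t (Suc r) (zz (Suc r) * B \<gamma>)))\<^sup>2) =
      (\<Sum>(b, p)\<in>insert r {..<r} \<times> ?S. (cmod (t (Suc r) (zz (Suc r) * B (Transposition.transpose r b \<circ> p))))\<^sup>2)"
    by (subst sum.reindex_bij_betw[OF bij, symmetric]) (simp add: case_prod_beta)
  also have "\<dots> = (\<Sum>b\<in>insert r {..<r}. \<Sum>p\<in>?S. (cmod (t (Suc r) (zz (Suc r) * B (Transposition.transpose r b \<circ> p))))\<^sup>2)"
    by (rule sum.cartesian_product[symmetric])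
  also have "\<dots> = (\<Sum>p\<in>?S. (cmod (t (Suc r) (zz (Suc r) * B p)))\<^sup>2) +
      (\<Sum>b<r. \<Sum>p\<in>?S. (cmod (t (Suc r) (zz (Suc r) * B (Transposition.transpose r b \<circ> p))))\<^sup>2)"
    by (subst sum.insert) auto
  also have "(\<Sum>p\<in>?S. (cmod (t (Suc r) (zz (Suc r) * B p)))\<^sup>2) = (cmod \<beta>)\<^sup>2 * (\<Sum>p\<in>?S. (cmod (t r (zz r * B p)))\<^sup>2)"
    by (simp add: v1 norm_mult power_mult_distrib sum_distrib_left del: zz.simps)
  also have "(\<Sum>b<r. \<Sum>p\<in>?S. (cmod (t (Suc r) (zz (Suc r) * B (Transposition.transpose r b \<circ> p))))\<^sup>2) =
      real r * (\<Sum>p\<in>?S. (cmod (t r (zz r * B p)))\<^sup>2)"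
    by (simp add: v2 del: zz.simps)
  finally show ?case unfolding Suc.IH by (simp add: algebra_simps)
qed

end

section \<open>Growth estimates\<close>

text \<open>Taking the root \<open>s\<close> of order \<open>Suc c\<close> reduces the polynomial
  bound to \<open>s ^ m \<le> m + 1\<close>. Squaring Bernoulli's inequality gives quadratic growth
  of \<open>s ^ (2 * j)\<close>, which contradicts this linear bound.\<close>

lemma subexponential_bound:
  fixes x :: real
  assumes "\<And>m. x ^ m \<le> real (m + 1) ^ c"
  shows "x \<le> 1"
proof (rule ccontr)
  assume "\<not> x \<le> 1"
  then have x: "x > 1" by simp
  define s where "s = root (Suc c) x"
  have s1: "s > 1" using x by (simp add: s_def)
  have sc: "s ^ Suc c = x" unfolding s_def by (rule real_root_pow_pos2) (use x in auto)
  have sm: "s ^ m \<le> real (m + 1)" for m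
  proof (rule power_le_imp_le_base)
    have "(s ^ m) ^ Suc c = x ^ m" by (metis sc power_mult mult.commute)
    also have "\<dots> \<le> real (m + 1) ^ c" by (rule assms)
    also have "\<dots> \<le> real (m + 1) ^ Suc c" by (rule power_increasing) auto
    finally show "(s ^ m) ^ Suc c \<le> real (m + 1) ^ Suc c" .
  qed simp
  define d where "d = s - 1"
  have d: "d > 0" using s1 by (simp add: d_def)
  \<comment> \<open>With this \<open>j\<close> the quadratic term of the square of
    \<open>1 + j d\<close> alone exceeds \<open>2 * j\<close>.\<close>
  obtain j :: nat where j: "real j > 2 / d\<^sup>2" using reals_Archimedean2 by blast
  have jd: "real j * d\<^sup>2 > 2" using j d by (simp add: field_simps)
  have "1 + real j * d \<le> s ^ j" using Bernoulli_inequality[of d j] d by (simp add: d_def)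
  then have "(1 + real j * d)\<^sup>2 \<le> (s ^ j)\<^sup>2" using d by (intro power_mono) auto
  also have "\<dots> = s ^ (2 * j)" by (simp add: power_mult[symmetric] mult.commute)
  also have "\<dots> \<le> 2 * real j + 1" using sm[of "2 * j"] by simp
  finally have "2 * real j * d + real j * (real j * d\<^sup>2) \<le> 2 * real j" by (simp add: power2_eq_square algebra_simps)
  moreover have "j > 0" using j d by (intro gr0I) (auto simp: field_simps)
  moreover have "real j * (real j * d\<^sup>2) > real j * 2" using jd \<open>j > 0\<close> by (intro mult_strict_left_mono) auto
  moreover have "2 * real j * d \<ge> 0" using d by simp
  ultimately show False by linarith
qed

text \<open>A rising factorial exceeds \<open>r!\<close> by a polynomial factor only: the quotient
  \<open>(a + r) / (r + 1)\<close> of successive steps is at most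
  \<open>((r + 2) / (r + 1)) ^ a\<close> by Bernoulli's inequality, and these bounds
  telescope.\<close>

lemma shifted_factorial_bound:
  fixes x :: real
  assumes "0 \<le> x" "x \<le> real a"
  shows "(\<Prod>i<r. x + real i) \<le> fact r * real (r + 1) ^ a"
proof (induction r)
  case (Suc r)
  have "real (r + 1) ^ a * (real a + real r) \<le> real (r + 1) * real (r + 2) ^ a"
  proof -
    have "1 + real a * (1 / real (r + 1)) \<le> (1 + 1 / real (r + 1)) ^ a"
      using Bernoulli_inequality[of "1 / real (r + 1)" a] by (simp add: field_simps)
    also have "1 + 1 / real (r + 1) = real (r + 2) / real (r + 1)" by (simp add: field_simps)
    finally have b: "1 + real a / real (r + 1) \<le> real (r + 2) ^ a / real (r + 1) ^ a"
      by (simp add: power_divide)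
    have "real (r + 1) ^ a * (real a + real r) \<le> real (r + 1) ^ a * (real (r + 1) * (1 + real a / real (r + 1)))"
      by (intro mult_left_mono) (auto simp: field_simps)
    also have "\<dots> \<le> real (r + 1) ^ a * (real (r + 1) * (real (r + 2) ^ a / real (r + 1) ^ a))"
      by (intro mult_left_mono b) auto
    also have "\<dots> = real (r + 1) * real (r + 2) ^ a" by simp
    finally show ?thesis .
  qed
  then have s: "fact r * (real (r + 1) ^ a * (real a + real r)) \<le> fact r * (real (r + 1) * real (r + 2) ^ a)"
    by (intro mult_left_mono) auto
  have "(\<Prod>i<Suc r. x + real i) = (\<Prod>i<r. x + real i) * (x + real r)" by simp
  also have "\<dots> \<le> (fact r * real (r + 1) ^ a) * (real a + real r)"
    using Suc.IH assms by (intro mult_mono) auto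
  also have "\<dots> \<le> fact (Suc r) * real (Suc r + 1) ^ a"
    using s by (simp add: mult_ac fact_Suc del: of_nat_Suc)
  finally show ?case .
qed simp

text \<open>The factorials cancel up to a polynomial in \<open>m\<close> of fixed degree, so for
  large \<open>m\<close> only the bases are compared. The case \<open>N = 0\<close> is separate
  because the quotient \<open>b / N\<close> is formed.\<close>

lemma growth_bound:
  fixes N b :: real
  assumes N: "N \<ge> 0" and b: "b \<ge> 0"
    and g: "\<And>m. fact m * b ^ (2 * m) \<le> N ^ (2 * m) * (\<Prod>i<m. b\<^sup>2 + real i)"
  shows "b \<le> N"
proof (rule ccontr)
  assume bN: "\<not> b \<le> N"
  define a where "a = nat \<lceil>b\<^sup>2\<rceil>"
  have a: "b\<^sup>2 \<le> real a" unfolding a_def by linarith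
  have le: "b ^ (2 * m) \<le> N ^ (2 * m) * real (m + 1) ^ a" for m
  proof -
    have "fact m * b ^ (2 * m) \<le> N ^ (2 * m) * (fact m * real (m + 1) ^ a)"
      using g[of m] shifted_factorial_bound[OF _ a, of m] N
      by (intro order.trans[OF g] mult_left_mono) auto
    then have "fact m * b ^ (2 * m) \<le> fact m * (N ^ (2 * m) * real (m + 1) ^ a)"
      by (simp only: mult_ac)
    then show ?thesis by (rule mult_left_le_imp_le) simp
  qed
  show False
  proof (cases "N = 0")
    case True
    then show ?thesis using le[of 1] bN by simp
  next
    case False
    then have N0: "N > 0" using N by simp
    have "((b / N)\<^sup>2) ^ m \<le> real (m + 1) ^ a" for m
    proof -
      have "((b / N)\<^sup>2) ^ m = b ^ (2 * m) / N ^ (2 * m)" by (simp add: power_mult[symmetric] power_divide)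
      also have "\<dots> \<le> real (m + 1) ^ a"
        using le[of m] N0 by (subst pos_divide_le_eq) (auto simp: mult_ac)
      finally show ?thesis .
    qed
    then have "(b / N)\<^sup>2 \<le> 1" by (rule subexponential_bound)
    then have "b / N \<le> 1" using power2_le_imp_le[of "b / N" 1] by simp
    then show False using bN N0 by simp
  qed
qed

text \<open>Among the \<open>m + 1\<close> terms of the expansion of \<open>(b + 1) ^ m\<close> some
  term is at least the average. For its index \<open>r\<close> the left side of the hypothesis is
  \<open>fact r\<close> times the square of that term, so \<open>(b + 1) ^ (2 * m)\<close> is
  bounded by \<open>N ^ (2 * m)\<close> up to a polynomial.\<close>

lemma growth_bound_binomial:
  fixes N b :: real
  assumes N: "N \<ge> 0" and b: "b \<ge> 0"
    and g: "\<And>m r. r \<le> m \<Longrightarrow> (real (m choose r))\<^sup>2 * fact r * b ^ (2 * r) \<le> N ^ (2 * m) * (\<Prod>i<r. b\<^sup>2 + real i)"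
  shows "b + 1 \<le> N"
proof (rule ccontr)
  assume bN: "\<not> b + 1 \<le> N"
  define a where "a = nat \<lceil>b\<^sup>2\<rceil>"
  have a: "b\<^sup>2 \<le> real a" unfolding a_def by linarith
  \<comment> \<open>The exponent is \<open>a\<close> from the rising factorial, plus 2 from squaring
    the factor \<open>m + 1\<close> lost in the choice of one term.\<close>
  have le: "(b + 1) ^ (2 * m) \<le> N ^ (2 * m) * real (m + 1) ^ (a + 2)" for m
  proof -
    obtain r where r: "r \<le> m" "(b + 1) ^ m \<le> real (m + 1) * (real (m choose r) * b ^ r)"
    proof (rule ccontr)
      note ex = that
      assume "\<not> thesis"
      then have lt: "real (m choose r) * b ^ r < (b + 1) ^ m / real (m + 1)" if "r \<le> m" for r
        using ex[of r] \<open>\<not> thesis\<close> \<open>r \<le> m\<close> by (force simp: field_simps not_le)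
      have "(b + 1) ^ m = (\<Sum>r\<le>m. real (m choose r) * b ^ r)"
        by (subst binomial_ring) simp
      also have "\<dots> < (\<Sum>r\<le>m. (b + 1) ^ m / real (m + 1))"
        by (rule sum_strict_mono) (use lt in auto)
      also have "\<dots> = (b + 1) ^ m" by simp
      finally show False by simp
    qed
    let ?c = "real (m choose r) * b ^ r"
    have "fact r * ?c\<^sup>2 = (real (m choose r))\<^sup>2 * fact r * b ^ (2 * r)"
      by (simp add: power_mult_distrib power_mult[symmetric] mult_ac)
    also have "\<dots> \<le> N ^ (2 * m) * (\<Prod>i<r. b\<^sup>2 + real i)" by (rule g[OF r(1)])
    also have "\<dots> \<le> N ^ (2 * m) * (fact r * real (r + 1) ^ a)"
      using shifted_factorial_bound[OF _ a, of r] N by (intro mult_left_mono) auto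
    finally have "fact r * ?c\<^sup>2 \<le> fact r * (N ^ (2 * m) * real (r + 1) ^ a)" by (simp only: mult_ac)
    then have c: "?c\<^sup>2 \<le> N ^ (2 * m) * real (r + 1) ^ a" by (rule mult_left_le_imp_le) simp
    have "(b + 1) ^ (2 * m) = ((b + 1) ^ m)\<^sup>2" by (simp add: power_mult[symmetric] mult.commute)
    also have "\<dots> \<le> (real (m + 1) * ?c)\<^sup>2" using r(2) b by (intro power_mono) auto
    also have "\<dots> = (real (m + 1))\<^sup>2 * ?c\<^sup>2" by (rule power_mult_distrib)
    also have "\<dots> \<le> (real (m + 1))\<^sup>2 * (N ^ (2 * m) * real (r + 1) ^ a)" by (intro mult_left_mono c) auto
    also have "\<dots> \<le> (real (m + 1))\<^sup>2 * (N ^ (2 * m) * real (m + 1) ^ a)"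
      using r(1) N by (intro mult_left_mono power_mono) auto
    finally show ?thesis by (simp only: power_add mult_ac)
  qed
  show False
  proof (cases "N = 0")
    case True
    then show ?thesis using le[of 1] bN b by simp
  next
    case False
    then have N0: "N > 0" using N by simp
    have "(((b + 1) / N)\<^sup>2) ^ m \<le> real (m + 1) ^ (a + 2)" for m
    proof -
      have "(((b + 1) / N)\<^sup>2) ^ m = (b + 1) ^ (2 * m) / N ^ (2 * m)" by (simp add: power_mult[symmetric] power_divide)
      also have "\<dots> \<le> real (m + 1) ^ (a + 2)"
        using le[of m] N0 by (subst pos_divide_le_eq) (auto simp: mult_ac)
      finally show ?thesis .
    qed
    then have "((b + 1) / N)\<^sup>2 \<le> 1" by (rule subexponential_bound)
    then have "(b + 1) / N \<le> 1" using power2_le_imp_le[of "(b + 1) / N" 1] by simp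
    then show False using bN N0 by simp
  qed
qed

section \<open>Auxiliary facts for the test matrix\<close>

lemma lin_mult_mult_superset:
  fixes a b c :: "'g::monoid_add \<Rightarrow>\<^sub>0 complex"
  assumes "finite A" "keys a \<subseteq> A" "finite B'" "keys b \<subseteq> B'" "finite C" "keys c \<subseteq> C"
  shows "lin \<phi> (a * b * c) = (\<Sum>g\<in>A. \<Sum>h\<in>B'. \<Sum>i\<in>C. lookup a g * lookup b h * lookup c i * \<phi> (g + h + i))"
proof -
  have z: "lookup x g = 0" if "g \<notin> keys x" for g and x :: "'g \<Rightarrow>\<^sub>0 complex" using that by (simp add: in_keys_iff)
  have 1: "(\<Sum>i\<in>keys c. lookup a g * lookup b h * lookup c i * \<phi> (g + h + i)) =
      (\<Sum>i\<in>C. lookup a g * lookup b h * lookup c i * \<phi> (g + h + i))" for g h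
    by (rule sum.mono_neutral_left) (use assms z in auto)
  have 2: "(\<Sum>h\<in>keys b. \<Sum>i\<in>C. lookup a g * lookup b h * lookup c i * \<phi> (g + h + i)) =
      (\<Sum>h\<in>B'. \<Sum>i\<in>C. lookup a g * lookup b h * lookup c i * \<phi> (g + h + i))" for g
    by (rule sum.mono_neutral_left) (use assms z in auto)
  show ?thesis unfolding lin_mult_mult 1 2
    by (rule sum.mono_neutral_left) (use assms z in auto)
qed

lemma ex_permutes_image:
  assumes S: "S \<subseteq> {..<m}" "card S = r" and r: "r \<le> m"
  shows "\<exists>p. p permutes {..<m} \<and> p ` {..<r} = S"
proof -
  have fS: "finite S" using S finite_subset by blast
  obtain g where g: "bij_betw g {..<r} S" using finite_same_card_bij[of "{..<r}" S] S fS by auto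
  have "card ({..<m} - S) = card {r..<m}" using S fS by (simp add: card_Diff_subset)
  then obtain h where h: "bij_betw h {r..<m} ({..<m} - S)"
    using finite_same_card_bij[of "{r..<m}" "{..<m} - S"] by auto
  define p where "p x = (if x < r then g x else if x < m then h x else x)" for x
  have pg: "bij_betw p {..<r} S" using g bij_betw_cong[of "{..<r}" p g S] by (simp add: p_def)
  have ph: "bij_betw p {r..<m} ({..<m} - S)" using h bij_betw_cong[of "{r..<m}" p h "{..<m} - S"] by (simp add: p_def)
  have "bij_betw p ({..<r} \<union> {r..<m}) (S \<union> ({..<m} - S))" by (rule bij_betw_combine[OF pg ph]) auto
  moreover have "{..<r} \<union> {r..<m} = {..<m}" "S \<union> ({..<m} - S) = {..<m}" using S r by auto
  ultimately have "p permutes {..<m}" by (intro bij_imp_permutes) (use r in \<open>auto simp: p_def\<close>)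
  then show ?thesis using pg by (auto simp: bij_betw_def)
qed

lemma stab_inv_bij: "g \<in> stab k m \<Longrightarrow> bij_betw (inv (ap g)) (legs k m) (legs k m)"
proof -
  assume g: "g \<in> stab k m"
  have "inv (ap g) ` legs k m = inv (ap g) ` (ap g ` legs k m)" using g by (simp add: stab_def)
  also have "\<dots> = legs k m" using bij_ap[of g] by (simp add: image_image bij_is_inj)
  finally show ?thesis using bij_imp_bij_inv[OF bij_ap[of g]]
    by (auto simp: bij_betw_def bij_def intro: inj_on_subset)
qed

section \<open>Idempotents of nonpositive trace\<close>

text \<open>The additional data describe a graph without vertexless loops whose edges are cut in the
  middle: the half-edge \<open>x\<close> hangs at the vertex \<open>v0 x\<close> and is one of the
  two halves of the edge \<open>\<epsilon>0 x\<close>.\<close>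

locale block_system = rank_bounded f n + idempotent k \<alpha> n for f n k \<alpha> +
  fixes v0 :: "nat \<Rightarrow> nat" and V0 :: "nat set" and \<epsilon>0 :: "nat \<Rightarrow> nat" and E0 :: "nat set"
  assumes fin0: "finite V0" "finite E0" and v0: "v0 ` {..<k} \<subseteq> V0" and \<epsilon>0: "\<epsilon>0 ` {..<k} \<subseteq> E0"
    and two: "\<And>h. h \<in> E0 \<Longrightarrow> card {x\<in>{..<k}. \<epsilon>0 x = h} = 2"
begin

text \<open>The blocks below \<open>r\<close> consist of bare strands, each of the blocks \<open>r, \<dots>, m - 1\<close> carries a copy of the graph.\<close>

definition HS :: "nat \<Rightarrow> nat \<Rightarrow> lsys" where
  "HS r m = LSys (legs k m) ({r..<m} \<times> {..<k}) ({r..<m} \<times> V0) (\<lambda>(i, x). (i, v0 x)) ({r..<m} \<times> E0) (\<lambda>(i, x). (i, \<epsilon>0 x))"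

definition SG :: "(nat \<Rightarrow> nat) \<Rightarrow> (nat, nat) multigraph" where
  "SG p = Multigraph V0 E0 (\<lambda>h. image_mset (\<lambda>x. v0 (p x)) (mset_set {x\<in>{..<k}. \<epsilon>0 x = h}))"

definition \<phi> :: "nat \<Rightarrow> nat \<Rightarrow> gp \<Rightarrow> complex" where
  "\<phi> r m g = f (graph_of (clo (HS r m) (ap g)))"

text \<open>The linear extension of \<open>f\<close> at the graph with the idempotent inserted
  between the vertex ends and the edge ends of its half-edges.\<close>

definition q :: complex where
  "q = (\<Sum>p | p permutes {..<k}. \<alpha> p * f (graph_of (SG p)))"

lemma two': "h \<in> E0 \<Longrightarrow> card {l \<in> I \<times> {..<k}. (case l of (i, x) \<Rightarrow> (i, \<epsilon>0 x)) = (i0, h)} = 2" if "i0 \<in> I"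
proof -
  assume h: "h \<in> E0"
  have "{l \<in> I \<times> {..<k}. (case l of (i, x) \<Rightarrow> (i, \<epsilon>0 x)) = (i0, h)} = Pair i0 ` {x\<in>{..<k}. \<epsilon>0 x = h}"
    using that by auto
  then show ?thesis using two[OF h] by (simp add: card_image inj_on_def)
qed

lemma wf_HS: "wf_sys (HS r m)"
  unfolding wf_sys_def HS_def lsys.sel
proof (intro conjI ballI)
  fix h assume "h \<in> {r..<m} \<times> E0"
  then obtain i0 h0 where h: "h = (i0, h0)" "i0 \<in> {r..<m}" "h0 \<in> E0" by (elim SigmaE)
  show "card {l \<in> {r..<m} \<times> {..<k}. (case l of (i, x) \<Rightarrow> (i, \<epsilon>0 x)) = h} = 2"
    unfolding h(1) by (rule two'[OF h(2,3)])
qed (use fin0 v0 \<epsilon>0 in \<open>auto simp: legs_def\<close>)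

lemma \<phi>_strands:
  assumes g: "g \<in> stab k r" shows "\<phi> r r g = of_real n ^ loops (legs k r) (ap g)"
proof -
  let ?\<sigma> = "ap g" and ?S = "Inp ` legs k r \<union> Out ` legs k r"
  have b: "bij_betw ?\<sigma> (legs k r) (legs k r)" by (rule stab_bij[OF g])
  have lg: "lg (HS r r) = legs k r" by (simp add: HS_def)
  have w: "wf_multigraph (pre (HS r r) ?\<sigma>)" by (rule wf_pre[OF wf_HS]) (use b in \<open>simp add: lg bij_betw_def\<close>)
  have "isomorphic (dissolve ?S (pre (HS r r) ?\<sigma>)) (dissolve (id ` ?S) (pre (strands (legs k r)) ?\<sigma>))"
    by (rule dissolve_isomorphic[OF w, where \<beta> = id]) (auto simp: HS_def)
  then have "isomorphic (clo (HS r r) ?\<sigma>) (clo (strands (legs k r)) ?\<sigma>)" by (simp add: clo_def lg)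
  moreover have "wf_multigraph (clo (HS r r) ?\<sigma>)" by (rule wf_clo[OF wf_HS]) (simp add: lg b)
  ultimately have "graph_of (clo (HS r r) ?\<sigma>) = graph_of (clo (strands (legs k r)) ?\<sigma>)" by (intro graph_of_cong)
  then show ?thesis unfolding \<phi>_def using f_strands[OF finite_legs b] by simp
qed

text \<open>The closing permutation preserves the last block, so this copy of the graph splits off
  as a disjoint part and \<open>f\<close> is multiplicative. Projection to the second component,
  which forgets the block number, identifies it with \<open>SG p\<close>.\<close>

lemma \<phi>_Suc:
  assumes g: "g \<in> stab k m" and p: "p permutes {..<k}" and r: "r \<le> m"
  shows "\<phi> r (Suc m) (g + emb m p) = \<phi> r m g * f (graph_of (SG p))"
proof -
  note em = ap_emb[OF permutes_bij[OF p]]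
  let ?\<sigma> = "ap (g + emb m p)"
  let ?R = "{m} \<times> {..<k}"
  let ?vm = "\<lambda>(i, x). (i, v0 x)" and ?em = "\<lambda>(i, x). (i, \<epsilon>0 x)"
  define Y where "Y = LSys ?R ?R ({m} \<times> V0) ?vm ({m} \<times> E0) ?em"
  have lgH: "lg (HS r m) = legs k m" by (simp add: HS_def)
  have wY: "wf_sys Y"
    unfolding wf_sys_def Y_def lsys.sel
  proof (intro conjI ballI)
    fix h assume "h \<in> {m} \<times> E0"
    then obtain i0 h0 where h: "h = (i0, h0)" "i0 \<in> {m}" "h0 \<in> E0" by (elim SigmaE)
    show "card {l \<in> ?R. (case l of (i, x) \<Rightarrow> (i, \<epsilon>0 x)) = h} = 2"
      unfolding h(1) by (rule two'[OF h(2,3)])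
  qed (use fin0 v0 \<epsilon>0 in auto)
  have pk: "p x < k \<longleftrightarrow> x < k" for x using permutes_in_image[OF p, of x] by simp
  have ps: "\<exists>x'<k. x = p x'" if "x < k" for x using permutes_image[OF p] \<open>x < k\<close> by blast
  have e1: "?\<sigma> l = ap g l" if "l \<in> legs k m" for l
    using that by (cases l) (auto simp: ap_plus em)
  have e2: "?\<sigma> (m, x) = (m, p x)" for x
    using stab_fix[OF g, of m] by (simp add: ap_plus em)
  have b1: "bij_betw ?\<sigma> (legs k m) (legs k m)"
    using stab_bij[OF g] bij_betw_cong[of "legs k m" ?\<sigma> "ap g"] e1 by blast
  have b2: "bij_betw ?\<sigma> ?R ?R"
  proof (rule bij_betw_imageI)
    show "inj_on ?\<sigma> ?R" using bij_ap by (metis bij_is_inj inj_on_subset subset_UNIV)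
    show "?\<sigma> ` ?R = ?R"
    proof (intro equalityI subsetI)
      fix l assume "l \<in> ?R"
      then obtain x where x: "x < k" "l = (m, x)" by auto
      then obtain x' where "x' < k" "x = p x'" using ps by blast
      then have "l = ?\<sigma> (m, x')" "(m, x') \<in> ?R" using x e2 by simp_all
      then show "l \<in> ?\<sigma> ` ?R" by (rule image_eqI)
    qed (use e2 pk in auto)
  qed
  have iso: "isomorphic (clo (HS r (Suc m)) ?\<sigma>) (disjoint_union (clo (HS r m) ?\<sigma>) (clo Y ?\<sigma>))"
  proof (rule clo_union[OF wf_HS wY])
    have A: "{r..<Suc m} = {r..<m} \<union> {m}" using r by auto
    show "HS r (Suc m) = LSys (lg (HS r m) \<union> lg Y) (hl (HS r m) \<union> hl Y) (vs (HS r m) \<union> vs Y) ?vm (es (HS r m) \<union> es Y) ?em"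
      by (simp only: HS_def Y_def lsys.sel legs_Suc A Sigma_Un_distrib1)
    show "bij_betw ?\<sigma> (lg (HS r m)) (lg (HS r m))" "bij_betw ?\<sigma> (lg Y) (lg Y)"
      using b1 b2 by (simp_all add: lgH Y_def)
  qed (auto simp: HS_def Y_def legs_def)
  have w1: "wf_multigraph (clo (HS r m) ?\<sigma>)" by (rule wf_clo[OF wf_HS]) (simp add: lgH b1)
  have w2: "wf_multigraph (clo Y ?\<sigma>)" by (rule wf_clo[OF wY]) (simp add: Y_def b2)
  have "bij_betw ?\<sigma> (legs k (Suc m)) (legs k (Suc m))"
    unfolding legs_Suc by (rule bij_betw_combine[OF b1 b2]) (auto simp: legs_def)
  then have "wf_multigraph (clo (HS r (Suc m)) ?\<sigma>)" by (intro wf_clo[OF wf_HS]) (simp add: HS_def)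
  then have "graph_of (clo (HS r (Suc m)) ?\<sigma>) = graph_of (disjoint_union (clo (HS r m) ?\<sigma>) (clo Y ?\<sigma>))"
    using iso by (rule graph_of_cong)
  then have "\<phi> r (Suc m) (g + emb m p) = f (graph_of (clo (HS r m) ?\<sigma>)) * f (graph_of (clo Y ?\<sigma>))"
    unfolding \<phi>_def using f_disjoint_union[OF w1 w2] by simp
  also have "graph_of (clo (HS r m) ?\<sigma>) = graph_of (clo (HS r m) (ap g))"
    by (rule clo_cong[OF _ wf_HS]) (use e1 b1 in \<open>auto simp: lgH\<close>)
  also have "graph_of (clo Y ?\<sigma>) = graph_of (SG p)"
  proof (rule graph_of_cong[OF w2], rule isomorphic_trans)
    show "isomorphic (clo Y ?\<sigma>) (star_graph Y ?\<sigma>)"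
      by (rule clo_star_graph[OF wY]) (use b2 in \<open>auto simp: Y_def\<close>)
    have "ends (SG p) (snd h) = image_mset snd (ends (star_graph Y ?\<sigma>) h)" if hE: "h \<in> edges (star_graph Y ?\<sigma>)" for h
    proof -
      obtain h0 where h: "h = (m, h0)" using hE by (auto simp: star_graph_def Y_def)
      have "{l \<in> ?R. (case l of (i, x) \<Rightarrow> (i, \<epsilon>0 x)) = h} = Pair m ` {x\<in>{..<k}. \<epsilon>0 x = h0}"
        unfolding h by auto
      then have "mset_set {l \<in> ?R. (case l of (i, x) \<Rightarrow> (i, \<epsilon>0 x)) = h} = image_mset (Pair m) (mset_set {x\<in>{..<k}. \<epsilon>0 x = h0})"
        by (simp add: image_mset_mset_set inj_on_def)
      then show ?thesis by (simp add: star_graph_def Y_def SG_def h multiset.map_comp comp_def e2)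
    qed
    then show "isomorphic (star_graph Y ?\<sigma>) (SG p)" unfolding isomorphic_def
      by (intro exI[of _ snd] conjI ballI) (auto simp: star_graph_def Y_def SG_def bij_betw_def inj_on_def image_iff)
  qed
  finally show ?thesis by (simp add: \<phi>_def)
qed

lemma lin_\<phi>_e:
  assumes a: "a \<in> SA k m" and r: "r \<le> m"
  shows "lin (\<phi> r (Suc m)) (a * e m) = lin (\<phi> r m) a * q"
proof -
  have "a * e m = (\<Sum>g\<in>keys a. \<Sum>p | p permutes {..<k}. single (g + emb m p) (lookup a g * \<alpha> p))"
    unfolding E_def by (subst poly_mapping_expand[of a]) (simp add: sum_product mult_single)
  then have "lin (\<phi> r (Suc m)) (a * e m) = (\<Sum>g\<in>keys a. \<Sum>p | p permutes {..<k}.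
      lookup a g * \<alpha> p * \<phi> r (Suc m) (g + emb m p))"
    by (simp add: lin_sum)
  also have "\<dots> = (\<Sum>g\<in>keys a. \<Sum>p | p permutes {..<k}. (lookup a g * \<phi> r m g) * (\<alpha> p * f (graph_of (SG p))))"
    using a r by (intro sum.cong refl) (subst \<phi>_Suc, auto simp: SA_def)
  finally show ?thesis by (simp add: lin_def q_def sum_product)
qed

lemma lin_\<phi>_hh:
  assumes a: "a \<in> SA k r" shows "lin (\<phi> r (r + s)) (a * hh r s) = t r a * q ^ s"
proof (induction s)
  case 0
  show ?case using a by (auto simp: lin_def t_def \<phi>_strands SA_def intro!: sum.cong)
next
  case (Suc s)
  have "a * hh r s \<in> SA k (r + s)" by (intro SA_mult hh_SA SA_mono[OF _ a]) simp
  from lin_\<phi>_e[OF this, of r] have "lin (\<phi> r (Suc (r + s))) (a * hh r s * e (r + s)) = t r a * q ^ s * q"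
    using Suc.IH by simp
  then show ?case by (simp add: mult.assoc mult.commute)
qed

text \<open>The test matrix is indexed by two \<open>r\<close>-element sets of blocks and a
  permutation of \<open>r\<close> blocks. It is block diagonal, because different sets bring some
  \<open>1 - e\<close> against an \<open>e\<close>. Each diagonal entry is
  \<open>\<beta> ^ r * q ^ s\<close>, and the square sum of each row is known from
  \<open>zz_B_norm\<close>. In the trace inequality the square of the number of rows stands against
  its first power, so one factor \<open>(m choose r)\<^sup>2 * r!\<close> remains on the
  left.\<close>

lemma growth:
  assumes q: "q \<noteq> 0 \<or> s = 0" and m: "m = r + s"
  shows "(real (m choose r))\<^sup>2 * fact r * cmod \<beta> ^ (2 * r) \<le> (n ^ k) ^ (2 * m) * (\<Prod>i<r. (cmod \<beta>)\<^sup>2 + real i)"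
proof -
  define Z where "Z = zz r * hh r s"
  have ZZ: "Z * Z = Z"
  proof -
    have "Z * Z = zz r * (hh r s * zz r) * hh r s" by (simp add: Z_def mult.assoc)
    also have "\<dots> = (zz r * zz r) * (hh r s * hh r s)" by (simp add: zz_hh_commute[symmetric] mult.assoc)
    finally show ?thesis by (simp add: zz_zz hh_hh Z_def)
  qed
  have eZ: "e i * Z = 0" if "i < r" for i
    using zz_e[OF that] zz_e_commute[of r i] by (simp add: Z_def mult.assoc[symmetric])
  have Ze: "Z * e i = Z" if "r \<le> i" "i < m" for i
    using hh_e[of r i s] that m by (simp add: Z_def mult.assoc)
  \<comment> \<open>Some block \<open>i < r\<close> is sent to a block carrying \<open>e\<close>.
    There a factor \<open>e\<close> can be inserted at no cost, moved through
    \<open>B \<gamma>\<close> to block \<open>i\<close>, and annihilated by the factor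
    \<open>1 - e i\<close> of \<open>Z\<close>.\<close>
  have ZBZ0: "Z * B \<gamma> * Z = 0" if \<gamma>: "\<gamma> permutes {..<m}" and ne: "\<gamma> ` {..<r} \<noteq> {..<r}" for \<gamma>
  proof -
    have "\<exists>i<r. r \<le> \<gamma> i"
    proof (rule ccontr)
      assume "\<not> ?thesis"
      then have "\<gamma> ` {..<r} \<subseteq> {..<r}" by (auto simp: not_le)
      moreover have "card (\<gamma> ` {..<r}) = card {..<r}"
        by (rule card_image) (use permutes_inj[OF \<gamma>] inj_on_subset in blast)
      ultimately show False using ne card_subset_eq[of "{..<r}" "\<gamma> ` {..<r}"] by simp
    qed
    then obtain i where i: "i < r" "r \<le> \<gamma> i" by blast
    have "\<gamma> i < m" using permutes_in_image[OF \<gamma>, of i] i m by simp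
    then have 1: "Z * e (\<gamma> i) = Z" using Ze i by simp
    have "Z * B \<gamma> * Z = Z * e (\<gamma> i) * B \<gamma> * Z" by (simp only: 1)
    also have "\<dots> = Z * B \<gamma> * (e i * Z)"
      using B_E[OF permutes_bij[OF \<gamma>], of k \<alpha> i] by (simp add: mult.assoc[symmetric]) (simp add: mult.assoc)
    finally show ?thesis using eZ[OF i(1)] by simp
  qed
  have ZBZ: "lin (\<phi> r m) (Z * B \<gamma> * Z) = t r (zz r * B \<gamma>) * q ^ s" if \<gamma>: "\<gamma> permutes {..<r}" for \<gamma>
  proof -
    have "Z * B \<gamma> * Z = zz r * (hh r s * B \<gamma>) * (zz r * hh r s)" by (simp add: Z_def mult.assoc)
    also have "\<dots> = zz r * B \<gamma> * (hh r s * zz r) * hh r s" by (simp add: hh_B_commute[OF \<gamma>] mult.assoc)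
    also have "\<dots> = (zz r * B \<gamma> * zz r) * (hh r s * hh r s)" by (simp add: zz_hh_commute[symmetric] mult.assoc)
    finally have "Z * B \<gamma> * Z = (zz r * B \<gamma> * zz r) * hh r s" by (simp add: hh_hh)
    then have "lin (\<phi> r m) (Z * B \<gamma> * Z) = t r (zz r * B \<gamma> * zz r) * q ^ s"
      unfolding m using lin_\<phi>_hh[of "zz r * B \<gamma> * zz r" r s] SA_mult zz_SA B_SA[OF \<gamma>] by simp
    also have "t r (zz r * B \<gamma> * zz r) = t r (zz r * (zz r * B \<gamma>))"
      by (rule t_commute) (intro SA_mult zz_SA B_SA[OF \<gamma>])+
    finally show ?thesis by (simp add: mult.assoc[symmetric] zz_zz)
  qed
  define SS where "SS = {S. S \<subseteq> {..<m} \<and> card S = r}"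
  define PP where "PP = {\<pi>. \<pi> permutes {..<r}}"
  have rm: "r \<le> m" using m by simp
  have "\<forall>S\<in>SS. \<exists>p. p permutes {..<m} \<and> p ` {..<r} = S"
    using ex_permutes_image rm by (auto simp: SS_def)
  then obtain c where c: "\<And>S. S \<in> SS \<Longrightarrow> c S permutes {..<m}" "\<And>S. S \<in> SS \<Longrightarrow> c S ` {..<r} = S"
    by metis
  have PPm: "\<pi> permutes {..<m}" if "\<pi> \<in> PP" for \<pi>
    using that permutes_subset[of \<pi> "{..<r}" "{..<m}"] rm by (auto simp: PP_def)
  define X where "X = SS \<times> SS \<times> PP"
  have finX: "finite X" by (simp add: X_def SS_def PP_def finite_permutations)
  \<comment> \<open>\<open>left\<close> and \<open>right\<close> undo the permutations of a row. The
    product becomes \<open>Z * B g * Z * B d * Z\<close>, where \<open>g\<close> compares the first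
    sets and the permutations, and \<open>d\<close> compares the second sets.\<close>
  define row where "row x = (case x of (S, T, \<pi>) \<Rightarrow> B (c S) * B \<pi> * Z * B (inv (c T)))" for x
  define left where "left x = (case x of (S, T, \<pi>) \<Rightarrow> Z * B (inv \<pi>) * B (inv (c S)))" for x :: "nat set \<times> nat set \<times> (nat \<Rightarrow> nat)"
  define right where "right x = (case x of (S, T, \<pi>) \<Rightarrow> B (c T) * Z)" for x :: "nat set \<times> nat set \<times> (nat \<Rightarrow> nat)"
  have ZSA: "Z \<in> SA k m" unfolding Z_def m by (intro SA_mult hh_SA SA_mono[OF _ zz_SA]) simp
  have SAs: "row x \<in> SA k m" "left x \<in> SA k m" "right x \<in> SA k m" if "x \<in> X" for x
  proof -
    obtain S T \<pi> where x: "x = (S, T, \<pi>)" "S \<in> SS" "T \<in> SS" "\<pi> \<in> PP" using \<open>x \<in> X\<close> by (auto simp: X_def)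
    show "row x \<in> SA k m" "left x \<in> SA k m" "right x \<in> SA k m"
      unfolding x row_def left_def right_def prod.case
      by (intro SA_mult ZSA B_SA c(1) permutes_inv PPm x)+
  qed
  define T where "T x y = lin (\<phi> r m) (left y * row x * right y)" for x y
  have T: "T (S, S2, \<pi>) (S', S2', \<pi>') = (if S = S' \<and> S2 = S2' then t r (zz r * B (inv \<pi>' \<circ> \<pi>)) * q ^ s else 0)"
    if x: "(S, S2, \<pi>) \<in> X" "(S', S2', \<pi>') \<in> X" for S S2 \<pi> S' S2' \<pi>'
  proof -
    have S: "S \<in> SS" "S2 \<in> SS" "S' \<in> SS" "S2' \<in> SS" and \<pi>: "\<pi> \<in> PP" "\<pi>' \<in> PP" using x by (auto simp: X_def)
    have \<pi>r: "\<pi> permutes {..<r}" "\<pi>' permutes {..<r}" using \<pi> by (auto simp: PP_def)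
    let ?g = "inv \<pi>' \<circ> inv (c S') \<circ> c S \<circ> \<pi>" and ?d = "inv (c S2) \<circ> c S2'"
    have g: "?g permutes {..<m}" and d: "?d permutes {..<m}"
      by (intro permutes_compose permutes_inv PPm \<pi> c(1) S)+
    note bj = permutes_bij[OF c(1)[OF S(1)]] permutes_bij[OF c(1)[OF S(2)]] permutes_bij[OF c(1)[OF S(3)]]
      permutes_bij[OF c(1)[OF S(4)]] permutes_bij[OF \<pi>r(1)] permutes_bij[OF \<pi>r(2)]
    have Bg: "B (inv \<pi>') * B (inv (c S')) * B (c S) * B \<pi> = B ?g"
      using bj by (simp add: B_mult bij_comp bij_imp_bij_inv)
    have Bd: "B (inv (c S2)) * B (c S2') = B ?d"
      using bj by (simp add: B_mult bij_comp bij_imp_bij_inv)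
    have "left (S', S2', \<pi>') * row (S, S2, \<pi>) * right (S', S2', \<pi>') =
        Z * (B (inv \<pi>') * B (inv (c S')) * B (c S) * B \<pi>) * Z * (B (inv (c S2)) * B (c S2')) * Z"
      by (simp add: left_def row_def right_def mult.assoc)
    then have prod: "left (S', S2', \<pi>') * row (S, S2, \<pi>) * right (S', S2', \<pi>') = Z * B ?g * Z * B ?d * Z"
      unfolding Bg Bd .
    consider "S \<noteq> S'" | "S2 \<noteq> S2'" | "S = S'" "S2 = S2'" by blast
    then show ?thesis
    proof cases
      case 1
      have "?g ` {..<r} \<noteq> {..<r}"
      proof
        assume "?g ` {..<r} = {..<r}"
        then have "inv \<pi>' ` inv (c S') ` c S ` \<pi> ` {..<r} = {..<r}" by (simp add: image_comp)
        then have "inv \<pi>' ` inv (c S') ` S = {..<r}" by (simp add: permutes_image[OF \<pi>r(1)] c(2)[OF S(1)])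
        then have "c S' ` \<pi>' ` inv \<pi>' ` inv (c S') ` S = c S' ` \<pi>' ` {..<r}" by simp
        moreover have "\<pi>' ` inv \<pi>' ` A = A" for A
          using bij_is_surj[OF bj(6)] by (simp add: image_f_inv_f)
        moreover have "c S' ` inv (c S') ` A = A" for A
          using bij_is_surj[OF bj(3)] by (simp add: image_f_inv_f)
        ultimately have "S = S'" by (simp add: permutes_image[OF \<pi>r(2)] c(2)[OF S(3)])
        then show False using 1 by simp
      qed
      then have "Z * B ?g * Z = 0" by (rule ZBZ0[OF g])
      then show ?thesis using 1 unfolding T_def prod by simp
    next
      case 2
      have "?d ` {..<r} \<noteq> {..<r}"
      proof
        assume "?d ` {..<r} = {..<r}"
        then have "c S2 ` inv (c S2) ` c S2' ` {..<r} = c S2 ` {..<r}" by (simp add: image_comp)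
        moreover have "c S2 ` inv (c S2) ` A = A" for A
          using bij_is_surj[OF bj(2)] by (simp add: image_f_inv_f)
        ultimately have "S2' = S2" by (simp add: c(2)[OF S(2)] c(2)[OF S(4)])
        then show False using 2 by simp
      qed
      then have "Z * B ?d * Z = 0" by (rule ZBZ0[OF d])
      moreover have "Z * B ?g * Z * B ?d * Z = Z * B ?g * (Z * B ?d * Z)" by (simp add: mult.assoc)
      ultimately show ?thesis using 2 unfolding T_def prod by simp
    next
      case 3
      have i1: "inv (c A) (c A x) = x" if "A \<in> SS" for A x
        using permutes_inj[OF c(1)[OF that]] by simp
      have "?g = inv \<pi>' \<circ> \<pi>" "?d = id" using 3 S i1 by (auto simp: fun_eq_iff)
      then have "Z * B ?g * Z * B ?d * Z = Z * B (inv \<pi>' \<circ> \<pi>) * Z"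
        by (simp only: B_id mult_1_right) (simp only: mult.assoc ZZ)
      then show ?thesis using 3 ZBZ[OF permutes_compose[OF \<pi>r(1) permutes_inv[OF \<pi>r(2)]]] unfolding T_def prod by simp
    qed
  qed
  \<comment> \<open>The \<open>K\<close> legs have \<open>2 * K\<close> ports, each of which gets a
    label; this is the source of the bound \<open>n ^ (2 * K)\<close>.\<close>
  define K where "K = m * k"
  have "card (legs k m) = K" by (simp add: legs_def K_def)
  then obtain en where en: "bij_betw en {1..K} (legs k m)"
    using finite_same_card_bij[of "{1..K}" "legs k m"] by auto
  have lgH: "lg (HS r m) = legs k m" by (simp add: HS_def)
  define P where "P = (\<Union>x\<in>X. keys (row x))"
  define QL where "QL = (\<Union>x\<in>X. keys (left x))"
  define QR where "QR = (\<Union>x\<in>X. keys (right x))"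
  have fins: "finite P" "finite QL" "finite QR" using finX by (auto simp: P_def QL_def QR_def)
  have st: "p \<in> stab k m" if "p \<in> P \<or> p \<in> QL \<or> p \<in> QR" for p
    using that SAs unfolding P_def QL_def QR_def SA_def by blast
  define R where "R p = row_fragment K en (HS r m) (ap p)" for p
  \<comment> \<open>In \<open>glue_row_col\<close> the input permutation \<tau> is the inverse of
    \<open>h\<close> and the output permutation \<rho> is \<open>g\<close>, so that gluing to the
    row of \<open>p\<close> closes up with \<open>g + p + h\<close>.\<close>
  define C where "C gh = col_fragment K en (HS r m) (inv (ap (snd gh))) (ap (fst gh))" for gh :: "gp \<times> gp"
  have Rf: "R p \<in> fragments (2 * K)" if "p \<in> P" for p
    unfolding R_def by (rule row_fragment_in[OF wf_HS]) (use en st that stab_bij in \<open>auto simp: lgH\<close>)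
  have Cf: "C gh \<in> fragments (2 * K)" if "gh \<in> QL \<times> QR" for gh
    unfolding C_def by (rule col_fragment_in[OF wf_HS]) (use en st that stab_bij stab_inv_bij in \<open>auto simp: lgH\<close>)
  have Mf: "connection_matrix f (2 * K) (R p) (C (g, h)) = \<phi> r m (g + p + h)" if "p \<in> P" "g \<in> QL" "h \<in> QR" for p g h
  proof -
    have "graph_of (glue (2 * K) (R p) (C (g, h))) = graph_of (clo (HS r m) (ap (g + p + h)))"
      unfolding R_def C_def fst_conv snd_conv
    proof (rule glue_row_col[OF wf_HS])
      show "bij_betw (ap (g + p + h)) (lg (HS r m)) (lg (HS r m))"
        unfolding lgH using st that by (intro stab_bij stab_plus) auto
      fix l show "ap (g + p + h) (inv (ap h) l) = ap g (ap p l)"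
        using bij_is_surj[OF bij_ap[of h]] by (simp add: ap_plus surj_f_inv_f)
    qed (use en st that stab_bij stab_inv_bij in \<open>auto simp: lgH\<close>)
    then show ?thesis by (simp add: connection_matrix_def \<phi>_def)
  qed
  have "(cmod (\<Sum>x\<in>X. T x x))\<^sup>2 \<le> n ^ (2 * K) * (\<Sum>x\<in>X. \<Sum>y\<in>X. (cmod (T x y))\<^sup>2)"
  proof (rule rank_trace_inequality[OF rank[of "2 * K"] finX fins(1) finite_cartesian_product[OF fins(2,3)] Rf Cf])
    fix x y assume x: "x \<in> X" and y: "y \<in> X"
    have "T x y = (\<Sum>g\<in>QL. \<Sum>p\<in>P. \<Sum>h\<in>QR. lookup (left y) g * lookup (row x) p * lookup (right y) h * \<phi> r m (g + p + h))"
      unfolding T_def by (rule lin_mult_mult_superset) (use fins x y in \<open>auto simp: P_def QL_def QR_def\<close>)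
    also have "\<dots> = (\<Sum>p\<in>P. \<Sum>g\<in>QL. \<Sum>h\<in>QR. lookup (left y) g * lookup (row x) p * lookup (right y) h * \<phi> r m (g + p + h))"
      by (rule sum.swap)
    also have "\<dots> = (\<Sum>p\<in>P. \<Sum>(g, h)\<in>QL \<times> QR. lookup (left y) g * lookup (row x) p * lookup (right y) h * \<phi> r m (g + p + h))"
      by (simp only: sum.cartesian_product)
    also have "\<dots> = (\<Sum>p\<in>P. \<Sum>gh\<in>QL \<times> QR. lookup (row x) p * (lookup (left y) (fst gh) * lookup (right y) (snd gh)) *
        connection_matrix f (2 * K) (R p) (C gh))"
    proof (intro sum.cong refl)
      fix p gh assume p: "p \<in> P" and gh: "gh \<in> QL \<times> QR"
      obtain g h where [simp]: "gh = (g, h)" by (rule prod.exhaust)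
      have M: "connection_matrix f (2 * K) (R p) (C (g, h)) = \<phi> r m (g + p + h)" by (rule Mf) (use p gh in auto)
      show "(case gh of (g, h) \<Rightarrow> lookup (left y) g * lookup (row x) p * lookup (right y) h * \<phi> r m (g + p + h)) =
        lookup (row x) p * (lookup (left y) (fst gh) * lookup (right y) (snd gh)) * connection_matrix f (2 * K) (R p) (C gh)"
        unfolding \<open>gh = (g, h)\<close> prod.case fst_conv snd_conv M by (simp only: mult_ac)
    qed
    finally show "T x y = \<dots>" .
  qed
  moreover have "(\<Sum>x\<in>X. T x x) = of_nat (card X) * (\<beta> ^ r * q ^ s)"
  proof -
    have "T x x = \<beta> ^ r * q ^ s" if "x \<in> X" for x
    proof -
      obtain S S2 \<pi> where xx: "x = (S, S2, \<pi>)" by (rule prod_cases3)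
      have "\<pi> permutes {..<r}" using that by (auto simp: xx X_def PP_def)
      then have "inv \<pi> \<circ> \<pi> = id" using permutes_inv_o(2) by blast
      then show ?thesis using T[of S S2 \<pi> S S2 \<pi>] that by (simp only: xx B_id mult_1_right t_zz) simp
    qed
    then show ?thesis by simp
  qed
  moreover have "(\<Sum>x\<in>X. \<Sum>y\<in>X. (cmod (T x y))\<^sup>2) =
      real (card X) * ((\<Prod>i<r. (cmod \<beta>)\<^sup>2 + real i) * cmod q ^ (2 * s))"
  proof -
    have "(\<Sum>y\<in>X. (cmod (T x y))\<^sup>2) = (\<Prod>i<r. (cmod \<beta>)\<^sup>2 + real i) * cmod q ^ (2 * s)" if x: "x \<in> X" for x
    proof -
      obtain S S2 \<pi> where xx: "x = (S, S2, \<pi>)" by (rule prod_cases3)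
      then have S: "S \<in> SS" "S2 \<in> SS" "\<pi> permutes {..<r}" using x by (auto simp: X_def PP_def)
      have "(\<Sum>y\<in>X. (cmod (T x y))\<^sup>2) = (\<Sum>y\<in>(\<lambda>\<pi>'. (S, S2, \<pi>')) ` PP. (cmod (T x y))\<^sup>2)"
      proof (rule sum.mono_neutral_right[OF finX])
        show "(\<lambda>\<pi>'. (S, S2, \<pi>')) ` PP \<subseteq> X" using S by (auto simp: X_def)
        show "\<forall>y\<in>X - (\<lambda>\<pi>'. (S, S2, \<pi>')) ` PP. (cmod (T x y))\<^sup>2 = 0"
        proof
          fix y assume y: "y \<in> X - (\<lambda>\<pi>'. (S, S2, \<pi>')) ` PP"
          obtain S' S2' \<pi>' where yy: "y = (S', S2', \<pi>')" by (rule prod_cases3)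
          then have "\<not> (S = S' \<and> S2 = S2')" using y by (auto simp: X_def)
          then show "(cmod (T x y))\<^sup>2 = 0" using T[of S S2 \<pi> S' S2' \<pi>'] x y xx yy by auto
        qed
      qed
      also have "\<dots> = (\<Sum>\<pi>'\<in>PP. (cmod (T x (S, S2, \<pi>')))\<^sup>2)"
        by (subst sum.reindex) (auto simp: inj_on_def)
      also have "\<dots> = (\<Sum>\<pi>'\<in>PP. (cmod (t r (zz r * B (inv \<pi>' \<circ> \<pi>))))\<^sup>2 * cmod q ^ (2 * s))"
      proof (rule sum.cong[OF refl])
        fix \<pi>' assume "\<pi>' \<in> PP"
        then have "(S, S2, \<pi>') \<in> X" using S by (simp add: X_def)
        then show "(cmod (T x (S, S2, \<pi>')))\<^sup>2 = (cmod (t r (zz r * B (inv \<pi>' \<circ> \<pi>))))\<^sup>2 * cmod q ^ (2 * s)"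
          using T[of S S2 \<pi> S S2 \<pi>'] x xx by (simp add: norm_mult norm_power power_mult_distrib power_mult[symmetric] mult.commute)
      qed
      also have "\<dots> = (\<Sum>\<pi>'\<in>PP. (cmod (t r (zz r * B (inv \<pi>' \<circ> \<pi>))))\<^sup>2) * cmod q ^ (2 * s)"
        by (rule sum_distrib_right[symmetric])
      \<comment> \<open>With \<open>\<pi>'\<close> also its inverse times \<open>\<pi>\<close> runs
        through the whole group, so all rows have the same square sum.\<close>
      also have "(\<Sum>\<pi>'\<in>PP. (cmod (t r (zz r * B (inv \<pi>' \<circ> \<pi>))))\<^sup>2) = (\<Sum>\<gamma>\<in>PP. (cmod (t r (zz r * B \<gamma>)))\<^sup>2)"
      proof (rule sum.reindex_bij_betw)
        show "bij_betw (\<lambda>\<pi>'. inv \<pi>' \<circ> \<pi>) PP PP"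
        proof (rule bij_betw_byWitness[where f' = "\<lambda>\<gamma>. \<pi> \<circ> inv \<gamma>"])
          have ii: "\<pi> \<circ> inv (inv \<pi>' \<circ> \<pi>) = \<pi>'" "inv (\<pi> \<circ> inv \<pi>') \<circ> \<pi> = \<pi>'" if "\<pi>' permutes {..<r}" for \<pi>'
          proof -
            note b = permutes_bij[OF S(3)] permutes_bij[OF that]
            have "inv (inv \<pi>' \<circ> \<pi>) = inv \<pi> \<circ> \<pi>'" "inv (\<pi> \<circ> inv \<pi>') = \<pi>' \<circ> inv \<pi>"
              using b by (simp_all add: o_inv_distrib bij_imp_bij_inv inv_inv_eq)
            then show "\<pi> \<circ> inv (inv \<pi>' \<circ> \<pi>) = \<pi>'" "inv (\<pi> \<circ> inv \<pi>') \<circ> \<pi> = \<pi>'"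
              using b by (auto simp: fun_eq_iff bij_is_surj surj_f_inv_f bij_is_inj)
          qed
          show "\<forall>a\<in>PP. \<pi> \<circ> inv (inv a \<circ> \<pi>) = a" "\<forall>a\<in>PP. inv (\<pi> \<circ> inv a) \<circ> \<pi> = a"
            using ii by (auto simp: PP_def)
          show "(\<lambda>\<pi>'. inv \<pi>' \<circ> \<pi>) ` PP \<subseteq> PP" "(\<lambda>\<gamma>. \<pi> \<circ> inv \<gamma>) ` PP \<subseteq> PP"
            using S(3) by (auto simp: PP_def intro: permutes_compose permutes_inv)
        qed
      qed
      also have "\<dots> = (\<Prod>i<r. (cmod \<beta>)\<^sup>2 + real i)" unfolding PP_def by (rule zz_B_norm)
      finally show ?thesis .
    qed
    then show ?thesis by simp
  qed
  ultimately have main: "(real (card X))\<^sup>2 * (cmod \<beta> ^ (2 * r) * cmod q ^ (2 * s)) \<le>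
      n ^ (2 * K) * (real (card X) * ((\<Prod>i<r. (cmod \<beta>)\<^sup>2 + real i) * cmod q ^ (2 * s)))"
    by (simp add: norm_mult norm_power power_mult_distrib power_mult[symmetric] mult.commute[of _ 2])
  have "card SS = m choose r" unfolding SS_def using n_subsets[of "{..<m}" r] by simp
  moreover have "card PP = fact r" unfolding PP_def using card_permutations[of "{..<r}" r] by simp
  ultimately have cX: "real (card X) = (real (m choose r))\<^sup>2 * fact r"
    by (simp add: X_def card_cartesian_product power2_eq_square)
  have cX0: "real (card X) > 0" unfolding cX using rm by (simp add: zero_less_binomial)
  have q0: "cmod q ^ (2 * s) > 0" using q by auto
  have "(real (card X) * cmod q ^ (2 * s)) * (real (card X) * cmod \<beta> ^ (2 * r)) \<le>
      (real (card X) * cmod q ^ (2 * s)) * (n ^ (2 * K) * (\<Prod>i<r. (cmod \<beta>)\<^sup>2 + real i))"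
    using main by (simp only: power2_eq_square mult_ac)
  then have "real (card X) * cmod \<beta> ^ (2 * r) \<le> n ^ (2 * K) * (\<Prod>i<r. (cmod \<beta>)\<^sup>2 + real i)"
    by (rule mult_left_le_imp_le) (use cX0 q0 in simp)
  moreover have "n ^ (2 * K) = (n ^ k) ^ (2 * m)" by (simp add: K_def power_mult[symmetric] mult_ac)
  ultimately show ?thesis by (simp only: cX)
qed

lemma n_nonneg: "n \<ge> 0"
proof -
  have "0 \<le> ereal (n ^ 1)" by (rule order.trans[OF _ rank[of 1]]) simp
  then show ?thesis by simp
qed

text \<open>For \<open>\<epsilon> \<le> 0\<close> the trace of \<open>1 - e\<close> is at least the
  trace \<open>n ^ k\<close> of the identity, while \<open>growth\<close> with \<open>s = 0\<close>,
  which puts no condition on \<open>q\<close>, bounds it by \<open>n ^ k\<close>.\<close>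

lemma trace_zero:
  assumes "\<epsilon> = of_real x" "x \<le> 0" shows "\<epsilon> = 0"
proof -
  have b: "cmod \<beta> = n ^ k - x"
  proof -
    have "\<beta> = of_real (n ^ k - x)" by (simp add: \<beta>_def assms(1))
    moreover have "n ^ k - x \<ge> 0" using zero_le_power[OF n_nonneg, of k] assms(2) by linarith
    ultimately show ?thesis by (simp only: norm_of_real abs_of_nonneg)
  qed
  have "cmod \<beta> \<le> n ^ k"
    by (rule growth_bound) (use growth[of 0] n_nonneg in auto)
  then show ?thesis using b assms by simp
qed

text \<open>For \<open>\<epsilon> = 0\<close> already \<open>1 - e\<close> has the full trace
  \<open>n ^ k\<close>. A nonzero \<open>q\<close> would admit any number \<open>s\<close> of blocks
  with \<open>e\<close>, and the binomial form of the growth bound would yield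
  \<open>n ^ k + 1 \<le> n ^ k\<close>.\<close>

lemma q_zero:
  assumes "\<epsilon> = 0" shows "q = 0"
proof (rule ccontr)
  assume q: "q \<noteq> 0"
  have "cmod \<beta> + 1 \<le> n ^ k"
    by (rule growth_bound_binomial) (use growth[of "m - r" m r for m r] q n_nonneg in auto)
  moreover have "cmod \<beta> = n ^ k" using assms n_nonneg by (simp add: \<beta>_def norm_power)
  ultimately show False by simp
qed

end

section \<open>Integrality of the value at the vertexless loop\<close>

definition cyc :: "nat \<Rightarrow> (nat \<Rightarrow> nat) \<Rightarrow> nat" where
  "cyc k p = loops (legs k 1) (ap (emb 0 p))"

lemma emb_bij_betw:
  assumes p: "p permutes {..<k}"
  shows "bij_betw (ap (emb 0 p)) (legs k 1) (legs k 1)"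
  using emb_stab[OF p, of 0 1] by (intro stab_bij) simp

lemma card_cyc:
  assumes p: "p permutes {..<k}"
  shows "card {c \<in> {..<k} \<rightarrow>\<^sub>E {..<q}. \<forall>x<k. c (p x) = c x} = q ^ cyc k p"
proof -
  let ?A = "{c \<in> {..<k} \<rightarrow>\<^sub>E {..<q}. \<forall>x<k. c (p x) = c x}"
  note em = ap_emb[OF permutes_bij[OF p]]
  have px: "p x < k" if "x < k" for x using permutes_in_image[OF p, of x] that by simp
  have "bij_betw (\<lambda>\<phi>. restrict (\<lambda>x. \<phi> (0, x)) {..<k}) (inv_cols q (legs k 1) (ap (emb 0 p))) ?A"
  proof (rule bij_betw_byWitness[where f' = "\<lambda>c. restrict (\<lambda>l. c (snd l)) (legs k 1)"])
    show "\<forall>\<phi>\<in>inv_cols q (legs k 1) (ap (emb 0 p)). restrict (\<lambda>l. (restrict (\<lambda>x. \<phi> (0, x)) {..<k}) (snd l)) (legs k 1) = \<phi>"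
    proof (intro ballI ext)
      fix \<phi> and l :: "nat \<times> nat" assume "\<phi> \<in> inv_cols q (legs k 1) (ap (emb 0 p))"
      then have "\<phi> \<in> legs k 1 \<rightarrow>\<^sub>E {..<q}" by (simp add: inv_cols_def)
      from PiE_arb[OF this, of l] show "restrict (\<lambda>l. (restrict (\<lambda>x. \<phi> (0, x)) {..<k}) (snd l)) (legs k 1) l = \<phi> l"
        by (cases l) auto
    qed
    show "\<forall>c\<in>?A. restrict (\<lambda>x. (restrict (\<lambda>l. c (snd l)) (legs k 1)) (0, x)) {..<k} = c"
    proof (intro ballI ext)
      fix c x assume "c \<in> ?A"
      then have "c \<in> {..<k} \<rightarrow>\<^sub>E {..<q}" by simp
      from PiE_arb[OF this, of x] show "restrict (\<lambda>x. (restrict (\<lambda>l. c (snd l)) (legs k 1)) (0, x)) {..<k} x = c x"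
        by (cases "x < k") auto
    qed
    show "(\<lambda>\<phi>. restrict (\<lambda>x. \<phi> (0, x)) {..<k}) ` inv_cols q (legs k 1) (ap (emb 0 p)) \<subseteq> ?A"
    proof (rule image_subsetI)
      fix \<phi> assume "\<phi> \<in> inv_cols q (legs k 1) (ap (emb 0 p))"
      then have 1: "\<phi> \<in> legs k 1 \<rightarrow>\<^sub>E {..<q}" and 2: "\<forall>l\<in>legs k 1. \<phi> (ap (emb 0 p) l) = \<phi> l" by (auto simp: inv_cols_def)
      have "\<phi> (0, p x) = \<phi> (0, x)" if "x < k" for x using bspec[OF 2, of "(0, x)"] that by (simp add: em)
      moreover have "\<phi> (0, x) < q" if "x < k" for x using PiE_mem[OF 1, of "(0, x)"] that by simp
      ultimately show "restrict (\<lambda>x. \<phi> (0, x)) {..<k} \<in> ?A" using px by auto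
    qed
    show "(\<lambda>c. restrict (\<lambda>l. c (snd l)) (legs k 1)) ` ?A \<subseteq> inv_cols q (legs k 1) (ap (emb 0 p))"
    proof (rule image_subsetI)
      fix c assume "c \<in> ?A"
      then have 1: "c \<in> {..<k} \<rightarrow>\<^sub>E {..<q}" and 2: "\<And>x. x < k \<Longrightarrow> c (p x) = c x" by auto
      show "restrict (\<lambda>l. c (snd l)) (legs k 1) \<in> inv_cols q (legs k 1) (ap (emb 0 p))"
        unfolding inv_cols_def
      proof (intro CollectI conjI ballI)
        show "restrict (\<lambda>l. c (snd l)) (legs k 1) \<in> legs k 1 \<rightarrow>\<^sub>E {..<q}" using PiE_mem[OF 1] by auto
        fix l assume "l \<in> legs k 1"
        then obtain x where "l = (0, x)" "x < k" by (cases l) auto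
        then show "restrict (\<lambda>l. c (snd l)) (legs k 1) (ap (emb 0 p) l) = restrict (\<lambda>l. c (snd l)) (legs k 1) l"
          using px 2 by (simp add: em)
      qed
    qed
  qed
  then have "card ?A = card (inv_cols q (legs k 1) (ap (emb 0 p)))" by (rule bij_betw_same_card[symmetric])
  then show ?thesis using card_inv_cols[OF finite_legs emb_bij_betw[OF p]] by (simp add: cyc_def)
qed

lemma cyc_inv:
  assumes p: "p permutes {..<k}" shows "cyc k (inv p) = cyc k p"
proof -
  have px: "p x < k" "inv p x < k" if "x < k" for x
    using permutes_in_image[OF p, of x] permutes_in_image[OF permutes_inv[OF p], of x] that by simp_all
  have "(\<forall>x<k. c (inv p x) = c x) \<longleftrightarrow> (\<forall>x<k. c (p x) = c x)" for c :: "nat \<Rightarrow> nat"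
  proof
    assume a: "\<forall>x<k. c (inv p x) = c x"
    show "\<forall>x<k. c (p x) = c x"
    proof (intro allI impI)
      fix x assume "x < k"
      then have "c (inv p (p x)) = c (p x)" using a px by blast
      then show "c (p x) = c x" by (simp add: permutes_inverses(2)[OF p])
    qed
  next
    assume a: "\<forall>x<k. c (p x) = c x"
    show "\<forall>x<k. c (inv p x) = c x"
    proof (intro allI impI)
      fix x assume "x < k"
      then have "c (p (inv p x)) = c (inv p x)" using a px by blast
      then show "c (inv p x) = c x" by (simp add: permutes_inverses(1)[OF p])
    qed
  qed
  then have "(2::nat) ^ cyc k (inv p) = 2 ^ cyc k p"
    using card_cyc[OF p, of 2] card_cyc[OF permutes_inv[OF p], of 2] by simp
  then show ?thesis by simp
qed

lemma emb_plus: "bij p \<Longrightarrow> bij q \<Longrightarrow> emb i p + emb i q = emb i (p \<circ> q)"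
  by (rule gp_eqI) (auto simp: ap_plus ap_emb bij_comp)

lemma cyc_commute:
  assumes p: "p permutes {..<k}" and q: "q permutes {..<k}"
  shows "cyc k (p \<circ> q) = cyc k (q \<circ> p)"
proof -
  have "ap (emb 0 (p \<circ> q)) = ap (emb 0 p) \<circ> ap (emb 0 q)" "ap (emb 0 (q \<circ> p)) = ap (emb 0 q) \<circ> ap (emb 0 p)"
    using emb_plus permutes_bij p q by (metis ap_plus)+
  then show ?thesis unfolding cyc_def
    using loops_comp_commute[OF finite_legs emb_bij_betw[OF p] emb_bij_betw[OF q]] by simp
qed

lemma cyc_inv_comp:
  assumes p: "p permutes {..<k}" and q: "q permutes {..<k}"
  shows "cyc k (inv p \<circ> q) = cyc k (p \<circ> inv q)"
proof -
  have "inv (inv p \<circ> q) = inv q \<circ> p"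
    using permutes_bij[OF p] permutes_bij[OF q] by (simp add: o_inv_distrib bij_imp_bij_inv inv_inv_eq)
  then have "cyc k (inv p \<circ> q) = cyc k (inv q \<circ> p)"
    using cyc_inv[OF permutes_compose[OF q permutes_inv[OF p]]] by simp
  then show ?thesis using cyc_commute[OF p permutes_inv[OF q]] by simp
qed

text \<open>Reading the \<open>k\<close> points as blocks of width 1 makes \<open>loops_swap\<close>
  available for permutations of points.\<close>

lemma cyc_eq_blk:
  assumes p: "p permutes {..<k}"
  shows "cyc k p = loops (legs 1 k) (ap (blk p))"
  unfolding cyc_def
proof (rule loops_relabel[where \<beta> = "\<lambda>(b, x). (x, b)"])
  show "bij_betw (\<lambda>(b, x). (x, b)) (legs k 1) (legs 1 k)"
    by (rule bij_betw_byWitness[where f' = "\<lambda>(b, x). (x, b)"]) auto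
qed (use emb_bij_betw[OF p] stab_bij[OF blk_stab[OF p]] in \<open>auto simp: ap_emb ap_blk permutes_bij[OF p]\<close>)

lemma cyc_Suc_fix:
  assumes p: "p permutes {..<k}"
  shows "cyc (Suc k) p = cyc k p + 1"
proof -
  have p': "p permutes {..<Suc k}" by (rule permutes_subset[OF p]) auto
  have U: "legs 1 (Suc k) = legs 1 k \<union> {(k, 0)}" by (auto simp: legs_def)
  have pk: "p k = k" using permutes_not_in[OF p] by simp
  have fx: "ap (blk p) (k, 0) = (k, 0)" by (simp add: ap_blk permutes_bij[OF p] pk)
  have b: "bij_betw (ap (blk p)) {(k, 0)} {(k, 0)}" using fx by (simp add: bij_betw_def)
  have "cyc (Suc k) p = loops (legs 1 k) (ap (blk p)) + loops {(k, 0)} (ap (blk p))"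
    unfolding cyc_eq_blk[OF p'] U
    by (rule loops_union) (use b stab_bij[OF blk_stab[OF p]] in auto)
  also have "loops {(k, 0)} (ap (blk p)) = loops {(k, 0)} id"
    by (rule loops_cong) (use b fx in auto)
  also have "\<dots> = 1" by (simp add: loops_id)
  finally show ?thesis by (simp add: cyc_eq_blk[OF p])
qed

lemma cyc_Suc_transpose:
  assumes p: "p permutes {..<k}" and b: "b < k"
  shows "cyc (Suc k) (Transposition.transpose k b \<circ> p) = cyc k p"
proof -
  let ?s = "Transposition.transpose b k"
  have p': "p permutes {..<Suc k}" by (rule permutes_subset[OF p]) auto
  have s: "?s permutes {..<Suc k}" using b by (intro permutes_swap_id) auto
  have pk: "p k = k" using permutes_not_in[OF p] by simp
  have "Transposition.transpose k b \<circ> p = ?s \<circ> p" by (simp add: transpose_commute)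
  then have "cyc (Suc k) (Transposition.transpose k b \<circ> p) = cyc (Suc k) (p \<circ> ?s)"
    using cyc_commute[OF s p'] by simp
  also have "\<dots> = loops (legs 1 (Suc k)) (ap (blk (p \<circ> ?s)))"
    by (rule cyc_eq_blk) (rule permutes_compose[OF s p'])
  also have "ap (blk (p \<circ> ?s)) = ap (blk p) \<circ> (\<lambda>(b', x). (?s b', x))"
    by (auto simp: ap_blk permutes_bij[OF p] bij_comp)
  also have "loops (legs 1 (Suc k)) \<dots> = loops (legs 1 k) (ap (blk p))"
    by (rule loops_swap[OF stab_bij[OF blk_stab[OF p]] _ b]) (simp add: ap_blk permutes_bij[OF p] pk)
  finally show ?thesis unfolding cyc_eq_blk[OF p] .
qed

lemma permutes_Suc_bij:
  "bij_betw (\<lambda>(b, p). Transposition.transpose k b \<circ> p) ({..k} \<times> {p. p permutes {..<k}}) {p. p permutes {..<Suc k}}"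
proof (rule bij_betw_imageI)
  have ins: "{..<Suc k} = insert k {..<k}" "{..k} = insert k {..<k}" by auto
  show "(\<lambda>(b, p). Transposition.transpose k b \<circ> p) ` ({..k} \<times> {p. p permutes {..<k}}) = {p. p permutes {..<Suc k}}"
    unfolding ins permutes_insert by auto
  show "inj_on (\<lambda>(b, p). Transposition.transpose k b \<circ> p) ({..k} \<times> {p. p permutes {..<k}})"
  proof (rule inj_onI, clarify)
    fix b p c q assume p: "p permutes {..<k}" and q: "q permutes {..<k}"
      and eq: "Transposition.transpose k b \<circ> p = Transposition.transpose k c \<circ> q"
    have "p k = k" "q k = k" using permutes_not_in[OF p] permutes_not_in[OF q] by auto
    then have bc: "b = c" using fun_cong[OF eq, of k] by simp
    have "Transposition.transpose k b \<circ> (Transposition.transpose k b \<circ> p) = Transposition.transpose k b \<circ> (Transposition.transpose k b \<circ> q)"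
      using eq bc by simp
    then show "b = c \<and> p = q" using bc by (simp add: fun_eq_iff)
  qed
qed

lemma sum_permutes_Suc:
  "(\<Sum>p | p permutes {..<Suc k}. g p) = (\<Sum>p | p permutes {..<k}. g p + (\<Sum>b<k. g (Transposition.transpose k b \<circ> p)))"
proof -
  have "(\<Sum>p | p permutes {..<Suc k}. g p) = (\<Sum>(b, p)\<in>{..k} \<times> {p. p permutes {..<k}}. g (Transposition.transpose k b \<circ> p))"
    by (subst sum.reindex_bij_betw[OF permutes_Suc_bij, symmetric]) (simp add: case_prod_beta)
  also have "\<dots> = (\<Sum>b\<le>k. \<Sum>p | p permutes {..<k}. g (Transposition.transpose k b \<circ> p))"
    by (rule sum.cartesian_product[symmetric])
  also have "\<dots> = (\<Sum>p | p permutes {..<k}. \<Sum>b\<le>k. g (Transposition.transpose k b \<circ> p))"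
    by (rule sum.swap)
  also have "\<dots> = (\<Sum>p | p permutes {..<k}. g p + (\<Sum>b<k. g (Transposition.transpose k b \<circ> p)))"
  proof (rule sum.cong[OF refl])
    fix p :: "nat \<Rightarrow> nat"
    have "{..k} = insert k {..<k}" by auto
    then show "(\<Sum>b\<le>k. g (Transposition.transpose k b \<circ> p)) = g p + (\<Sum>b<k. g (Transposition.transpose k b \<circ> p))"
      by simp
  qed
  finally show ?thesis .
qed

text \<open>The right side is the falling factorial, the trace of \<open>k!\<close> times the
  antisymmetrizer. In passing from \<open>k\<close> to \<open>k + 1\<close> a fixed last point
  contributes \<open>z\<close>, and each of the \<open>k\<close> transpositions with it contributes
  -1 without changing the number of cycles.\<close>

lemma sum_sign_cyc:
  fixes z :: complex
  shows "(\<Sum>p | p permutes {..<k}. of_int (sign p) * z ^ cyc k p) = (\<Prod>i<k. z - of_nat i)"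
proof (induction k)
  case 0
  have "{p. p permutes {..<0::nat}} = {id}" by auto
  moreover have "(2::nat) ^ cyc 0 id = 1"
    using card_cyc[of id 0 2] by (simp add: permutes_id)
  then have "cyc 0 id = 0" by (cases "cyc 0 id") auto
  then have "cyc 0 (\<lambda>x. x) = 0" by (simp only: id_def)
  ultimately show ?case by (simp add: sign_id)
next
  case (Suc k)
  have "(\<Sum>p | p permutes {..<Suc k}. of_int (sign p) * z ^ cyc (Suc k) p) =
      (\<Sum>p | p permutes {..<k}. (z - of_nat k) * (of_int (sign p) * z ^ cyc k p))"
    unfolding sum_permutes_Suc
  proof (rule sum.cong[OF refl])
    fix p assume "p \<in> {p. p permutes {..<k}}"
    then have p: "p permutes {..<k}" by simp
    have pp: "permutation p" using p permutation_permutes by blast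
    have "(\<Sum>b<k. of_int (sign (Transposition.transpose k b \<circ> p)) * z ^ cyc (Suc k) (Transposition.transpose k b \<circ> p)) =
        (\<Sum>b<k. - (of_int (sign p) * z ^ cyc k p))"
    proof (rule sum.cong[OF refl])
      fix b assume "b \<in> {..<k}"
      then have b: "b < k" by simp
      have "sign (Transposition.transpose k b \<circ> p) = - sign p"
        using sign_compose[OF permutation_swap_id pp, of k b] b by (simp add: sign_swap_id)
      then show "of_int (sign (Transposition.transpose k b \<circ> p)) * z ^ cyc (Suc k) (Transposition.transpose k b \<circ> p) =
          - (of_int (sign p) * z ^ cyc k p)"
        using cyc_Suc_transpose[OF p b] by simp
    qed
    then show "of_int (sign p) * z ^ cyc (Suc k) p + (\<Sum>b<k. of_int (sign (Transposition.transpose k b \<circ> p)) * z ^ cyc (Suc k) (Transposition.transpose k b \<circ> p)) =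
        (z - of_nat k) * (of_int (sign p) * z ^ cyc k p)"
      by (simp add: cyc_Suc_fix[OF p] algebra_simps)
  qed
  then show ?case using Suc.IH by (simp add: sum_distrib_left[symmetric] mult.commute)
qed

section \<open>Convolution and idempotents\<close>

lemma E_mult_E:
  "E k \<alpha> 0 * E k \<alpha>' 0 = (\<Sum>r | r permutes {..<k}. single (emb 0 r) (\<Sum>p | p permutes {..<k}. \<alpha> p * \<alpha>' (inv p \<circ> r)))"
proof -
  have "E k \<alpha> 0 * E k \<alpha>' 0 = (\<Sum>p | p permutes {..<k}. \<Sum>q | q permutes {..<k}. single (emb 0 (p \<circ> q)) (\<alpha> p * \<alpha>' q))"
    unfolding E_def sum_product by (intro sum.cong refl) (simp add: mult_single emb_plus permutes_bij)
  also have "\<dots> = (\<Sum>p | p permutes {..<k}. \<Sum>r | r permutes {..<k}. single (emb 0 r) (\<alpha> p * \<alpha>' (inv p \<circ> r)))"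
  proof (rule sum.cong[OF refl])
    fix p assume "p \<in> {p. p permutes {..<k}}"
    then have p: "p permutes {..<k}" by simp
    have bb: "bij_betw (\<lambda>q. p \<circ> q) {q. q permutes {..<k}} {q. q permutes {..<k}}"
      by (rule bij_betw_byWitness[where f' = "\<lambda>q. inv p \<circ> q"])
        (use p in \<open>auto simp: fun_eq_iff permutes_inverses intro!: permutes_compose permutes_inv\<close>)
    have "(\<Sum>r | r permutes {..<k}. single (emb 0 r) (\<alpha> p * \<alpha>' (inv p \<circ> r))) =
        (\<Sum>q | q permutes {..<k}. single (emb 0 (p \<circ> q)) (\<alpha> p * \<alpha>' (inv p \<circ> (p \<circ> q))))"
      by (rule sum.reindex_bij_betw[OF bb, symmetric])
    moreover have "inv p \<circ> (p \<circ> q) = q" for q :: "nat \<Rightarrow> nat" using permutes_inv_o(2)[OF p] by (simp add: comp_assoc[symmetric])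
    ultimately show "(\<Sum>q | q permutes {..<k}. single (emb 0 (p \<circ> q)) (\<alpha> p * \<alpha>' q)) =
        (\<Sum>r | r permutes {..<k}. single (emb 0 r) (\<alpha> p * \<alpha>' (inv p \<circ> r)))"
      by (simp only:)
  qed
  also have "\<dots> = (\<Sum>r | r permutes {..<k}. \<Sum>p | p permutes {..<k}. single (emb 0 r) (\<alpha> p * \<alpha>' (inv p \<circ> r)))"
    by (rule sum.swap)
  finally show ?thesis
  proof (rule trans, intro sum.cong refl)
    have ss: "(\<Sum>p\<in>A. single g (h p)) = single g (\<Sum>p\<in>A. h p)" for A and g :: gp and h :: "(nat \<Rightarrow> nat) \<Rightarrow> complex"
      by (induction A rule: infinite_finite_induct) (auto simp: single_add)
    show "(\<Sum>p | p permutes {..<k}. single (emb 0 r) (\<alpha> p * \<alpha>' (inv p \<circ> r))) =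
        single (emb 0 r) (\<Sum>p | p permutes {..<k}. \<alpha> p * \<alpha>' (inv p \<circ> r))" for r
      by (rule ss)
  qed
qed

lemma idempotentI:
  assumes "\<And>r. r permutes {..<k} \<Longrightarrow> (\<Sum>p | p permutes {..<k}. \<alpha> p * \<alpha> (inv p \<circ> r)) = \<alpha> r"
  shows "idempotent k \<alpha>"
  by standard (subst E_mult_E, simp add: E_def assms)

lemma sign_bij_sum:
  fixes g :: "(nat \<Rightarrow> nat) \<Rightarrow> complex"
  assumes "l \<le> k"
  shows "(\<Sum>p | p permutes {..<k}. (if p permutes {..<l} then g p else 0)) = (\<Sum>p | p permutes {..<l}. g p)"
proof -
  have "{p. p permutes {..<l}} \<subseteq> {p. p permutes {..<k}}"
    using permutes_subset[of _ "{..<l}" "{..<k}"] assms by auto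
  then have "{p. p permutes {..<k}} \<inter> {p. p permutes {..<l}} = {p. p permutes {..<l}}" by blast
  then show ?thesis by (simp add: sum.If_cases finite_permutations)
qed

context rank_bounded
begin

lemma n_ge_0: "n \<ge> 0"
proof -
  have "0 \<le> ereal (n ^ 1)" by (rule order.trans[OF _ rank[of 1]]) simp
  then show ?thesis by simp
qed

lemma block_system_intro:
  assumes "idempotent k \<alpha>" "finite V0" "finite E0" "v0 ` {..<k} \<subseteq> V0" "\<epsilon>0 ` {..<k} \<subseteq> E0"
    "\<And>h. h \<in> E0 \<Longrightarrow> card {x\<in>{..<k}. \<epsilon>0 x = h} = 2"
  shows "block_system f n k \<alpha> v0 V0 \<epsilon>0 E0"
  using assms rank_bounded_axioms by (simp add: block_system_def block_system_axioms_def)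

text \<open>
  Were \<open>n\<close> not an integer, an antisymmetrizer on \<open>\<lfloor>n\<rfloor> + 2\<close> strands would be an idempotent of
  negative trace. A further strand is added if necessary to make the number of legs even.
\<close>

lemma n_nat: "n \<in> \<nat>"
proof (rule ccontr)
  assume nn: "n \<notin> \<nat>"
  \<comment> \<open>For this \<open>l\<close> exactly one of the factors \<open>n - i\<close> with
    \<open>i < l\<close> is negative, namely the last one.\<close>
  define l where "l = nat \<lfloor>n\<rfloor> + 2"
  define k where "k = (if even l then l else Suc l)"
  have lk: "l \<le> k" and ek: "even k" by (auto simp: k_def)
  define \<alpha> where "\<alpha> p = (if p permutes {..<l} then of_int (sign p) / fact l else 0 :: complex)" for p
  have n0: "n > 0" using n_ge_0 nn by (metis Nats_0 order_le_less)
  have idem: "idempotent k \<alpha>"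
  proof (rule idempotentI)
    fix r assume r: "r permutes {..<k}"
    have "(\<Sum>p | p permutes {..<k}. \<alpha> p * \<alpha> (inv p \<circ> r)) =
        (\<Sum>p | p permutes {..<k}. if p permutes {..<l} then of_int (sign p) / fact l * \<alpha> (inv p \<circ> r) else 0)"
      by (rule sum.cong) (auto simp: \<alpha>_def)
    also have "\<dots> = (\<Sum>p | p permutes {..<l}. of_int (sign p) / fact l * \<alpha> (inv p \<circ> r))"
      by (rule sign_bij_sum[OF lk])
    also have "\<dots> = (\<Sum>p | p permutes {..<l}. \<alpha> r / fact l)"
    proof (rule sum.cong[OF refl])
      fix p assume "p \<in> {p. p permutes {..<l}}"
      then have p: "p permutes {..<l}" by simp
      have pr: "p \<circ> (inv p \<circ> r) = r" using permutes_inv_o(1)[OF p] by (simp add: comp_assoc[symmetric])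
      have iff: "inv p \<circ> r permutes {..<l} \<longleftrightarrow> r permutes {..<l}"
      proof
        assume "inv p \<circ> r permutes {..<l}"
        from permutes_compose[OF this p] show "r permutes {..<l}" by (simp only: pr)
      qed (use permutes_compose permutes_inv[OF p] in blast)
      show "of_int (sign p) / fact l * \<alpha> (inv p \<circ> r) = \<alpha> r / fact l"
      proof (cases "r permutes {..<l}")
        case True
        have "permutation p" "permutation r" "permutation (inv p)"
          using p True permutes_inv[OF p] permutation_permutes by blast+
        then have "sign (inv p \<circ> r) = sign p * sign r" by (simp add: sign_compose sign_inverse)
        moreover have "sign p * sign p = 1" by (simp add: sign_def)
        then have "of_int (sign p) * (of_int (sign p) :: complex) = 1" by (metis of_int_1 of_int_mult)
        ultimately show ?thesis using True iff by (simp add: \<alpha>_def mult.assoc[symmetric])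
      qed (use iff in \<open>simp add: \<alpha>_def\<close>)
    qed
    also have "\<dots> = \<alpha> r" using card_permutations[of "{..<l}" l] by simp
    finally show "(\<Sum>p | p permutes {..<k}. \<alpha> p * \<alpha> (inv p \<circ> r)) = \<alpha> r" .
  qed
  have fib: "card {x\<in>{..<k}. x div 2 = h} = 2" if "h \<in> {..<k div 2}" for h
  proof -
    have "{x\<in>{..<k}. x div 2 = h} = {2 * h, 2 * h + 1}" using that ek by (auto elim!: evenE)
    then show ?thesis by simp
  qed
  \<comment> \<open>Any graph with \<open>k\<close> half-edges will do, here one vertex with
    \<open>k div 2\<close> loops, since \<open>trace_zero\<close> speaks only of the trace of the
    idempotent.\<close>
  interpret block_system f n k \<alpha> "\<lambda>_. 0" "{0}" "\<lambda>x. x div 2" "{..<k div 2}"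
    by (rule block_system_intro[OF idem]) (use fib ek in \<open>auto elim!: evenE\<close>)
  have cyck: "of_real n ^ cyc k p = of_real n ^ (k - l) * (of_real n ^ cyc l p :: complex)" if "p permutes {..<l}" for p
    using cyc_Suc_fix[OF that] by (auto simp: k_def)
  have "\<epsilon> = (\<Sum>p | p permutes {..<k}. if p permutes {..<l} then of_int (sign p) / fact l * of_real n ^ cyc k p else 0)"
    unfolding \<epsilon>_def cyc_def[symmetric] by (rule sum.cong) (auto simp: \<alpha>_def)
  also have "\<dots> = (\<Sum>p | p permutes {..<l}. of_int (sign p) / fact l * of_real n ^ cyc k p)"
    by (rule sign_bij_sum[OF lk])
  also have "\<dots> = of_real n ^ (k - l) / fact l * (\<Sum>p | p permutes {..<l}. of_int (sign p) * of_real n ^ cyc l p)"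
    unfolding sum_distrib_left by (rule sum.cong) (auto simp: cyck)
  also have "\<dots> = of_real (n ^ (k - l) / fact l * (\<Prod>i<l. n - real i))"
    unfolding sum_sign_cyc by simp
  finally have eps: "\<epsilon> = of_real (n ^ (k - l) / fact l * (\<Prod>i<l. n - real i))" .
  have "(\<Prod>i<l. n - real i) < 0"
  proof -
    define m where "m = nat \<lfloor>n\<rfloor>"
    have m: "real m < n" "n < real m + 1"
    proof -
      have "real m \<le> n" "n < real m + 1" using n0 unfolding m_def by linarith+
      moreover have "n \<noteq> real m" using nn by auto
      ultimately show "real m < n" "n < real m + 1" by auto
    qed
    have "(\<Prod>i<Suc m. n - real i) > 0" by (rule prod_pos) (use m in auto)
    moreover have "(\<Prod>i<l. n - real i) = (\<Prod>i<Suc m. n - real i) * (n - real (Suc m))" by (simp add: l_def m_def)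
    ultimately show ?thesis using m by (simp only: mult_less_0_iff) simp
  qed
  then have neg: "n ^ (k - l) / fact l * (\<Prod>i<l. n - real i) < 0"
    using n0 by (intro mult_pos_neg) auto
  from trace_zero[OF eps less_imp_le[OF neg]] have "\<epsilon> = 0" .
  then show False using eps neg by (metis of_real_eq_0_iff less_irrefl)
qed

end

section \<open>Values at stars\<close>

text \<open>The half-edge \<open>x\<close> is split into its edge end at \<open>w x\<close> and its
  vertex end at \<open>v x\<close>, and \<open>p\<close> tells which vertex end is joined to which
  edge end. The uncut graph is the case \<open>p = id\<close>.\<close>

definition star :: "nat \<Rightarrow> (nat \<Rightarrow> nat) \<Rightarrow> nat set \<Rightarrow> (nat \<Rightarrow> nat) \<Rightarrow> nat set \<Rightarrow> (nat \<Rightarrow> nat) \<Rightarrow> (nat, nat) multigraph" where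
  "star k v V w H p = Multigraph V H (\<lambda>h. image_mset (\<lambda>x. v (p x)) (mset_set {x\<in>{..<k}. w x = h}))"

definition star_data :: "nat \<Rightarrow> (nat \<Rightarrow> nat) \<Rightarrow> nat set \<Rightarrow> (nat \<Rightarrow> nat) \<Rightarrow> nat set \<Rightarrow> bool" where
  "star_data k v V w H \<longleftrightarrow> finite V \<and> finite H \<and> v ` {..<k} \<subseteq> V \<and> w ` {..<k} \<subseteq> H \<and>
    (\<forall>h\<in>H. card {x\<in>{..<k}. w x = h} = 2)"

context rank_bounded
begin

text \<open>The assumption says that \<open>x\<close> lies in the kernel of the Gram matrix. The
  projection \<open>e\<close> of the identity to this kernel acts on it as a unit under convolution
  from the right, because it differs from the identity by translates of the class function
  \<open>?N\<close>, which the kernel annihilates. So \<open>e\<close> is idempotent, and its trace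
  is 0 as \<open>e\<close> lies in the kernel itself. By \<open>q_zero\<close> the values of
  \<open>f\<close> vanish at \<open>e\<close>, and \<open>x = x * e\<close> extends this to
  \<open>x\<close>.\<close>

lemma gram_residual_zero:
  assumes D: "star_data k v V w H"
    and x: "\<And>r. r permutes {..<k} \<Longrightarrow> (\<Sum>p | p permutes {..<k}. x p * of_real n ^ cyc k (p \<circ> inv r)) = 0"
  shows "(\<Sum>p | p permutes {..<k}. x p * f (graph_of (star k v V w H p))) = 0"
proof -
  let ?P = "{p. p permutes {..<k}}"
  let ?N = "\<lambda>p. of_real n ^ cyc k p :: complex"
  have finP: "finite ?P" by (simp add: finite_permutations)
  \<comment> \<open>The residual of the unit vector at \<open>id\<close> is orthogonal to all
    columns; as the columns are real, this is the kernel condition without conjugates.\<close>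
  obtain c where c: "\<forall>r\<in>?P. (\<Sum>p\<in>?P. ((if p = id then 1 else 0) - (\<Sum>s\<in>?P. c s * ?N (p \<circ> inv s))) * cnj (?N (p \<circ> inv r))) = 0"
    using orthogonal_projection[OF finP finP, of "\<lambda>p. if p = id then 1 else 0" "\<lambda>s p. ?N (p \<circ> inv s)"] by blast
  define e where "e p = (if p = id then 1 else 0) - (\<Sum>s\<in>?P. c s * ?N (p \<circ> inv s))" for p
  have e: "(\<Sum>p\<in>?P. e p * ?N (p \<circ> inv r)) = 0" if "r \<in> ?P" for r
    using c that unfolding e_def by simp
  have swp: "(\<Sum>p\<in>?P. y p * ?N (inv p \<circ> r)) = 0"
    if y: "\<And>r. r \<in> ?P \<Longrightarrow> (\<Sum>p\<in>?P. y p * ?N (p \<circ> inv r)) = 0" and r: "r \<in> ?P" for y r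
  proof -
    have "(\<Sum>p\<in>?P. y p * ?N (inv p \<circ> r)) = (\<Sum>p\<in>?P. y p * ?N (p \<circ> inv r))"
      by (rule sum.cong) (use r cyc_inv_comp in auto)
    then show ?thesis using y[OF r] by simp
  qed
  have conv: "(\<Sum>p\<in>?P. y p * e (inv p \<circ> r)) = y r"
    if y: "\<And>r. r \<in> ?P \<Longrightarrow> (\<Sum>p\<in>?P. y p * ?N (p \<circ> inv r)) = 0" and r: "r \<in> ?P" for y r
  proof -
    have "(\<Sum>p\<in>?P. y p * e (inv p \<circ> r)) = (\<Sum>p\<in>?P. y p * (if inv p \<circ> r = id then 1 else 0)) -
        (\<Sum>p\<in>?P. \<Sum>s\<in>?P. c s * (y p * ?N (inv p \<circ> r \<circ> inv s)))"
      unfolding e_def by (simp add: right_diff_distrib sum_subtractf sum_distrib_left mult_ac)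
    also have "(\<Sum>p\<in>?P. \<Sum>s\<in>?P. c s * (y p * ?N (inv p \<circ> r \<circ> inv s))) =
        (\<Sum>s\<in>?P. c s * (\<Sum>p\<in>?P. y p * ?N (inv p \<circ> (r \<circ> inv s))))"
      by (subst sum.swap) (simp add: sum_distrib_left comp_assoc)
    also have "\<dots> = 0"
      by (rule sum.neutral) (use r in \<open>auto intro!: swp[OF y] permutes_compose permutes_inv\<close>)
    also have "(\<Sum>p\<in>?P. y p * (if inv p \<circ> r = id then 1 else 0)) = (\<Sum>p\<in>?P. if p = r then y p else 0)"
    proof (rule sum.cong[OF refl])
      fix p assume "p \<in> ?P"
      then have p: "p permutes {..<k}" by simp
      have "inv p \<circ> r = id \<longleftrightarrow> p = r"
      proof
        assume "inv p \<circ> r = id"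
        then have "p \<circ> (inv p \<circ> r) = p" by simp
        then show "p = r" using permutes_inv_o(1)[OF p] by (simp add: comp_assoc[symmetric])
      qed (use permutes_inv_o(2)[OF p] in simp)
      then show "y p * (if inv p \<circ> r = id then 1 else 0) = (if p = r then y p else 0)" by simp
    qed
    also have "\<dots> = y r" using r finP by simp
    finally show ?thesis by (simp only: diff_zero)
  qed
  have idem: "idempotent k e"
    by (rule idempotentI, rule conv[OF e]) simp_all
  \<comment> \<open>Replacing \<open>v\<close> by \<open>v \<circ> g\<close> gives star data again,
    so \<open>q_zero\<close> covers all left translates of \<open>e\<close>.\<close>
  have key: "(\<Sum>p\<in>?P. e p * f (graph_of (star k v V w H (g \<circ> p)))) = 0" if g: "g \<in> ?P" for g
  proof -
    have gx: "g x < k" if "x < k" for x using g permutes_in_image[of g "{..<k}" x] that by simp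
    interpret block_system f n k e "v \<circ> g" V w H
      by (rule block_system_intro[OF idem]) (use D gx in \<open>auto simp: star_data_def\<close>)
    have "idempotent.\<epsilon> k e n = (\<Sum>p\<in>?P. e p * ?N (p \<circ> inv id))"
      unfolding \<epsilon>_def cyc_def by simp
    also have "\<dots> = 0" by (rule e) (simp add: permutes_id)
    finally have "q = 0" by (rule q_zero)
    then show ?thesis unfolding q_def SG_def star_def comp_apply .
  qed
  have x': "(\<Sum>p\<in>?P. x p * ?N (p \<circ> inv r)) = 0" if "r \<in> ?P" for r using x that by simp
  have "0 = (\<Sum>g\<in>?P. x g * (\<Sum>p\<in>?P. e p * f (graph_of (star k v V w H (g \<circ> p)))))"
    using key by simp
  also have "\<dots> = (\<Sum>g\<in>?P. \<Sum>p\<in>?P. x g * (e p * f (graph_of (star k v V w H (g \<circ> p)))))"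
    by (simp add: sum_distrib_left)
  also have "\<dots> = (\<Sum>g\<in>?P. \<Sum>h\<in>?P. x g * (e (inv g \<circ> h) * f (graph_of (star k v V w H h))))"
  proof (rule sum.cong[OF refl])
    fix g assume "g \<in> ?P"
    then have g: "g permutes {..<k}" by simp
    have bb: "bij_betw (\<lambda>p. g \<circ> p) ?P ?P"
      by (rule bij_betw_byWitness[where f' = "\<lambda>q. inv g \<circ> q"])
        (use g in \<open>auto simp: fun_eq_iff permutes_inverses intro!: permutes_compose permutes_inv\<close>)
    have "inv g \<circ> (g \<circ> p) = p" for p :: "nat \<Rightarrow> nat" using permutes_inv_o(2)[OF g] by (simp add: comp_assoc[symmetric])
    then show "(\<Sum>p\<in>?P. x g * (e p * f (graph_of (star k v V w H (g \<circ> p))))) =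
        (\<Sum>h\<in>?P. x g * (e (inv g \<circ> h) * f (graph_of (star k v V w H h))))"
      by (subst sum.reindex_bij_betw[OF bb, symmetric]) simp
  qed
  also have "\<dots> = (\<Sum>h\<in>?P. (\<Sum>g\<in>?P. x g * e (inv g \<circ> h)) * f (graph_of (star k v V w H h)))"
    by (subst sum.swap) (simp add: sum_distrib_right mult.assoc)
  also have "\<dots> = (\<Sum>h\<in>?P. x h * f (graph_of (star k v V w H h)))"
  proof (rule sum.cong[OF refl])
    fix h assume h: "h \<in> ?P"
    have "(\<Sum>g\<in>?P. x g * e (inv g \<circ> h)) = x h" by (rule conv[OF x' h])
    then show "(\<Sum>g\<in>?P. x g * e (inv g \<circ> h)) * f (graph_of (star k v V w H h)) = x h * f (graph_of (star k v V w H h))"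
      by (simp only:)
  qed
  finally show ?thesis by simp
qed

text \<open>The residual \<open>e\<close> of the values after projection to the columns lies in the
  kernel, and so does its complex conjugate since the matrix is real. By
  \<open>gram_residual_zero\<close> the conjugate pairs to 0 with the values, and by orthogonality
  with the projection, so \<open>e\<close> has norm 0.\<close>

lemma gram_solution:
  assumes D: "star_data k v V w H"
  shows "\<exists>a. \<forall>p. p permutes {..<k} \<longrightarrow>
    (\<Sum>s | s permutes {..<k}. a s * of_real n ^ cyc k (p \<circ> inv s)) = f (graph_of (star k v V w H p))"
proof -
  let ?P = "{p. p permutes {..<k}}"
  let ?N = "\<lambda>p. of_real n ^ cyc k p :: complex"
  let ?F = "\<lambda>p. f (graph_of (star k v V w H p))"
  have finP: "finite ?P" by (simp add: finite_permutations)
  obtain c where c: "\<forall>r\<in>?P. (\<Sum>p\<in>?P. (?F p - (\<Sum>s\<in>?P. c s * ?N (p \<circ> inv s))) * cnj (?N (p \<circ> inv r))) = 0"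
    using orthogonal_projection[OF finP finP, of ?F "\<lambda>s p. ?N (p \<circ> inv s)"] by blast
  define e where "e p = ?F p - (\<Sum>s\<in>?P. c s * ?N (p \<circ> inv s))" for p
  have e: "(\<Sum>p\<in>?P. e p * ?N (p \<circ> inv r)) = 0" if "r \<in> ?P" for r
    using c that unfolding e_def by simp
  have ce: "(\<Sum>p\<in>?P. cnj (e p) * ?N (p \<circ> inv r)) = 0" if "r \<in> ?P" for r
  proof -
    have "(\<Sum>p\<in>?P. cnj (e p) * ?N (p \<circ> inv r)) = cnj (\<Sum>p\<in>?P. e p * ?N (p \<circ> inv r))" by simp
    then show ?thesis using e[OF that] by simp
  qed
  have "(\<Sum>p\<in>?P. cnj (e p) * ?F p) = 0"
    by (rule gram_residual_zero[OF D]) (use ce in simp)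
  moreover have "(\<Sum>p\<in>?P. cnj (e p) * (\<Sum>s\<in>?P. c s * ?N (p \<circ> inv s))) = 0"
  proof -
    have "(\<Sum>p\<in>?P. cnj (e p) * (\<Sum>s\<in>?P. c s * ?N (p \<circ> inv s))) = (\<Sum>s\<in>?P. c s * (\<Sum>p\<in>?P. cnj (e p) * ?N (p \<circ> inv s)))"
      unfolding sum_distrib_left by (subst sum.swap) (simp add: mult_ac)
    then show ?thesis using ce by simp
  qed
  ultimately have "(\<Sum>p\<in>?P. cnj (e p) * e p) = 0"
    unfolding e_def by (simp add: right_diff_distrib sum_subtractf)
  moreover have "(\<Sum>p\<in>?P. cnj (e p) * e p) = of_real (\<Sum>p\<in>?P. (cmod (e p))\<^sup>2)"
    unfolding of_real_sum by (intro sum.cong refl) (simp only: complex_norm_square mult.commute)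
  ultimately have "(\<Sum>p\<in>?P. (cmod (e p))\<^sup>2) = 0" by (metis of_real_eq_0_iff)
  then have "e p = 0" if "p \<in> ?P" for p
    using finP that by (subst (asm) sum_nonneg_eq_0_iff) auto
  then show ?thesis by (intro exI[of _ c]) (simp add: e_def)
qed

end

section \<open>Monomials and coefficients\<close>

lemma sum_PiE_insert:
  assumes "finite S" "x \<notin> S"
  shows "(\<Sum>d\<in>insert x S \<rightarrow>\<^sub>E T. g d) = (\<Sum>d\<in>S \<rightarrow>\<^sub>E T. \<Sum>i\<in>T. g (d(x := i)))"
proof -
  have "(\<Sum>d\<in>insert x S \<rightarrow>\<^sub>E T. g d) = (\<Sum>d\<in>(\<lambda>(y, g). g(x := y)) ` (T \<times> (S \<rightarrow>\<^sub>E T)). g d)"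
    by (simp only: PiE_insert_eq)
  also have "\<dots> = (\<Sum>(y, d)\<in>T \<times> (S \<rightarrow>\<^sub>E T). g (d(x := y)))"
    by (subst sum.reindex[OF inj_combinator[OF assms(2)]]) (simp add: case_prod_beta comp_def)
  also have "\<dots> = (\<Sum>y\<in>T. \<Sum>d\<in>S \<rightarrow>\<^sub>E T. g (d(x := y)))" by (rule sum.cartesian_product[symmetric])
  finally show ?thesis by (simp only: sum.swap[of _ "S \<rightarrow>\<^sub>E T"])
qed

lemma mset_image_eq_bij:
  assumes "finite X" "finite Y" "image_mset f (mset_set X) = image_mset g (mset_set Y)"
  shows "\<exists>h. bij_betw h X Y \<and> (\<forall>a\<in>X. g (h a) = f a)"
  using assms
proof (induction X arbitrary: Y rule: finite_induct)
  case empty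
  then have "Y = {}" by (simp add: mset_set_empty_iff)
  then show ?case by (auto simp: bij_betw_def)
next
  case (insert a X)
  have "f a \<in># image_mset g (mset_set Y)" using insert.prems(2)[symmetric] insert.hyps by simp
  then obtain b where b: "b \<in> Y" "g b = f a" using insert.prems(1) by auto
  have "image_mset f (mset_set X) = image_mset g (mset_set (Y - {b}))"
  proof -
    have "image_mset g (mset_set (Y - {b})) = image_mset g (mset_set Y) - {#f a#}"
      using insert.prems(1) b by (simp add: mset_set_Diff image_mset_Diff)
    also have "\<dots> = add_mset (f a) (image_mset f (mset_set X)) - {#f a#}"
      using insert.prems(2)[symmetric] insert.hyps by simp
    finally show ?thesis by simp
  qed
  then obtain h where h: "bij_betw h X (Y - {b})" "\<forall>a\<in>X. g (h a) = f a"
    using insert.IH[of "Y - {b}"] insert.prems(1) by auto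
  have "bij_betw (h(a := b)) X (Y - {b})"
  proof -
    have "(h(a := b)) x = h x" if "x \<in> X" for x using insert.hyps(2) that by auto
    then have "bij_betw (h(a := b)) X (Y - {b}) = bij_betw h X (Y - {b})" by (rule bij_betw_cong)
    then show ?thesis using h(1) by simp
  qed
  then have "bij_betw (h(a := b)) (X \<union> {a}) (Y - {b} \<union> {b})"
    by (rule bij_betw_combine) auto
  moreover have e: "X \<union> {a} = insert a X" "Y - {b} \<union> {b} = Y" using b by auto
  ultimately have bb: "bij_betw (h(a := b)) (insert a X) Y" by (simp only:)
  have "\<forall>x\<in>insert a X. g ((h(a := b)) x) = f x" using h(2) b insert.hyps by auto
  then show ?case using bb by blast
qed

text \<open>The monomial in the variables \<open>Y\<close> belonging to a colouring of the legs: one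
  variable per vertex, indexed by the colours of the legs there. Applied to edges instead of
  vertices it gives the monomial in the \<open>g\<close>.\<close>

definition vmon :: "nat \<Rightarrow> (nat \<Rightarrow> nat) \<Rightarrow> nat set \<Rightarrow> (nat \<Rightarrow> nat) \<Rightarrow> nat multiset multiset" where
  "vmon k v V c = image_mset (\<lambda>u. image_mset c (mset_set {x\<in>{..<k}. v x = u})) (mset_set V)"

text \<open>Equal monomials differ only by renaming: first the vertices are matched so that the
  colours at them agree, then the legs at each pair of matched vertices.\<close>

lemma vmon_bij:
  assumes V: "finite V" "v ` {..<k} \<subseteq> V" and V2: "finite V2" "v2 ` {..<k2} \<subseteq> V2"
    and eq: "vmon k v V c = vmon k2 v2 V2 c2"
  shows "\<exists>\<pi> g. bij_betw \<pi> {..<k} {..<k2} \<and> bij_betw g V V2 \<and> (\<forall>x<k. v2 (\<pi> x) = g (v x) \<and> c2 (\<pi> x) = c x)"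
proof -
  obtain g where g: "bij_betw g V V2" and gm: "\<forall>u\<in>V. image_mset c2 (mset_set {x\<in>{..<k2}. v2 x = g u}) = image_mset c (mset_set {x\<in>{..<k}. v x = u})"
    using mset_image_eq_bij[OF V(1) V2(1) eq[unfolded vmon_def]] by blast
  have "\<forall>u\<in>V. \<exists>h. bij_betw h {x\<in>{..<k}. v x = u} {x\<in>{..<k2}. v2 x = g u} \<and> (\<forall>x\<in>{x\<in>{..<k}. v x = u}. c2 (h x) = c x)"
  proof
    fix u assume "u \<in> V"
    then show "\<exists>h. bij_betw h {x\<in>{..<k}. v x = u} {x\<in>{..<k2}. v2 x = g u} \<and> (\<forall>x\<in>{x\<in>{..<k}. v x = u}. c2 (h x) = c x)"
      using gm by (intro mset_image_eq_bij) auto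
  qed
  from bchoice[OF this] obtain h where hh: "\<forall>u\<in>V. bij_betw (h u) {x\<in>{..<k}. v x = u} {x\<in>{..<k2}. v2 x = g u} \<and>
    (\<forall>x\<in>{x\<in>{..<k}. v x = u}. c2 (h u x) = c x)" by (elim exE)
  have h: "bij_betw (h u) {x\<in>{..<k}. v x = u} {x\<in>{..<k2}. v2 x = g u}" if "u \<in> V" for u
    using hh[rule_format, OF that] by (rule conjunct1)
  have hc: "c2 (h u x) = c x" if "u \<in> V" "x \<in> {x\<in>{..<k}. v x = u}" for u x
    using bspec[OF conjunct2[OF bspec[OF hh that(1)]] that(2)] .
  define \<pi> where "\<pi> x = h (v x) x" for x
  have vV: "v x \<in> V" if "x < k" for x using V that by auto
  have \<pi>: "\<pi> x < k2 \<and> v2 (\<pi> x) = g (v x)" if "x < k" for x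
    using bij_betwE[OF h[OF vV[OF that]]] that unfolding \<pi>_def by auto
  have "bij_betw \<pi> {..<k} {..<k2}"
  proof (rule bij_betw_imageI)
    show "inj_on \<pi> {..<k}"
    proof (rule inj_onI)
      fix x y assume xy: "x \<in> {..<k}" "y \<in> {..<k}" "\<pi> x = \<pi> y"
      then have "g (v x) = g (v y)" using \<pi> by (metis lessThan_iff)
      then have "v x = v y" using g vV xy by (auto simp: bij_betw_def inj_on_def)
      then show "x = y" using xy h[OF vV[of x]] unfolding \<pi>_def by (auto simp: bij_betw_def inj_on_def)
    qed
    show "\<pi> ` {..<k} = {..<k2}"
    proof (intro equalityI subsetI)
      fix y assume y: "y \<in> {..<k2}"
      then have "v2 y \<in> g ` V" using V2 g by (auto simp: bij_betw_def)
      then obtain u where u: "u \<in> V" "v2 y = g u" by blast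
      then have "y \<in> h u ` {x\<in>{..<k}. v x = u}" using h[OF u(1)] y by (simp add: bij_betw_def)
      then obtain x where "x < k" "v x = u" "y = h u x" by auto
      then show "y \<in> \<pi> ` {..<k}" by (intro image_eqI[of _ _ x]) (auto simp: \<pi>_def)
    qed (use \<pi> in auto)
  qed
  moreover have "c2 (\<pi> x) = c x" if "x < k" for x
    using hc[OF vV[OF that], of x] that by (simp add: \<pi>_def)
  ultimately show ?thesis using g \<pi> by blast
qed

lemma vmon_exists:
  "\<exists>k v V c. finite V \<and> v ` {..<k} \<subseteq> V \<and> vmon k v V c = M \<and> k = (\<Sum>\<alpha>\<in>#M. size \<alpha>) \<and> (\<forall>x<k. \<exists>\<alpha>\<in>#M. c x \<in># \<alpha>)"
proof (induction M)
  case empty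
  show ?case by (intro exI[of _ 0] exI[of _ "\<lambda>_. 0"] exI[of _ "{}"]) (auto simp: vmon_def)
next
  case (add \<alpha> M)
  then obtain k v V c where h: "finite V" "v ` {..<k} \<subseteq> V" "vmon k v V c = M" "k = (\<Sum>\<alpha>\<in>#M. size \<alpha>)"
    "\<forall>x<k. \<exists>\<alpha>\<in>#M. c x \<in># \<alpha>" by blast
  obtain l where l: "mset l = \<alpha>" using ex_mset by blast
  obtain u where u: "u \<notin> V" using ex_new_if_finite[OF infinite_UNIV_nat h(1)] by blast
  define k' where "k' = k + length l"
  define v' where "v' x = (if x < k then v x else u)" for x
  define c' where "c' x = (if x < k then c x else l ! (x - k))" for x
  have 1: "{x\<in>{..<k'}. v' x = y} = {x\<in>{..<k}. v x = y}" if "y \<in> V" for y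
    using u that h(2) by (auto simp: v'_def k'_def)
  have "v x \<noteq> u" if "x < k" for x using u h(2) that by auto
  then have 2: "{x\<in>{..<k'}. v' x = u} = {k..<k'}" by (auto simp: v'_def k'_def not_less)
  have "image_mset c' (mset_set {k..<k'}) = image_mset (\<lambda>i. l ! i) (mset_set {..<length l})"
  proof -
    have "{k..<k'} = (\<lambda>i. i + k) ` {..<length l}" unfolding k'_def
      by (simp add: lessThan_atLeast0 add.commute)
    then have "mset_set {k..<k'} = image_mset (\<lambda>i. i + k) (mset_set {..<length l})"
      by (simp add: image_mset_mset_set inj_on_def)
    then show ?thesis by (simp add: multiset.map_comp comp_def c'_def)
  qed
  also have "\<dots> = mset l"
    by (metis lessThan_atLeast0 map_nth mset_map mset_upt)
  finally have 3: "image_mset c' (mset_set {x\<in>{..<k'}. v' x = u}) = \<alpha>" using l 2 by simp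
  have 4: "image_mset c' (mset_set {x\<in>{..<k'}. v' x = y}) = image_mset c (mset_set {x\<in>{..<k}. v x = y})" if "y \<in> V" for y
    unfolding 1[OF that] by (rule image_mset_cong) (auto simp: c'_def)
  have "vmon k' v' (insert u V) c' = add_mset \<alpha> M"
  proof -
    have "vmon k' v' (insert u V) c' = add_mset (image_mset c' (mset_set {x\<in>{..<k'}. v' x = u}))
        (image_mset (\<lambda>y. image_mset c' (mset_set {x\<in>{..<k'}. v' x = y})) (mset_set V))"
      unfolding vmon_def mset_set.insert[OF h(1) u] by (rule image_mset_add_mset)
    also have "image_mset (\<lambda>y. image_mset c' (mset_set {x\<in>{..<k'}. v' x = y})) (mset_set V) = M"
      unfolding h(3)[symmetric] vmon_def by (rule image_mset_cong) (use h(1) 4 in simp)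
    finally show ?thesis unfolding 3 .
  qed
  moreover have "v' ` {..<k'} \<subseteq> insert u V" using h(2) by (auto simp: v'_def)
  moreover have "k' = (\<Sum>\<alpha>\<in>#add_mset \<alpha> M. size \<alpha>)" using h(4) l by (auto simp: k'_def)
  moreover have "\<exists>\<alpha>\<in>#add_mset \<alpha> M. c' x \<in># \<alpha>" if "x < k'" for x
  proof (cases "x < k")
    case False
    then have "c' x \<in># \<alpha>" using that l by (auto simp: c'_def k'_def)
    then show ?thesis by simp
  qed (use h(5) in \<open>auto simp: c'_def\<close>)
  ultimately show ?case using h(1) by (intro exI[of _ k'] exI[of _ v'] exI[of _ "insert u V"] exI[of _ c']) auto
qed

lemma size_vmon:
  assumes "finite V" "v ` {..<k} \<subseteq> V"
  shows "(\<Sum>\<alpha>\<in>#vmon k v V c. size \<alpha>) = k"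
proof -
  have "(\<Sum>\<alpha>\<in>#vmon k v V c. size \<alpha>) = (\<Sum>u\<in>V. card {x\<in>{..<k}. v x = u})"
    by (simp add: vmon_def multiset.map_comp comp_def sum_unfold_sum_mset)
  also have "\<dots> = card (\<Union>u\<in>V. {x\<in>{..<k}. v x = u})"
    by (rule card_UN_disjoint[symmetric]) (use assms in auto)
  also have "(\<Union>u\<in>V. {x\<in>{..<k}. v x = u}) = {..<k}" using assms by auto
  finally show ?thesis by simp
qed

lemma vmon_memberD: "finite V \<Longrightarrow> \<alpha> \<in># vmon k v V c \<Longrightarrow> i \<in># \<alpha> \<Longrightarrow> \<exists>x<k. c x = i"
  by (auto simp: vmon_def)

section \<open>Disjoint sums of star structures\<close>

definition merge :: "nat \<Rightarrow> (nat \<Rightarrow> nat) \<Rightarrow> (nat \<Rightarrow> nat) \<Rightarrow> nat \<Rightarrow> nat" where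
  "merge k c d x = (if x < k then c x else d x)"

text \<open>The first structure is moved to the even and the second to the odd numbers, so that a
  disjoint sum stays on natural numbers.\<close>

definition sumf :: "nat \<Rightarrow> (nat \<Rightarrow> nat) \<Rightarrow> (nat \<Rightarrow> nat) \<Rightarrow> nat \<Rightarrow> nat" where
  "sumf k v v1 x = (if x < k then 2 * v x else 2 * v1 (x - k) + 1)"

definition sumV :: "nat set \<Rightarrow> nat set \<Rightarrow> nat set" where
  "sumV V V1 = (\<lambda>y. 2 * y) ` V \<union> (\<lambda>y. 2 * y + 1) ` V1"

lemma even_ne: "2 * (a::nat) \<noteq> 2 * b + 1" "2 * b + 1 \<noteq> 2 * (a::nat)"
  by presburger+

lemma sum_fibre_l: "{x\<in>{..<k + k1}. sumf k v v1 x = 2 * u} = {x\<in>{..<k}. v x = u}"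
  using even_ne by (auto simp: sumf_def split: if_splits)

lemma sum_fibre_r: "{x\<in>{..<k + k1}. sumf k v v1 x = 2 * u + 1} = (\<lambda>x. x + k) ` {x\<in>{..<k1}. v1 x = u}"
proof (intro equalityI subsetI)
  fix x assume "x \<in> {x\<in>{..<k + k1}. sumf k v v1 x = 2 * u + 1}"
  then have x: "x < k + k1" "sumf k v v1 x = 2 * u + 1" by auto
  then have "\<not> x < k" using even_ne(1)[of "v x" u] by (auto simp: sumf_def)
  then show "x \<in> (\<lambda>x. x + k) ` {x\<in>{..<k1}. v1 x = u}"
    using x by (intro image_eqI[of _ _ "x - k"]) (auto simp: sumf_def)
qed (auto simp: sumf_def)

lemma mset_set_sumV:
  assumes "finite V" "finite V1"
  shows "mset_set (sumV V V1) = image_mset (\<lambda>y. 2 * y) (mset_set V) + image_mset (\<lambda>y. 2 * y + 1) (mset_set V1)"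
  unfolding sumV_def using assms even_ne
  by (subst mset_set_Union) (auto simp: image_mset_mset_set inj_on_def)

lemma vmon_sum:
  assumes "finite V" "finite V1"
  shows "vmon (k + k1) (sumf k v v1) (sumV V V1) (merge k c (\<lambda>x. d (x - k))) = vmon k v V c + vmon k1 v1 V1 d"
proof -
  have l: "image_mset (merge k c (\<lambda>x. d (x - k))) (mset_set {x\<in>{..<k + k1}. sumf k v v1 x = 2 * u}) = image_mset c (mset_set {x\<in>{..<k}. v x = u})" for u
    unfolding sum_fibre_l by (rule image_mset_cong) (auto simp: merge_def)
  have r: "image_mset (merge k c (\<lambda>x. d (x - k))) (mset_set {x\<in>{..<k + k1}. sumf k v v1 x = 2 * u + 1}) = image_mset d (mset_set {x\<in>{..<k1}. v1 x = u})" for u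
  proof -
    have "mset_set ((\<lambda>x. x + k) ` {x\<in>{..<k1}. v1 x = u}) = image_mset (\<lambda>x. x + k) (mset_set {x\<in>{..<k1}. v1 x = u})"
      by (simp add: image_mset_mset_set inj_on_def)
    then show ?thesis unfolding sum_fibre_r by (simp add: multiset.map_comp comp_def merge_def)
  qed
  show ?thesis
    unfolding vmon_def mset_set_sumV[OF assms] image_mset_union multiset.map_comp comp_def l r ..
qed

lemma star_data_sum:
  assumes D: "star_data k v V w H" and D1: "star_data k1 v1 V1 w1 H1"
  shows "star_data (k + k1) (sumf k v v1) (sumV V V1) (sumf k w w1) (sumV H H1)"
proof -
  have im: "sumf k v v1 ` {..<k + k1} \<subseteq> sumV V V1" if "v ` {..<k} \<subseteq> V" "v1 ` {..<k1} \<subseteq> V1" for v v1 V V1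
    using that by (fastforce simp: sumf_def sumV_def image_subset_iff)
  have "card {x\<in>{..<k + k1}. sumf k w w1 x = h} = 2" if "h \<in> sumV H H1" for h
  proof -
    from that consider u where "u \<in> H" "h = 2 * u" | u where "u \<in> H1" "h = 2 * u + 1" by (auto simp: sumV_def)
    then show ?thesis
    proof cases
      case 1
      then show ?thesis using D unfolding 1(2) sum_fibre_l by (simp add: star_data_def)
    next
      case 2
      then show ?thesis using D1 unfolding 2(2) sum_fibre_r by (simp add: star_data_def card_image inj_on_def)
    qed
  qed
  then show ?thesis using im D D1 unfolding star_data_def by (auto simp: sumV_def)
qed

lemma wf_star:
  assumes D: "star_data k v V w H" and p: "p permutes {..<k}"
  shows "wf_multigraph (star k v V w H p)"
proof -
  have "v (p x) \<in> V" if "x < k" for x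
    using D permutes_in_image[OF p, of x] that by (auto simp: star_data_def)
  then show ?thesis using D unfolding wf_multigraph_def star_def star_data_def by auto
qed

text \<open>\<open>p\<close> fixes all legs from \<open>k\<close> on, so it recloses the first part
  and leaves the second part as the graph itself.\<close>

lemma star_sum_isomorphic:
  assumes D: "star_data k v V w H" and D1: "star_data k1 v1 V1 w1 H1" and p: "p permutes {..<k}"
  shows "isomorphic (disjoint_union (star k v V w H p) (star k1 v1 V1 w1 H1 id))
    (star (k + k1) (sumf k v v1) (sumV V V1) (sumf k w w1) (sumV H H1) p)"
proof -
  let ?b = "case_sum (\<lambda>y. 2 * y) (\<lambda>y. 2 * y + 1) :: nat + nat \<Rightarrow> nat"
  have bij: "bij_betw ?b (A <+> A') (sumV A A')" for A A'
  proof (rule bij_betw_imageI)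
    show "inj_on ?b (A <+> A')" using even_ne by (auto simp: inj_on_def)
    show "?b ` (A <+> A') = sumV A A'" by (auto simp: sumV_def Plus_def image_Un image_image)
  qed
  have px: "p x < k" if "x < k" for x using permutes_in_image[OF p, of x] that by simp
  have pk: "p (x + k) = x + k" for x using permutes_not_in[OF p] by simp
  have el: "image_mset (\<lambda>x. sumf k v v1 (p x)) (mset_set {x\<in>{..<k + k1}. sumf k w w1 x = 2 * h}) =
      image_mset (\<lambda>x. 2 * v (p x)) (mset_set {x\<in>{..<k}. w x = h})" for h
    unfolding sum_fibre_l by (rule image_mset_cong) (use px in \<open>auto simp: sumf_def\<close>)
  have er: "image_mset (\<lambda>x. sumf k v v1 (p x)) (mset_set {x\<in>{..<k + k1}. sumf k w w1 x = 2 * h + 1}) =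
      image_mset (\<lambda>x. 2 * v1 x + 1) (mset_set {x\<in>{..<k1}. w1 x = h})" for h
  proof -
    have "mset_set ((\<lambda>x. x + k) ` {x\<in>{..<k1}. w1 x = h}) = image_mset (\<lambda>x. x + k) (mset_set {x\<in>{..<k1}. w1 x = h})"
      by (simp add: image_mset_mset_set inj_on_def)
    then show ?thesis unfolding sum_fibre_r by (simp add: multiset.map_comp comp_def sumf_def pk)
  qed
  show ?thesis unfolding isomorphic_def
  proof (intro exI[of _ ?b] conjI ballI)
    show "bij_betw ?b (verts (disjoint_union (star k v V w H p) (star k1 v1 V1 w1 H1 id)))
        (verts (star (k + k1) (sumf k v v1) (sumV V V1) (sumf k w w1) (sumV H H1) p))"
      "bij_betw ?b (edges (disjoint_union (star k v V w H p) (star k1 v1 V1 w1 H1 id)))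
        (edges (star (k + k1) (sumf k v v1) (sumV V V1) (sumf k w w1) (sumV H H1) p))"
      using bij by (simp_all add: star_def)
    fix h assume "h \<in> edges (disjoint_union (star k v V w H p) (star k1 v1 V1 w1 H1 id))"
    then consider u where "h = Inl u" | u where "h = Inr u" by (cases h) auto
    then show "ends (star (k + k1) (sumf k v v1) (sumV V V1) (sumf k w w1) (sumV H H1) p) (?b h) =
        image_mset ?b (ends (disjoint_union (star k v V w H p) (star k1 v1 V1 w1 H1 id)) h)"
    proof cases
      case 1
      then show ?thesis using el[of u] unfolding star_def multigraph.sel sum.case disjoint_union_sel
        by (simp add: multiset.map_comp comp_def)
    next
      case 2
      then show ?thesis using er[of u] unfolding star_def multigraph.sel sum.case disjoint_union_sel
        by (simp add: multiset.map_comp comp_def)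
    qed
  qed
qed

text \<open>The matrix coefficient, at the basis vectors given by \<open>c\<close> and
  \<open>c'\<close>, of the element \<open>a\<close> of the group algebra acting on the
  \<open>k\<close>-fold tensor power by permutation of the factors.\<close>

definition val :: "nat \<Rightarrow> ((nat \<Rightarrow> nat) \<Rightarrow> complex) \<Rightarrow> (nat \<Rightarrow> nat) \<Rightarrow> (nat \<Rightarrow> nat) \<Rightarrow> complex" where
  "val k a c c' = (\<Sum>s | s permutes {..<k}. a s * of_bool (\<forall>x<k. c (s x) = c' x))"

lemma val_cong:
  assumes "\<And>x. x < k \<Longrightarrow> c x = d x" "\<And>x. x < k \<Longrightarrow> c' x = d' x"
  shows "val k a c c' = val k a d d'"
  unfolding val_def
proof (rule sum.cong[OF refl])
  fix s assume "s \<in> {s. s permutes {..<k}}"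
  then have "s x < k" if "x < k" for x using permutes_in_image[of s "{..<k}" x] that by simp
  then have "(\<forall>x<k. c (s x) = c' x) = (\<forall>x<k. d (s x) = d' x)" using assms by auto
  then show "a s * of_bool (\<forall>x<k. c (s x) = c' x) = a s * of_bool (\<forall>x<k. d (s x) = d' x)" by simp
qed

context
  fixes N :: nat
begin

abbreviation "cols k \<equiv> {..<k} \<rightarrow>\<^sub>E {..<N}"

text \<open>\<open>c \<circ> s = c \<circ> p\<close> means that \<open>c\<close> is constant on the
  cycles of \<open>p \<circ> inv s\<close>, so the sum over \<open>c\<close> is counted by
  \<open>card_cyc\<close>. Thus the linear system of \<open>gram_solution\<close> prescribes these
  traces.\<close>

lemma val_pairing:
  assumes p: "p permutes {..<k}"
  shows "(\<Sum>c\<in>cols k. val k a c (c \<circ> p)) = (\<Sum>s | s permutes {..<k}. a s * of_nat N ^ cyc k (p \<circ> inv s))"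
proof -
  have "(\<Sum>c\<in>cols k. of_bool (\<forall>x<k. c (s x) = (c \<circ> p) x)) = (of_nat N ^ cyc k (p \<circ> inv s) :: complex)"
    if s: "s permutes {..<k}" for s
  proof -
    have sx: "s x < k" "inv s x < k" if "x < k" for x
      using permutes_in_image[OF s, of x] permutes_in_image[OF permutes_inv[OF s], of x] that by simp_all
    have "(\<forall>x<k. c (s x) = (c \<circ> p) x) \<longleftrightarrow> (\<forall>x<k. c ((p \<circ> inv s) x) = c x)" for c :: "nat \<Rightarrow> nat"
    proof
      assume a: "\<forall>x<k. c (s x) = (c \<circ> p) x"
      show "\<forall>x<k. c ((p \<circ> inv s) x) = c x"
      proof (intro allI impI)
        fix x assume "x < k"
        then have "c (s (inv s x)) = (c \<circ> p) (inv s x)" using a sx by blast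
        then show "c ((p \<circ> inv s) x) = c x" by (simp add: permutes_inverses(1)[OF s])
      qed
    next
      assume a: "\<forall>x<k. c ((p \<circ> inv s) x) = c x"
      show "\<forall>x<k. c (s x) = (c \<circ> p) x"
      proof (intro allI impI)
        fix x assume "x < k"
        then have "c ((p \<circ> inv s) (s x)) = c (s x)" using a sx by blast
        then show "c (s x) = (c \<circ> p) x" by (simp add: permutes_inverses(2)[OF s])
      qed
    qed
    then have "(\<Sum>c\<in>cols k. of_bool (\<forall>x<k. c (s x) = (c \<circ> p) x)) =
        (\<Sum>c\<in>cols k. if \<forall>x<k. c ((p \<circ> inv s) x) = c x then 1 else (0::complex))"
      by (intro sum.cong refl) (simp only: of_bool_def)
    also have "\<dots> = of_nat (card {c\<in>cols k. \<forall>x<k. c ((p \<circ> inv s) x) = c x})"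
      by (subst sum.inter_filter[symmetric]) (auto intro: finite_PiE)
    finally show ?thesis
      using card_cyc[OF permutes_compose[OF permutes_inv[OF s] p], of N] by simp
  qed
  note key = this
  have "(\<Sum>c\<in>cols k. val k a c (c \<circ> p)) = (\<Sum>s | s permutes {..<k}. a s * (\<Sum>c\<in>cols k. of_bool (\<forall>x<k. c (s x) = (c \<circ> p) x)))"
    unfolding val_def by (subst sum.swap) (simp add: sum_distrib_left)
  then show ?thesis using key by simp
qed

text \<open>The coefficients are in general not determined by the traces, but the operator is.
  Adjoints of permutation operators are permutation operators, so for the difference
  \<open>d\<close> the square sum of all matrix coefficients is a linear combination of traces that
  vanish.\<close>

lemma val_unique:
  assumes eq: "\<And>p. p permutes {..<k} \<Longrightarrow> (\<Sum>c\<in>cols k. val k a c (c \<circ> p)) = (\<Sum>c\<in>cols k. val k b c (c \<circ> p))"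
    and c: "\<And>x. x < k \<Longrightarrow> c x < N" and c': "\<And>x. x < k \<Longrightarrow> c' x < N"
  shows "val k a c c' = val k b c c'"
proof -
  let ?P = "{s. s permutes {..<k}}"
  define d where "d s = a s - b s" for s
  have vd: "val k d c c' = val k a c c' - val k b c c'" for c c'
    by (simp add: val_def d_def algebra_simps sum_subtractf)
  have z: "(\<Sum>c\<in>cols k. val k d c (c \<circ> p)) = 0" if "p \<in> ?P" for p
    using eq that by (simp add: vd sum_subtractf)
  have finC: "finite (cols k)" by (auto intro: finite_PiE)
  \<comment> \<open>Expanding the conjugated coefficient leaves, for each \<open>s\<close>, only the
    column \<open>c' = c \<circ> s\<close>.\<close>
  have row: "(\<Sum>c'\<in>cols k. cnj (val k d c c') * val k d c c') = (\<Sum>s\<in>?P. cnj (d s) * val k d c (c \<circ> s))" if c: "c \<in> cols k" for c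
  proof -
    have "(\<Sum>c'\<in>cols k. cnj (val k d c c') * val k d c c') =
        (\<Sum>c'\<in>cols k. \<Sum>s\<in>?P. cnj (d s) * (of_bool (\<forall>x<k. c (s x) = c' x) * val k d c c'))"
    proof (rule sum.cong[OF refl])
      fix c' 
      have "cnj (val k d c c') = (\<Sum>s\<in>?P. cnj (d s) * of_bool (\<forall>x<k. c (s x) = c' x))"
        unfolding val_def cnj_sum complex_cnj_mult by (intro sum.cong refl) (simp add: of_bool_def)
      then show "cnj (val k d c c') * val k d c c' = (\<Sum>s\<in>?P. cnj (d s) * (of_bool (\<forall>x<k. c (s x) = c' x) * val k d c c'))"
        by (simp only: sum_distrib_right mult.assoc)
    qed
    also have "\<dots> = (\<Sum>s\<in>?P. cnj (d s) * (\<Sum>c'\<in>cols k. of_bool (\<forall>x<k. c (s x) = c' x) * val k d c c'))"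
      by (subst sum.swap) (simp add: sum_distrib_left)
    also have "\<dots> = (\<Sum>s\<in>?P. cnj (d s) * val k d c (c \<circ> s))"
    proof (rule sum.cong[OF refl])
      fix s assume "s \<in> ?P"
      then have sx: "s x < k" if "x < k" for x using permutes_in_image[of s "{..<k}" x] that by simp
      let ?cs = "restrict (c \<circ> s) {..<k}"
      have cs: "?cs \<in> cols k" using sx PiE_mem[OF c] by auto
      have "(\<Sum>c'\<in>cols k. of_bool (\<forall>x<k. c (s x) = c' x) * val k d c c') = (\<Sum>c'\<in>cols k. if c' = ?cs then val k d c ?cs else 0)"
      proof (rule sum.cong[OF refl])
        fix c' assume c': "c' \<in> cols k"
        have "(\<forall>x<k. c (s x) = c' x) \<longleftrightarrow> c' = ?cs"
        proof
          assume "\<forall>x<k. c (s x) = c' x"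
          then show "c' = ?cs" using PiE_arb[OF c'] by (intro ext) auto
        qed auto
        then show "of_bool (\<forall>x<k. c (s x) = c' x) * val k d c c' = (if c' = ?cs then val k d c ?cs else 0)" by simp
      qed
      also have "\<dots> = val k d c ?cs" using cs finC by simp
      also have "\<dots> = val k d c (c \<circ> s)" by (rule val_cong) auto
      finally show "cnj (d s) * (\<Sum>c'\<in>cols k. of_bool (\<forall>x<k. c (s x) = c' x) * val k d c c') = cnj (d s) * val k d c (c \<circ> s)"
        by (simp only:)
    qed
    finally show ?thesis .
  qed
  have "(\<Sum>c\<in>cols k. \<Sum>c'\<in>cols k. cnj (val k d c c') * val k d c c') = (\<Sum>c\<in>cols k. \<Sum>s\<in>?P. cnj (d s) * val k d c (c \<circ> s))"
    by (rule sum.cong[OF refl row])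
  also have "\<dots> = (\<Sum>s\<in>?P. cnj (d s) * (\<Sum>c\<in>cols k. val k d c (c \<circ> s)))"
    by (subst sum.swap) (simp add: sum_distrib_left)
  also have "\<dots> = 0" by (rule sum.neutral) (simp add: z)
  finally have "of_real (\<Sum>c\<in>cols k. \<Sum>c'\<in>cols k. (cmod (val k d c c'))\<^sup>2) = (0::complex)"
    unfolding of_real_sum by (simp only: complex_norm_square mult.commute)
  then have 0: "(\<Sum>c\<in>cols k. \<Sum>c'\<in>cols k. (cmod (val k d c c'))\<^sup>2) = 0" by (simp only: of_real_eq_0_iff)
  let ?c = "restrict c {..<k}" and ?c' = "restrict c' {..<k}"
  have m: "?c \<in> cols k" "?c' \<in> cols k" using c c' by auto
  have "(\<Sum>c'\<in>cols k. (cmod (val k d ?c c'))\<^sup>2) = 0"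
    using 0 m(1) finC by (subst (asm) sum_nonneg_eq_0_iff) (auto intro: sum_nonneg)
  then have "(cmod (val k d ?c ?c'))\<^sup>2 = 0"
    using m(2) finC by (subst (asm) sum_nonneg_eq_0_iff) auto
  then have "val k d ?c ?c' = 0" by simp
  moreover have "val k d ?c ?c' = val k d c c'" by (rule val_cong) auto
  ultimately show ?thesis by (simp add: vd)
qed

text \<open>The partial trace over the last tensor factor. A permutation fixing the last point
  contributes a factor \<open>N\<close>; for \<open>transpose k b \<circ> p\<close> the summed
  colour is forced to be \<open>c b\<close>, and \<open>p\<close> remains. The result is again the
  operator of a group algebra element, now for \<open>k\<close> points.\<close>

lemma contract_leg:
  assumes c: "\<And>x. x < k \<Longrightarrow> c x < N"
  shows "(\<Sum>i<N. val (Suc k) a (c(k := i)) (c'(k := i))) =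
    val k (\<lambda>p. of_nat N * a p + (\<Sum>b<k. a (Transposition.transpose k b \<circ> p))) c c'"
proof -
  have "(\<Sum>i<N. of_bool (\<forall>x<Suc k. (c(k := i)) (p x) = (c'(k := i)) x)) = (of_nat N * of_bool (\<forall>x<k. c (p x) = c' x) :: complex)"
    if p: "p permutes {..<k}" for p
  proof -
    have px: "p x < k" if "x < k" for x using permutes_in_image[OF p, of x] that by simp
    have pk: "p k = k" using permutes_not_in[OF p] by simp
    have "(\<forall>x<Suc k. (c(k := i)) (p x) = (c'(k := i)) x) \<longleftrightarrow> (\<forall>x<k. c (p x) = c' x)" for i
      using px pk by (auto simp: less_Suc_eq)
    then show ?thesis by simp
  qed
  note one = this
  have "(\<Sum>i<N. of_bool (\<forall>x<Suc k. (c(k := i)) ((Transposition.transpose k b \<circ> p) x) = (c'(k := i)) x)) =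
      (of_bool (\<forall>x<k. c (p x) = c' x) :: complex)"
    if p: "p permutes {..<k}" and b: "b < k" for p b
  proof -
    let ?t = "Transposition.transpose k b \<circ> p"
    have px: "p x < k" if "x < k" for x using permutes_in_image[OF p, of x] that by simp
    have pk: "p k = k" using permutes_not_in[OF p] by simp
    have t: "?t k = b" "\<And>x. x < k \<Longrightarrow> p x = b \<Longrightarrow> ?t x = k" "\<And>x. x < k \<Longrightarrow> p x \<noteq> b \<Longrightarrow> ?t x = p x"
      using pk px by (auto simp: Transposition.transpose_def)
    have "(\<forall>x<Suc k. (c(k := i)) (?t x) = (c'(k := i)) x) \<longleftrightarrow> i = c b \<and> (\<forall>x<k. c (p x) = c' x)" for i
    proof
      assume a: "\<forall>x<Suc k. (c(k := i)) (?t x) = (c'(k := i)) x"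
      have "(c(k := i)) (?t k) = (c'(k := i)) k" using a by blast
      then have i: "i = c b" using t(1) b by auto
      have "c (p x) = c' x" if x: "x < k" for x
      proof -
        have e: "(c(k := i)) (?t x) = (c'(k := i)) x" using a x by (blast intro: less_SucI)
        show ?thesis
        proof (cases "p x = b")
          case True
          then show ?thesis using e t(2)[OF x True] i x by (simp only: fun_upd_apply) (simp split: if_splits)
        next
          case False
          then show ?thesis using e t(3)[OF x False] px[OF x] x by (simp only: fun_upd_apply) (simp split: if_splits)
        qed
      qed
      then show "i = c b \<and> (\<forall>x<k. c (p x) = c' x)" using i by blast
    next
      assume a: "i = c b \<and> (\<forall>x<k. c (p x) = c' x)"
      show "\<forall>x<Suc k. (c(k := i)) (?t x) = (c'(k := i)) x"
      proof (intro allI impI)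
        fix x assume "x < Suc k"
        then consider "x = k" | "x < k" "p x = b" | "x < k" "p x \<noteq> b" by linarith
        then show "(c(k := i)) (?t x) = (c'(k := i)) x"
        proof cases
          case 1
          then show ?thesis using t(1) a b by (simp only: fun_upd_apply) auto
        next
          case 2
          then have "c' x = c b" using a by metis
          then show ?thesis using t(2)[OF 2] a 2(1) by (simp only: fun_upd_apply) auto
        next
          case 3
          then show ?thesis using t(3)[OF 3] a px[OF 3(1)] by (simp only: fun_upd_apply) auto
        qed
      qed
    qed
    then have "(\<Sum>i<N. of_bool (\<forall>x<Suc k. (c(k := i)) (?t x) = (c'(k := i)) x)) =
        (\<Sum>i<N. if i = c b then of_bool (\<forall>x<k. c (p x) = c' x) else (0::complex))"
      by (intro sum.cong refl) auto
    also have "\<dots> = of_bool (\<forall>x<k. c (p x) = c' x)" using c[OF b] by simp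
    finally show ?thesis .
  qed
  note two = this
  have "(\<Sum>i<N. val (Suc k) a (c(k := i)) (c'(k := i))) =
      (\<Sum>s | s permutes {..<Suc k}. a s * (\<Sum>i<N. of_bool (\<forall>x<Suc k. (c(k := i)) (s x) = (c'(k := i)) x)))"
    unfolding val_def sum_distrib_left by (rule sum.swap)
  also have "\<dots> = (\<Sum>p | p permutes {..<k}. a p * (of_nat N * of_bool (\<forall>x<k. c (p x) = c' x)) +
      (\<Sum>b<k. a (Transposition.transpose k b \<circ> p) * of_bool (\<forall>x<k. c (p x) = c' x)))"
    unfolding sum_permutes_Suc
  proof (rule sum.cong[OF refl])
    fix p assume "p \<in> {p. p permutes {..<k}}"
    then have p: "p permutes {..<k}" by simp
    show "a p * (\<Sum>i<N. of_bool (\<forall>x<Suc k. (c(k := i)) (p x) = (c'(k := i)) x)) +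
        (\<Sum>b<k. a (Transposition.transpose k b \<circ> p) * (\<Sum>i<N. of_bool (\<forall>x<Suc k. (c(k := i)) ((Transposition.transpose k b \<circ> p) x) = (c'(k := i)) x))) =
        a p * (of_nat N * of_bool (\<forall>x<k. c (p x) = c' x)) +
        (\<Sum>b<k. a (Transposition.transpose k b \<circ> p) * of_bool (\<forall>x<k. c (p x) = c' x))"
      unfolding one[OF p] by (intro arg_cong2[of _ _ _ _ "(+)"] refl sum.cong) (simp only: lessThan_iff two[OF p])
  qed
  also have "\<dots> = val k (\<lambda>p. of_nat N * a p + (\<Sum>b<k. a (Transposition.transpose k b \<circ> p))) c c'"
    unfolding val_def by (intro sum.cong refl) (simp add: distrib_right sum_distrib_right)
  finally show ?thesis .
qed

lemma contract_legs:
  "\<exists>a'. \<forall>c c'. (\<forall>x<k. c x < N) \<longrightarrow>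
    (\<Sum>d\<in>{k..<k + k1} \<rightarrow>\<^sub>E {..<N}. val (k + k1) a (merge k c d) (merge k c' d)) = val k a' c c'"
proof (induction k1 arbitrary: a)
  case 0
  have "val k a (merge k c d) (merge k c' d) = val k a c c'" for c c' d
    by (rule val_cong) (auto simp: merge_def)
  then show ?case by auto
next
  case (Suc k1)
  let ?a = "\<lambda>p. of_nat N * a p + (\<Sum>b<k + k1. a (Transposition.transpose (k + k1) b \<circ> p))"
  obtain a' where a': "\<And>c c'. (\<forall>x<k. c x < N) \<Longrightarrow>
    (\<Sum>d\<in>{k..<k + k1} \<rightarrow>\<^sub>E {..<N}. val (k + k1) ?a (merge k c d) (merge k c' d)) = val k a' c c'"
    using Suc.IH[of ?a] by blast
  have ins: "{k..<k + Suc k1} = insert (k + k1) {k..<k + k1}" by auto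
  have "(\<Sum>d\<in>{k..<k + Suc k1} \<rightarrow>\<^sub>E {..<N}. val (k + Suc k1) a (merge k c d) (merge k c' d)) = val k a' c c'"
    if c: "\<forall>x<k. c x < N" for c c'
  proof -
    have "(\<Sum>d\<in>{k..<k + Suc k1} \<rightarrow>\<^sub>E {..<N}. val (k + Suc k1) a (merge k c d) (merge k c' d)) =
        (\<Sum>d\<in>{k..<k + k1} \<rightarrow>\<^sub>E {..<N}. \<Sum>i<N. val (Suc (k + k1)) a (merge k c (d(k + k1 := i))) (merge k c' (d(k + k1 := i))))"
      unfolding ins by (subst sum_PiE_insert) auto
    also have "\<dots> = (\<Sum>d\<in>{k..<k + k1} \<rightarrow>\<^sub>E {..<N}. val (k + k1) ?a (merge k c d) (merge k c' d))"
    proof (rule sum.cong[OF refl])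
      fix d assume d: "d \<in> {k..<k + k1} \<rightarrow>\<^sub>E {..<N}"
      have "(\<Sum>i<N. val (Suc (k + k1)) a (merge k c (d(k + k1 := i))) (merge k c' (d(k + k1 := i)))) =
          (\<Sum>i<N. val (Suc (k + k1)) a ((merge k c d)(k + k1 := i)) ((merge k c' d)(k + k1 := i)))"
        by (intro sum.cong refl val_cong) (auto simp: merge_def)
      also have "\<dots> = val (k + k1) ?a (merge k c d) (merge k c' d)"
        by (rule contract_leg) (use c PiE_mem[OF d] in \<open>auto simp: merge_def\<close>)
      finally show "(\<Sum>i<N. val (Suc (k + k1)) a (merge k c (d(k + k1 := i))) (merge k c' (d(k + k1 := i)))) =
          val (k + k1) ?a (merge k c d) (merge k c' d)" .
    qed
    also have "\<dots> = val k a' c c'" by (rule a'[OF c])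
    finally show ?thesis .
  qed
  then show ?case by blast
qed

lemma sum_cols_merge:
  "(\<Sum>C\<in>cols (k + k1). g C) = (\<Sum>c\<in>cols k. \<Sum>d\<in>{k..<k + k1} \<rightarrow>\<^sub>E {..<N}. g (restrict (merge k c d) {..<k + k1}))"
proof -
  have "(\<Sum>C\<in>cols (k + k1). g C) = (\<Sum>(c, d)\<in>cols k \<times> ({k..<k + k1} \<rightarrow>\<^sub>E {..<N}). g (restrict (merge k c d) {..<k + k1}))"
  proof (rule sum.reindex_bij_witness[where i = "\<lambda>(c, d). restrict (merge k c d) {..<k + k1}"
        and j = "\<lambda>C. (restrict C {..<k}, restrict C {k..<k + k1})"])
    fix C assume C: "C \<in> cols (k + k1)"
    show *: "(case (restrict C {..<k}, restrict C {k..<k + k1}) of (c, d) \<Rightarrow> restrict (merge k c d) {..<k + k1}) = C"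
      using PiE_arb[OF C] by (auto simp: merge_def fun_eq_iff)
    show "(restrict C {..<k}, restrict C {k..<k + k1}) \<in> cols k \<times> ({k..<k + k1} \<rightarrow>\<^sub>E {..<N})"
      using PiE_mem[OF C] by auto
    show "(case (restrict C {..<k}, restrict C {k..<k + k1}) of (c, d) \<Rightarrow> g (restrict (merge k c d) {..<k + k1})) = g C"
      using * by simp
  next
    fix cd assume "cd \<in> cols k \<times> ({k..<k + k1} \<rightarrow>\<^sub>E {..<N})"
    then obtain c d where cd: "cd = (c, d)" and c: "c \<in> cols k" and d: "d \<in> {k..<k + k1} \<rightarrow>\<^sub>E {..<N}" by auto
    have "restrict (restrict (merge k c d) {..<k + k1}) {..<k} = c"
      using PiE_arb[OF c] by (auto simp: merge_def fun_eq_iff)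
    moreover have "restrict (restrict (merge k c d) {..<k + k1}) {k..<k + k1} = d"
    proof
      fix x show "restrict (restrict (merge k c d) {..<k + k1}) {k..<k + k1} x = d x"
        using PiE_arb[OF d, of x] by (cases "x \<in> {k..<k + k1}") (auto simp: merge_def)
    qed
    ultimately show "(restrict (case cd of (c, d) \<Rightarrow> restrict (merge k c d) {..<k + k1}) {..<k},
        restrict (case cd of (c, d) \<Rightarrow> restrict (merge k c d) {..<k + k1}) {k..<k + k1}) = cd"
      by (simp add: cd)
    show "(case cd of (c, d) \<Rightarrow> restrict (merge k c d) {..<k + k1}) \<in> cols (k + k1)"
      using PiE_mem[OF c] PiE_mem[OF d] by (auto simp: cd merge_def)
  qed
  then show ?thesis by (simp only: sum.cartesian_product)
qed

end

section \<open>The functional on monomials\<close>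

locale rank_bounded_nat = rank_bounded f "real N" for f N
begin

abbreviation "Cols k \<equiv> {..<k} \<rightarrow>\<^sub>E {..<N}"

definition sol :: "nat \<Rightarrow> (nat \<Rightarrow> nat) \<Rightarrow> nat set \<Rightarrow> (nat \<Rightarrow> nat) \<Rightarrow> nat set \<Rightarrow> ((nat \<Rightarrow> nat) \<Rightarrow> complex) \<Rightarrow> bool" where
  "sol k v V w H a \<longleftrightarrow> (\<forall>p. p permutes {..<k} \<longrightarrow>
    (\<Sum>c\<in>Cols k. val k a c (c \<circ> p)) = f (graph_of (star k v V w H p)))"

lemma sol_exists: "star_data k v V w H \<Longrightarrow> \<exists>a. sol k v V w H a"
  using gram_solution[of k v V w H] unfolding sol_def by (simp add: val_pairing)

lemma sol_unique:
  assumes "sol k v V w H a" "sol k v V w H b"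
    and "\<And>x. x < k \<Longrightarrow> c x < N" "\<And>x. x < k \<Longrightarrow> c' x < N"
  shows "val k a c c' = val k b c c'"
  by (rule val_unique[where N = N]) (use assms in \<open>auto simp: sol_def\<close>)

text \<open>The coefficient functional is carried from one star structure to another by the bijections
  that match the legs at the vertices (\<open>\<pi>\<close>) and at the edges (\<open>\<pi>'\<close>) separately.\<close>

lemma sol_transport:
  assumes D: "star_data k v V w H" and D2: "star_data k v2 V2 w2 H2"
    and \<pi>: "\<pi> permutes {..<k}" "bij_betw g V V2" "\<And>x. x < k \<Longrightarrow> v2 (\<pi> x) = g (v x)"
    and \<pi>': "\<pi>' permutes {..<k}" "bij_betw h H H2" "\<And>x. x < k \<Longrightarrow> w2 (\<pi>' x) = h (w x)"
    and a: "sol k v2 V2 w2 H2 a"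
  shows "sol k v V w H (\<lambda>s. a (\<pi> \<circ> s \<circ> inv \<pi>'))"
    and "(\<And>x. x < k \<Longrightarrow> c2 (\<pi> x) = c x) \<Longrightarrow> (\<And>x. x < k \<Longrightarrow> c2' (\<pi>' x) = c' x) \<Longrightarrow>
      val k (\<lambda>s. a (\<pi> \<circ> s \<circ> inv \<pi>')) c c' = val k a c2 c2'"
proof -
  have bx: "\<pi> x < k" "\<pi>' x < k" if "x < k" for x
    using permutes_in_image[OF \<pi>(1), of x] permutes_in_image[OF \<pi>'(1), of x] that by simp_all
  have val: "val k (\<lambda>s. a (\<pi> \<circ> s \<circ> inv \<pi>')) c c' = val k a c2 c2'"
    if c: "\<And>x. x < k \<Longrightarrow> c2 (\<pi> x) = c x" and c': "\<And>x. x < k \<Longrightarrow> c2' (\<pi>' x) = c' x" for c c' c2 c2' :: "nat \<Rightarrow> nat"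
    unfolding val_def
  proof (rule sum.reindex_bij_witness[where i = "\<lambda>s. inv \<pi> \<circ> s \<circ> \<pi>'" and j = "\<lambda>s. \<pi> \<circ> s \<circ> inv \<pi>'"], goal_cases)
    case (1 s)
    show ?case using \<pi>(1) \<pi>'(1) by (simp add: fun_eq_iff permutes_inverses)
  next
    case (2 s)
    then show ?case using \<pi>(1) \<pi>'(1) by (auto intro: permutes_compose permutes_inv)
  next
    case (3 s)
    show ?case using \<pi>(1) \<pi>'(1) by (simp add: fun_eq_iff permutes_inverses)
  next
    case (4 s)
    then show ?case using \<pi>(1) \<pi>'(1) by (auto intro: permutes_compose permutes_inv)
  next
    case (5 s)
    then have sx: "s x < k" if "x < k" for x using permutes_in_image[of s "{..<k}" x] that by simp
    have ix: "inv \<pi>' x < k" if "x < k" for x using permutes_in_image[OF permutes_inv[OF \<pi>'(1)], of x] that by simp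
    have "(\<forall>x<k. c2 ((\<pi> \<circ> s \<circ> inv \<pi>') x) = c2' x) \<longleftrightarrow> (\<forall>x<k. c2 ((\<pi> \<circ> s \<circ> inv \<pi>') (\<pi>' x)) = c2' (\<pi>' x))"
    proof
      assume r: "\<forall>x<k. c2 ((\<pi> \<circ> s \<circ> inv \<pi>') (\<pi>' x)) = c2' (\<pi>' x)"
      show "\<forall>x<k. c2 ((\<pi> \<circ> s \<circ> inv \<pi>') x) = c2' x"
      proof (intro allI impI)
        fix x assume "x < k"
        then have "c2 ((\<pi> \<circ> s \<circ> inv \<pi>') (\<pi>' (inv \<pi>' x))) = c2' (\<pi>' (inv \<pi>' x))" using r ix by blast
        then show "c2 ((\<pi> \<circ> s \<circ> inv \<pi>') x) = c2' x" by (simp only: permutes_inverses(1)[OF \<pi>'(1)])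
      qed
    qed (use bx in blast)
    also have "\<dots> \<longleftrightarrow> (\<forall>x<k. c (s x) = c' x)"
      using c c' sx by (simp add: permutes_inverses(2)[OF \<pi>'(1)])
    finally show ?case by simp
  qed
  show "(\<And>x. x < k \<Longrightarrow> c2 (\<pi> x) = c x) \<Longrightarrow> (\<And>x. x < k \<Longrightarrow> c2' (\<pi>' x) = c' x) \<Longrightarrow>
      val k (\<lambda>s. a (\<pi> \<circ> s \<circ> inv \<pi>')) c c' = val k a c2 c2'" by (rule val)
  show "sol k v V w H (\<lambda>s. a (\<pi> \<circ> s \<circ> inv \<pi>'))"
    unfolding sol_def
  proof (intro allI impI)
    fix p assume p: "p permutes {..<k}"
    let ?q = "\<pi> \<circ> p \<circ> inv \<pi>'"
    have q: "?q permutes {..<k}" using p \<pi>(1) \<pi>'(1) by (auto intro: permutes_compose permutes_inv)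
    have px: "p x < k" if "x < k" for x using permutes_in_image[OF p, of x] that by simp
    have ipx: "inv \<pi> x < k" if "x < k" for x using permutes_in_image[OF permutes_inv[OF \<pi>(1)], of x] that by simp
    have "(\<Sum>c\<in>Cols k. val k (\<lambda>s. a (\<pi> \<circ> s \<circ> inv \<pi>')) c (c \<circ> p)) = (\<Sum>c\<in>Cols k. val k a c (c \<circ> ?q))"
    proof (rule sum.reindex_bij_witness[where i = "\<lambda>c. c \<circ> \<pi>" and j = "\<lambda>c. c \<circ> inv \<pi>"], goal_cases)
      case (1 c)
      show ?case using \<pi>(1) by (simp add: fun_eq_iff permutes_inverses)
    next
      case (2 c)
      have "inv \<pi> x = x" if "x \<notin> {..<k}" for x using permutes_not_in[OF permutes_inv[OF \<pi>(1)] that] .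
      then show ?case using PiE_mem[OF 2] PiE_arb[OF 2] ipx by (intro PiE_I) auto
    next
      case (3 c)
      show ?case using \<pi>(1) by (simp add: fun_eq_iff permutes_inverses)
    next
      case (4 c)
      have "\<pi> x = x" if "x \<notin> {..<k}" for x using permutes_not_in[OF \<pi>(1) that] .
      then show ?case using PiE_mem[OF 4] PiE_arb[OF 4] bx by (intro PiE_I) auto
    next
      case (5 c)
      show ?case
        by (rule val[symmetric]) (simp_all add: permutes_inverses(2)[OF \<pi>(1)] permutes_inverses(2)[OF \<pi>'(1)])
    qed
    also have "\<dots> = f (graph_of (star k v2 V2 w2 H2 ?q))" using a q unfolding sol_def by blast
    also have "graph_of (star k v2 V2 w2 H2 ?q) = graph_of (star k v V w H p)"
    proof (rule graph_of_cong[OF wf_star[OF D p], symmetric])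
      show "isomorphic (star k v V w H p) (star k v2 V2 w2 H2 ?q)"
        unfolding isomorphic_def star_def multigraph.sel
      proof (rule exI[of _ g], rule exI[of _ h], intro conjI \<pi>(2) \<pi>'(2) ballI)
        fix y assume y: "y \<in> H"
        have bb: "{x\<in>{..<k}. w2 x = h y} = \<pi>' ` {x\<in>{..<k}. w x = y}"
        proof (intro equalityI subsetI)
          fix x assume x: "x \<in> {x\<in>{..<k}. w2 x = h y}"
          then obtain z where z: "z < k" "x = \<pi>' z"
            using permutes_in_image[OF permutes_inv[OF \<pi>'(1)], of x] permutes_inverses(1)[OF \<pi>'(1), of x] by (metis (no_types, lifting) lessThan_iff mem_Collect_eq)
          then have "h (w z) = h y" using x \<pi>'(3) by auto
          then have "w z = y" using \<pi>'(2) y D z by (auto simp: bij_betw_def inj_on_def star_data_def)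
          then show "x \<in> \<pi>' ` {x\<in>{..<k}. w x = y}" using z by auto
        qed (use \<pi>'(3) bx in auto)
        have "mset_set {x\<in>{..<k}. w2 x = h y} = image_mset \<pi>' (mset_set {x\<in>{..<k}. w x = y})"
          unfolding bb by (rule image_mset_mset_set[symmetric]) (use permutes_inj_on[OF \<pi>'(1)] in blast)
        then have "image_mset (\<lambda>x. v2 (?q x)) (mset_set {x\<in>{..<k}. w2 x = h y}) =
            image_mset (\<lambda>x. v2 (\<pi> (p x))) (mset_set {x\<in>{..<k}. w x = y})"
          by (simp add: multiset.map_comp comp_def permutes_inverses(2)[OF \<pi>'(1)])
        also have "\<dots> = image_mset (\<lambda>x. g (v (p x))) (mset_set {x\<in>{..<k}. w x = y})"
          by (rule image_mset_cong) (use \<pi>(3) px in auto)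
        finally show "image_mset (\<lambda>x. v2 (?q x)) (mset_set {x\<in>{..<k}. w2 x = h y}) =
            image_mset g (image_mset (\<lambda>x. v (p x)) (mset_set {x\<in>{..<k}. w x = y}))"
          by (simp add: multiset.map_comp comp_def)
      qed
    qed
    finally show "(\<Sum>c\<in>Cols k. val k (\<lambda>s. a (\<pi> \<circ> s \<circ> inv \<pi>')) c (c \<circ> p)) = f (graph_of (star k v V w H p))" .
  qed
qed

text \<open>A monomial \<open>\<Prod>Y\<^sub>\<alpha> \<Prod>g\<^sub>\<beta>\<close> is the pair of the multisets of its \<open>\<alpha>\<close> and its \<open>\<beta>\<close>. It is represented by a star
  structure with the colouring \<open>c\<close> of the legs at the vertices and \<open>c'\<close> at the edges.\<close>

definition rep :: "nat multiset multiset \<times> nat multiset multiset \<Rightarrow> nat \<Rightarrow> (nat \<Rightarrow> nat) \<Rightarrow> nat set \<Rightarrow>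
    (nat \<Rightarrow> nat) \<Rightarrow> nat set \<Rightarrow> (nat \<Rightarrow> nat) \<Rightarrow> (nat \<Rightarrow> nat) \<Rightarrow> bool" where
  "rep m k v V w H c c' \<longleftrightarrow> star_data k v V w H \<and> (\<forall>x<k. c x < N) \<and> (\<forall>x<k. c' x < N) \<and>
    m = (vmon k v V c, vmon k w H c')"

text \<open>These are exactly the monomials that occur for some coloured graph with separately
  coloured vertex ends and edge ends; see \<open>good_rep\<close> and \<open>rep_exists\<close>. The
  last condition equates the numbers of the two kinds of ends.\<close>

definition good :: "nat multiset multiset \<times> nat multiset multiset \<Rightarrow> bool" where
  "good m \<longleftrightarrow> (\<forall>\<alpha>\<in>#fst m. \<forall>i\<in>#\<alpha>. i < N) \<and> (\<forall>\<beta>\<in>#snd m. size \<beta> = 2 \<and> (\<forall>i\<in>#\<beta>. i < N)) \<and>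
    (\<Sum>\<alpha>\<in>#fst m. size \<alpha>) = (\<Sum>\<beta>\<in>#snd m. size \<beta>)"

lemma good_rep: "rep m k v V w H c c' \<Longrightarrow> good m"
proof -
  assume r: "rep m k v V w H c c'"
  then have D: "star_data k v V w H" and m: "m = (vmon k v V c, vmon k w H c')"
    and c: "\<And>x. x < k \<Longrightarrow> c x < N" "\<And>x. x < k \<Longrightarrow> c' x < N"
    by (auto simp: rep_def)
  have "size \<beta> = 2" if b: "\<beta> \<in># vmon k w H c'" for \<beta>
    using b D by (auto simp: vmon_def star_data_def)
  moreover have "(\<Sum>\<alpha>\<in>#vmon k v V c. size \<alpha>) = (\<Sum>\<beta>\<in>#vmon k w H c'. size \<beta>)"
    using D size_vmon[of V v k c] size_vmon[of H w k c'] by (simp add: star_data_def)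
  moreover have "finite V" "finite H" using D by (auto simp: star_data_def)
  ultimately show ?thesis
    unfolding good_def m fst_conv snd_conv using c vmon_memberD by metis
qed

lemma rep_exists: "good m \<Longrightarrow> \<exists>k v V w H c c'. rep m k v V w H c c'"
proof -
  assume g: "good m"
  obtain A B where m: "m = (A, B)" by (cases m)
  obtain k v V c where 1: "finite V" "v ` {..<k} \<subseteq> V" "vmon k v V c = A" "k = (\<Sum>\<alpha>\<in>#A. size \<alpha>)" "\<forall>x<k. \<exists>\<alpha>\<in>#A. c x \<in># \<alpha>"
    using vmon_exists[of A] by blast
  obtain k' w H c' where 2: "finite H" "w ` {..<k'} \<subseteq> H" "vmon k' w H c' = B" "k' = (\<Sum>\<alpha>\<in>#B. size \<alpha>)" "\<forall>x<k'. \<exists>\<alpha>\<in>#B. c' x \<in># \<alpha>"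
    using vmon_exists[of B] by blast
  have k: "k' = k" using g 1(4) 2(4) by (simp add: good_def m)
  have "card {x\<in>{..<k}. w x = h} = 2" if h: "h \<in> H" for h
  proof -
    have "image_mset c' (mset_set {x\<in>{..<k}. w x = h}) \<in># B"
      unfolding 2(3)[symmetric] vmon_def k using h 2(1) by (simp add: k)
    then have "size (image_mset c' (mset_set {x\<in>{..<k}. w x = h})) = 2" using g by (auto simp: good_def m)
    then show ?thesis by simp
  qed
  then have "star_data k v V w H" using 1 2 by (auto simp: star_data_def k)
  moreover have "c x < N" "c' x < N" if "x < k" for x
    using 1(5) 2(5) g that unfolding good_def m k by auto
  ultimately have "rep m k v V w H c c'" using 1(3) 2(3) by (simp add: rep_def m k)
  then show ?thesis by blast
qed

lemma bij_betw_extend_permutes: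
  assumes "bij_betw \<pi> {..<k} {..<k}"
  obtains \<rho> where "\<rho> permutes {..<k}" "\<And>x. x < k \<Longrightarrow> \<rho> x = \<pi> x"
proof -
  let ?r = "\<lambda>x. if x < k then \<pi> x else x"
  have "?r permutes {..<k}"
  proof (rule bij_imp_permutes)
    have "bij_betw ?r {..<k} {..<k} = bij_betw \<pi> {..<k} {..<k}" by (rule bij_betw_cong) simp
    then show "bij_betw ?r {..<k} {..<k}" using assms by simp
  qed simp
  then show ?thesis by (rule that) simp
qed

text \<open>Two representations of a monomial are related by bijections of vertices, edges and legs.
  A solution for one transports to a solution for the other; solutions are ambiguous, but by
  \<open>sol_unique\<close> their matrix coefficients are not.\<close>

lemma rep_unique:
  assumes r: "rep m k v V w H c c'" and a: "sol k v V w H a"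
    and r2: "rep m k2 v2 V2 w2 H2 c2 c2'" and a2: "sol k2 v2 V2 w2 H2 a2"
  shows "val k a c c' = val k2 a2 c2 c2'"
proof -
  have D: "star_data k v V w H" "star_data k2 v2 V2 w2 H2"
    and c: "\<And>x. x < k \<Longrightarrow> c x < N" "\<And>x. x < k \<Longrightarrow> c' x < N"
    and m: "vmon k v V c = vmon k2 v2 V2 c2" "vmon k w H c' = vmon k2 w2 H2 c2'"
    using r r2 by (auto simp: rep_def)
  have fin: "finite V" "v ` {..<k} \<subseteq> V" "finite H" "w ` {..<k} \<subseteq> H"
    "finite V2" "v2 ` {..<k2} \<subseteq> V2" "finite H2" "w2 ` {..<k2} \<subseteq> H2"
    using D by (simp_all add: star_data_def)
  have "k2 = k" using size_vmon[OF fin(1,2), of c] size_vmon[OF fin(5,6), of c2] m(1) by simp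
  note k = this
  obtain \<pi>0 g where p: "bij_betw \<pi>0 {..<k} {..<k2}" "bij_betw g V V2" "\<forall>x<k. v2 (\<pi>0 x) = g (v x) \<and> c2 (\<pi>0 x) = c x"
    using vmon_bij[OF fin(1,2,5,6) m(1)] by blast
  obtain \<pi>1 h where p': "bij_betw \<pi>1 {..<k} {..<k2}" "bij_betw h H H2" "\<forall>x<k. w2 (\<pi>1 x) = h (w x) \<and> c2' (\<pi>1 x) = c' x"
    using vmon_bij[OF fin(3,4,7,8) m(2)] by blast
  obtain \<pi> where \<pi>: "\<pi> permutes {..<k}" "\<And>x. x < k \<Longrightarrow> \<pi> x = \<pi>0 x"
    using bij_betw_extend_permutes p(1) unfolding k by blast
  obtain \<pi>' where \<pi>': "\<pi>' permutes {..<k}" "\<And>x. x < k \<Longrightarrow> \<pi>' x = \<pi>1 x"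
    using bij_betw_extend_permutes p'(1) unfolding k by blast
  have e: "\<And>x. x < k \<Longrightarrow> v2 (\<pi> x) = g (v x)" "\<And>x. x < k \<Longrightarrow> w2 (\<pi>' x) = h (w x)"
    "\<And>x. x < k \<Longrightarrow> c2 (\<pi> x) = c x" "\<And>x. x < k \<Longrightarrow> c2' (\<pi>' x) = c' x"
    using p(3) p'(3) \<pi>(2) \<pi>'(2) by auto
  note t = sol_transport[OF D(1) D(2)[unfolded k] \<pi>(1) p(2) e(1) \<pi>'(1) p'(2) e(2) a2[unfolded k]]
  have "val k a c c' = val k (\<lambda>s. a2 (\<pi> \<circ> s \<circ> inv \<pi>')) c c'"
    by (rule sol_unique[OF a t(1) c])
  also have "\<dots> = val k a2 c2 c2'" by (rule t(2)) (use e(3,4) in auto)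
  finally show ?thesis by (simp add: k)
qed

text \<open>The description is justified by \<open>rep_unique\<close>. The value 0 on all other
  monomials is compatible with \<open>phi_mult\<close>, because multiplication by the monomials of a
  graph neither creates nor destroys goodness.\<close>

definition phi :: "nat multiset multiset \<times> nat multiset multiset \<Rightarrow> complex" where
  "phi m = (if good m then THE z. \<exists>k v V w H c c' a. rep m k v V w H c c' \<and> sol k v V w H a \<and> z = val k a c c' else 0)"

lemma phi_eq:
  assumes r: "rep m k v V w H c c'" and a: "sol k v V w H a"
  shows "phi m = val k a c c'"
proof -
  have "(THE z. \<exists>k v V w H c c' a. rep m k v V w H c c' \<and> sol k v V w H a \<and> z = val k a c c') = val k a c c'"
  proof (rule the_equality)
    show "\<exists>k2 v V w H c2 c2' a2. rep m k2 v V w H c2 c2' \<and> sol k2 v V w H a2 \<and> val k a c c' = val k2 a2 c2 c2'"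
      using r a by blast
    fix z assume "\<exists>k v V w H c c' a. rep m k v V w H c c' \<and> sol k v V w H a \<and> z = val k a c c'"
    then show "z = val k a c c'" using rep_unique[OF r a] by metis
  qed
  then show ?thesis using good_rep[OF r] by (simp add: phi_def)
qed

lemma good_add: "rep m1 k v V w H c c' \<Longrightarrow> good (m + m1) \<longleftrightarrow> good m"
  using good_rep[of m1 k v V w H c c'] by (auto simp: good_def)

lemma phi_zero: "phi 0 = 1"
proof -
  let ?u = "\<lambda>_. 0 :: nat"
  have r: "rep 0 0 ?u {} ?u {} ?u ?u" by (simp add: rep_def star_data_def vmon_def zero_prod_def)
  obtain a where a: "sol 0 ?u {} ?u {} a" using sol_exists[of 0 ?u "{}" ?u "{}"] by (auto simp: star_data_def)
  have "val 0 a ?u ?u = (\<Sum>c\<in>Cols 0. val 0 a c (c \<circ> id))"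
    by (simp add: val_def)
  also have "\<dots> = f (graph_of (star 0 ?u {} ?u {} id))" using a unfolding sol_def by (simp add: permutes_id)
  also have "star 0 ?u {} ?u {} id = Multigraph {} {} (\<lambda>_. {#})" by (simp add: star_def)
  finally show ?thesis using phi_eq[OF r a] by (simp add: graph_of_empty f_empty)
qed

text \<open>The left side is the functional at \<open>m\<close> times the generic partition function
  of the graph. Summing over the colours of the new legs amounts to the partial trace
  \<open>a'\<close> of a solution for the disjoint sum. By multiplicativity of \<open>f\<close> it
  has the same traces as \<open>?F\<close> times a solution for \<open>m\<close>, and
  \<open>val_unique\<close> makes their coefficients equal.\<close>

lemma phi_mult:
  assumes D1: "star_data k1 v1 V1 w1 H1"
  shows "(\<Sum>d\<in>Cols k1. phi (m + (vmon k1 v1 V1 d, vmon k1 w1 H1 d))) = f (graph_of (star k1 v1 V1 w1 H1 id)) * phi m"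
proof (cases "good m")
  case False
  have "phi (m + (vmon k1 v1 V1 d, vmon k1 w1 H1 d)) = 0" if d: "d \<in> Cols k1" for d
  proof -
    have "rep (vmon k1 v1 V1 d, vmon k1 w1 H1 d) k1 v1 V1 w1 H1 d d"
      using D1 PiE_mem[OF d] by (auto simp: rep_def)
    then have "\<not> good (m + (vmon k1 v1 V1 d, vmon k1 w1 H1 d))" using good_add False by blast
    then show ?thesis by (simp add: phi_def)
  qed
  then show ?thesis using False by (simp add: phi_def)
next
  case True
  then obtain k v V w H c c' where r: "rep m k v V w H c c'" using rep_exists by blast
  then have D: "star_data k v V w H" and m: "m = (vmon k v V c, vmon k w H c')"
    and c: "\<And>x. x < k \<Longrightarrow> c x < N" "\<And>x. x < k \<Longrightarrow> c' x < N"
    by (auto simp: rep_def)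
  have fin: "finite V" "finite V1" "finite H" "finite H1" using D D1 by (auto simp: star_data_def)
  obtain a where a: "sol k v V w H a" using sol_exists[OF D] by blast
  let ?v = "sumf k v v1" and ?V = "sumV V V1" and ?w = "sumf k w w1" and ?H = "sumV H H1"
  have D2: "star_data (k + k1) ?v ?V ?w ?H" by (rule star_data_sum[OF D D1])
  obtain b where b: "sol (k + k1) ?v ?V ?w ?H b" using sol_exists[OF D2] by blast
  obtain a' where a': "\<And>c c'. (\<forall>x<k. c x < N) \<Longrightarrow>
    (\<Sum>d\<in>{k..<k + k1} \<rightarrow>\<^sub>E {..<N}. val (k + k1) b (merge k c d) (merge k c' d)) = val k a' c c'"
    using contract_legs[where N = N and k = k and ?k1.0 = k1 and a = b] by blast
  let ?F = "f (graph_of (star k1 v1 V1 w1 H1 id))"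
  have pair: "(\<Sum>c\<in>Cols k. val k a' c (c \<circ> p)) = ?F * f (graph_of (star k v V w H p))" if p: "p permutes {..<k}" for p
  proof -
    have p2: "p permutes {..<k + k1}" by (rule permutes_subset[OF p]) auto
    have px: "p x < k" if "x < k" for x using permutes_in_image[OF p, of x] that by simp
    have pk: "p x = x" if "\<not> x < k" for x using permutes_not_in[OF p, of x] that by simp
    have "(\<Sum>c\<in>Cols k. val k a' c (c \<circ> p)) =
        (\<Sum>c\<in>Cols k. \<Sum>d\<in>{k..<k + k1} \<rightarrow>\<^sub>E {..<N}. val (k + k1) b (merge k c d) (merge k (c \<circ> p) d))"
      by (rule sum.cong[OF refl], rule a'[symmetric]) auto
    also have "\<dots> = (\<Sum>c\<in>Cols k. \<Sum>d\<in>{k..<k + k1} \<rightarrow>\<^sub>E {..<N}. val (k + k1) b (restrict (merge k c d) {..<k + k1}) (restrict (merge k c d) {..<k + k1} \<circ> p))"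
    proof (intro sum.cong refl val_cong)
      fix c d x assume x: "x < k + k1"
      show "merge k c d x = restrict (merge k c d) {..<k + k1} x" using x by simp
      have "p x < k + k1" using permutes_in_image[OF p2, of x] x by simp
      then show "merge k (c \<circ> p) d x = (restrict (merge k c d) {..<k + k1} \<circ> p) x"
        using px[of x] pk[of x] by (auto simp: merge_def)
    qed
    also have "\<dots> = (\<Sum>C\<in>Cols (k + k1). val (k + k1) b C (C \<circ> p))"
      by (rule sum_cols_merge[symmetric])
    also have "\<dots> = f (graph_of (star (k + k1) ?v ?V ?w ?H p))" using b p2 unfolding sol_def by blast
    also have "graph_of (star (k + k1) ?v ?V ?w ?H p) = graph_of (disjoint_union (star k v V w H p) (star k1 v1 V1 w1 H1 id))"
      by (rule graph_of_cong[symmetric]) (use wf_star[OF D p] wf_star[OF D1 permutes_id] star_sum_isomorphic[OF D D1 p] wf_disjoint_union in blast)+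
    also have "f \<dots> = f (graph_of (star k v V w H p)) * ?F"
      by (rule f_disjoint_union[OF wf_star[OF D p] wf_star[OF D1 permutes_id]])
    finally show ?thesis by (simp only: mult.commute)
  qed
  have "val k a' c c' = val k (\<lambda>s. ?F * a s) c c'"
  proof (rule val_unique[where N = N, OF _ c])
    fix p assume p: "p permutes {..<k}"
    have "val k (\<lambda>s. ?F * a s) c c' = ?F * val k a c c'" for c c'
      by (simp add: val_def sum_distrib_left mult.assoc)
    then have "(\<Sum>c\<in>Cols k. val k (\<lambda>s. ?F * a s) c (c \<circ> p)) = ?F * (\<Sum>c\<in>Cols k. val k a c (c \<circ> p))"
      by (simp add: sum_distrib_left)
    also have "(\<Sum>c\<in>Cols k. val k a c (c \<circ> p)) = f (graph_of (star k v V w H p))" using a p unfolding sol_def by blast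
    finally show "(\<Sum>c\<in>Cols k. val k a' c (c \<circ> p)) = (\<Sum>c\<in>Cols k. val k (\<lambda>s. ?F * a s) c (c \<circ> p))"
      using pair[OF p] by (simp only:)
  qed
  then have va: "val k a' c c' = ?F * val k a c c'" by (simp add: val_def sum_distrib_left mult.assoc)
  have "phi (m + (vmon k1 v1 V1 d, vmon k1 w1 H1 d)) =
      val (k + k1) b (merge k c (\<lambda>x. d (x - k))) (merge k c' (\<lambda>x. d (x - k)))" if d: "d \<in> Cols k1" for d
  proof (rule phi_eq[OF _ b])
    show "rep (m + (vmon k1 v1 V1 d, vmon k1 w1 H1 d)) (k + k1) ?v ?V ?w ?H (merge k c (\<lambda>x. d (x - k))) (merge k c' (\<lambda>x. d (x - k)))"
      using D2 c PiE_mem[OF d] unfolding rep_def m vmon_sum[OF fin(1,2)] vmon_sum[OF fin(3,4)]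
      by (auto simp: merge_def)
  qed
  then have "(\<Sum>d\<in>Cols k1. phi (m + (vmon k1 v1 V1 d, vmon k1 w1 H1 d))) =
      (\<Sum>d\<in>Cols k1. val (k + k1) b (merge k c (\<lambda>x. d (x - k))) (merge k c' (\<lambda>x. d (x - k))))" by (rule sum.cong[OF refl])
  also have "\<dots> = (\<Sum>d\<in>{k..<k + k1} \<rightarrow>\<^sub>E {..<N}. val (k + k1) b (merge k c d) (merge k c' d))"
  proof (rule sum.reindex_bij_witness[where i = "\<lambda>d. restrict (\<lambda>x. d (x + k)) {..<k1}" and j = "\<lambda>d. restrict (\<lambda>x. d (x - k)) {k..<k + k1}"], goal_cases)
    case (1 d)
    then show ?case using PiE_arb[OF 1] by (auto simp: fun_eq_iff)
  next
    case (2 d)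
    then show ?case using PiE_mem[OF 2] by (intro restrict_PiE_iff[THEN iffD2] ballI) auto
  next
    case (3 d)
    show ?case
    proof
      fix x show "restrict (\<lambda>x. restrict (\<lambda>x. d (x + k)) {..<k1} (x - k)) {k..<k + k1} x = d x"
        using PiE_arb[OF 3, of x] by (cases "x \<in> {k..<k + k1}") auto
    qed
  next
    case (4 d)
    then show ?case using PiE_mem[OF 4] by (intro restrict_PiE_iff[THEN iffD2] ballI) auto
  next
    case (5 d)
    show ?case by (rule val_cong) (auto simp: merge_def)
  qed
  also have "\<dots> = val k a' c c'" by (rule a') (use c in blast)
  finally show ?thesis unfolding va phi_eq[OF r a] .
qed

end

section \<open>The Nullstellensatz\<close>

text \<open>This makes the set of monomials countable, on which the cardinality argument below
  relies.\<close>

instance multiset :: (countable) countable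
proof (rule countable_classI[of "\<lambda>M. to_nat (SOME l. mset l = M)"])
  fix M M' :: "'a multiset"
  assume "to_nat (SOME l. mset l = M) = to_nat (SOME l. mset l = M')"
  then have "(SOME l. mset l = M) = (SOME l. mset l = M')" by simp
  moreover have "mset (SOME l. mset l = M) = M" for M :: "'a multiset"
    by (rule someI_ex[OF ex_mset])
  ultimately show "M = M'" by metis
qed

definition ideal_of :: "'r::comm_ring_1 set \<Rightarrow> bool" where
  "ideal_of I \<longleftrightarrow> 0 \<in> I \<and> (\<forall>x\<in>I. \<forall>y\<in>I. x + y \<in> I) \<and> (\<forall>x\<in>I. \<forall>r. r * x \<in> I)"

lemma ideal_of_diff: "ideal_of I \<Longrightarrow> x \<in> I \<Longrightarrow> y \<in> I \<Longrightarrow> x - y \<in> I"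
proof -
  assume I: "ideal_of I" "x \<in> I" "y \<in> I"
  then have "x + (-1) * y \<in> I" unfolding ideal_of_def by blast
  then show ?thesis by simp
qed

lemma ideal_of_sum: "ideal_of I \<Longrightarrow> (\<And>a. a \<in> A \<Longrightarrow> g a \<in> I) \<Longrightarrow> (\<Sum>a\<in>A. g a) \<in> I"
  by (induction A rule: infinite_finite_induct) (auto simp: ideal_of_def)

text \<open>Zorn's lemma. Maximality is recorded as invertibility modulo \<open>M\<close>: for
  \<open>x\<close> outside \<open>M\<close>, the ideal generated by \<open>M\<close> and
  \<open>x\<close> must contain 1.\<close>

lemma maximal_ideal_exists:
  assumes I: "ideal_of I" "1 \<notin> I"
  shows "\<exists>M. ideal_of M \<and> I \<subseteq> M \<and> 1 \<notin> M \<and> (\<forall>x. x \<notin> M \<longrightarrow> (\<exists>s. s * x - 1 \<in> M))"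
proof -
  let ?A = "{M. ideal_of M \<and> I \<subseteq> M \<and> 1 \<notin> M}"
  have "\<exists>M\<in>?A. \<forall>X\<in>?A. M \<subseteq> X \<longrightarrow> X = M"
  proof (rule subset_Zorn_nonempty)
    show "?A \<noteq> {}" using I by blast
    fix C assume ne: "C \<noteq> {}" and ch: "subset.chain ?A C"
    have mem: "ideal_of M" "I \<subseteq> M" "1 \<notin> M" if "M \<in> C" for M
      using ch that by (auto simp: subset.chain_def)
    have add: "x + y \<in> \<Union>C" if x: "x \<in> M" "M \<in> C" and y: "y \<in> M'" "M' \<in> C" for x y M M'
    proof -
      have "M \<subseteq> M' \<or> M' \<subseteq> M" using ch x y by (auto simp: subset.chain_def)
      then obtain L where L: "L \<in> C" "x \<in> L" "y \<in> L" using x y by blast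
      then have "x + y \<in> L" using mem(1)[OF L(1)] by (simp add: ideal_of_def)
      then show ?thesis using L(1) by blast
    qed
    have mult: "r * x \<in> \<Union>C" if x: "x \<in> M" "M \<in> C" for x r M
    proof -
      have "r * x \<in> M" using mem(1)[OF x(2)] x(1) by (simp add: ideal_of_def)
      then show ?thesis using x(2) by blast
    qed
    have "0 \<in> \<Union>C" using ne mem(1) by (fastforce simp: ideal_of_def)
    then have "ideal_of (\<Union>C)" unfolding ideal_of_def using add mult by blast
    then show "\<Union>C \<in> ?A" using ne mem(2,3) by blast
  qed
  then obtain M where "M \<in> ?A" and max: "\<forall>X\<in>?A. M \<subseteq> X \<longrightarrow> X = M" by (rule bexE)
  then have M: "ideal_of M" "I \<subseteq> M" "1 \<notin> M" by simp_all
  have "\<exists>s. s * x - 1 \<in> M" if x: "x \<notin> M" for x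
  proof -
    let ?X = "{s * x + m |s m. m \<in> M}"
    have MX: "M \<subseteq> ?X"
    proof
      fix m assume "m \<in> M"
      then have "m = 0 * x + m \<and> m \<in> M" by simp
      then show "m \<in> ?X" by blast
    qed
    have add: "y + z \<in> ?X" if "y \<in> ?X" "z \<in> ?X" for y z
    proof -
      obtain s m t k where "y = s * x + m" "z = t * x + k" "m \<in> M" "k \<in> M" using \<open>y \<in> ?X\<close> \<open>z \<in> ?X\<close> by blast
      then have "y + z = (s + t) * x + (m + k)" "m + k \<in> M" using M(1) by (auto simp: ideal_of_def algebra_simps)
      then show ?thesis by blast
    qed
    have mult: "r * y \<in> ?X" if "y \<in> ?X" for y r
    proof -
      obtain s m where "y = s * x + m" "m \<in> M" using \<open>y \<in> ?X\<close> by blast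
      then have "r * y = (r * s) * x + r * m" "r * m \<in> M" using M(1) by (auto simp: ideal_of_def algebra_simps)
      then show ?thesis by blast
    qed
    have "0 \<in> ?X" by (rule subsetD[OF MX]) (use M(1) in \<open>simp add: ideal_of_def\<close>)
    then have idX: "ideal_of ?X" unfolding ideal_of_def using add mult by blast
    have "x = 1 * x + 0" "0 \<in> M" using M(1) by (auto simp: ideal_of_def)
    then have "x \<in> ?X" by blast
    then have "?X \<noteq> M" using x by blast
    then have "1 \<in> ?X" using bspec[OF max, of ?X] idX MX M(2) by blast
    then obtain s m where sm: "1 = s * x + m" "m \<in> M" by blast
    have "(-1) * m \<in> M" using M(1) sm(2) unfolding ideal_of_def by blast
    moreover have "(-1) * m = s * x - 1" using sm(1) by (simp add: algebra_simps)
    ultimately show ?thesis by (intro exI[of _ s]) simp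
  qed
  then show ?thesis using M by blast
qed

text \<open>The weak Nullstellensatz in countably many variables: a maximal ideal has residue field
  \<open>\<complex>\<close>, since otherwise the uncountably many inverses of \<open>r - \<lambda>\<close> would be linearly independent.\<close>

lemma maximal_ideal_eigenvalue:
  fixes M :: "('m::{comm_monoid_add,countable} \<Rightarrow>\<^sub>0 complex) set"
  assumes M: "ideal_of M" "1 \<notin> M" "\<And>x. x \<notin> M \<Longrightarrow> \<exists>s. s * x - 1 \<in> M"
  shows "\<exists>z. r - single 0 z \<in> M"
proof (rule ccontr)
  assume no: "\<nexists>z. r - single 0 z \<in> M"
  have zero: "0 \<in> M" and add: "\<And>x y. x \<in> M \<Longrightarrow> y \<in> M \<Longrightarrow> x + y \<in> M" and mult: "\<And>x s. x \<in> M \<Longrightarrow> s * x \<in> M"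
    using M(1) by (auto simp: ideal_of_def)
  have prime: "x \<in> M" if "x * y \<in> M" "y \<notin> M" for x y
  proof -
    obtain s where "s * y - 1 \<in> M" using M(3)[OF \<open>y \<notin> M\<close>] by blast
    then have "s * (x * y) - x * (s * y - 1) \<in> M" using that mult M(1) ideal_of_diff by blast
    then show ?thesis by (simp add: algebra_simps)
  qed
  let ?C = "single 0 :: complex \<Rightarrow> 'm \<Rightarrow>\<^sub>0 complex"
  define ev :: "complex poly \<Rightarrow> 'm \<Rightarrow>\<^sub>0 complex" where "ev P = poly (map_poly ?C P) r" for P
  have ev_pCons: "ev (pCons a P) = ?C a + r * ev P" for a P
    unfolding ev_def by (simp add: map_poly_pCons)
  have ev_0: "ev 0 = 0" by (simp add: ev_def)
  have ev_add: "ev (P + Q) = ev P + ev Q" for P Q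
    by (induction P Q rule: poly_induct2) (simp_all add: ev_0 ev_pCons single_add algebra_simps)
  have ev_smult: "ev (smult a P) = ?C a * ev P" for a P
    by (induction P) (simp_all add: ev_0 ev_pCons mult_single algebra_simps)
  have ev_mult: "ev (P * Q) = ev P * ev Q" for P Q
    by (induction P) (simp_all add: ev_0 ev_pCons ev_add ev_smult algebra_simps)
  have ev_linear: "ev [:- z, 1:] = r - ?C z" for z
    by (simp add: ev_pCons ev_0 single_uminus)
  have ev_sum: "ev (\<Sum>i\<in>A. g i) = (\<Sum>i\<in>A. ev (g i))" for g :: "real \<Rightarrow> complex poly" and A
    by (induction A rule: infinite_finite_induct) (simp_all add: ev_0 ev_add)
  \<comment> \<open>If no \<open>r - z\<close> lies in \<open>M\<close>, then \<open>r\<close> is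
    transcendental modulo \<open>M\<close>: a nonconstant polynomial has a root, whose linear factor
    can be cancelled because \<open>M\<close> is prime.\<close>
  have nz: "ev P \<notin> M" if "P \<noteq> 0" for P
    using that
  proof (induction "degree P" arbitrary: P rule: less_induct)
    case less
    show ?case
    proof (cases "degree P = 0")
      case True
      then obtain a where a: "P = [:a:]" by (rule degree_eq_zeroE)
      then have "a \<noteq> 0" using less.prems by auto
      show ?thesis
      proof
        assume "ev P \<in> M"
        then have "?C (1 / a) * ev P \<in> M" by (rule mult)
        then show False using \<open>a \<noteq> 0\<close> M(2) by (simp add: a ev_pCons ev_0 mult_single)
      qed
    next
      case False
      then obtain z where "poly P z = 0"
        using fundamental_theorem_of_algebra[of P] by (auto simp: constant_degree)
      then obtain Q where Q: "P = [:- z, 1:] * Q" by (auto simp: poly_eq_0_iff_dvd dvd_def)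
      then have "Q \<noteq> 0" using less.prems by auto
      then have "degree Q < degree P" unfolding Q by (subst degree_mult_eq) auto
      then have "ev Q \<notin> M" using less.hyps \<open>Q \<noteq> 0\<close> by blast
      then show ?thesis using prime[of "r - ?C z" "ev Q"] no unfolding Q ev_mult ev_linear by blast
    qed
  qed
  have "\<forall>x::real. \<exists>s. s * (r - ?C (of_real x)) - 1 \<in> M" using M(3) no by blast
  then obtain s where s: "\<And>x::real. s x * (r - ?C (of_real x)) - 1 \<in> M" by metis
  let ?e = "from_nat :: nat \<Rightarrow> 'm"
  \<comment> \<open>Every inverse \<open>s x\<close> has finite support in a countable set of
    monomials, so one finite set of monomials contains the supports for infinitely many of the
    uncountably many \<open>x\<close>. More than \<open>j\<close> of them are linearly
    dependent.\<close>
  have "\<exists>j. infinite {x. keys (s x) \<subseteq> ?e ` {..<j}}"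
  proof (rule ccontr)
    assume "\<nexists>j. infinite {x. keys (s x) \<subseteq> ?e ` {..<j}}"
    then have "countable (\<Union>j. {x. keys (s x) \<subseteq> ?e ` {..<j}})"
      by (intro countable_UN) (auto intro: countable_finite)
    moreover have "(\<Union>j. {x. keys (s x) \<subseteq> ?e ` {..<j}}) = UNIV"
    proof (intro equalityI subsetI UNIV_I)
      fix x :: real
      define j where "j = Suc (Max (to_nat ` keys (s x)))"
      have "keys (s x) \<subseteq> ?e ` {..<j}"
      proof
        fix m assume "m \<in> keys (s x)"
        then have "to_nat m < j" unfolding j_def by (simp add: less_Suc_eq_le)
        then show "m \<in> ?e ` {..<j}" by (intro image_eqI[of _ _ "to_nat m"]) auto
      qed
      then show "x \<in> (\<Union>j. {x. keys (s x) \<subseteq> ?e ` {..<j}})" by blast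
    qed
    ultimately show False using uncountable_UNIV_real by simp
  qed
  then obtain j where "infinite {x. keys (s x) \<subseteq> ?e ` {..<j}}" by blast
  then obtain X where X: "X \<subseteq> {x. keys (s x) \<subseteq> ?e ` {..<j}}" "finite X" "card X = Suc j"
    using infinite_arbitrarily_large by metis
  have "card (?e ` {..<j}) < card X" using card_image_le[of "{..<j}" ?e] X(3) by simp
  then obtain c where c: "\<forall>m\<in>?e ` {..<j}. (\<Sum>x\<in>X. c x * lookup (s x) m) = 0" "\<exists>x\<in>X. c x \<noteq> 0"
    using nontrivial_solution[of "?e ` {..<j}" X "\<lambda>x m. lookup (s x) m"] X(2) by auto
  have cs: "(\<Sum>x\<in>X. ?C (c x) * s x) = 0"
  proof (rule poly_mapping_eqI)
    fix m
    have "lookup (?C a * p) m = a * lookup p m" for a p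
    proof -
      have "?C a * p = Poly_Mapping.map ((*) a) p" by (rule mult_map_scale_conv_mult[symmetric])
      then show ?thesis by (simp add: map.rep_eq when_def)
    qed
    then have "lookup (\<Sum>x\<in>X. ?C (c x) * s x) m = (\<Sum>x\<in>X. c x * lookup (s x) m)"
      by (simp add: lookup_sum)
    also have "\<dots> = 0"
    proof (cases "m \<in> ?e ` {..<j}")
      case False
      then have "m \<notin> keys (s x)" if "x \<in> X" for x using X(1) that by blast
      then have "lookup (s x) m = 0" if "x \<in> X" for x using that by (simp add: in_keys_iff)
      then show ?thesis by simp
    qed (use c(1) in blast)
    finally show "lookup (\<Sum>x\<in>X. ?C (c x) * s x) m = lookup 0 m" by simp
  qed
  let ?l = "\<lambda>x::real. [:- of_real x, 1:] :: complex poly"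
  \<comment> \<open>The dependency between the inverses of \<open>r - x\<close>, multiplied by all
    these differences, becomes a polynomial relation for \<open>r\<close>. At the point
    \<open>x\<close> every summand except that of \<open>x\<close> vanishes, so the polynomial is
    nonzero.\<close>
  define P where "P = (\<Sum>x\<in>X. smult (c x) (\<Prod>y\<in>X - {x}. ?l y))"
  have "P \<noteq> 0"
  proof -
    obtain x where x: "x \<in> X" "c x \<noteq> 0" using c(2) by blast
    have "poly P (of_real x) = (\<Sum>z\<in>X. c z * (\<Prod>y\<in>X - {z}. of_real x - of_real y))"
      unfolding P_def poly_sum poly_smult poly_prod by simp
    also have "\<dots> = (\<Sum>z\<in>X. if z = x then c x * (\<Prod>y\<in>X - {x}. of_real x - of_real y) else 0)"
    proof (rule sum.cong[OF refl])
      fix z assume "z \<in> X"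
      have "(\<Prod>y\<in>X - {z}. of_real x - of_real y) = (0::complex)" if "z \<noteq> x"
        using X(2) x(1) that by (intro prod_zero) auto
      then show "c z * (\<Prod>y\<in>X - {z}. of_real x - of_real y) = (if z = x then c x * (\<Prod>y\<in>X - {x}. of_real x - of_real y) else 0)"
        by auto
    qed
    also have "\<dots> = c x * (\<Prod>y\<in>X - {x}. of_real x - of_real y)" using X(2) x(1) by simp
    also have "\<dots> \<noteq> 0" using x(2) X(2) by (auto simp: prod_zero_iff)
    finally show ?thesis by auto
  qed
  moreover have "ev P \<in> M"
  proof -
    let ?P = "\<lambda>x. ev (\<Prod>y\<in>X - {x}. ?l y)"
    let ?Q = "ev (\<Prod>y\<in>X. ?l y)"
    have Q: "?Q = (r - ?C (of_real x)) * ?P x" if "x \<in> X" for x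
      using prod.remove[OF X(2) that, of ?l] by (simp only: ev_mult ev_linear)
    have "(\<Sum>x\<in>X. ?C (c x) * ?P x * (s x * (r - ?C (of_real x)) - 1)) \<in> M"
      by (rule ideal_of_sum[OF M(1)]) (use s mult in blast)
    also have "(\<Sum>x\<in>X. ?C (c x) * ?P x * (s x * (r - ?C (of_real x)) - 1)) = (\<Sum>x\<in>X. ?C (c x) * s x * ?Q - ?C (c x) * ?P x)"
      by (rule sum.cong[OF refl]) (simp add: Q algebra_simps)
    also have "\<dots> = (\<Sum>x\<in>X. ?C (c x) * s x) * ?Q - ev P"
      unfolding P_def ev_sum ev_smult by (simp add: sum_subtractf sum_distrib_right)
    finally have "- ev P \<in> M" unfolding cs by simp
    then have "(-1) * (- ev P) \<in> M" by (rule mult)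
    then show ?thesis by simp
  qed
  ultimately show False using nz by blast
qed

text \<open>Modulo a maximal ideal every element is congruent to exactly one scalar, and the
  character is this scalar.\<close>

lemma character_exists:
  fixes I :: "('m::{comm_monoid_add,countable} \<Rightarrow>\<^sub>0 complex) set"
  assumes I: "ideal_of I" "1 \<notin> I"
  obtains hm where "hm 1 = 1" "\<And>x y. hm (x + y) = hm x + hm y" "\<And>x y. hm (x * y) = hm x * hm y"
    "\<And>z. hm (single 0 z) = (z::complex)" "\<And>x. x \<in> I \<Longrightarrow> hm x = 0"
proof -
  obtain M where M: "ideal_of M" "I \<subseteq> M" "1 \<notin> M" "\<And>x. x \<notin> M \<Longrightarrow> \<exists>s. s * x - 1 \<in> M"
    using maximal_ideal_exists[OF I] by blast
  have add: "\<And>x y. x \<in> M \<Longrightarrow> y \<in> M \<Longrightarrow> x + y \<in> M" and mult: "\<And>x s. x \<in> M \<Longrightarrow> s * x \<in> M"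
    using M(1) by (auto simp: ideal_of_def)
  let ?C = "single 0 :: complex \<Rightarrow> 'm \<Rightarrow>\<^sub>0 complex"
  define hm where "hm r = (SOME z. r - ?C z \<in> M)" for r
  have hm: "r - ?C (hm r) \<in> M" for r
    unfolding hm_def by (rule someI_ex[OF maximal_ideal_eigenvalue[OF M(1,3,4)]])
  have uniq: "hm r = z" if "r - ?C z \<in> M" for r z
  proof (rule ccontr)
    assume n: "hm r \<noteq> z"
    have "?C (1 / (z - hm r)) * ((r - ?C (hm r)) - (r - ?C z)) \<in> M"
      by (intro mult ideal_of_diff[OF M(1)] hm that)
    also have "(r - ?C (hm r)) - (r - ?C z) = ?C (z - hm r)" by (simp add: single_diff)
    finally show False using n M(3) by (simp add: mult_single)
  qed
  show ?thesis
  proof (rule that[of hm])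
    show c: "hm (?C z) = z" for z by (rule uniq) (use M(1) in \<open>simp add: ideal_of_def\<close>)
    show "hm 1 = 1" using c[of 1] by simp
    show "hm (x + y) = hm x + hm y" for x y
    proof (rule uniq)
      have "(x - ?C (hm x)) + (y - ?C (hm y)) \<in> M" by (intro add hm)
      then show "x + y - ?C (hm x + hm y) \<in> M" by (simp add: single_add algebra_simps)
    qed
    show "hm (x * y) = hm x * hm y" for x y
    proof (rule uniq)
      have "y * (x - ?C (hm x)) + ?C (hm x) * (y - ?C (hm y)) \<in> M" by (intro add mult hm)
      moreover have "?C (hm x * hm y) = ?C (hm x) * ?C (hm y)" by (simp add: mult_single)
      ultimately show "x * y - ?C (hm x * hm y) \<in> M" by (simp add: algebra_simps)
    qed
    show "hm x = 0" if "x \<in> I" for x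
      by (rule uniq) (use that M(2) in auto)
  qed
qed

section \<open>Necessity\<close>

lemma partition_function_graph_of:
  assumes G: "wf_multigraph G"
  shows "partition_function k y (graph_of G) = multigraph_partition_function k y G"
proof -
  obtain H :: "(nat, nat) multigraph" where H: "wf_multigraph H" "isomorphic G H"
    using ex_nat_multigraph[OF G] by blast
  have "graph_of G = abs_graph H" using graph_of_cong[OF G H(2)] graph_of_nat[OF H(1)] by simp
  then have "partition_function k y (graph_of G) = multigraph_partition_function k y H"
    using partition_function.abs_eq[of H k y] H(1) isomorphic_refl[of H] by simp
  then show ?thesis using multigraph_partition_function_isomorphic[OF G H(2)] by simp
qed

lemma replicate_mset_sum: "replicate_mset (\<Sum>e\<in>C. g e) x = (\<Sum>e\<in>C. replicate_mset (g e) x)"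
proof (rule multiset_eqI)
  fix z show "count (replicate_mset (\<Sum>e\<in>C. g e) x) z = count (\<Sum>e\<in>C. replicate_mset (g e) x) z"
    unfolding count_sum_mset_fun by (cases "z = x") simp_all
qed

text \<open>A colouring of the merged edges is a colouring of the old edges that is constant on
  classes, and for this agreement on adjacent edges suffices. Dissolved vertices contribute no
  weight.\<close>

lemma multigraph_partition_function_dissolve:
  assumes X: "wf_multigraph X"
  shows "multigraph_partition_function n y (dissolve S X) =
    (\<Sum>\<kappa> | \<kappa> \<in> edges X \<rightarrow>\<^sub>E {1..n} \<and> (\<forall>(e, e')\<in>adj S X. \<kappa> e = \<kappa> e').
      \<Prod>v\<in>verts X - S. y (count (colours_at X \<kappa> v)))"
proof -
  have fin: "finite (edges X)" using X by (simp add: wf_multigraph_def)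
  let ?q = "edges X // (adj S X)\<^sup>*"
  have const: "\<kappa> e = \<kappa> e'" if "\<forall>(e, e')\<in>adj S X. \<kappa> e = \<kappa> e'" "(e, e') \<in> (adj S X)\<^sup>*" for \<kappa> :: "'b \<Rightarrow> nat" and e e'
    using that(2) by (induction rule: rtrancl_induct) (use that(1) in auto)
  have mem: "cls S X e \<in> ?q" if "e \<in> edges X" for e using that by (simp add: quotient_cls)
  have sm: "(SOME e. e \<in> C) \<in> edges X \<and> cls S X (SOME e. e \<in> C) = C" if "C \<in> ?q" for C
  proof -
    obtain e where e: "e \<in> edges X" "C = cls S X e" using \<open>C \<in> ?q\<close> by (auto simp: quotient_cls)
    then have "(SOME e. e \<in> C) \<in> C" by (intro someI[of "\<lambda>e. e \<in> C" e]) simp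
    then have "(e, SOME e. e \<in> C) \<in> (adj S X)\<^sup>*" using e(2) by simp
    then show ?thesis using e adj_rtrancl_edges cls_eq_iff by metis
  qed
  show ?thesis
    unfolding multigraph_partition_function_def dissolve_sel
  proof (rule sum.reindex_bij_witness[where i = "\<lambda>\<kappa>. restrict (\<lambda>C. \<kappa> (SOME e. e \<in> C)) ?q"
        and j = "\<lambda>\<kappa>. restrict (\<lambda>e. \<kappa> (cls S X e)) (edges X)"], goal_cases)
    case (1 \<kappa>)
    show ?case
    proof
      fix C show "restrict (\<lambda>C. restrict (\<lambda>e. \<kappa> (cls S X e)) (edges X) (SOME e. e \<in> C)) ?q C = \<kappa> C"
        using sm[of C] PiE_arb[OF 1, of C] by (cases "C \<in> ?q") simp_all
    qed
  next
    case (2 \<kappa>)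
    have "restrict (\<lambda>e. \<kappa> (cls S X e)) (edges X) \<in> edges X \<rightarrow>\<^sub>E {1..n}"
      by (intro restrict_PiE_iff[THEN iffD2] ballI PiE_mem[OF 2] mem)
    moreover have "restrict (\<lambda>e. \<kappa> (cls S X e)) (edges X) e = restrict (\<lambda>e. \<kappa> (cls S X e)) (edges X) e'"
      if ee: "(e, e') \<in> adj S X" for e e'
    proof -
      have "cls S X e = cls S X e'" using ee unfolding cls_eq_iff by blast
      then show ?thesis using adj_edges[OF ee] by (simp only: restrict_apply simp_thms if_True)
    qed
    ultimately show ?case by blast
  next
    case (3 \<kappa>)
    then have k: "\<kappa> \<in> edges X \<rightarrow>\<^sub>E {1..n}" "\<forall>(e, e')\<in>adj S X. \<kappa> e = \<kappa> e'" by auto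
    show ?case
    proof
      fix e show "restrict (\<lambda>e. restrict (\<lambda>C. \<kappa> (SOME e. e \<in> C)) ?q (cls S X e)) (edges X) e = \<kappa> e"
      proof (cases "e \<in> edges X")
        case True
        have "cls S X (SOME e'. e' \<in> cls S X e) = cls S X e" using sm[OF mem[OF True]] by blast
        then have "(SOME e'. e' \<in> cls S X e, e) \<in> (adj S X)\<^sup>*" unfolding cls_eq_iff .
        then show ?thesis using const[OF k(2)] True mem[OF True] by simp
      qed (use PiE_arb[OF k(1)] in simp)
    qed
  next
    case (4 \<kappa>)
    then have k: "\<kappa> \<in> edges X \<rightarrow>\<^sub>E {1..n}" by auto
    show ?case using sm by (intro restrict_PiE_iff[THEN iffD2] ballI PiE_mem[OF k]) blast
  next
    case (5 \<kappa>)
    let ?k = "restrict (\<lambda>e. \<kappa> (cls S X e)) (edges X)"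
    have "colours_at X ?k v = colours_at (dissolve S X) \<kappa> v" if v: "v \<in> verts X - S" for v
    proof -
      have "colours_at (dissolve S X) \<kappa> v = (\<Sum>C\<in>?q. \<Sum>e\<in>C. replicate_mset (count (ends X e) v) (?k e))"
        unfolding colours_at_def dissolve_sel
      proof (rule sum.cong[OF refl])
        fix C assume C: "C \<in> ?q"
        obtain e0 where e0: "e0 \<in> edges X" "C = cls S X e0" using C by (auto simp: quotient_cls)
        have ke: "?k e = \<kappa> C" if "e \<in> C" for e
        proof -
          have "(e0, e) \<in> (adj S X)\<^sup>*" using that e0(2) by simp
          then have "cls S X e = C" "e \<in> edges X" using e0 adj_rtrancl_edges cls_eq_iff by metis+
          then show ?thesis by (simp only: restrict_apply if_True)
        qed
        have "replicate_mset (count (\<Sum>e\<in>C. filter_mset (\<lambda>v. v \<notin> S) (ends X e)) v) (\<kappa> C) =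
            (\<Sum>e\<in>C. replicate_mset (count (ends X e) v) (\<kappa> C))"
          unfolding count_sum_mset_fun replicate_mset_sum using v by simp
        also have "\<dots> = (\<Sum>e\<in>C. replicate_mset (count (ends X e) v) (?k e))"
          by (rule sum.cong[OF refl]) (simp only: ke)
        finally show "replicate_mset (count (\<Sum>e\<in>C. filter_mset (\<lambda>v. v \<notin> S) (ends X e)) v) (\<kappa> C) =
            (\<Sum>e\<in>C. replicate_mset (count (ends X e) v) (?k e))" .
      qed
      also have "\<dots> = colours_at X ?k v" unfolding colours_at_def by (rule sum_quotient[OF fin])
      finally show ?thesis by simp
    qed
    then show ?case by (intro prod.cong refl) (simp only: dissolve_sel)
  qed
qed

section \<open>Partition functions of fragments and their gluings\<close>

lemma sum_PiE_Plus:
  "(\<Sum>\<kappa>\<in>A <+> D \<rightarrow>\<^sub>E T. g \<kappa>) = (\<Sum>\<kappa>\<in>A \<rightarrow>\<^sub>E T. \<Sum>\<kappa>'\<in>D \<rightarrow>\<^sub>E T. g (case_sum \<kappa> \<kappa>'))"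
proof -
  have "(\<Sum>\<kappa>\<in>A <+> D \<rightarrow>\<^sub>E T. g \<kappa>) = (\<Sum>(\<kappa>, \<kappa>')\<in>(A \<rightarrow>\<^sub>E T) \<times> (D \<rightarrow>\<^sub>E T). g (case_sum \<kappa> \<kappa>'))"
  proof (rule sum.reindex_bij_witness[where i = "\<lambda>(\<kappa>, \<kappa>'). case_sum \<kappa> \<kappa>'" and j = "\<lambda>\<kappa>. (\<kappa> \<circ> Inl, \<kappa> \<circ> Inr)"], goal_cases)
    case (1 \<kappa>)
    show ?case unfolding prod.case comp_def by (rule surjective_sum)
  next
    case (2 \<kappa>)
    show ?case by (auto intro!: PiE_I PiE_mem[OF 2] PiE_arb[OF 2])
  next
    case (3 p)
    show ?case by (cases p) (simp add: fun_eq_iff)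
  next
    case (4 p)
    then obtain \<kappa> \<kappa>' where p: "p = (\<kappa>, \<kappa>')" "\<kappa> \<in> A \<rightarrow>\<^sub>E T" "\<kappa>' \<in> D \<rightarrow>\<^sub>E T" by (elim SigmaE)
    show ?case unfolding p(1) prod.case
    proof (rule PiE_I)
      fix x assume "x \<in> A <+> D"
      then show "case_sum \<kappa> \<kappa>' x \<in> T" using PiE_mem[OF p(2)] PiE_mem[OF p(3)] by (cases x) auto
    next
      fix x assume "x \<notin> A <+> D"
      then show "case_sum \<kappa> \<kappa>' x = undefined" using PiE_arb[OF p(2)] PiE_arb[OF p(3)] by (cases x) auto
    qed
  next
    case (5 \<kappa>)
    have "case_sum (\<kappa> \<circ> Inl) (\<kappa> \<circ> Inr) = \<kappa>" unfolding comp_def by (rule surjective_sum)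
    then show ?case by (simp only: prod.case)
  qed
  then show ?thesis by (simp only: sum.cartesian_product)
qed

text \<open>The factor in the factorization of the connection matrix: the colours at the labelled
  ends are prescribed by \<open>\<phi>\<close>, and labelled vertices carry no weight because gluing
  dissolves them.\<close>

definition open_partition_function :: "nat \<Rightarrow> nat \<Rightarrow> ((nat \<Rightarrow> nat) \<Rightarrow> complex) \<Rightarrow> fragment \<Rightarrow> (nat \<Rightarrow> nat) \<Rightarrow> complex" where
  "open_partition_function n K y F \<phi> = (\<Sum>\<kappa>\<in>edges (fst F) \<rightarrow>\<^sub>E {1..n}.
     of_bool (\<forall>i\<in>{1..K}. \<forall>e\<in>edges (fst F). snd F i \<in># ends (fst F) e \<longrightarrow> \<kappa> e = \<phi> i) *
     (\<Prod>v\<in>verts (fst F) - snd F ` {1..K}. y (count (colours_at (fst F) \<kappa> v))))"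

lemma fragment_edge:
  assumes "(G, l) \<in> fragments K"
  obtains en where "\<And>i. i \<in> {1..K} \<Longrightarrow> en i \<in> edges G"
    "\<And>i e. i \<in> {1..K} \<Longrightarrow> e \<in> edges G \<Longrightarrow> l i \<in># ends G e \<longleftrightarrow> e = en i"
proof -
  have fin: "finite (edges G)" using assms by (auto simp: fragments_def wf_multigraph_def)
  have "\<forall>i\<in>{1..K}. \<exists>e0. e0 \<in> edges G \<and> (\<forall>e\<in>edges G. l i \<in># ends G e \<longleftrightarrow> e = e0)"
  proof
    fix i assume "i \<in> {1..K}"
    then have "(\<Sum>e\<in>edges G. count (ends G e) (l i)) = 1"
      using assms by (auto simp: fragments_def Defs.degree_def)
    then obtain e0 where e0: "e0 \<in> edges G" "count (ends G e0) (l i) = 1"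
      "\<forall>e\<in>edges G. e0 \<noteq> e \<longrightarrow> count (ends G e) (l i) = 0"
      unfolding sum_eq_1_iff[OF fin] by blast
    then have "l i \<in># ends G e0" by (simp add: count_inI)
    moreover have "l i \<notin># ends G e" if "e \<in> edges G" "e \<noteq> e0" for e
      using e0(3) that by (auto simp: not_in_iff)
    ultimately show "\<exists>e0. e0 \<in> edges G \<and> (\<forall>e\<in>edges G. l i \<in># ends G e \<longleftrightarrow> e = e0)" using e0(1) by blast
  qed
  from bchoice[OF this] obtain en where "\<forall>i\<in>{1..K}. en i \<in> edges G \<and> (\<forall>e\<in>edges G. l i \<in># ends G e \<longleftrightarrow> e = en i)" by blast
  then show ?thesis by (intro that[of en]) auto
qed

text \<open>The two edges that meet at a label must get the same colour, and once this common colour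
  is fixed the two fragments are coloured independently. Well-formedness is proved along the way,
  since a label has degree 1 on each side and hence 2 after identification.\<close>

lemma
  assumes G: "(G, l) \<in> fragments K" and H: "(H, m) \<in> fragments K"
  shows multigraph_partition_function_glue: "multigraph_partition_function n y (glue K (G, l) (H, m)) =
      (\<Sum>\<phi>\<in>{1..K} \<rightarrow>\<^sub>E {1..n}. open_partition_function n K y (G, l) \<phi> * open_partition_function n K y (H, m) \<phi>)"
    and wf_glue: "wf_multigraph (glue K (G, l) (H, m))"
proof -
  have wf: "wf_multigraph G" "wf_multigraph H"
    and l: "\<And>i. i \<in> {1..K} \<Longrightarrow> l i \<in> verts G" and m: "\<And>i. i \<in> {1..K} \<Longrightarrow> m i \<in> verts H"
    and inj: "inj_on l {1..K}" "inj_on m {1..K}"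
    and deg: "\<And>i. i \<in> {1..K} \<Longrightarrow> Defs.degree G (l i) = 1" "\<And>i. i \<in> {1..K} \<Longrightarrow> Defs.degree H (m i) = 1"
    using G H by (auto simp: fragments_def)
  have fin: "finite (edges G)" "finite (edges H)" "finite (verts G)" "finite (verts H)"
    using wf by (auto simp: wf_multigraph_def)
  define \<psi> where "\<psi> w = (if w \<in> m ` {1..K} then Inl (l (inv_into {1..K} m w)) else Inr w)" for w
  define X where "X = map_verts (case_sum Inl \<psi>) (disjoint_union G H)"
  define S :: "(nat + nat) set" where "S = Inl ` l ` {1..K}"
  have glue: "glue K (G, l) (H, m) = dissolve S X" by (simp add: X_def S_def \<psi>_def[abs_def])
  have wfX: "wf_multigraph X" unfolding X_def by (intro wf_map_verts wf_disjoint_union wf)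
  have \<psi>m: "\<psi> (m i) = Inl (l i)" if "i \<in> {1..K}" for i
    using that inj(2) by (simp add: \<psi>_def)
  have \<psi>l: "\<psi> w = Inl (l i) \<longleftrightarrow> w = m i" if i: "i \<in> {1..K}" for i w
  proof
    assume a: "\<psi> w = Inl (l i)"
    then have w: "w \<in> m ` {1..K}" by (auto simp: \<psi>_def split: if_splits)
    then obtain j where j: "j \<in> {1..K}" "w = m j" by blast
    then have "l j = l i" using a \<psi>m[OF j(1)] by simp
    then have "j = i" by (rule inj_onD[OF inj(1) _ j(1) i])
    then show "w = m i" using j(2) by simp
  qed (use \<psi>m i in simp)
  have \<psi>r: "\<psi> w' = Inr w \<longleftrightarrow> w' = w \<and> w \<notin> m ` {1..K}" for w w' by (auto simp: \<psi>_def)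
  have \<psi>n: "\<psi> w \<noteq> Inl v" if "v \<notin> l ` {1..K}" for v w
    using that inj(2) by (auto simp: \<psi>_def)
  have edX: "edges X = edges G <+> edges H" by (simp add: X_def)
  have endl: "ends X (Inl e) = image_mset Inl (ends G e)" for e
    by (simp add: X_def multiset.map_comp comp_def)
  have endr: "ends X (Inr d) = image_mset \<psi> (ends H d)" for d
    by (simp add: X_def multiset.map_comp comp_def)
  have cl: "count (ends X (Inl e)) (Inl v) = count (ends G e) v" "count (ends X (Inl e)) (Inr w) = 0" for e v w
    unfolding endl by (rule count_image_mset_inj) (auto simp: inj_on_def count_eq_zero_iff)
  have count_image_single: "count (image_mset h M) x = count M z" if "\<And>a. h a = x \<longleftrightarrow> a = z" for h :: "nat \<Rightarrow> nat + nat" and M x z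
  proof (induction M)
    case (add a M)
    then show ?case using that[of a] by simp
  qed simp
  have cr: "count (ends X (Inr d)) (Inl (l i)) = count (ends H d) (m i)" if "i \<in> {1..K}" for d i
    unfolding endr by (rule count_image_single[OF \<psi>l[OF that]])
  have crn: "count (ends X (Inr d)) (Inl v) = 0" if "v \<notin> l ` {1..K}" for d v
  proof -
    have "Inl v \<notin># image_mset \<psi> (ends H d)" using \<psi>n[OF that] by fastforce
    then show ?thesis unfolding endr by (simp only: not_in_iff)
  qed
  have crr: "count (ends X (Inr d)) (Inr w) = count (ends H d) w" if "w \<notin> m ` {1..K}" for d w
    unfolding endr by (rule count_image_single) (use \<psi>r that in auto)
  have plus: "(\<Sum>e\<in>edges X. g e) = (\<Sum>e\<in>edges G. g (Inl e)) + (\<Sum>d\<in>edges H. g (Inr d))" for g :: "nat + nat \<Rightarrow> 'z::comm_monoid_add"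
    unfolding edX Plus_def using fin by (subst sum.union_disjoint) (auto simp: sum.reindex)
  show wfg: "wf_multigraph (glue K (G, l) (H, m))"
    unfolding glue
  proof (rule wf_dissolve[OF wfX])
    fix v assume "v \<in> S"
    then obtain i where i: "i \<in> {1..K}" "v = Inl (l i)" by (auto simp: S_def)
    show "Defs.degree X v = 2"
      using deg[OF i(1)] by (simp add: Defs.degree_def plus i(2) cl cr[OF i(1)])
  qed (simp add: S_def)
  have vX: "verts X - S = Inl ` (verts G - l ` {1..K}) \<union> Inr ` (verts H - m ` {1..K})"
  proof -
    have "verts X = Inl ` verts G \<union> \<psi> ` verts H"
      by (simp add: X_def Plus_def image_Un image_image)
    moreover have "\<psi> ` verts H \<subseteq> S \<union> Inr ` (verts H - m ` {1..K})"
      using inj(2) by (auto simp: \<psi>_def S_def)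
    moreover have "Inr ` (verts H - m ` {1..K}) \<subseteq> \<psi> ` verts H"
      by (auto simp: \<psi>_def image_iff)
    ultimately show ?thesis by (auto simp: S_def)
  qed
  obtain en where en: "\<And>i. i \<in> {1..K} \<Longrightarrow> en i \<in> edges G"
    "\<And>i e. i \<in> {1..K} \<Longrightarrow> e \<in> edges G \<Longrightarrow> l i \<in># ends G e \<longleftrightarrow> e = en i" using fragment_edge[OF G] by blast
  obtain dn where dn: "\<And>i. i \<in> {1..K} \<Longrightarrow> dn i \<in> edges H"
    "\<And>i e. i \<in> {1..K} \<Longrightarrow> e \<in> edges H \<Longrightarrow> m i \<in># ends H e \<longleftrightarrow> e = dn i" using fragment_edge[OF H] by blast
  have inX: "Inl (l i) \<in># ends X e \<longleftrightarrow> e = Inl (en i) \<or> e = Inr (dn i)" if i: "i \<in> {1..K}" and e: "e \<in> edges X" for i e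
  proof (cases e)
    case (Inl a)
    then have "Inl (l i) \<in># ends X e \<longleftrightarrow> l i \<in># ends G a" by (auto simp: endl)
    then show ?thesis using en(2)[OF i, of a] Inl e by (auto simp: edX)
  next
    case (Inr a)
    have "Inl (l i) \<in># ends X e \<longleftrightarrow> m i \<in># ends H a"
      using cr[OF i, of a] unfolding Inr by (metis count_greater_zero_iff)
    then show ?thesis using dn(2)[OF i, of a] Inr e by (auto simp: edX)
  qed
  have adjX: "(\<forall>(e, e')\<in>adj S X. case_sum \<kappa> \<kappa>' e = case_sum \<kappa> \<kappa>' e') \<longleftrightarrow> (\<forall>i\<in>{1..K}. \<kappa> (en i) = \<kappa>' (dn i))" for \<kappa> \<kappa>' :: "nat \<Rightarrow> nat"
  proof
    assume a: "\<forall>(e, e')\<in>adj S X. case_sum \<kappa> \<kappa>' e = case_sum \<kappa> \<kappa>' e'"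
    show "\<forall>i\<in>{1..K}. \<kappa> (en i) = \<kappa>' (dn i)"
    proof
      fix i assume i: "i \<in> {1..K}"
      have e: "Inl (en i) \<in> edges X" "Inr (dn i) \<in> edges X"
        using en(1)[OF i] dn(1)[OF i] by (auto simp: edX)
      then have "Inl (l i) \<in># ends X (Inl (en i))" "Inl (l i) \<in># ends X (Inr (dn i))"
        using inX[OF i] by simp_all
      then have "(Inl (en i), Inr (dn i)) \<in> adj S X"
        using e i by (auto simp: adj_def S_def simp del: atLeastAtMost_iff)
      then show "\<kappa> (en i) = \<kappa>' (dn i)" using a by auto
    qed
  next
    assume a: "\<forall>i\<in>{1..K}. \<kappa> (en i) = \<kappa>' (dn i)"
    show "\<forall>(e, e')\<in>adj S X. case_sum \<kappa> \<kappa>' e = case_sum \<kappa> \<kappa>' e'"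
    proof clarify
      fix e e' assume "(e, e') \<in> adj S X"
      then obtain i where i: "i \<in> {1..K}" "e \<in> edges X" "e' \<in> edges X" "Inl (l i) \<in># ends X e" "Inl (l i) \<in># ends X e'"
        by (auto simp: adj_def S_def)
      then have "e = Inl (en i) \<or> e = Inr (dn i)" "e' = Inl (en i) \<or> e' = Inr (dn i)" using inX by blast+
      then show "case_sum \<kappa> \<kappa>' e = case_sum \<kappa> \<kappa>' e'" using a i(1) by auto
    qed
  qed
  have oG: "open_partition_function n K y (G, l) \<phi> = (\<Sum>\<kappa>\<in>edges G \<rightarrow>\<^sub>E {1..n}.
     of_bool (\<forall>i\<in>{1..K}. \<kappa> (en i) = \<phi> i) * (\<Prod>v\<in>verts G - l ` {1..K}. y (count (colours_at G \<kappa> v))))" for \<phi>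
  proof -
    have "(\<forall>i\<in>{1..K}. \<forall>e\<in>edges G. l i \<in># ends G e \<longrightarrow> \<kappa> e = \<phi> i) \<longleftrightarrow> (\<forall>i\<in>{1..K}. \<kappa> (en i) = \<phi> i)" for \<kappa>
      using en by blast
    then show ?thesis by (simp only: open_partition_function_def fst_conv snd_conv)
  qed
  have oH: "open_partition_function n K y (H, m) \<phi> = (\<Sum>\<kappa>\<in>edges H \<rightarrow>\<^sub>E {1..n}.
     of_bool (\<forall>i\<in>{1..K}. \<kappa> (dn i) = \<phi> i) * (\<Prod>v\<in>verts H - m ` {1..K}. y (count (colours_at H \<kappa> v))))" for \<phi>
  proof -
    have "(\<forall>i\<in>{1..K}. \<forall>e\<in>edges H. m i \<in># ends H e \<longrightarrow> \<kappa> e = \<phi> i) \<longleftrightarrow> (\<forall>i\<in>{1..K}. \<kappa> (dn i) = \<phi> i)" for \<kappa>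
      using dn by blast
    then show ?thesis by (simp only: open_partition_function_def fst_conv snd_conv)
  qed
  define gG where "gG \<kappa> = (\<Prod>v\<in>verts G - l ` {1..K}. y (count (colours_at G \<kappa> v)))" for \<kappa>
  define gH where "gH \<kappa> = (\<Prod>v\<in>verts H - m ` {1..K}. y (count (colours_at H \<kappa> v)))" for \<kappa>
  have finE: "finite (edges X \<rightarrow>\<^sub>E {1..n})" using fin by (intro finite_PiE) (auto simp: edX)
  have prod: "(\<Prod>v\<in>verts X - S. y (count (colours_at X (case_sum \<kappa> \<kappa>') v))) = gG \<kappa> * gH \<kappa>'" for \<kappa> \<kappa>'
  proof -
    have 1: "colours_at X (case_sum \<kappa> \<kappa>') (Inl v) = colours_at G \<kappa> v" if "v \<in> verts G - l ` {1..K}" for v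
      using crn that by (simp add: colours_at_def plus cl)
    have 2: "colours_at X (case_sum \<kappa> \<kappa>') (Inr w) = colours_at H \<kappa>' w" if "w \<in> verts H - m ` {1..K}" for w
      using crr that by (simp add: colours_at_def plus cl)
    have "(\<Prod>v\<in>verts X - S. y (count (colours_at X (case_sum \<kappa> \<kappa>') v))) =
        (\<Prod>v\<in>verts G - l ` {1..K}. y (count (colours_at X (case_sum \<kappa> \<kappa>') (Inl v)))) *
        (\<Prod>w\<in>verts H - m ` {1..K}. y (count (colours_at X (case_sum \<kappa> \<kappa>') (Inr w))))"
      unfolding vX using fin by (subst prod.union_disjoint) (auto simp: prod.reindex)
    also have "\<dots> = gG \<kappa> * gH \<kappa>'" unfolding gG_def gH_def using 1 2 by simp
    finally show ?thesis .
  qed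
  have "multigraph_partition_function n y (glue K (G, l) (H, m)) =
      (\<Sum>\<kappa>\<in>edges X \<rightarrow>\<^sub>E {1..n}. if \<forall>(e, e')\<in>adj S X. \<kappa> e = \<kappa> e' then \<Prod>v\<in>verts X - S. y (count (colours_at X \<kappa> v)) else 0)"
    unfolding glue multigraph_partition_function_dissolve[OF wfX]
    by (subst sum.inter_filter[OF finE, symmetric]) (rule sum.cong, auto)
  also have "\<dots> = (\<Sum>\<kappa>\<in>edges G \<rightarrow>\<^sub>E {1..n}. \<Sum>\<kappa>'\<in>edges H \<rightarrow>\<^sub>E {1..n}.
      of_bool (\<forall>i\<in>{1..K}. \<kappa> (en i) = \<kappa>' (dn i)) * (gG \<kappa> * gH \<kappa>'))"
    unfolding edX sum_PiE_Plus adjX prod by (simp only: of_bool_def if_distrib[of "\<lambda>x. x * _"] mult_1 mult_zero_left)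
  \<comment> \<open>Agreement at all labels is written as a sum over the common colours
    \<open>\<phi>\<close>, at most one term of which is nonzero; this separates the two
    fragments.\<close>
  also have "\<dots> = (\<Sum>\<kappa>\<in>edges G \<rightarrow>\<^sub>E {1..n}. \<Sum>\<kappa>'\<in>edges H \<rightarrow>\<^sub>E {1..n}.
      (\<Sum>\<phi>\<in>{1..K} \<rightarrow>\<^sub>E {1..n}. of_bool (\<forall>i\<in>{1..K}. \<kappa> (en i) = \<phi> i) * of_bool (\<forall>i\<in>{1..K}. \<kappa>' (dn i) = \<phi> i)) * (gG \<kappa> * gH \<kappa>'))"
  proof (intro sum.cong refl arg_cong2[of _ _ _ _ "(*)"])
    fix \<kappa> \<kappa>' assume k: "\<kappa> \<in> edges G \<rightarrow>\<^sub>E {1..n}"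
    let ?p = "restrict (\<lambda>i. \<kappa> (en i)) {1..K}"
    have p: "?p \<in> {1..K} \<rightarrow>\<^sub>E {1..n}" by (intro restrict_PiE_iff[THEN iffD2] ballI PiE_mem[OF k] en(1))
    have "(\<Sum>\<phi>\<in>{1..K} \<rightarrow>\<^sub>E {1..n}. of_bool (\<forall>i\<in>{1..K}. \<kappa> (en i) = \<phi> i) * of_bool (\<forall>i\<in>{1..K}. \<kappa>' (dn i) = \<phi> i)) =
        (\<Sum>\<phi>\<in>{1..K} \<rightarrow>\<^sub>E {1..n}. if \<phi> = ?p then of_bool (\<forall>i\<in>{1..K}. \<kappa> (en i) = \<kappa>' (dn i)) else (0::complex))"
    proof (rule sum.cong[OF refl])
      fix \<phi> assume f: "\<phi> \<in> {1..K} \<rightarrow>\<^sub>E {1..n}"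
      have e: "(\<forall>i\<in>{1..K}. \<kappa> (en i) = \<phi> i) \<longleftrightarrow> \<phi> = ?p"
      proof
        assume a: "\<forall>i\<in>{1..K}. \<kappa> (en i) = \<phi> i"
        show "\<phi> = ?p"
        proof
          fix i show "\<phi> i = ?p i" using a PiE_arb[OF f, of i] by (cases "i \<in> {1..K}") simp_all
        qed
      qed simp
      show "of_bool (\<forall>i\<in>{1..K}. \<kappa> (en i) = \<phi> i) * of_bool (\<forall>i\<in>{1..K}. \<kappa>' (dn i) = \<phi> i) =
          (if \<phi> = ?p then of_bool (\<forall>i\<in>{1..K}. \<kappa> (en i) = \<kappa>' (dn i)) else (0::complex))"
      proof (cases "\<phi> = ?p")
        case True
        have "(\<forall>i\<in>{1..K}. \<kappa>' (dn i) = ?p i) \<longleftrightarrow> (\<forall>i\<in>{1..K}. \<kappa> (en i) = \<kappa>' (dn i))"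
          by (metis restrict_apply')
        moreover have "of_bool (\<forall>i\<in>{1..K}. \<kappa> (en i) = ?p i) = (1::complex)" by simp
        ultimately show ?thesis unfolding True by (simp only: simp_thms if_True mult_1)
      next
        case False
        then have "of_bool (\<forall>i\<in>{1..K}. \<kappa> (en i) = \<phi> i) = (0::complex)" unfolding e by (simp only: of_bool_eq)
        then show ?thesis by (simp only: mult_zero_left if_not_P[OF False])
      qed
    qed
    also have "\<dots> = of_bool (\<forall>i\<in>{1..K}. \<kappa> (en i) = \<kappa>' (dn i))"
    proof -
      have "finite ({1..K} \<rightarrow>\<^sub>E {1..n})" by (simp add: finite_PiE)
      then show ?thesis by (simp only: sum.delta p if_True)
    qed
    finally show "of_bool (\<forall>i\<in>{1..K}. \<kappa> (en i) = \<kappa>' (dn i)) =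
      (\<Sum>\<phi>\<in>{1..K} \<rightarrow>\<^sub>E {1..n}. of_bool (\<forall>i\<in>{1..K}. \<kappa> (en i) = \<phi> i) * of_bool (\<forall>i\<in>{1..K}. \<kappa>' (dn i) = \<phi> i) :: complex)" ..
  qed
  also have "\<dots> = (\<Sum>\<kappa>\<in>edges G \<rightarrow>\<^sub>E {1..n}. \<Sum>\<phi>\<in>{1..K} \<rightarrow>\<^sub>E {1..n}. \<Sum>\<kappa>'\<in>edges H \<rightarrow>\<^sub>E {1..n}.
      (of_bool (\<forall>i\<in>{1..K}. \<kappa> (en i) = \<phi> i) * gG \<kappa>) * (of_bool (\<forall>i\<in>{1..K}. \<kappa>' (dn i) = \<phi> i) * gH \<kappa>'))"
    unfolding sum_distrib_right by (rule sum.cong[OF refl], subst sum.swap) (simp only: mult_ac)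
  also have "\<dots> = (\<Sum>\<phi>\<in>{1..K} \<rightarrow>\<^sub>E {1..n}. open_partition_function n K y (G, l) \<phi> * open_partition_function n K y (H, m) \<phi>)"
    unfolding oG oH gG_def[symmetric] gH_def[symmetric] sum_product by (rule sum.swap)
  finally show "multigraph_partition_function n y (glue K (G, l) (H, m)) =
      (\<Sum>\<phi>\<in>{1..K} \<rightarrow>\<^sub>E {1..n}. open_partition_function n K y (G, l) \<phi> * open_partition_function n K y (H, m) \<phi>)" .
qed

lemma partition_function_rank_bound:
  "partition_function n y empty_graph = 1"
  "partition_function n y vertexless_loop = of_nat n"
  "ereal_of_enat (matrix_rank (fragments K) (fragments K) (connection_matrix (partition_function n y) K)) \<le> ereal (real n ^ K)"
proof -
  show "partition_function n y empty_graph = 1"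
    unfolding graph_of_empty[symmetric]
    by (subst partition_function_graph_of) (auto simp: wf_multigraph_def multigraph_partition_function_def)
  show "partition_function n y vertexless_loop = of_nat n"
    unfolding graph_of_vertexless_loop[symmetric]
    by (subst partition_function_graph_of)
      (auto simp: wf_multigraph_def multigraph_partition_function_def card_PiE)
  let ?M = "connection_matrix (partition_function n y) K"
  let ?o = "open_partition_function n K y"
  have "matrix_rank (fragments K) (fragments K) ?M \<le> enat (card ({1..K} \<rightarrow>\<^sub>E {1..n}))"
  proof (rule matrix_rank_le_inner_dimension)
    fix F F' assume F: "F \<in> fragments K" "F' \<in> fragments K"
    obtain G l H m where e: "F = (G, l)" "F' = (H, m)" by (cases F; cases F')
    show "?M F F' = (\<Sum>\<phi>\<in>{1..K} \<rightarrow>\<^sub>E {1..n}. ?o F \<phi> * ?o F' \<phi>)"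
      using F multigraph_partition_function_glue[of G l K H m n y] partition_function_graph_of[OF wf_glue, of G l K H m n y]
      unfolding connection_matrix_def e by (simp only:)
  qed (simp add: finite_PiE)
  moreover have "card ({1..K} \<rightarrow>\<^sub>E {1..n}) = n ^ K" by (simp add: card_PiE)
  ultimately have "ereal_of_enat (matrix_rank (fragments K) (fragments K) ?M) \<le> ereal_of_enat (enat (n ^ K))"
    by (simp only: ereal_of_enat_le_iff)
  then show "ereal_of_enat (matrix_rank (fragments K) (fragments K) ?M) \<le> ereal (real n ^ K)"
    by (simp only: ereal_of_enat_simps of_nat_power)
qed

section \<open>Sufficiency\<close>

text \<open>Diagonalization of a symmetric form over the complex numbers, where all square roots
  exist. A nonzero diagonal entry splits off one square; if the diagonal vanishes, a nonzero entry
  off the diagonal splits off two. Each step empties as many rows as it produces summands, so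
  \<open>card S\<close> summands suffice.\<close>

lemma symmetric_matrix_factorization:
  fixes g :: "'i \<Rightarrow> 'i \<Rightarrow> complex"
  assumes "finite S" "\<And>i j. g i j = g j i" "\<And>i j. i \<notin> S \<Longrightarrow> g i j = 0"
  shows "\<exists>a. \<forall>i j. g i j = (\<Sum>l<card S. a i l * a j l)"
  using assms
proof (induction "card S" arbitrary: S g rule: less_induct)
  case less
  note fin = less.prems(1) and sym = less.prems(2) and supp = less.prems(3)
  have supp': "g i j = 0" if "j \<notin> S" for i j using supp[OF that, of i] sym by simp
  consider (diag) i where "g i i \<noteq> 0" | (off) i j where "\<And>i. g i i = 0" "g i j \<noteq> 0" | (zero) "\<And>i j. g i j = 0"
    by blast
  then show ?case
  proof cases
    case zero
    then show ?thesis by (intro exI[of _ "\<lambda>_ _. 0"]) simp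
  next
    case diag
    define u where "u x = g x i / csqrt (g i i)" for x
    have uu: "u x * u y = g x i * g y i / g i i" for x y
      using power2_csqrt[of "g i i"] by (simp add: u_def power2_eq_square)
    let ?g = "\<lambda>x y. g x y - u x * u y"
    have i: "i \<in> S" using diag supp by blast
    have "?g x y = 0" if "x \<notin> S - {i}" for x y
    proof (cases "x = i")
      case True
      then show ?thesis using diag sym[of i y] by (simp add: uu)
    next
      case False
      then show ?thesis using that supp by (simp add: uu)
    qed
    moreover have "?g x y = ?g y x" for x y using sym[of x y] by (simp add: mult.commute)
    moreover have cS: "card S = Suc (card (S - {i}))" by (rule card_Suc_Diff1[OF fin i, symmetric])
    ultimately obtain a where a: "\<And>x y. ?g x y = (\<Sum>l<card (S - {i}). a x l * a y l)"
      using less.hyps[of "S - {i}" ?g] fin by auto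
    have "g x y = (\<Sum>l<card S. (if l < card (S - {i}) then a x l else u x) * (if l < card (S - {i}) then a y l else u y))" for x y
      using a[of x y] unfolding cS by (simp add: algebra_simps)
    then show ?thesis
      by (intro exI[of _ "\<lambda>x l. if l < card (S - {i}) then a x l else u x"]) blast
  next
    case off
    define b where "b = g i j"
    have b: "b \<noteq> 0" "g j i = b" "g i j = b" using off(2) sym[of j i] by (simp_all add: b_def)
    \<comment> \<open>\<open>p p\<^sup>T + q q\<^sup>T = (g\<^sub>i g\<^sub>j\<^sup>T + g\<^sub>j g\<^sub>i\<^sup>T) / b\<close> agrees with \<open>g\<close> in the rows \<open>i\<close> and \<open>j\<close>.\<close>
    define p where "p x = (g x i + g x j) / csqrt (2 * b)" for x
    define q where "q x = \<i> * (g x i - g x j) / csqrt (2 * b)" for x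
    have c2: "csqrt (2 * b) * csqrt (2 * b) = 2 * b" using power2_csqrt[of "2 * b"] by (simp only: power2_eq_square)
    have pq: "p x * p y + q x * q y = (g x i * g y j + g x j * g y i) / b" for x y
    proof -
      have "p x * p y = (g x i + g x j) * (g y i + g y j) / (2 * b)"
        unfolding p_def times_divide_times_eq c2 ..
      moreover have "q x * q y = - ((g x i - g x j) * (g y i - g y j)) / (2 * b)"
        unfolding q_def times_divide_times_eq c2 by (simp add: algebra_simps)
      ultimately have "p x * p y + q x * q y = ((g x i + g x j) * (g y i + g y j) - (g x i - g x j) * (g y i - g y j)) / (2 * b)"
        by (simp only: add_divide_distrib[symmetric] diff_conv_add_uminus)
      also have "(g x i + g x j) * (g y i + g y j) - (g x i - g x j) * (g y i - g y j) = 2 * (g x i * g y j + g x j * g y i)"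
        by (simp add: algebra_simps)
      finally show ?thesis by (simp only: mult_divide_mult_cancel_left[OF zero_neq_numeral[symmetric]])
    qed
    let ?g = "\<lambda>x y. g x y - (p x * p y + q x * q y)"
    have ij: "i \<in> S" "j \<in> S" "i \<noteq> j" using supp[of i j] supp'[of j i] off by auto
    have "?g x y = 0" if "x \<notin> S - {i, j}" for x y
    proof -
      consider "x = i" | "x = j" | "x \<notin> S" using \<open>x \<notin> S - {i, j}\<close> by blast
      then show ?thesis
        by cases (use b off(1) sym[of i y] sym[of j y] supp in \<open>simp_all add: pq\<close>)
    qed
    moreover have "?g x y = ?g y x" for x y using sym[of x y] by (simp add: mult.commute)
    moreover have cS: "card S = Suc (Suc (card (S - {i, j})))"
    proof -
      have "S - {i, j} = S - {i} - {j}" by auto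
      moreover have "card S = Suc (card (S - {i}))" by (rule card_Suc_Diff1[OF fin ij(1), symmetric])
      moreover have "card (S - {i}) = Suc (card (S - {i} - {j}))"
        by (rule card_Suc_Diff1[symmetric]) (use fin ij in auto)
      ultimately show ?thesis by simp
    qed
    ultimately obtain a where a: "\<And>x y. ?g x y = (\<Sum>l<card (S - {i, j}). a x l * a y l)"
      using less.hyps[of "S - {i, j}" ?g] fin by auto
    define k where "k = card (S - {i, j})"
    define A where "A x l = (if l < k then a x l else if l = k then p x else q x)" for x l
    have "g x y = (\<Sum>l<card S. A x l * A y l)" for x y
    proof -
      have "(\<Sum>l<k. A x l * A y l) = (\<Sum>l<k. a x l * a y l)" by (simp add: A_def)
      then have "(\<Sum>l<card S. A x l * A y l) = (\<Sum>l<k. a x l * a y l) + p x * p y + q x * q y"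
        unfolding cS k_def[symmetric] by (simp add: A_def)
      then show ?thesis using a[of x y] by (simp add: k_def algebra_simps)
    qed
    then show ?thesis by blast
  qed
qed

text \<open>Distributivity: a colouring of \<open>X\<close> is a family of colourings of the fibres
  of \<open>v\<close>, and by \<open>cong\<close> the factor at \<open>u\<close> sees only the fibre
  over \<open>u\<close>.\<close>

lemma sum_PiE_fibres:
  fixes F :: "'u \<Rightarrow> ('x \<Rightarrow> 'c) \<Rightarrow> 'r::comm_semiring_1"
  assumes fin: "finite V" "finite X" "finite T" and v: "v ` X \<subseteq> V"
    and cong: "\<And>u c d. u \<in> V \<Longrightarrow> (\<And>x. x \<in> X \<Longrightarrow> v x = u \<Longrightarrow> c x = d x) \<Longrightarrow> F u c = F u d"
  shows "(\<Sum>c\<in>X \<rightarrow>\<^sub>E T. \<Prod>u\<in>V. F u c) = (\<Prod>u\<in>V. \<Sum>d\<in>{x\<in>X. v x = u} \<rightarrow>\<^sub>E T. F u d)"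
proof -
  have "(\<Prod>u\<in>V. \<Sum>d\<in>{x\<in>X. v x = u} \<rightarrow>\<^sub>E T. F u d) =
      (\<Sum>D\<in>(\<Pi>\<^sub>E u\<in>V. {x\<in>X. v x = u} \<rightarrow>\<^sub>E T). \<Prod>u\<in>V. F u (D u))"
    by (rule prod_sum_PiE) (use fin in \<open>auto intro: finite_PiE\<close>)
  also have "\<dots> = (\<Sum>c\<in>X \<rightarrow>\<^sub>E T. \<Prod>u\<in>V. F u c)"
  proof (rule sum.reindex_bij_witness[where j = "\<lambda>D. restrict (\<lambda>x. D (v x) x) X"
        and i = "\<lambda>c. restrict (\<lambda>u. restrict c {x\<in>X. v x = u}) V"], goal_cases)
    case (1 D)
    show ?case
    proof
      fix u show "restrict (\<lambda>u. restrict (restrict (\<lambda>x. D (v x) x) X) {x\<in>X. v x = u}) V u = D u"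
      proof (cases "u \<in> V")
        case True
        then have Du: "D u \<in> {x\<in>X. v x = u} \<rightarrow>\<^sub>E T" using PiE_mem[OF 1] by blast
        have "restrict (restrict (\<lambda>x. D (v x) x) X) {x\<in>X. v x = u} = D u"
        proof
          fix x show "restrict (restrict (\<lambda>x. D (v x) x) X) {x\<in>X. v x = u} x = D u x"
            using PiE_arb[OF Du, of x] by (cases "x \<in> {x\<in>X. v x = u}") auto
        qed
        then show ?thesis using True by simp
      qed (use PiE_arb[OF 1] in simp)
    qed
  next
    case (2 D)
    have "D (v x) x \<in> T" if "x \<in> X" for x
    proof -
      have "D (v x) \<in> {z\<in>X. v z = v x} \<rightarrow>\<^sub>E T" using PiE_mem[OF 2] v that by blast
      then show ?thesis using that by (auto dest: PiE_mem)
    qed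
    then show ?case by (intro restrict_PiE_iff[THEN iffD2] ballI)
  next
    case (3 c)
    show ?case
    proof
      fix x show "restrict (\<lambda>x. restrict (\<lambda>u. restrict c {x\<in>X. v x = u}) V (v x) x) X x = c x"
        using PiE_arb[OF 3, of x] v by (cases "x \<in> X") auto
    qed
  next
    case (4 c)
    show ?case by (intro restrict_PiE_iff[THEN iffD2] ballI) (use PiE_mem[OF 4] in auto)
  next
    case (5 D)
    show ?case
    proof (rule prod.cong[OF refl])
      fix u assume "u \<in> V"
      then show "F u (restrict (\<lambda>x. D (v x) x) X) = F u (D u)" by (rule cong) simp
    qed
  qed
  finally show ?thesis ..
qed

text \<open>The linear substitution \<open>a\<close> applied to the symmetric tensor \<open>y\<close>.\<close>

definition twisted :: "nat \<Rightarrow> (nat multiset \<Rightarrow> complex) \<Rightarrow> (nat \<Rightarrow> nat \<Rightarrow> complex) \<Rightarrow> nat multiset \<Rightarrow> complex" where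
  "twisted N y a \<beta> = (let l = (SOME l. mset l = \<beta>) in
     \<Sum>c\<in>{..<length l} \<rightarrow>\<^sub>E {..<N}. y (image_mset c (mset_set {..<length l})) * (\<Prod>x<length l. a (c x) (l ! x)))"

text \<open>The list chosen in \<open>twisted\<close> has no influence on the value, as a bijection
  matches its positions with the elements of \<open>T\<close>, respecting the labels.\<close>

lemma twisted_image_mset:
  assumes T: "finite (T :: nat set)"
  shows "twisted N y a (image_mset d (mset_set T)) =
    (\<Sum>c\<in>T \<rightarrow>\<^sub>E {..<N}. y (image_mset c (mset_set T)) * (\<Prod>x\<in>T. a (c x) (d x)))"
proof -
  define l where "l = (SOME l. mset l = image_mset d (mset_set T))"
  have l: "mset l = image_mset d (mset_set T)" unfolding l_def by (rule someI_ex[OF ex_mset])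
  let ?L = "{..<length l}"
  have "image_mset ((!) l) (mset_set ?L) = image_mset d (mset_set T)"
    by (metis l lessThan_atLeast0 map_nth mset_map mset_upt)
  then obtain h where h: "bij_betw h ?L T" "\<And>x. x \<in> ?L \<Longrightarrow> d (h x) = l ! x"
    using mset_image_eq_bij[of ?L T "(!) l" d] T by blast
  have hT: "h x \<in> T" if "x \<in> ?L" for x using h(1) that by (rule bij_betw_apply)
  let ?i = "inv_into ?L h"
  have hi: "h (?i x) = x" "?i x \<in> ?L" if "x \<in> T" for x
    using bij_betw_inv_into_right[OF h(1) that] bij_betw_apply[OF bij_betw_inv_into[OF h(1)] that] by simp_all
  have ih: "?i (h x) = x" if "x \<in> ?L" for x using bij_betw_inv_into_left[OF h(1) that] .
  have mT: "mset_set T = image_mset h (mset_set ?L)"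
    using h(1) by (simp add: image_mset_mset_set bij_betw_def)
  have "twisted N y a (image_mset d (mset_set T)) =
      (\<Sum>c\<in>?L \<rightarrow>\<^sub>E {..<N}. y (image_mset c (mset_set ?L)) * (\<Prod>x<length l. a (c x) (l ! x)))"
    unfolding twisted_def l_def[symmetric] Let_def ..
  also have "\<dots> = (\<Sum>c\<in>T \<rightarrow>\<^sub>E {..<N}. y (image_mset c (mset_set T)) * (\<Prod>x\<in>T. a (c x) (d x)))"
  proof (rule sum.reindex_bij_witness[where i = "\<lambda>c. restrict (\<lambda>x. c (h x)) ?L" and j = "\<lambda>c. restrict (\<lambda>x. c (?i x)) T"], goal_cases)
    case (1 c)
    show ?case
    proof
      fix x show "restrict (\<lambda>x. restrict (\<lambda>x. c (?i x)) T (h x)) ?L x = c x"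
        using PiE_arb[OF 1, of x] hT[of x] ih[of x] by (cases "x \<in> ?L") simp_all
    qed
  next
    case (2 c)
    show ?case by (intro restrict_PiE_iff[THEN iffD2] ballI PiE_mem[OF 2] hi(2))
  next
    case (3 c)
    show ?case
    proof
      fix x show "restrict (\<lambda>x. restrict (\<lambda>x. c (h x)) ?L (?i x)) T x = c x"
        using PiE_arb[OF 3, of x] hi[of x] by (cases "x \<in> T") simp_all
    qed
  next
    case (4 c)
    show ?case by (intro restrict_PiE_iff[THEN iffD2] ballI PiE_mem[OF 4] hT)
  next
    case (5 c)
    let ?c = "restrict (\<lambda>x. c (?i x)) T"
    have ch: "?c (h x) = c x" if "x \<in> ?L" for x using hT[OF that] ih[OF that] by simp
    have "image_mset ?c (mset_set T) = image_mset c (mset_set ?L)"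
      unfolding mT multiset.map_comp by (rule image_mset_cong) (use ch in simp)
    moreover have "(\<Prod>x\<in>T. a (?c x) (d x)) = (\<Prod>x\<in>?L. a (?c (h x)) (d (h x)))"
      by (rule prod.reindex_bij_betw[OF h(1), symmetric])
    moreover have "\<dots> = (\<Prod>x\<in>?L. a (c x) (l ! x))"
      by (rule prod.cong[OF refl]) (simp only: ch h(2))
    ultimately show ?case by (simp only:)
  qed
  finally show ?thesis .
qed

text \<open>A loop at \<open>u\<close> has two legs there, which accounts for its multiplicity in
  \<open>colours_at\<close>.\<close>

lemma star_colours_at:
  assumes D: "star_data k v V w H"
  shows "colours_at (star k v V w H id) \<kappa> u = image_mset (\<lambda>x. \<kappa> (w x)) (mset_set {x\<in>{..<k}. v x = u})"
proof -
  have wH: "w ` {..<k} \<subseteq> H" and fH: "finite H" using D by (auto simp: star_data_def)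
  have "colours_at (star k v V w H id) \<kappa> u = (\<Sum>h\<in>H. \<Sum>x | x \<in> {x\<in>{..<k}. v x = u} \<and> w x = h. {#\<kappa> (w x)#})"
    unfolding colours_at_def star_def multigraph.sel
  proof (rule sum.cong[OF refl])
    fix h assume "h \<in> H"
    let ?W = "{x\<in>{..<k}. w x = h}" and ?T = "{x. x \<in> {x\<in>{..<k}. v x = u} \<and> w x = h}"
    have "count (image_mset (\<lambda>x. v (id x)) (mset_set ?W)) u = card ?T"
    proof -
      have "count (image_mset (\<lambda>x. v (id x)) (mset_set ?W)) u = (\<Sum>x\<in>?W. count {#v x#} u)"
        unfolding image_mset_set_sum count_sum_mset_fun by simp
      also have "\<dots> = (\<Sum>x\<in>?W. if v x = u then 1 else 0)" by (rule sum.cong) auto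
      also have "\<dots> = card {x\<in>?W. v x = u}" by (subst sum.inter_filter[symmetric]) auto
      also have "{x\<in>?W. v x = u} = ?T" by auto
      finally show ?thesis .
    qed
    moreover have "(\<Sum>x\<in>?T. {#\<kappa> (w x)#}) = (\<Sum>x\<in>?T. {#\<kappa> h#})" by (rule sum.cong) auto
    moreover have "\<dots> = replicate_mset (card ?T) (\<kappa> h)"
      by (rule multiset_eqI) (simp add: count_sum_mset_fun)
    ultimately show "replicate_mset (count (image_mset (\<lambda>x. v (id x)) (mset_set ?W)) u) (\<kappa> h) = (\<Sum>x\<in>?T. {#\<kappa> (w x)#})"
      by (simp only:)
  qed
  also have "\<dots> = (\<Sum>x\<in>{x\<in>{..<k}. v x = u}. {#\<kappa> (w x)#})"
    by (rule sum.group) (use wH fH in auto)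
  also have "\<dots> = image_mset (\<lambda>x. \<kappa> (w x)) (mset_set {x\<in>{..<k}. v x = u})"
    by (rule image_mset_set_sum[symmetric])
  finally show ?thesis .
qed

text \<open>The edge at position \<open>i\<close> of an enumeration receives the legs
  \<open>2 * i\<close> and \<open>2 * i + 1\<close>. A vertexless loop would have no legs, hence the
  second assumption.\<close>

lemma ex_star:
  fixes G :: "(nat, nat) multigraph"
  assumes G: "wf_multigraph G" and E: "\<And>e. e \<in> edges G \<Longrightarrow> ends G e \<noteq> {#}"
  shows "\<exists>k v w. star_data k v (verts G) w (edges G) \<and> isomorphic G (star k v (verts G) w (edges G) id)"
proof -
  have fin: "finite (verts G)" "finite (edges G)" using G by (auto simp: wf_multigraph_def)
  have "\<forall>e\<in>edges G. \<exists>p. ends G e = {#fst p, snd p#} \<and> fst p \<in> verts G \<and> snd p \<in> verts G"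
  proof
    fix e assume e: "e \<in> edges G"
    then have "size (ends G e) = 2" using G E[OF e] by (auto simp: wf_multigraph_def)
    moreover obtain q where q: "mset q = ends G e" using ex_mset by blast
    ultimately have "length q = 2" by (metis size_mset)
    then obtain a b where "q = [a, b]" by (auto simp: numeral_2_eq_2 length_Suc_conv)
    then have ab: "ends G e = {#a, b#}" using q by simp
    then have "a \<in> verts G" "b \<in> verts G" using wf_multigraph_ends[OF G e] by auto
    then show "\<exists>p. ends G e = {#fst p, snd p#} \<and> fst p \<in> verts G \<and> snd p \<in> verts G"
      using ab by (intro exI[of _ "(a, b)"]) simp
  qed
  from bchoice[OF this] obtain p where p: "\<And>e. e \<in> edges G \<Longrightarrow> ends G e = {#fst (p e), snd (p e)#}"
    "\<And>e. e \<in> edges G \<Longrightarrow> fst (p e) \<in> verts G \<and> snd (p e) \<in> verts G" by blast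
  obtain l where l: "set l = edges G" "distinct l" using finite_distinct_list[OF fin(2)] by blast
  define k where "k = 2 * length l"
  define w where "w x = l ! (x div 2)" for x
  define v where "v x = (if even x then fst (p (w x)) else snd (p (w x)))" for x
  have wE: "w x \<in> edges G" if "x < k" for x
    using that unfolding w_def l(1)[symmetric] by (intro nth_mem) (simp add: k_def)
  have fib: "\<exists>i. {x\<in>{..<k}. w x = e} = {2 * i, Suc (2 * i)} \<and> l ! i = e" if e: "e \<in> edges G" for e
  proof -
    obtain i where i: "i < length l" "l ! i = e" using e unfolding l(1)[symmetric] in_set_conv_nth by blast
    have "w x = e \<longleftrightarrow> x div 2 = i" if "x < k" for x
      using nth_eq_iff_index_eq[OF l(2), of "x div 2" i] i that by (simp add: w_def k_def less_mult_imp_div_less)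
    then have "{x\<in>{..<k}. w x = e} = {x. x < k \<and> x div 2 = i}" by auto
    also have "\<dots> = {2 * i, Suc (2 * i)}" using i(1) by (auto simp: k_def)
    finally show ?thesis using i(2) by blast
  qed
  have D: "star_data k v (verts G) w (edges G)"
    unfolding star_data_def
  proof (intro conjI ballI fin)
    show "v ` {..<k} \<subseteq> verts G" using p(2) wE by (auto simp: v_def)
    show "w ` {..<k} \<subseteq> edges G" using wE by auto
    fix e assume "e \<in> edges G"
    then obtain i where i: "{x\<in>{..<k}. w x = e} = {2 * i, Suc (2 * i)}" using fib by blast
    show "card {x\<in>{..<k}. w x = e} = 2" unfolding i by simp
  qed
  have "ends (star k v (verts G) w (edges G) id) e = ends G e" if e: "e \<in> edges G" for e
  proof -
    obtain i where i: "{x\<in>{..<k}. w x = e} = {2 * i, Suc (2 * i)}" "l ! i = e" using fib[OF e] by blast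
    have "mset_set {2 * i, Suc (2 * i)} = {#2 * i, Suc (2 * i)#}" by simp
    then show ?thesis unfolding star_def multigraph.sel i(1) by (simp add: v_def w_def i(2) p(1)[OF e])
  qed
  then have "isomorphic G (star k v (verts G) w (edges G) id)"
    unfolding isomorphic_def by (intro exI[of _ id]) (auto simp: star_def)
  then show ?thesis using D by blast
qed

lemma split_vertexless_loops:
  fixes G :: "(nat, nat) multigraph"
  assumes G: "wf_multigraph G"
  defines "G1 \<equiv> Multigraph (verts G) {e\<in>edges G. ends G e \<noteq> {#}} (ends G)"
    and "G2 \<equiv> Multigraph {} {e\<in>edges G. ends G e = {#}} (\<lambda>_. {#}) :: (nat, nat) multigraph"
  shows "wf_multigraph G1" "wf_multigraph G2" "isomorphic G (disjoint_union G1 G2)"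
proof -
  show "wf_multigraph G1" "wf_multigraph G2" using G by (auto simp: wf_multigraph_def G1_def G2_def)
  have "isomorphic (disjoint_union G1 G2) G"
    unfolding isomorphic_def
  proof (intro exI[of _ "case_sum id id"] conjI ballI)
    show "bij_betw (case_sum id id) (verts (disjoint_union G1 G2)) (verts G)"
      by (auto simp: bij_betw_def inj_on_def G1_def G2_def Plus_def image_Un image_image)
    show "bij_betw (case_sum id id) (edges (disjoint_union G1 G2)) (edges G)"
      by (auto simp: bij_betw_def inj_on_def G1_def G2_def Plus_def image_Un image_image)
    fix e assume "e \<in> edges (disjoint_union G1 G2)"
    then show "ends G (case_sum id id e) = image_mset (case_sum id id) (ends (disjoint_union G1 G2) e)"
      by (auto simp: G1_def G2_def multiset.map_comp comp_def)
  qed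
  then show "isomorphic G (disjoint_union G1 G2)"
    by (rule isomorphic_sym[rotated]) (intro wf_disjoint_union \<open>wf_multigraph G1\<close> \<open>wf_multigraph G2\<close>)
qed

lemma multigraph_partition_function_disjoint_loops:
  assumes "verts G2 = {}" "finite (edges G1)" "finite (edges G2)"
  shows "multigraph_partition_function n y (disjoint_union G1 G2) = multigraph_partition_function n y G1 * of_nat n ^ card (edges G2)"
proof -
  have "colours_at (disjoint_union G1 G2) (case_sum \<kappa> \<kappa>') (Inl v) = colours_at G1 \<kappa> v" for \<kappa> \<kappa>' v
  proof -
    have 1: "count (image_mset Inl (ends G1 e)) (Inl v) = count (ends G1 e) v" for e
      by (rule count_image_mset_inj) (simp add: inj_on_def)
    have 2: "count (image_mset Inr (ends G2 e)) (Inl v) = 0" for e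
      by (auto simp: count_eq_zero_iff)
    show ?thesis
      unfolding colours_at_def disjoint_union_sel Plus_def using assms(2,3)
      by (subst sum.union_disjoint) (auto simp: sum.reindex 1 2)
  qed
  then show ?thesis
    unfolding multigraph_partition_function_def disjoint_union_sel sum_PiE_Plus assms(1)
    using assms(3) by (simp add: Plus_def prod.reindex card_PiE sum_distrib_left mult.commute)
qed

context rank_bounded_nat
begin

text \<open>\<open>I\<close> is the largest ideal contained in the kernel of the functional. By
  \<open>phi_mult\<close> it contains the difference between the generic partition function and the
  value of \<open>f\<close> for every star structure, and by \<open>phi_zero\<close> it does not
  contain 1. A character that kills \<open>I\<close> supplies the weights as the images of the
  variables.\<close>

lemma tensor_model_exists:
  "\<exists>y g. \<forall>k v V w H. star_data k v V w H \<longrightarrow> f (graph_of (star k v V w H id)) =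
    (\<Sum>c\<in>Cols k. (\<Prod>u\<in>V. y (image_mset c (mset_set {x\<in>{..<k}. v x = u}))) *
      (\<Prod>h\<in>H. g (image_mset c (mset_set {x\<in>{..<k}. w x = h}))))"
proof -
  let ?lin = "lin phi"
  define I where "I = {x. \<forall>s. ?lin (s * x) = 0}"
  have I: "ideal_of I"
    unfolding ideal_of_def
  proof (intro conjI ballI allI)
    show "0 \<in> I" by (simp add: I_def)
    show "x + y \<in> I" if "x \<in> I" "y \<in> I" for x y using that by (simp add: I_def distrib_left lin_add)
    show "r * x \<in> I" if "x \<in> I" for x r
    proof -
      have "?lin (s * (r * x)) = 0" for s
      proof -
        have "?lin ((s * r) * x) = 0" using that unfolding I_def by blast
        then show ?thesis by (simp only: mult.assoc)
      qed
      then show ?thesis by (simp add: I_def)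
    qed
  qed
  have one: "1 \<notin> I"
  proof
    assume "1 \<in> I"
    then have "?lin (1 * 1) = 0" unfolding I_def by blast
    then show False using lin_single[of phi 0 1] phi_zero by simp
  qed
  obtain hm where hm1: "hm 1 = 1" and hm_add: "\<And>x y. hm (x + y) = hm x + hm y"
    and hm_mult: "\<And>x y. hm (x * y) = hm x * hm y" and hm_c: "\<And>z. hm (single 0 z) = z" and hm_I: "\<And>x. x \<in> I \<Longrightarrow> hm x = 0"
    using character_exists[OF I one] by blast
  have hm_sum: "hm (\<Sum>i\<in>A. q i) = (\<Sum>i\<in>A. hm (q i))" for q :: "(nat \<Rightarrow> nat) \<Rightarrow> _" and A
    using hm_c[of 0] by (induction A rule: infinite_finite_induct) (simp_all add: hm_add)
  define y where "y \<alpha> = hm (single ({#\<alpha>#}, {#}) 1)" for \<alpha>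
  define g where "g \<beta> = hm (single ({#}, {#\<beta>#}) 1)" for \<beta>
  let ?e = "{#} :: nat multiset multiset"
  have z: "single (?e, ?e) 1 = 1" by (simp flip: zero_prod_def zero_multiset_def)
  have hy: "hm (single (M, ?e) 1) = (\<Prod>\<alpha>\<in>#M. y \<alpha>)" for M
  proof (induction M)
    case empty
    show ?case unfolding z hm1 by simp
  next
    case (add \<alpha> M)
    have "single (add_mset \<alpha> M, ?e) 1 = single ({#\<alpha>#}, ?e) 1 * single (M, ?e) (1::complex)"
      by (simp add: mult_single)
    then show ?case using add.IH by (simp only: hm_mult y_def image_mset_add_mset prod_mset.add_mset)
  qed
  have hg: "hm (single (?e, M) 1) = (\<Prod>\<beta>\<in>#M. g \<beta>)" for M
  proof (induction M)
    case empty
    show ?case unfolding z hm1 by simp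
  next
    case (add \<beta> M)
    have "single (?e, add_mset \<beta> M) 1 = single (?e, {#\<beta>#}) 1 * single (?e, M) (1::complex)"
      by (simp add: mult_single)
    then show ?case using add.IH by (simp only: hm_mult g_def image_mset_add_mset prod_mset.add_mset)
  qed
  have hyg: "hm (single (M, M') 1) = (\<Prod>\<alpha>\<in>#M. y \<alpha>) * (\<Prod>\<beta>\<in>#M'. g \<beta>)" for M M'
  proof -
    have "single (M, M') 1 = single (M, ?e) 1 * single (?e, M') (1::complex)" by (simp add: mult_single)
    then show ?thesis by (simp only: hm_mult hy hg)
  qed
  have "f (graph_of (star k v V w H id)) =
    (\<Sum>c\<in>Cols k. (\<Prod>u\<in>V. y (image_mset c (mset_set {x\<in>{..<k}. v x = u}))) *
      (\<Prod>h\<in>H. g (image_mset c (mset_set {x\<in>{..<k}. w x = h}))))" if D: "star_data k v V w H" for k v V w H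
  proof -
    let ?F = "f (graph_of (star k v V w H id))"
    let ?m = "\<lambda>c. (vmon k v V c, vmon k w H c)"
    let ?x = "(\<Sum>c\<in>Cols k. single (?m c) 1) - single 0 ?F"
    have "?lin (s * ?x) = 0" for s
    proof -
      have "s * ?x = (\<Sum>m\<in>keys s. single m (lookup s m) * ?x)"
        unfolding sum_distrib_right[symmetric] using poly_mapping_expand[of s] by simp
      moreover have "?lin (single m a * ?x) = 0" for m a
      proof -
        have "single m a * ?x = (\<Sum>c\<in>Cols k. single (m + ?m c) a) - single m (a * ?F)"
          by (simp add: right_diff_distrib sum_distrib_left mult_single)
        then have "?lin (single m a * ?x) = a * (\<Sum>c\<in>Cols k. phi (m + ?m c)) - a * ?F * phi m"
          by (simp add: lin_diff lin_sum sum_distrib_left)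
        then show ?thesis unfolding phi_mult[OF D] by simp
      qed
      ultimately show ?thesis by (simp add: lin_sum)
    qed
    then have "?x \<in> I" by (simp add: I_def)
    then have "hm (?x + single 0 ?F) = hm (single 0 ?F)" unfolding hm_add using hm_I by simp
    then have "?F = (\<Sum>c\<in>Cols k. hm (single (?m c) 1))" by (simp add: hm_c hm_sum)
    moreover have "hm (single (?m c) 1) = (\<Prod>u\<in>V. y (image_mset c (mset_set {x\<in>{..<k}. v x = u}))) *
      (\<Prod>h\<in>H. g (image_mset c (mset_set {x\<in>{..<k}. w x = h})))" for c
      unfolding hyg vmon_def multiset.map_comp comp_def by (simp only: prod_unfold_prod_mset)
    ultimately show ?thesis by simp
  qed
  then show ?thesis by blast
qed

text \<open>Factoring \<open>g\<close> through \<open>a\<close> introduces one new colour per edge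
  and a factor \<open>a\<close> at each of its two legs. For fixed edge colours the sum over the old
  leg colours then splits over the vertices, where it is the twisted weight.\<close>

lemma star_partition_function:
  "\<exists>Y. \<forall>k v V w H. star_data k v V w H \<longrightarrow> f (graph_of (star k v V w H id)) =
    (\<Sum>\<kappa>\<in>H \<rightarrow>\<^sub>E {..<N}. \<Prod>u\<in>V. Y (image_mset (\<lambda>x. \<kappa> (w x)) (mset_set {x\<in>{..<k}. v x = u})))"
proof -
  obtain y g where yg: "\<And>k v V w H. star_data k v V w H \<Longrightarrow> f (graph_of (star k v V w H id)) =
    (\<Sum>c\<in>Cols k. (\<Prod>u\<in>V. y (image_mset c (mset_set {x\<in>{..<k}. v x = u}))) *
      (\<Prod>h\<in>H. g (image_mset c (mset_set {x\<in>{..<k}. w x = h}))))"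
    using tensor_model_exists by blast
  have "\<exists>a. \<forall>i j. (if i < N \<and> j < N then g {#i, j#} else 0) = (\<Sum>l<card {..<N}. a i l * a j l)"
    by (rule symmetric_matrix_factorization) (auto simp: add_mset_commute)
  then obtain a :: "nat \<Rightarrow> nat \<Rightarrow> complex" where a: "\<And>i j. i < N \<Longrightarrow> j < N \<Longrightarrow> g {#i, j#} = (\<Sum>l<N. a i l * a j l)"
    by (metis card_lessThan)
  let ?Y = "twisted N y a"
  have "f (graph_of (star k v V w H id)) =
    (\<Sum>\<kappa>\<in>H \<rightarrow>\<^sub>E {..<N}. \<Prod>u\<in>V. ?Y (image_mset (\<lambda>x. \<kappa> (w x)) (mset_set {x\<in>{..<k}. v x = u})))"
    if D: "star_data k v V w H" for k v V w H
  proof -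
    have fin: "finite V" "finite H" and vV: "v ` {..<k} \<subseteq> V" and wH: "w ` {..<k} \<subseteq> H"
      and two: "\<And>h. h \<in> H \<Longrightarrow> card {x\<in>{..<k}. w x = h} = 2" using D by (auto simp: star_data_def)
    let ?v = "\<lambda>u. {x\<in>{..<k}. v x = u}" and ?w = "\<lambda>h. {x\<in>{..<k}. w x = h}"
    have edge: "(\<Prod>h\<in>H. g (image_mset c (mset_set (?w h)))) = (\<Sum>\<kappa>\<in>H \<rightarrow>\<^sub>E {..<N}. \<Prod>x<k. a (c x) (\<kappa> (w x)))"
      if c: "c \<in> Cols k" for c
    proof -
      have "(\<Prod>h\<in>H. g (image_mset c (mset_set (?w h)))) = (\<Prod>h\<in>H. \<Sum>l<N. \<Prod>x\<in>?w h. a (c x) l)"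
      proof (rule prod.cong[OF refl])
        fix h assume "h \<in> H"
        then obtain x z where xz: "?w h = {x, z}" "x \<noteq> z" using two card_2_iff[of "?w h"] by blast
        have "x \<in> ?w h" "z \<in> ?w h" unfolding xz(1) by simp_all
        then have "x \<in> {..<k}" "z \<in> {..<k}" by simp_all
        then have "c x < N" "c z < N" using PiE_mem[OF c] by blast+
        then show "g (image_mset c (mset_set (?w h))) = (\<Sum>l<N. \<Prod>x\<in>?w h. a (c x) l)"
          unfolding xz(1) using xz(2) by (simp add: a)
      qed
      also have "\<dots> = (\<Sum>\<kappa>\<in>H \<rightarrow>\<^sub>E {..<N}. \<Prod>h\<in>H. \<Prod>x\<in>?w h. a (c x) (\<kappa> h))"
        by (rule prod_sum_PiE) (use fin in auto)
      also have "\<dots> = (\<Sum>\<kappa>\<in>H \<rightarrow>\<^sub>E {..<N}. \<Prod>h\<in>H. \<Prod>x\<in>?w h. a (c x) (\<kappa> (w x)))"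
        by (intro sum.cong prod.cong refl) auto
      also have "\<dots> = (\<Sum>\<kappa>\<in>H \<rightarrow>\<^sub>E {..<N}. \<Prod>x<k. a (c x) (\<kappa> (w x)))"
        by (intro sum.cong refl prod.group) (use fin wH in auto)
      finally show ?thesis .
    qed
    have "f (graph_of (star k v V w H id)) = (\<Sum>c\<in>Cols k. \<Sum>\<kappa>\<in>H \<rightarrow>\<^sub>E {..<N}.
        (\<Prod>u\<in>V. y (image_mset c (mset_set (?v u)))) * (\<Prod>x<k. a (c x) (\<kappa> (w x))))"
      unfolding yg[OF D] by (rule sum.cong[OF refl]) (simp only: edge sum_distrib_left)
    also have "\<dots> = (\<Sum>\<kappa>\<in>H \<rightarrow>\<^sub>E {..<N}. \<Sum>c\<in>Cols k.
        (\<Prod>u\<in>V. y (image_mset c (mset_set (?v u)))) * (\<Prod>x<k. a (c x) (\<kappa> (w x))))"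
      by (rule sum.swap)
    also have "\<dots> = (\<Sum>\<kappa>\<in>H \<rightarrow>\<^sub>E {..<N}. \<Sum>c\<in>Cols k.
        \<Prod>u\<in>V. y (image_mset c (mset_set (?v u))) * (\<Prod>x\<in>?v u. a (c x) (\<kappa> (w x))))"
    proof (intro sum.cong refl)
      fix \<kappa> c
      have "(\<Prod>x<k. a (c x) (\<kappa> (w x))) = (\<Prod>u\<in>V. \<Prod>x\<in>?v u. a (c x) (\<kappa> (w x)))"
        by (rule prod.group[symmetric]) (use fin vV in auto)
      then show "(\<Prod>u\<in>V. y (image_mset c (mset_set (?v u)))) * (\<Prod>x<k. a (c x) (\<kappa> (w x))) =
          (\<Prod>u\<in>V. y (image_mset c (mset_set (?v u))) * (\<Prod>x\<in>?v u. a (c x) (\<kappa> (w x))))"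
        by (simp only: prod.distrib)
    qed
    also have "\<dots> = (\<Sum>\<kappa>\<in>H \<rightarrow>\<^sub>E {..<N}. \<Prod>u\<in>V. \<Sum>d\<in>?v u \<rightarrow>\<^sub>E {..<N}.
        y (image_mset d (mset_set (?v u))) * (\<Prod>x\<in>?v u. a (d x) (\<kappa> (w x))))"
    proof (intro sum.cong refl sum_PiE_fibres)
      fix u and c d :: "nat \<Rightarrow> nat" and \<kappa>
      assume cd: "\<And>x. x \<in> {..<k} \<Longrightarrow> v x = u \<Longrightarrow> c x = d x"
      have "image_mset c (mset_set (?v u)) = image_mset d (mset_set (?v u))"
        by (rule image_mset_cong) (use cd in auto)
      moreover have "(\<Prod>x\<in>?v u. a (c x) (\<kappa> (w x))) = (\<Prod>x\<in>?v u. a (d x) (\<kappa> (w x)))"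
        by (rule prod.cong) (use cd in auto)
      ultimately show "y (image_mset c (mset_set (?v u))) * (\<Prod>x\<in>?v u. a (c x) (\<kappa> (w x))) =
          y (image_mset d (mset_set (?v u))) * (\<Prod>x\<in>?v u. a (d x) (\<kappa> (w x)))" by (simp only:)
    qed (use fin vV in auto)
    also have "\<dots> = (\<Sum>\<kappa>\<in>H \<rightarrow>\<^sub>E {..<N}. \<Prod>u\<in>V. ?Y (image_mset (\<lambda>x. \<kappa> (w x)) (mset_set (?v u))))"
      by (intro sum.cong prod.cong refl twisted_image_mset[symmetric]) simp
    finally show ?thesis .
  qed
  then show ?thesis by blast
qed

text \<open>Star structures cannot express vertexless loops, so these are split off and contribute a
  power of \<open>N\<close> on both sides.\<close>

lemma vertex_model_exists: "\<exists>y. f = partition_function N y"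
proof -
  obtain Y where Y: "\<And>k v V w H. star_data k v V w H \<Longrightarrow> f (graph_of (star k v V w H id)) =
    (\<Sum>\<kappa>\<in>H \<rightarrow>\<^sub>E {..<N}. \<Prod>u\<in>V. Y (image_mset (\<lambda>x. \<kappa> (w x)) (mset_set {x\<in>{..<k}. v x = u})))"
    using star_partition_function by blast
  \<comment> \<open>A vertex model takes incidence vectors of colours counted from 1, whereas
    \<open>Y\<close> takes multisets of colours counted from 0. \<open>inv count\<close> recovers
    the multiset, and subtracting 1 shifts the colours.\<close>
  define y where "y c = Y (image_mset (\<lambda>i. i - 1) (inv count c))" for c
  have y: "y (count M) = Y (image_mset (\<lambda>i. i - 1) M)" for M
    unfolding y_def by (simp add: inv_f_f[of count] inj_def count_inject)
  have st: "f (graph_of (star k v V w H id)) = multigraph_partition_function N y (star k v V w H id)"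
    if D: "star_data k v V w H" for k v V w H
  proof -
    have wH: "w x \<in> H" if "x < k" for x using D that by (auto simp: star_data_def)
    have es: "edges (star k v V w H id) = H" "verts (star k v V w H id) = V" by (simp_all add: star_def)
    have "multigraph_partition_function N y (star k v V w H id) =
        (\<Sum>\<kappa>\<in>H \<rightarrow>\<^sub>E {1..N}. \<Prod>u\<in>V. Y (image_mset (\<lambda>x. \<kappa> (w x) - 1) (mset_set {x\<in>{..<k}. v x = u})))"
      unfolding multigraph_partition_function_def star_colours_at[OF D] y es multiset.map_comp comp_def ..
    also have "\<dots> = (\<Sum>\<kappa>\<in>H \<rightarrow>\<^sub>E {..<N}. \<Prod>u\<in>V. Y (image_mset (\<lambda>x. \<kappa> (w x)) (mset_set {x\<in>{..<k}. v x = u})))"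
    proof (rule sum.reindex_bij_witness[where j = "\<lambda>\<kappa>. restrict (\<lambda>h. \<kappa> h - 1) H" and i = "\<lambda>\<kappa>. restrict (\<lambda>h. \<kappa> h + 1) H"], goal_cases)
      case (1 \<kappa>)
      show ?case
      proof
        fix h show "restrict (\<lambda>h. restrict (\<lambda>h. \<kappa> h - 1) H h + 1) H h = \<kappa> h"
          using PiE_arb[OF 1, of h] PiE_mem[OF 1, of h] by (cases "h \<in> H") auto
      qed
    next
      case (2 \<kappa>)
      show ?case by (intro restrict_PiE_iff[THEN iffD2] ballI) (use PiE_mem[OF 2] in fastforce)
    next
      case (3 \<kappa>)
      show ?case
      proof
        fix h show "restrict (\<lambda>h. restrict (\<lambda>h. \<kappa> h + 1) H h - 1) H h = \<kappa> h"
          using PiE_arb[OF 3, of h] by (cases "h \<in> H") auto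
      qed
    next
      case (4 \<kappa>)
      show ?case by (intro restrict_PiE_iff[THEN iffD2] ballI) (use PiE_mem[OF 4] in fastforce)
    next
      case (5 \<kappa>)
      show ?case
      proof (intro prod.cong refl arg_cong[of _ _ Y] image_mset_cong)
        fix u x assume "x \<in># mset_set {x\<in>{..<k}. v x = u}"
        then show "restrict (\<lambda>h. \<kappa> h - 1) H (w x) = \<kappa> (w x) - 1" using wH by simp
      qed
    qed
    finally show ?thesis using Y[OF D] by simp
  qed
  have "f gr = partition_function N y gr" for gr
  proof -
    obtain G :: "(nat, nat) multigraph" where G: "wf_multigraph G" "graph_of G = gr" using ex_graph_of by blast
    define G1 where "G1 = Multigraph (verts G) {e\<in>edges G. ends G e \<noteq> {#}} (ends G)"
    define G2 :: "(nat, nat) multigraph" where "G2 = Multigraph {} {e\<in>edges G. ends G e = {#}} (\<lambda>_. {#})"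
    have wf: "wf_multigraph G1" "wf_multigraph G2" and iso: "isomorphic G (disjoint_union G1 G2)"
      using split_vertexless_loops[OF G(1)] by (simp_all only: G1_def G2_def)
    have wfu: "wf_multigraph (disjoint_union G1 G2)" by (rule wf_disjoint_union[OF wf])
    have fin: "finite (edges G1)" "finite (edges G2)" using wf by (auto simp: wf_multigraph_def)
    obtain k v w where D: "star_data k v (verts G1) w (edges G1)"
      and i1: "isomorphic G1 (star k v (verts G1) w (edges G1) id)"
      using ex_star[OF wf(1)] by (auto simp: G1_def)
    have "f gr = f (graph_of G1) * f (graph_of G2)"
      using f_disjoint_union[OF wf] graph_of_cong[OF G(1) iso] G(2) by simp
    also have "f (graph_of G1) = multigraph_partition_function N y G1"
      using st[OF D] graph_of_cong[OF wf(1) i1] multigraph_partition_function_isomorphic[OF wf(1) i1] by simp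
    also have "f (graph_of G2) = of_nat N ^ card (edges G2)"
      using f_vertexless[OF wf(2)] by (simp add: G2_def)
    also have "multigraph_partition_function N y G1 * of_nat N ^ card (edges G2) =
        multigraph_partition_function N y (disjoint_union G1 G2)"
      by (rule multigraph_partition_function_disjoint_loops[symmetric]) (use fin in \<open>simp_all add: G2_def\<close>)
    also have "\<dots> = partition_function N y gr"
      using partition_function_graph_of[OF wfu] graph_of_cong[OF G(1) iso] G(2) by simp
    finally show ?thesis .
  qed
  then show ?thesis by blast
qed

end

theorem theorem1:
  fixes f :: "graph \<Rightarrow> complex"
  shows "(\<exists>k y. f = partition_function k y) \<longleftrightarrow>
    f empty_graph = 1 \<and> f vertexless_loop \<in> \<real> \<and>
    (\<forall>k. ereal_of_enat (matrix_rank (fragments k) (fragments k) (connection_matrix f k))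
           \<le> ereal (Re (f vertexless_loop) ^ k))"
proof
  assume "\<exists>k y. f = partition_function k y"
  then obtain n y where f: "f = partition_function n y" by blast
  show "f empty_graph = 1 \<and> f vertexless_loop \<in> \<real> \<and>
    (\<forall>k. ereal_of_enat (matrix_rank (fragments k) (fragments k) (connection_matrix f k))
           \<le> ereal (Re (f vertexless_loop) ^ k))"
    using partition_function_rank_bound[where n = n and y = y] unfolding f by simp
next
  assume a: "f empty_graph = 1 \<and> f vertexless_loop \<in> \<real> \<and>
    (\<forall>k. ereal_of_enat (matrix_rank (fragments k) (fragments k) (connection_matrix f k))
           \<le> ereal (Re (f vertexless_loop) ^ k))"
  define n where "n = Re (f vertexless_loop)"
  have rb: "rank_bounded f n"
  proof
    show "f empty_graph = 1" using a by blast
    show "f vertexless_loop = of_real n" using a of_real_Re unfolding n_def by metis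
    show "ereal_of_enat (matrix_rank (fragments k) (fragments k) (connection_matrix f k)) \<le> ereal (n ^ k)" for k
      using a unfolding n_def by blast
  qed
  then have "n \<in> \<nat>" by (rule rank_bounded.n_nat)
  then obtain N where N: "n = real N" by (auto elim: Nats_cases)
  have "rank_bounded_nat f N" using rb unfolding N by (rule rank_bounded_nat.intro)
  then show "\<exists>k y. f = partition_function k y" using rank_bounded_nat.vertex_model_exists by blast
qed

end
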